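(* Let $(\mathfrak g,s)$ be a semisimple, orthogonal, symmetric Lie algebra with Cartan-like decomposition $\mathfrak g=\mathfrak k\oplus\mathfrak p$ and associated pair $(G,K)$ with $K$ connected, and let $\mathfrak a\subseteq\mathfrak p$ be a maximal Abelian subspace with Weyl group $W$. Let $I$ be an open interval and let $\rho:I\to\mathfrak p$ be differentiable (respectively, continuously differentiable). Then there exists a differentiable (respectively, continuously differentiable) path $\lambda:I\to\mathfrak a$ satisfying $\pi\circ\rho=\pi\circ\lambda$. Moreover, for every $t\in I$, there is some $U\in K$ such that $\mathrm{Ad}_U^{-1}(\rho(t))\in\mathfrak a$ and $\mathrm{Ad}_U^{-1}(\Pi_{\rho(t)}(\rho'(t)))\in\mathfrak a$, and for any such $U$ it holds that $$(\lambda(t),\lambda'(t))=w\cdot\big(\mathrm{Ad}_U^{-1}(\rho(t)),\ \mathrm{Ad}_U^{-1}(\Pi_{\rho(t)}(\rho'(t)))\big)$$ for some Weyl group element $w\in W$, where $w\cdot(x,v)=(w\cdot x,w\cdot v)$.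
   Context: A symmetric Lie algebra $(\mathfrak g,s)$ is a real finite-dimensional Lie algebra $\mathfrak g$ with an involutive Lie algebra automorphism $s$; $\mathfrak k$ and $\mathfrak p$ denote the $+1$ and $-1$ eigenspaces of $s$, and $\mathfrak g=\mathfrak k\oplus\mathfrak p$ is the Cartan-like decomposition. It is semisimple if $\mathfrak g$ is, and orthogonal if the connected Lie subgroup $\mathrm{Int}_{\mathfrak k}(\mathfrak g)\subseteq \mathrm{GL}(\mathfrak g)$ with Lie algebra $\mathrm{ad}_{\mathfrak k}$ is compact. An associated pair $(G,K)$ consists of a connected Lie group $G$ with Lie algebra identified with $\mathfrak g$ and a Lie subgroup $K\subseteq G$ with Lie algebra $\mathfrak k$. $K$ acts on $\mathfrak p$ by the adjoint action, and $\pi:\mathfrak p\to\mathfrak p/K$ is the quotient map. The Weyl group is $W=N_K(\mathfrak a)/Z_K(\mathfrak a)$, where $N_K(\mathfrak a)=\{U\in K:\mathrm{Ad}_U(\mathfrak a)=\mathfrak a\}$ and $Z_K(\mathfrak a)=\{U\in K:\mathrm{Ad}_U(x)=x\ \forall x\in\mathfrak a\}$; it acts on $\mathfrak a$. Fix an $s$-invariant, $\mathrm{Ad}_K$-invariant inner product on $\mathfrak g$ (it exists by orthogonality). For $x\in\mathfrak p$, $\mathfrak p_x=\{y\in\mathfrak p:[x,y]=0\}$; one has the orthogonal decomposition $\mathfrak p=\mathrm{ad}_{\mathfrak k}(x)\oplus\mathfrak p_x$, and $\Pi_x:\mathfrak p\to\mathfrak p_x$ is the orthogonal projection onto $\mathfrak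 p_x$ (with kernel $\mathrm{ad}_{\mathfrak k}(x)$). *)

theory Defs
  imports "HOL-Analysis.Analysis" "HOL-Algebra.Coset" "HOL-Algebra.Generated_Groups"
begin

section \<open>Real Lie algebras\<close>

text \<open>
  A finite-dimensional real Lie algebra is a Euclidean space type together with a bracket. The
  Euclidean structure of the type provides only the vector space topology; its inner product
  plays no role.
\<close>

definition lie_algebra :: "('a::euclidean_space \<Rightarrow> 'a \<Rightarrow> 'a) \<Rightarrow> bool" where
  "lie_algebra br \<longleftrightarrow>
     bilinear br \<and>
     (\<forall>x. br x x = 0) \<and>
     (\<forall>x y z. br x (br y z) + br y (br z x) + br z (br x y) = 0)"

definition lie_ideal :: "('a::euclidean_space \<Rightarrow> 'a \<Rightarrow> 'a) \<Rightarrow> 'a set \<Rightarrow> bool" where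
  "lie_ideal br J \<longleftrightarrow> subspace J \<and> (\<forall>x. \<forall>y\<in>J. br x y \<in> J)"

definition derived_algebra :: "('a::euclidean_space \<Rightarrow> 'a \<Rightarrow> 'a) \<Rightarrow> 'a set \<Rightarrow> 'a set" where
  "derived_algebra br S = span {br x y | x y. x \<in> S \<and> y \<in> S}"

definition lie_solvable :: "('a::euclidean_space \<Rightarrow> 'a \<Rightarrow> 'a) \<Rightarrow> 'a set \<Rightarrow> bool" where
  "lie_solvable br S \<longleftrightarrow> (\<exists>n. (derived_algebra br ^^ n) S = {0})"

definition semisimple :: "('a::euclidean_space \<Rightarrow> 'a \<Rightarrow> 'a) \<Rightarrow> bool" where
  "semisimple br \<longleftrightarrow> (\<forall>J. lie_ideal br J \<and> lie_solvable br J \<longrightarrow> J = {0})"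


section \<open>Symmetric Lie algebras\<close>

definition symmetric_lie_algebra ::
    "('a::euclidean_space \<Rightarrow> 'a \<Rightarrow> 'a) \<Rightarrow> ('a \<Rightarrow> 'a) \<Rightarrow> bool" where
  "symmetric_lie_algebra br s \<longleftrightarrow>
     lie_algebra br \<and> linear s \<and> (\<forall>x y. s (br x y) = br (s x) (s y)) \<and> (\<forall>x. s (s x) = x)"

definition k_part :: "('a::euclidean_space \<Rightarrow> 'a) \<Rightarrow> 'a set" where
  "k_part s = {x. s x = x}"

definition p_part :: "('a::euclidean_space \<Rightarrow> 'a) \<Rightarrow> 'a set" where
  "p_part s = {x. s x = - x}"

definition GL :: "('a::real_normed_vector \<Rightarrow>\<^sub>L 'a) monoid" where
  "GL = \<lparr>carrier = {A. \<exists>B. A o\<^sub>L B = id_blinfun \<and> B o\<^sub>L A = id_blinfun},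
         mult = (o\<^sub>L), one = id_blinfun\<rparr>"

definition exp_end :: "('a::euclidean_space \<Rightarrow> 'a) \<Rightarrow> 'a \<Rightarrow>\<^sub>L 'a" where
  "exp_end A = (\<Sum>n. (1 / fact n) *\<^sub>R Blinfun (A ^^ n))"

text \<open>
  The connected Lie subgroup of \<open>GL(\<gg>)\<close> with Lie algebra \<open>ad \<kk>\<close>, constructed in the usual way as
  the subgroup generated by the exponentials of \<open>ad \<kk>\<close>. A connected Lie subgroup is compact in
  its own manifold topology iff it is compact as a subset of the general linear group, so
  compactness in the operator norm is what is asked for.
\<close>

definition Int_k :: "('a::euclidean_space \<Rightarrow> 'a \<Rightarrow> 'a) \<Rightarrow> ('a \<Rightarrow> 'a) \<Rightarrow> ('a \<Rightarrow>\<^sub>L 'a) set" where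
  "Int_k br s = generate GL ((\<lambda>x. exp_end (br x)) ` k_part s)"

definition orthogonal_sla :: "('a::euclidean_space \<Rightarrow> 'a \<Rightarrow> 'a) \<Rightarrow> ('a \<Rightarrow> 'a) \<Rightarrow> bool" where
  "orthogonal_sla br s \<longleftrightarrow> compact (Int_k br s)"

definition maximal_abelian ::
    "('a::euclidean_space \<Rightarrow> 'a \<Rightarrow> 'a) \<Rightarrow> 'a set \<Rightarrow> 'a set \<Rightarrow> bool" where
  "maximal_abelian br P a \<longleftrightarrow>
     subspace a \<and> a \<subseteq> P \<and> (\<forall>x\<in>a. \<forall>y\<in>a. br x y = 0) \<and>
     (\<forall>b. subspace b \<and> b \<subseteq> P \<and> (\<forall>x\<in>b. \<forall>y\<in>b. br x y = 0) \<and> a \<subseteq> b \<longrightarrow> b = a)"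


section \<open>Smooth manifolds\<close>

text \<open>Only meant for open \<open>S\<close>: being k times continuously differentiable on \<open>S\<close>.\<close>

primrec C_on :: "nat \<Rightarrow> ('a::euclidean_space \<Rightarrow> 'b::euclidean_space) \<Rightarrow> 'a set \<Rightarrow> bool" where
  "C_on 0 f S \<longleftrightarrow> continuous_on S f"
| "C_on (Suc k) f S \<longleftrightarrow>
     (\<forall>x\<in>S. f differentiable at x) \<and> (\<forall>v. C_on k (\<lambda>x. frechet_derivative f (at x) v) S)"

definition smooth_on :: "'a set \<Rightarrow> ('a::euclidean_space \<Rightarrow> 'b::euclidean_space) \<Rightarrow> bool" where
  "smooth_on S f \<longleftrightarrow> (\<forall>k. C_on k f S)"

text \<open>A chart is a pair of its domain and its coordinate map.\<close>

type_synonym ('p, 'm) chart = "'p set \<times> ('p \<Rightarrow> 'm)"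

definition chart_inv :: "('p, 'm) chart \<Rightarrow> 'm \<Rightarrow> 'p" where
  "chart_inv c = inv_into (fst c) (snd c)"

definition smooth_manifold :: "'p topology \<Rightarrow> ('p, 'm::euclidean_space) chart set \<Rightarrow> bool" where
  "smooth_manifold X A \<longleftrightarrow>
     Hausdorff_space X \<and> second_countable X \<and>
     (\<Union>c\<in>A. fst c) = topspace X \<and>
     (\<forall>c\<in>A. openin X (fst c) \<and> open (snd c ` fst c) \<and>
        homeomorphic_map (subtopology X (fst c)) (top_of_set (snd c ` fst c)) (snd c)) \<and>
     (\<forall>c\<in>A. \<forall>d\<in>A. smooth_on (snd c ` (fst c \<inter> fst d)) (snd d \<circ> chart_inv c))"

definition smooth_map ::
    "'p topology \<Rightarrow> ('p, 'm::euclidean_space) chart set \<Rightarrow>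
     'q topology \<Rightarrow> ('q, 'n::euclidean_space) chart set \<Rightarrow> ('p \<Rightarrow> 'q) \<Rightarrow> bool" where
  "smooth_map X A Y B f \<longleftrightarrow>
     continuous_map X Y f \<and>
     (\<forall>c\<in>A. \<forall>d\<in>B. smooth_on (snd c ` {p \<in> fst c. f p \<in> fst d}) (snd d \<circ> f \<circ> chart_inv c))"

definition prod_atlas ::
    "('p, 'm) chart set \<Rightarrow> ('q, 'n) chart set \<Rightarrow> ('p \<times> 'q, 'm \<times> 'n) chart set" where
  "prod_atlas A B = {(fst c \<times> fst d, map_prod (snd c) (snd d)) | c d. c \<in> A \<and> d \<in> B}"

text \<open>
  A tangent vector at \<open>p\<close> is the family of its coordinate representations in the charts around
  \<open>p\<close>, related by the derivatives of the coordinate changes; it is set to 0 on all other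
  arguments.
\<close>

definition tangent_space :: "('p, 'm::euclidean_space) chart set \<Rightarrow> 'p \<Rightarrow> (('p, 'm) chart \<Rightarrow> 'm) set" where
  "tangent_space A p =
     {v. (\<forall>c\<in>A. \<forall>d\<in>A. p \<in> fst c \<and> p \<in> fst d \<longrightarrow>
            v d = frechet_derivative (snd d \<circ> chart_inv c) (at (snd c p)) (v c)) \<and>
         (\<forall>c. c \<notin> A \<or> p \<notin> fst c \<longrightarrow> v c = 0)}"

text \<open>
  The differential of a smooth map at \<open>p\<close>; by the chain rule it does not depend on the chart
  chosen around \<open>p\<close>.
\<close>

definition tangent_map ::
    "('p, 'm::euclidean_space) chart set \<Rightarrow> ('q, 'n::euclidean_space) chart set \<Rightarrow> ('p \<Rightarrow> 'q) \<Rightarrow>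
     'p \<Rightarrow> (('p, 'm) chart \<Rightarrow> 'm) \<Rightarrow> (('q, 'n) chart \<Rightarrow> 'n)" where
  "tangent_map A B f p v =
     (\<lambda>d. if d \<in> B \<and> f p \<in> fst d
          then let c = (SOME c. c \<in> A \<and> p \<in> fst c)
               in frechet_derivative (snd d \<circ> f \<circ> chart_inv c) (at (snd c p)) (v c)
          else 0)"


section \<open>Lie groups\<close>

record ('g, 'm) smooth_group = "'g monoid" +
  topol :: "'g topology"
  atlas :: "('g, 'm) chart set"

definition lie_group :: "('g, 'm::euclidean_space) smooth_group \<Rightarrow> bool" where
  "lie_group G \<longleftrightarrow>
     group G \<and> topspace (topol G) = carrier G \<and> smooth_manifold (topol G) (atlas G) \<and>
     smooth_map (prod_topology (topol G) (topol G)) (prod_atlas (atlas G) (atlas G))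
       (topol G) (atlas G) (\<lambda>(x, y). x \<otimes>\<^bsub>G\<^esub> y) \<and>
     smooth_map (topol G) (atlas G) (topol G) (atlas G) (\<lambda>x. inv\<^bsub>G\<^esub> x)"

text \<open>
  Lie subgroups are immersed: \<open>K\<close> carries a topology and an atlas of its own, and its topology
  may be finer than the subspace topology.
\<close>

definition lie_subgroup ::
    "('g, 'k::euclidean_space) smooth_group \<Rightarrow> ('g, 'm::euclidean_space) smooth_group \<Rightarrow> bool" where
  "lie_subgroup K G \<longleftrightarrow>
     lie_group K \<and> subgroup (carrier K) G \<and>
     \<one>\<^bsub>K\<^esub> = \<one>\<^bsub>G\<^esub> \<and> (\<forall>x\<in>carrier K. \<forall>y\<in>carrier K. x \<otimes>\<^bsub>K\<^esub> y = x \<otimes>\<^bsub>G\<^esub> y) \<and>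
     smooth_map (topol K) (atlas K) (topol G) (atlas G) (\<lambda>x. x) \<and>
     (\<forall>x\<in>carrier K.
        inj_on (tangent_map (atlas K) (atlas G) (\<lambda>x. x) x) (tangent_space (atlas K) x))"

text \<open>
  \<open>\<iota>\<close> stands for a linear identification of the vector space \<open>'a\<close> with the tangent space of
  \<open>G\<close> at the identity, and \<open>Ad\<close> is the adjoint action of \<open>G\<close> transported to \<open>'a\<close>.
\<close>

definition Ad ::
    "('g, 'm::euclidean_space) smooth_group \<Rightarrow> ('a::euclidean_space \<Rightarrow> ('g, 'm) chart \<Rightarrow> 'm) \<Rightarrow>
     'g \<Rightarrow> 'a \<Rightarrow> 'a" where
  "Ad G \<iota> g x =
     inv_into UNIV \<iota>
       (tangent_map (atlas G) (atlas G) (\<lambda>h. g \<otimes>\<^bsub>G\<^esub> h \<otimes>\<^bsub>G\<^esub> inv\<^bsub>G\<^esub> g) \<one>\<^bsub>G\<^esub> (\<iota> x))"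

text \<open>
  \<open>\<iota>\<close> identifies \<open>('a, br)\<close> with the Lie algebra of \<open>G\<close>. The bracket of the latter is the
  differential of the adjoint representation: \<open>[x, y]\<close> is the derivative of \<open>g \<mapsto> Ad g y\<close> at the
  identity in the direction \<open>x\<close>, computed in any chart \<open>c\<close>.
\<close>

definition identifies_lie_algebra ::
    "('g, 'm::euclidean_space) smooth_group \<Rightarrow> ('a::euclidean_space \<Rightarrow> 'a \<Rightarrow> 'a) \<Rightarrow>
     ('a \<Rightarrow> ('g, 'm) chart \<Rightarrow> 'm) \<Rightarrow> bool" where
  "identifies_lie_algebra G br \<iota> \<longleftrightarrow>
     (\<forall>c. linear (\<lambda>x. \<iota> x c)) \<and>
     bij_betw \<iota> UNIV (tangent_space (atlas G) \<one>\<^bsub>G\<^esub>) \<and>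
     (\<forall>x y. \<forall>c\<in>atlas G. \<one>\<^bsub>G\<^esub> \<in> fst c \<longrightarrow>
        frechet_derivative (\<lambda>u. Ad G \<iota> (chart_inv c u) y) (at (snd c \<one>\<^bsub>G\<^esub>)) (\<iota> x c) = br x y)"

definition associated_pair ::
    "('a::euclidean_space \<Rightarrow> 'a \<Rightarrow> 'a) \<Rightarrow> ('a \<Rightarrow> 'a) \<Rightarrow>
     ('g, 'm::euclidean_space) smooth_group \<Rightarrow> ('a \<Rightarrow> ('g, 'm) chart \<Rightarrow> 'm) \<Rightarrow>
     ('g, 'k::euclidean_space) smooth_group \<Rightarrow> bool" where
  "associated_pair br s G \<iota> K \<longleftrightarrow>
     lie_group G \<and> connected_space (topol G) \<and> identifies_lie_algebra G br \<iota> \<and>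
     lie_subgroup K G \<and>
     tangent_map (atlas K) (atlas G) (\<lambda>x. x) \<one>\<^bsub>K\<^esub> ` tangent_space (atlas K) \<one>\<^bsub>K\<^esub>
       = \<iota> ` k_part s"


section \<open>Quotient map and Weyl group\<close>

text \<open>The quotient map \<open>\<pi>\<close>, sending a point to its \<open>K\<close>-orbit.\<close>

definition orbit_map ::
    "('g, 'm::euclidean_space) smooth_group \<Rightarrow> ('a::euclidean_space \<Rightarrow> ('g, 'm) chart \<Rightarrow> 'm) \<Rightarrow>
     ('g, 'k::euclidean_space) smooth_group \<Rightarrow> 'a \<Rightarrow> 'a set" where
  "orbit_map G \<iota> K x = (\<lambda>U. Ad G \<iota> U x) ` carrier K"

definition normalizer_K ::
    "('g, 'm::euclidean_space) smooth_group \<Rightarrow> ('a::euclidean_space \<Rightarrow> ('g, 'm) chart \<Rightarrow> 'm) \<Rightarrow>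
     ('g, 'k::euclidean_space) smooth_group \<Rightarrow> 'a set \<Rightarrow> 'g set" where
  "normalizer_K G \<iota> K a = {U \<in> carrier K. Ad G \<iota> U ` a = a}"

definition centralizer_K ::
    "('g, 'm::euclidean_space) smooth_group \<Rightarrow> ('a::euclidean_space \<Rightarrow> ('g, 'm) chart \<Rightarrow> 'm) \<Rightarrow>
     ('g, 'k::euclidean_space) smooth_group \<Rightarrow> 'a set \<Rightarrow> 'g set" where
  "centralizer_K G \<iota> K a = {U \<in> carrier K. \<forall>x\<in>a. Ad G \<iota> U x = x}"

definition weyl_group ::
    "('g, 'm::euclidean_space) smooth_group \<Rightarrow> ('a::euclidean_space \<Rightarrow> ('g, 'm) chart \<Rightarrow> 'm) \<Rightarrow>
     ('g, 'k::euclidean_space) smooth_group \<Rightarrow> 'a set \<Rightarrow> 'g set monoid" where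
  "weyl_group G \<iota> K a = K\<lparr>carrier := normalizer_K G \<iota> K a\<rparr> Mod centralizer_K G \<iota> K a"

text \<open>
  The action of a coset \<open>w\<close> in the Weyl group on \<open>a\<close>, through an arbitrary representative;
  meaningful on arguments in \<open>a\<close> only.
\<close>

definition weyl_act ::
    "('g, 'm::euclidean_space) smooth_group \<Rightarrow> ('a::euclidean_space \<Rightarrow> ('g, 'm) chart \<Rightarrow> 'm) \<Rightarrow>
     'g set \<Rightarrow> 'a \<Rightarrow> 'a" where
  "weyl_act G \<iota> w x = Ad G \<iota> (SOME U. U \<in> w) x"


section \<open>Invariant inner products and the projections\<close>

definition inner_product :: "('a::euclidean_space \<Rightarrow> 'a \<Rightarrow> real) \<Rightarrow> bool" where
  "inner_product B \<longleftrightarrow>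
     bilinear B \<and> (\<forall>x y. B x y = B y x) \<and> (\<forall>x. x \<noteq> 0 \<longrightarrow> B x x > 0)"

definition invariant_inner_product ::
    "('a::euclidean_space \<Rightarrow> 'a) \<Rightarrow> ('g, 'm::euclidean_space) smooth_group \<Rightarrow>
     ('a \<Rightarrow> ('g, 'm) chart \<Rightarrow> 'm) \<Rightarrow> ('g, 'k::euclidean_space) smooth_group \<Rightarrow>
     ('a \<Rightarrow> 'a \<Rightarrow> real) \<Rightarrow> bool" where
  "invariant_inner_product s G \<iota> K B \<longleftrightarrow>
     inner_product B \<and>
     (\<forall>x y. B (s x) (s y) = B x y) \<and>
     (\<forall>U\<in>carrier K. \<forall>x y. B (Ad G \<iota> U x) (Ad G \<iota> U y) = B x y)"

definition p_centralizer ::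
    "('a::euclidean_space \<Rightarrow> 'a \<Rightarrow> 'a) \<Rightarrow> ('a \<Rightarrow> 'a) \<Rightarrow> 'a \<Rightarrow> 'a set" where
  "p_centralizer br s x = {y \<in> p_part s. br x y = 0}"

text \<open>\<open>proj_p br s B x\<close> is \<open>\<Pi>\<^sub>x\<close>, the \<open>B\<close>-orthogonal projection onto \<open>p_centralizer br s x\<close>.\<close>

definition proj_p ::
    "('a::euclidean_space \<Rightarrow> 'a \<Rightarrow> 'a) \<Rightarrow> ('a \<Rightarrow> 'a) \<Rightarrow> ('a \<Rightarrow> 'a \<Rightarrow> real) \<Rightarrow> 'a \<Rightarrow> 'a \<Rightarrow> 'a" where
  "proj_p br s B x v =
     (THE y. y \<in> p_centralizer br s x \<and> (\<forall>z\<in>p_centralizer br s x. B (v - y) z = 0))"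

end

theory Submission
  imports Defs
begin

text \<open>
  Let \<open>H\<close> be the compact group \<open>Int\<^sub>k(g)\<close>, whose elements are all of the form \<open>Ad U\<close> with \<open>U \<in> K\<close>: a
  one-parameter subgroup of \<open>H\<close> is obtained in \<open>Ad K\<close> by Euler's method in a compact part of a chart. Maximizing
  \<open>A h\<^sub>1 \<bullet> h\<^sub>2\<close> over \<open>A \<in> H\<close> makes \<open>A h\<^sub>1\<close> and \<open>h\<^sub>2\<close> commute, which moves any commuting pair into \<open>a\<close> and
  shows that \<open>H\<close>-orbits meet \<open>a\<close> in orbits of the maps of \<open>a\<close> induced by its normalizer. These
  maps form a finite group, since \<open>ad\<^sub>h\<^sup>2\<close> has the same spectrum along an orbit, so that close commuting conjugates
  are equal.

  To first order the flow of \<open>ad\<^sub>k\<close> removes the tangential part of \<open>\<rho>'\<close>. Hence, moving \<open>\<rho> t\<close> and its normal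
  derivative into \<open>a\<close> together gives a path in \<open>a\<close> which is differentiable up to the finite group \<open>W\<close>. Such a
  path has a differentiable lift, by induction on the order of \<open>W\<close>: off the points fixed by \<open>W\<close> the group shrinks
  to a stabilizer, and at an isolated fixed point the one-sided difference quotients converge because their
  limit points lie in a finite set.

  For the continuity of \<open>\<lambda>'\<close> let \<open>\<lambda>' t\<^sub>n\<close> converge to \<open>y\<close> as \<open>t\<^sub>n\<close> tends to \<open>t\<^sub>0\<close>. For regular \<open>h \<in> a\<close> the maximum of
  \<open>A (\<rho> t) \<bullet> h\<close> over \<open>A \<in> H\<close> is attained on \<open>W (\<lambda> t)\<close>, and comparing the maxima at \<open>t\<^sub>n\<close> and \<open>t\<^sub>0\<close> gives
  \<open>w y \<bullet> h = w (\<lambda>' t\<^sub>0) \<bullet> h\<close> for some \<open>w\<close>. If \<open>y \<noteq> \<lambda>' t\<^sub>0\<close>, this fails for \<open>h\<close> off finitely many hyperplanes.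
\<close>

section \<open>Differentiable lifts for finite isometry groups\<close>

text \<open>The Killing form is negative definite on \<open>k_part s\<close> but only nondegenerate
  on \<open>p_part s\<close>, where summands of compact and of noncompact type may occur side by
  side; the invariant inner product is definite, but its infinitesimal invariance is known for
  \<open>k_part s\<close> alone. A maximum over \<open>H\<close> yields orthogonality for the inner
  product, whereas commuting is read off from the Killing form of a bracket of two elements of
  \<open>p_part s\<close>, which lies in \<open>k_part s\<close>. The operator
  \<open>killing_operator\<close>, which expresses one form by the other, translates between the
  two. No roots are introduced: regular elements are found by dimension, and perturbing an element
  rests on \<open>centralizer_upper_semicontinuous\<close>. Points and derivatives are moved into
  \<open>a\<close> separately for each time, so the path \<open>x\<close> in \<open>a\<close> may
  well be discontinuous. What survives is \<open>orbit_differentiable\<close>, a property that does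
  not change when the path is multiplied by group elements depending arbitrarily on time; this
  freedom lets the induction choose representatives adapted to a stabilizer.\<close>

definition isometry_group_on :: "('a::euclidean_space \<Rightarrow> 'a) set \<Rightarrow> 'a set \<Rightarrow> bool" where
  "isometry_group_on W a \<longleftrightarrow> finite W \<and> W \<noteq> {} \<and> subspace a \<and>
     (\<forall>w\<in>W. linear w \<and> (\<forall>x\<in>a. w x \<in> a \<and> norm (w x) = norm x)) \<and>
     (\<forall>w\<in>W. \<forall>w'\<in>W. w \<circ> w' \<in> W) \<and> (\<forall>w\<in>W. \<exists>w'\<in>W. \<forall>x\<in>a. w' (w x) = x)"

text \<open>One \<open>w\<close> has to serve for the value and for the derivative, as in the
  theorem. The derivative is the full one, \<open>at t\<close>, even if \<open>J\<close> is not
  open, so the property can depend on \<open>l\<close> outside of \<open>J\<close>; this is why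
  \<open>lift_on_cong\<close> asks for agreement on an open set.\<close>

definition lift_on ::
  "('a::euclidean_space \<Rightarrow> 'a) set \<Rightarrow> (real \<Rightarrow> 'a) \<Rightarrow> (real \<Rightarrow> 'a) \<Rightarrow> real set \<Rightarrow> (real \<Rightarrow> 'a) \<Rightarrow> bool" where
  "lift_on W x v J l \<longleftrightarrow>
     (\<forall>t\<in>J. \<exists>w\<in>W. l t = w (x t) \<and> (l has_vector_derivative w (v t)) (at t))"

text \<open>A first-order expansion at \<open>t\<close> in which \<open>x s\<close> may first be
  moved by a group element depending on \<open>s\<close> and \<open>\<epsilon>\<close>. Continuity
  of \<open>x\<close> is not implied.\<close>

definition orbit_differentiable ::
  "('a::euclidean_space \<Rightarrow> 'a) set \<Rightarrow> (real \<Rightarrow> 'a) \<Rightarrow> (real \<Rightarrow> 'a) \<Rightarrow> real set \<Rightarrow> bool" where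
  "orbit_differentiable W x v I \<longleftrightarrow> (\<forall>t\<in>I. \<forall>\<epsilon>>0. \<exists>\<delta>>0. \<forall>s\<in>I. \<bar>s - t\<bar> < \<delta> \<longrightarrow>
     (\<exists>w\<in>W. norm (w (x s) - x t - (s - t) *\<^sub>R v t) \<le> \<epsilon> * \<bar>s - t\<bar>))"

lemma has_vector_derivative_at_alt:
  fixes f :: "real \<Rightarrow> 'a::real_normed_vector"
  shows "(f has_vector_derivative D) (at t) \<longleftrightarrow>
    (\<forall>e>0. \<exists>d>0. \<forall>s. \<bar>s - t\<bar> < d \<longrightarrow> norm (f s - f t - (s - t) *\<^sub>R D) \<le> e * \<bar>s - t\<bar>)"
  unfolding has_vector_derivative_def has_derivative_at_alt
  by (simp add: bounded_linear_scaleR_left)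

lemma has_vector_derivative_glue:
  fixes f g :: "real \<Rightarrow> 'a::real_normed_vector"
  assumes "(f has_vector_derivative D) (at m)" "(g has_vector_derivative D) (at m)" "f m = g m"
  shows "((\<lambda>t. if t \<le> m then f t else g t) has_vector_derivative D) (at m)"
  unfolding has_vector_derivative_at_alt
proof (intro allI impI)
  fix e :: real assume "e > 0"
  with assms obtain d1 d2 where d: "d1 > 0" "d2 > 0"
    and b: "\<And>s. \<bar>s - m\<bar> < d1 \<Longrightarrow> norm (f s - f m - (s - m) *\<^sub>R D) \<le> e * \<bar>s - m\<bar>"
    and "\<And>s. \<bar>s - m\<bar> < d2 \<Longrightarrow> norm (g s - g m - (s - m) *\<^sub>R D) \<le> e * \<bar>s - m\<bar>"
    unfolding has_vector_derivative_at_alt by metis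
  then show "\<exists>d>0. \<forall>s. \<bar>s - m\<bar> < d \<longrightarrow>
      norm ((if s \<le> m then f s else g s) - (if m \<le> m then f m else g m) - (s - m) *\<^sub>R D) \<le> e * \<bar>s - m\<bar>"
    using assms(3) d by (intro exI[of _ "min d1 d2"] conjI allI impI) (use b in force)+
qed

text \<open>The identity function itself may be missing from \<open>W\<close>: its elements are
  linear maps of the whole space, but the group laws that involve inverses hold on \<open>a\<close>
  only.\<close>

lemma isometry_group_on_id:
  assumes "isometry_group_on W a" obtains e where "e \<in> W" "\<And>x. x \<in> a \<Longrightarrow> e x = x"
proof -
  obtain w where "w \<in> W" using assms by (auto simp: isometry_group_on_def)
  moreover then obtain w' where "w' \<in> W" "\<forall>x\<in>a. w' (w x) = x"
    using assms unfolding isometry_group_on_def by meson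
  ultimately show thesis using that[of "w' \<circ> w"] assms
    unfolding isometry_group_on_def by auto
qed

lemma isometry_group_on_inverse:
  assumes "isometry_group_on W a" "w \<in> W"
  obtains w' where "w' \<in> W" "\<And>x. x \<in> a \<Longrightarrow> w' (w x) = x" "\<And>x. x \<in> a \<Longrightarrow> w (w' x) = x"
proof -
  obtain w' where w': "w' \<in> W" "\<And>x. x \<in> a \<Longrightarrow> w' (w x) = x"
    using assms unfolding isometry_group_on_def by meson
  obtain w'' where w'': "w'' \<in> W" "\<And>x. x \<in> a \<Longrightarrow> w'' (w' x) = x"
    using assms w' unfolding isometry_group_on_def by meson
  have "w (w' x) = x" if "x \<in> a" for x
  proof -
    have "w' x \<in> a" "w (w' x) \<in> a"
      using assms w' that unfolding isometry_group_on_def by blast+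
    then show ?thesis using w'(2)[of "w' x"] w''(2)[of "w (w' x)"] w''(2)[OF that] by simp
  qed
  then show thesis using that w' by blast
qed

lemma isometry_group_on_bounds:
  assumes "isometry_group_on W a" "w \<in> W" "x \<in> a" "y \<in> a" "z \<in> a"
  shows "norm (w x - w y - r *\<^sub>R w z) = norm (x - y - r *\<^sub>R z)"
proof -
  have "x - y - r *\<^sub>R z \<in> a" "linear w"
    using assms by (auto simp: isometry_group_on_def intro: subspace_diff subspace_scale)
  moreover from this have "w (x - y - r *\<^sub>R z) = w x - w y - r *\<^sub>R w z"
    by (simp add: linear_diff linear_scale)
  moreover have "norm (w (x - y - r *\<^sub>R z)) = norm (x - y - r *\<^sub>R z)"
    using assms calculation(1) unfolding isometry_group_on_def by blast
  ultimately show ?thesis by simp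
qed

section \<open>Gluing and extending lifts\<close>

lemma lift_on_comp:
  assumes "isometry_group_on W a" "lift_on W x v J l" "w \<in> W"
  shows "lift_on W x v J (\<lambda>t. w (l t))"
  unfolding lift_on_def
proof
  fix t assume "t \<in> J"
  then obtain w' where w': "w' \<in> W" "l t = w' (x t)" "(l has_vector_derivative w' (v t)) (at t)"
    using assms unfolding lift_on_def by blast
  have "bounded_linear w" using assms by (simp add: isometry_group_on_def linear_conv_bounded_linear)
  then have "((\<lambda>t. w (l t)) has_vector_derivative (w \<circ> w') (v t)) (at t)"
    using w' by (simp add: bounded_linear.has_vector_derivative)
  moreover have "w \<circ> w' \<in> W" using assms w' by (simp add: isometry_group_on_def)
  ultimately show "\<exists>w''\<in>W. w (l t) = w'' (x t) \<and> ((\<lambda>t. w (l t)) has_vector_derivative w'' (v t)) (at t)"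
    using w' by (intro bexI[of _ "w \<circ> w'"]) auto
qed

lemma lift_on_cong:
  assumes "lift_on W x v J l" "open O'" "J' \<subseteq> J" "J' \<subseteq> O'" "\<And>t. t \<in> O' \<Longrightarrow> l t = l' t"
  shows "lift_on W x v J' l'"
  unfolding lift_on_def
proof
  fix t assume t: "t \<in> J'"
  then obtain w where w: "w \<in> W" "l t = w (x t)" "(l has_vector_derivative w (v t)) (at t)"
    using assms unfolding lift_on_def by blast
  moreover have "(l' has_vector_derivative w (v t)) (at t)"
    by (rule has_vector_derivative_transform_within_open[OF w(3) assms(2)]) (use t assms in auto)
  moreover have "l' t = l t" using t assms by auto
  ultimately show "\<exists>w\<in>W. l' t = w (x t) \<and> (l' has_vector_derivative w (v t)) (at t)" by auto
qed

lemma lift_on_subset: "lift_on W x v J l \<Longrightarrow> J' \<subseteq> J \<Longrightarrow> lift_on W x v J' l"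
  unfolding lift_on_def by blast

text \<open>At \<open>m\<close> each lift takes its value and its derivative through one group
  element, \<open>w1\<close> or \<open>w2\<close>. Multiplying one side by the quotient of these
  therefore matches value and derivative at once. Two versions are needed because an extension to
  the right must leave the left piece unchanged, and conversely.\<close>

lemma lift_on_glue:
  assumes W: "isometry_group_on W a" and rxv: "range x \<subseteq> a" "range v \<subseteq> a"
    and l: "lift_on W x v J1 l1" "lift_on W x v J2 l2" and m: "m \<in> J1" "m \<in> J2"
  obtains w w' where "w \<in> W" "w' \<in> W" "\<And>t. w' (w (x t)) = x t"
    "lift_on W x v ({t\<in>J1. t \<le> m} \<union> {t\<in>J2. m \<le> t}) (\<lambda>t. if t \<le> m then l1 t else w (l2 t))"
    "lift_on W x v ({t\<in>J1. t \<le> m} \<union> {t\<in>J2. m \<le> t}) (\<lambda>t. if t < m then w' (l1 t) else l2 t)"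
proof -
  have xv: "x t \<in> a" "v t \<in> a" for t using rxv by auto
  have glue: "lift_on W x v ({t\<in>J1. t \<le> m} \<union> {t\<in>J2. m \<le> t}) (\<lambda>t. if t \<le> m then l1 t else l2 t)"
    if l: "lift_on W x v J1 l1" "lift_on W x v J2 l2" and u: "u \<in> W" "l1 m = u (x m)" "l2 m = u (x m)"
      "(l1 has_vector_derivative u (v m)) (at m)" "(l2 has_vector_derivative u (v m)) (at m)" for l1 l2 u
    unfolding lift_on_def
  proof
    let ?l = "\<lambda>t. if t \<le> m then l1 t else l2 t"
    fix t assume t: "t \<in> {t\<in>J1. t \<le> m} \<union> {t\<in>J2. m \<le> t}"
    consider "t < m" | "t = m" | "t > m" by linarith
    then show "\<exists>w\<in>W. ?l t = w (x t) \<and> (?l has_vector_derivative w (v t)) (at t)"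
    proof cases
      case 1
      have "lift_on W x v (J1 \<inter> {..<m}) ?l"
        by (rule lift_on_cong[OF l(1), of "{..<m}"]) auto
      then show ?thesis using 1 t unfolding lift_on_def by auto
    next
      case 2
      have "(?l has_vector_derivative u (v m)) (at m)"
        by (rule has_vector_derivative_glue) (use u in auto)
      then show ?thesis using 2 u by auto
    next
      case 3
      have "lift_on W x v (J2 \<inter> {m<..}) ?l"
        by (rule lift_on_cong[OF l(2), of "{m<..}"]) auto
      then show ?thesis using 3 t unfolding lift_on_def by auto
    qed
  qed
  obtain w1 where w1: "w1 \<in> W" "l1 m = w1 (x m)" "(l1 has_vector_derivative w1 (v m)) (at m)"
    using l m unfolding lift_on_def by blast
  obtain w2 where w2: "w2 \<in> W" "l2 m = w2 (x m)" "(l2 has_vector_derivative w2 (v m)) (at m)"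
    using l m unfolding lift_on_def by blast
  obtain w1' where w1': "w1' \<in> W" "\<And>x. x \<in> a \<Longrightarrow> w1' (w1 x) = x" "\<And>x. x \<in> a \<Longrightarrow> w1 (w1' x) = x"
    using isometry_group_on_inverse[OF W w1(1)] by metis
  obtain w2' where w2': "w2' \<in> W" "\<And>x. x \<in> a \<Longrightarrow> w2' (w2 x) = x" "\<And>x. x \<in> a \<Longrightarrow> w2 (w2' x) = x"
    using isometry_group_on_inverse[OF W w2(1)] by metis
  have clos: "w1 \<circ> w2' \<in> W" "w2 \<circ> w1' \<in> W"
    using W w1 w2 w1' w2' by (auto simp: isometry_group_on_def)
  have ina: "w1 (x t) \<in> a" "w2 (x t) \<in> a" "w1' (x t) \<in> a" "w2' (x t) \<in> a"  for t
    using W w1 w2 w1' w2' xv by (auto simp: isometry_group_on_def)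
  have bl: "bounded_linear w" if "w \<in> W" for w
    using W that by (simp add: isometry_group_on_def linear_conv_bounded_linear)
  have "lift_on W x v ({t\<in>J1. t \<le> m} \<union> {t\<in>J2. m \<le> t}) (\<lambda>t. if t \<le> m then l1 t else (w1 \<circ> w2') (l2 t))"
  proof (rule glue[OF l(1) lift_on_comp[OF W l(2) clos(1)] w1(1,2) _ w1(3)])
    show "((\<lambda>t. (w1 \<circ> w2') (l2 t)) has_vector_derivative w1 (v m)) (at m)"
      using bounded_linear.has_vector_derivative[OF bl[OF clos(1)] w2(3)] w2'(2) xv by simp
  qed (simp add: w2 w2' xv)
  moreover
  have "lift_on W x v ({t\<in>J1. t \<le> m} \<union> {t\<in>J2. m \<le> t}) (\<lambda>t. if t \<le> m then (w2 \<circ> w1') (l1 t) else l2 t)"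
  proof (rule glue[OF lift_on_comp[OF W l(1) clos(2)] l(2) w2(1) _ w2(2) _ w2(3)])
    show "((\<lambda>t. (w2 \<circ> w1') (l1 t)) has_vector_derivative w2 (v m)) (at m)"
      using bounded_linear.has_vector_derivative[OF bl[OF clos(2)] w1(3)] w1'(2) xv by simp
  qed (simp add: w1 w1' xv)
  \<comment> \<open>At \<open>m\<close> both branches have the value \<open>w2 (x m)\<close>, so the
    inequality may be made strict.\<close>
  then have "lift_on W x v ({t\<in>J1. t \<le> m} \<union> {t\<in>J2. m \<le> t}) (\<lambda>t. if t < m then (w2 \<circ> w1') (l1 t) else l2 t)"
  proof (rule back_subst[of "lift_on W x v _"])
    show "(\<lambda>t. if t \<le> m then (w2 \<circ> w1') (l1 t) else l2 t) = (\<lambda>t. if t < m then (w2 \<circ> w1') (l1 t) else l2 t)"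
      by (rule ext) (auto simp: w1 w1' xv w2 order.order_iff_strict)
  qed
  ultimately show thesis
    using that[OF clos] w1' w2' xv ina by simp
qed

text \<open>Compactness enters through the interval principle \<open>Bolzano\<close>. The open
  margin \<open>\<eta>\<close> is part of the claim because at the common endpoint of two intervals
  both lifts need two-sided derivatives.\<close>

lemma lift_on_compact_interval:
  assumes W: "isometry_group_on W a" and rxv: "range x \<subseteq> a" "range v \<subseteq> a" and "c \<le> d"
    and loc: "\<And>t. t \<in> {c..d} \<Longrightarrow> \<exists>\<delta>>0. \<exists>l. lift_on W x v {t-\<delta><..<t+\<delta>} l"
  shows "\<exists>\<eta>>0. \<exists>l. lift_on W x v {c-\<eta><..<d+\<eta>} l"
  using \<open>c \<le> d\<close>
proof (induction rule: Bolzano)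
  case (trans p q r)
  then obtain \<eta>1 \<eta>2 l1 l2 where "\<eta>1 > 0" "lift_on W x v {p-\<eta>1<..<q+\<eta>1} l1"
    "\<eta>2 > 0" "lift_on W x v {q-\<eta>2<..<r+\<eta>2} l2" by auto
  then have "q \<in> {p-\<eta>1<..<q+\<eta>1}" "q \<in> {q-\<eta>2<..<r+\<eta>2}" using trans by auto
  with \<open>lift_on W x v {p-\<eta>1<..<q+\<eta>1} l1\<close> \<open>lift_on W x v {q-\<eta>2<..<r+\<eta>2} l2\<close>
  obtain w where "lift_on W x v ({t\<in>{p-\<eta>1<..<q+\<eta>1}. t \<le> q} \<union> {t\<in>{q-\<eta>2<..<r+\<eta>2}. q \<le> t})
      (\<lambda>t. if t \<le> q then l1 t else w (l2 t))"
    by (rule lift_on_glue[OF W rxv])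
  then show ?case
    by (intro exI[of _ "min \<eta>1 \<eta>2"] conjI exI[of _ "\<lambda>t. if t \<le> q then l1 t else w (l2 t)"]
        lift_on_subset[OF \<open>lift_on W x v (_ \<union> _) _\<close>])
      (use \<open>\<eta>1 > 0\<close> \<open>\<eta>2 > 0\<close> trans in auto)
next
  case (local t)
  then obtain \<delta> l where "\<delta> > 0" "lift_on W x v {t-\<delta><..<t+\<delta>} l"
    by (meson loc atLeastAtMost_iff)
  then show ?case
    by (intro exI[of _ "\<delta>/2"] conjI allI impI exI[of _ "\<delta>/2"] exI[of _ l]
        lift_on_subset[OF \<open>lift_on W x v _ l\<close>]) auto
qed

text \<open>The lift \<open>l'\<close> on the larger interval is turned by one group element beyond
  \<open>d\<close> and by another one before \<open>c\<close>. Agreement with \<open>l\<close> is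
  kept on \<open>{c..d}\<close> only; the margin of \<open>l\<close> is given up.\<close>

lemma lift_on_extend:
  assumes W: "isometry_group_on W a" and rxv: "range x \<subseteq> a" "range v \<subseteq> a"
    and l: "lift_on W x v {c-\<eta><..<d+\<eta>} l" "\<eta> > 0" "lift_on W x v {c'-\<eta>'<..<d'+\<eta>'} l'" "\<eta>' > 0"
    and ord: "c' \<le> c" "c \<le> d" "d \<le> d'"
  shows "\<exists>m. lift_on W x v {c'-\<eta>'<..<d'+\<eta>'} m \<and> (\<forall>t\<in>{c..d}. m t = l t)"
proof -
  have "d \<in> {c-\<eta><..<d+\<eta>}" "d \<in> {c'-\<eta>'<..<d'+\<eta>'}" using l ord by auto
  with l(1,3) obtain w where w: "lift_on W x v ({t\<in>{c-\<eta><..<d+\<eta>}. t \<le> d} \<union> {t\<in>{c'-\<eta>'<..<d'+\<eta>'}. d \<le> t})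
      (\<lambda>t. if t \<le> d then l t else w (l' t))"
    by (rule lift_on_glue[OF W rxv])
  let ?m = "\<lambda>t. if t \<le> d then l t else w (l' t)"
  have "c \<in> {c'-\<eta>'<..<d'+\<eta>'}" "c \<in> {t\<in>{c-\<eta><..<d+\<eta>}. t \<le> d} \<union> {t\<in>{c'-\<eta>'<..<d'+\<eta>'}. d \<le> t}"
    using l ord by auto
  with l(3) w obtain u where u: "lift_on W x v ({t\<in>{c'-\<eta>'<..<d'+\<eta>'}. t \<le> c} \<union>
      {t\<in>{t\<in>{c-\<eta><..<d+\<eta>}. t \<le> d} \<union> {t\<in>{c'-\<eta>'<..<d'+\<eta>'}. d \<le> t}. c \<le> t})
      (\<lambda>t. if t < c then u (l' t) else ?m t)"
    by (rule lift_on_glue[OF W rxv])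
  show ?thesis
    by (rule exI[of _ "\<lambda>t. if t < c then u (l' t) else ?m t"], rule conjI,
        rule lift_on_subset[OF u]) (use ord l in auto)
qed

text \<open>Lifts on an exhausting sequence of compact intervals are chosen one after the other,
  each extending the previous one, so at every point the values become stationary.\<close>

lemma lift_on_open_interval:
  assumes W: "isometry_group_on W a" and rxv: "range x \<subseteq> a" "range v \<subseteq> a"
    and I: "open I" "connected I"
    and loc: "\<And>t. t \<in> I \<Longrightarrow> \<exists>\<delta>>0. \<exists>l. lift_on W x v {t-\<delta><..<t+\<delta>} l"
  shows "\<exists>l. lift_on W x v I l"
proof (cases "I = {}")
  case True then show ?thesis by (simp add: lift_on_def)
next
  case False
  have int: "\<And>p q r. p \<in> I \<Longrightarrow> r \<in> I \<Longrightarrow> p \<le> q \<Longrightarrow> q \<le> r \<Longrightarrow> q \<in> I"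
    using I(2) unfolding connected_iff_interval by blast
  define D where "D = I \<inter> \<rat>"
  have between: "\<exists>p\<in>D. \<exists>q\<in>D. p < t \<and> t < q" if t: "t \<in> I" for t
  proof -
    obtain e where e: "e > 0" "\<And>s. \<bar>s - t\<bar> < e \<Longrightarrow> s \<in> I"
      using I(1) t by (auto simp: open_real)
    obtain p where "p \<in> \<rat>" "t - e < p" "p < t" using Rats_dense_in_real[of "t - e" t] e by auto
    moreover obtain q where "q \<in> \<rat>" "t < q" "q < t + e" using Rats_dense_in_real[of t "t + e"] e by auto
    ultimately show ?thesis unfolding D_def using e(2)[of p] e(2)[of q] by auto
  qed
  then have "D \<noteq> {}" using False by auto
  moreover have "countable D" unfolding D_def by (simp add: countable_rat)
  ultimately obtain q :: "nat \<Rightarrow> real" where q: "range q = D"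
    by (metis range_from_nat_into)
  \<comment> \<open>The hull of the first \<open>n + 1\<close> points in an enumeration of the
    rationals of \<open>I\<close>: these intervals increase, and their interiors cover
    \<open>I\<close>.\<close>
  define c d where "c n = Min (q ` {..n})" and "d n = Max (q ` {..n})" for n
  have cd: "c n \<in> I" "d n \<in> I" "c n \<le> d n" "c (Suc n) \<le> c n" "d n \<le> d (Suc n)" for n
  proof -
    have "q ` {..n} \<subseteq> I" using q by (auto simp: D_def)
    moreover have "c n \<in> q ` {..n}" "d n \<in> q ` {..n}" unfolding c_def d_def
      by (rule Min_in Max_in; simp)+
    ultimately show "c n \<in> I" "d n \<in> I" by auto
    show "c n \<le> d n" unfolding c_def d_def by (rule order_trans[OF Min_le Max_ge, of _ "q 0"]) auto
    show "c (Suc n) \<le> c n" "d n \<le> d (Suc n)" unfolding c_def d_def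
      by (auto intro!: Min_antimono Max_mono)
  qed
  have ex: "\<exists>\<eta>>0. \<exists>l. lift_on W x v {c n-\<eta><..<d n+\<eta>} l" for n
    by (rule lift_on_compact_interval[OF W rxv cd(3)]) (use loc int cd in \<open>meson atLeastAtMost_iff\<close>)
  let ?P = "\<lambda>n (l::real\<Rightarrow>'a). \<exists>\<eta>>0. lift_on W x v {c n-\<eta><..<d n+\<eta>} l"
  have "\<exists>f. \<forall>n. ?P n (f n) \<and> (\<forall>t\<in>{c n..d n}. f (Suc n) t = f n t)"
  proof (rule dependent_nat_choice)
    show "\<exists>l. ?P 0 l" using ex by blast
    fix l n assume "?P n l"
    then obtain \<eta> where \<eta>: "\<eta> > 0" "lift_on W x v {c n-\<eta><..<d n+\<eta>} l" by auto
    obtain \<eta>' l' where \<eta>': "\<eta>' > 0" "lift_on W x v {c (Suc n)-\<eta>'<..<d (Suc n)+\<eta>'} l'"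
      using ex[of "Suc n"] by blast
    show "\<exists>m. ?P (Suc n) m \<and> (\<forall>t\<in>{c n..d n}. m t = l t)"
      using lift_on_extend[OF W rxv \<eta>(2,1) \<eta>'(2,1) cd(4,3,5)] \<eta>' by auto
  qed
  then obtain f where f: "\<And>n. ?P n (f n)" "\<And>n t. t \<in> {c n..d n} \<Longrightarrow> f (Suc n) t = f n t" by blast
  have mono: "c (n + k) \<le> c n \<and> d n \<le> d (n + k)" for n k
    by (induction k) (auto intro: order_trans[OF cd(4)] order_trans[OF _ cd(5)])
  have stable: "f (n + k) t = f n t" if "t \<in> {c n..d n}" for n k t
  proof (induction k)
    case (Suc k)
    have "t \<in> {c (n + k)..d (n + k)}" using that mono[of n k] by auto
    then show ?case using f(2) Suc by simp
  qed simp
  have cov: "\<exists>n. t \<in> {c n<..<d n}" if tI: "t \<in> I" for t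
  proof -
    obtain i j where ij: "q i < t" "t < q j" using between[OF tI] q by (metis rangeE)
    have "c (max i j) \<le> q i" "q j \<le> d (max i j)" unfolding c_def d_def
      by (auto intro!: Min_le Max_ge)
    then show ?thesis using ij by (intro exI[of _ "max i j"]) auto
  qed
  define N where "N t = (LEAST n. t \<in> {c n<..<d n})" for t
  define l where "l t = f (N t) t" for t
  have lf: "l t = f n t" if "t \<in> {c n<..<d n}" for n t
  proof -
    have "t \<in> {c (N t)<..<d (N t)}" unfolding N_def by (rule LeastI[of "\<lambda>n. t \<in> {c n<..<d n}", OF that])
    moreover have "N t \<le> n" unfolding N_def by (rule Least_le[of "\<lambda>n. t \<in> {c n<..<d n}", OF that])
    ultimately show ?thesis unfolding l_def using stable[of t "N t" "n - N t"] by auto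
  qed
  have "lift_on W x v {c n<..<d n} l" for n
  proof -
    obtain \<eta> where "\<eta> > 0" "lift_on W x v {c n-\<eta><..<d n+\<eta>} (f n)" using f(1) by blast
    moreover have "f n t = l t" if "t \<in> {c n<..<d n}" for t using lf[OF that] by simp
    ultimately show ?thesis
      by (rule_tac lift_on_cong[of W x v _ "f n" "{c n<..<d n}"]) auto
  qed
  then have "lift_on W x v I l" using cov unfolding lift_on_def by blast
  then show ?thesis by blast
qed

lemma lift_on_open:
  assumes W: "isometry_group_on W a" and rxv: "range x \<subseteq> a" "range v \<subseteq> a"
    and I: "open I"
    and loc: "\<And>t. t \<in> I \<Longrightarrow> \<exists>\<delta>>0. \<exists>l. lift_on W x v {t-\<delta><..<t+\<delta>} l"
  shows "\<exists>l. lift_on W x v I l"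
proof -
  let ?C = "connected_component_set I"
  have "\<exists>l. lift_on W x v (?C t) l" for t
    by (rule lift_on_open_interval[OF W rxv open_connected_component[OF I]])
      (use loc connected_component_subset in blast)+
  then have L: "lift_on W x v (?C t) (SOME l. lift_on W x v (?C t) l)" for t
    by (rule someI_ex)
  \<comment> \<open>The choice depends on the component as a set, hence is the same for all of its
    points.\<close>
  define l where "l t = (SOME l. lift_on W x v (?C t) l) t" for t
  have "lift_on W x v (?C t) l" for t
  proof (rule lift_on_cong[OF L[of t] open_connected_component[OF I]])
    fix s assume "s \<in> ?C t"
    then have "?C s = ?C t" by (metis connected_component_eq)
    then show "(SOME l. lift_on W x v (?C t) l) s = l s" by (simp add: l_def)
  qed auto
  moreover have "t \<in> ?C t" if "t \<in> I" for t using that by simp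
  ultimately have "lift_on W x v I l" unfolding lift_on_def by blast
  then show ?thesis by blast
qed

section \<open>Paths that are differentiable up to the group\<close>

lemma orbit_differentiableE:
  assumes "orbit_differentiable W x v I" "t \<in> I" "\<epsilon> > 0"
  obtains d where "d > 0" "\<And>s. s \<in> I \<Longrightarrow> \<bar>s - t\<bar> < d \<Longrightarrow>
    \<exists>w\<in>W. norm (w (x s) - x t - (s - t) *\<^sub>R v t) \<le> \<epsilon> * \<bar>s - t\<bar>"
proof -
  have "\<exists>\<delta>>0. \<forall>s\<in>I. \<bar>s - t\<bar> < \<delta> \<longrightarrow>
     (\<exists>w\<in>W. norm (w (x s) - x t - (s - t) *\<^sub>R v t) \<le> \<epsilon> * \<bar>s - t\<bar>)"
    using assms by (simp add: orbit_differentiable_def)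
  then show thesis using that by blast
qed

lemma isometry_group_on_mult:
  "isometry_group_on W a \<Longrightarrow> w \<in> W \<Longrightarrow> w' \<in> W \<Longrightarrow> (\<lambda>x. w (w' x)) \<in> W"
  unfolding isometry_group_on_def comp_def by blast

lemma isometry_group_on_closed: "isometry_group_on W a \<Longrightarrow> w \<in> W \<Longrightarrow> x \<in> a \<Longrightarrow> w x \<in> a"
  unfolding isometry_group_on_def by blast

lemma isometry_group_on_norm: "isometry_group_on W a \<Longrightarrow> w \<in> W \<Longrightarrow> x \<in> a \<Longrightarrow> norm (w x) = norm x"
  unfolding isometry_group_on_def by blast

text \<open>Isometries preserve the error bound, so it can be multiplied by group elements. The
  first form changes the representatives at \<open>s\<close> and at \<open>t\<close> independently;
  the second one leaves the point at \<open>s\<close> as a given lift has it and puts the unknown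
  element at \<open>t\<close>.\<close>

lemma orbit_differentiable_mult:
  assumes W: "isometry_group_on W a" and xv: "range x \<subseteq> a" "range v \<subseteq> a" and u: "u \<in> W" "u' \<in> W"
    and b: "\<exists>w\<in>W. norm (w (x s) - x t - (s - t) *\<^sub>R v t) \<le> \<epsilon> * \<bar>s - t\<bar>"
  shows "\<exists>w\<in>W. norm (w (u (x s)) - u' (x t) - (s - t) *\<^sub>R u' (v t)) \<le> \<epsilon> * \<bar>s - t\<bar>"
    and "\<exists>w\<in>W. norm (u (x s) - w (x t) - (s - t) *\<^sub>R w (v t)) \<le> \<epsilon> * \<bar>s - t\<bar>"
proof -
  have xa: "x t \<in> a" "v t \<in> a" for t using xv by auto
  obtain w where w: "w \<in> W" "norm (w (x s) - x t - (s - t) *\<^sub>R v t) \<le> \<epsilon> * \<bar>s - t\<bar>" using b by auto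
  obtain v' where v': "v' \<in> W" "\<And>x. x \<in> a \<Longrightarrow> v' (u x) = x"
    using isometry_group_on_inverse[OF W u(1)] by metis
  have "norm (u' (w (x s)) - u' (x t) - (s - t) *\<^sub>R u' (v t)) \<le> \<epsilon> * \<bar>s - t\<bar>"
    using isometry_group_on_bounds[OF W u(2)] w isometry_group_on_closed[OF W] xa by metis
  moreover have "(\<lambda>x. u' (w (v' x))) \<in> W"
    using isometry_group_on_mult[OF W u(2) isometry_group_on_mult[OF W w(1) v'(1)]] by simp
  ultimately show "\<exists>w\<in>W. norm (w (u (x s)) - u' (x t) - (s - t) *\<^sub>R u' (v t)) \<le> \<epsilon> * \<bar>s - t\<bar>"
    using v'(2)[OF xa(1)] by (intro bexI[of _ "\<lambda>x. u' (w (v' x))"]) auto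
  obtain w' where w': "w' \<in> W" "\<And>x. x \<in> a \<Longrightarrow> w' (w x) = x"
    using isometry_group_on_inverse[OF W w(1)] by metis
  have uw: "(\<lambda>x. u (w' x)) \<in> W" by (rule isometry_group_on_mult[OF W u(1) w'(1)])
  have "norm (u (w' (w (x s))) - u (w' (x t)) - (s - t) *\<^sub>R u (w' (v t))) \<le> \<epsilon> * \<bar>s - t\<bar>"
    using isometry_group_on_bounds[OF W uw isometry_group_on_closed[OF W w(1)] xa(1,2)] w(2) xa(1) by simp
  then show "\<exists>w\<in>W. norm (u (x s) - w (x t) - (s - t) *\<^sub>R w (v t)) \<le> \<epsilon> * \<bar>s - t\<bar>"
    using w'(2)[OF xa(1)] uw by (intro bexI[of _ "\<lambda>x. u (w' x)"]) auto
qed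

text \<open>As the argument tends to \<open>t\<close>, the values of \<open>q\<close> approach the
  finite set \<open>S\<close>; connectedness forbids passing from one point of \<open>S\<close> to
  another, so they converge to a single one.\<close>

lemma tendsto_of_near_finite:
  fixes q :: "real \<Rightarrow> 'a::real_normed_vector"
  assumes I: "connected I" "continuous_on I q" and "finite S"
    and near: "\<And>e. e > 0 \<Longrightarrow> \<exists>d>0. \<forall>s\<in>I. \<bar>s - t\<bar> < d \<longrightarrow> (\<exists>y\<in>S. norm (q s - y) \<le> e)"
    and acc: "\<And>d. d > 0 \<Longrightarrow> \<exists>s\<in>I. \<bar>s - t\<bar> < d" 
  shows "\<exists>y\<in>S. \<forall>e>0. \<exists>d>0. \<forall>s\<in>I. \<bar>s - t\<bar> < d \<longrightarrow> norm (q s - y) \<le> e"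
proof -
  obtain r where r: "r > 0" "\<And>y z. y \<in> S \<Longrightarrow> z \<in> S \<Longrightarrow> y \<noteq> z \<Longrightarrow> r \<le> norm (y - z)"
  proof -
    define R where "R = insert 1 ((\<lambda>(y, z). norm (y - z)) ` {(y, z) \<in> S \<times> S. y \<noteq> z})"
    have "finite {(y, z) \<in> S \<times> S. y \<noteq> z}" using \<open>finite S\<close>
      by (rule_tac finite_subset[of _ "S \<times> S"]) auto
    then have "finite R" by (simp add: R_def)
    then have "Min R > 0" by (subst Min_gr_iff) (auto simp: R_def)
    moreover have "Min R \<le> norm (y - z)" if "y \<in> S" "z \<in> S" "y \<noteq> z" for y z
      by (rule Min_le[OF \<open>finite R\<close>]) (use that in \<open>auto simp: R_def\<close>)
    ultimately show thesis using that by blast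
  qed
  \<comment> \<open>Distinct points of \<open>S\<close> are at least \<open>r\<close> apart. A value
    within \<open>e0\<close> of another point of \<open>S\<close> has distance at least
    \<open>3 * e0\<close> from \<open>y\<close>, so the distance from \<open>y\<close> never equals
    \<open>2 * e0\<close>.\<close>
  define e0 where "e0 = r / 4"
  have e0: "e0 > 0" using r by (simp add: e0_def)
  obtain d0 where d0: "d0 > 0" "\<And>s. s \<in> I \<Longrightarrow> \<bar>s - t\<bar> < d0 \<Longrightarrow> \<exists>y\<in>S. norm (q s - y) \<le> e0"
    using near[OF e0] by auto
  obtain s0 where s0: "s0 \<in> I" "\<bar>s0 - t\<bar> < d0" using acc[OF d0(1)] by auto
  obtain y where y: "y \<in> S" "norm (q s0 - y) \<le> e0" using d0(2)[OF s0] by auto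
  define I0 where "I0 = I \<inter> {t-d0<..<t+d0}"
  have "connected I0" unfolding I0_def using I(1)
    by (metis is_interval_connected_1 is_interval_Int is_interval_oo)
  have "continuous_on I0 (\<lambda>s. norm (q s - y))" unfolding I0_def
    by (intro continuous_intros continuous_on_subset[OF I(2)]) auto
  then have conn: "connected ((\<lambda>s. norm (q s - y)) ` I0)"
    using \<open>connected I0\<close> by (rule connected_continuous_image)
  have stay: "norm (q s - y) \<le> e0" if "s \<in> I0" for s
  proof (rule ccontr)
    assume far: "\<not> norm (q s - y) \<le> e0"
    have dich: "norm (q u - y) \<le> e0 \<or> norm (q u - y) \<ge> 3 * e0" if u: "u \<in> I0" for u
    proof -
      obtain z where z: "z \<in> S" "norm (q u - z) \<le> e0"
        using d0(2)[of u] u by (auto simp: I0_def abs_less_iff)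
      show ?thesis
      proof (cases "z = y")
        case False
        then have "r \<le> norm (y - z)" using r y z by auto
        also have "\<dots> \<le> norm (q u - y) + norm (q u - z)"
          using norm_triangle_ineq4[of "q u - z" "q u - y"] by (simp add: norm_minus_commute)
        finally show ?thesis using z by (simp add: e0_def)
      qed (use z in simp)
    qed
    have "s0 \<in> I0" using s0 by (auto simp: I0_def)
    have "2 * e0 \<in> (\<lambda>s. norm (q s - y)) ` I0"
    proof (rule connectedD_interval[OF conn])
      show "norm (q s0 - y) \<in> (\<lambda>s. norm (q s - y)) ` I0" using \<open>s0 \<in> I0\<close> by auto
      show "norm (q s - y) \<in> (\<lambda>s. norm (q s - y)) ` I0" using that by auto
      show "norm (q s0 - y) \<le> 2 * e0" "2 * e0 \<le> norm (q s - y)"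
        using y e0 dich[OF that] far by auto
    qed
    then show False using dich e0 by force
  qed
  show ?thesis
  proof (intro bexI[OF _ y(1)] allI impI)
    fix e :: real assume "e > 0"
    then have "min e e0 > 0" using e0 by simp
    from near[OF this] obtain d where d: "d > 0"
      "\<And>s. s \<in> I \<Longrightarrow> \<bar>s - t\<bar> < d \<Longrightarrow> \<exists>z\<in>S. norm (q s - z) \<le> min e e0" by auto
    show "\<exists>d>0. \<forall>s\<in>I. \<bar>s - t\<bar> < d \<longrightarrow> norm (q s - y) \<le> e"
    proof (intro exI[of _ "min d d0"] conjI ballI impI)
      fix s assume s: "s \<in> I" "\<bar>s - t\<bar> < min d d0"
      then obtain z where z: "z \<in> S" "norm (q s - z) \<le> min e e0" using d by auto
      have "norm (q s - y) \<le> e0" using stay[of s] s by (auto simp: I0_def abs_less_iff)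
      then have "norm (y - z) \<le> 2 * e0"
        using norm_triangle_ineq4[of "q s - z" "q s - y"] z by (simp add: norm_minus_commute)
      then have "y = z" using r(2)[OF y(1) z(1)] e0 r(1) by (auto simp: e0_def)
      then show "norm (q s - y) \<le> e" using z by simp
    qed (use d d0 in auto)
  qed
qed

text \<open>As \<open>x t\<close> is fixed by \<open>W\<close>, the difference quotients of the lift
  at \<open>t\<close> come close to the finite orbit of \<open>v t\<close>. They are continuous on
  the interval \<open>J\<close>, which avoids \<open>t\<close>, and so converge to one point of the
  orbit.\<close>

lemma lift_on_one_sided:
  assumes W: "isometry_group_on W a" and rxv: "range x \<subseteq> a" "range v \<subseteq> a"
    and od: "orbit_differentiable W x v I" and t: "t \<in> I" "\<forall>w\<in>W. w (x t) = x t"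
    and J: "J \<subseteq> I" "connected J" "t \<notin> J" "\<forall>d>0. \<exists>s\<in>J. \<bar>s - t\<bar> < d"
    and l: "lift_on W x v J l"
  shows "\<exists>w\<in>W. \<forall>e>0. \<exists>d>0. \<forall>s\<in>J. \<bar>s - t\<bar> < d \<longrightarrow>
           norm (l s - x t - (s - t) *\<^sub>R w (v t)) \<le> e * \<bar>s - t\<bar>"
proof -
  define q where "q s = (1 / (s - t)) *\<^sub>R (l s - x t)" for s
  have q: "norm (q s - y) \<le> e \<longleftrightarrow> norm (l s - x t - (s - t) *\<^sub>R y) \<le> e * \<bar>s - t\<bar>" if "s \<in> J" for s y e
  proof -
    have "s - t \<noteq> 0" using that J by auto
    then have "l s - x t - (s - t) *\<^sub>R y = (s - t) *\<^sub>R (q s - y)"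
      by (simp add: q_def scaleR_diff_right)
    then have "norm (l s - x t - (s - t) *\<^sub>R y) = \<bar>s - t\<bar> * norm (q s - y)" by simp
    then show ?thesis using \<open>s - t \<noteq> 0\<close> by (simp add: mult.commute)
  qed
  have "\<exists>y\<in>(\<lambda>w. w (v t)) ` W. \<forall>e>0. \<exists>d>0. \<forall>s\<in>J. \<bar>s - t\<bar> < d \<longrightarrow> norm (q s - y) \<le> e"
  proof (rule tendsto_of_near_finite[OF J(2)])
    have "continuous_on J l"
      using l unfolding lift_on_def continuous_on_eq_continuous_within
      by (meson has_vector_derivative_continuous continuous_at_imp_continuous_within)
    then show "continuous_on J q" unfolding q_def using J by (intro continuous_intros) auto
    show "finite ((\<lambda>w. w (v t)) ` W)" using W by (simp add: isometry_group_on_def)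
    fix e :: real assume "e > 0"
    then obtain d where d: "d > 0" "\<And>s. s \<in> I \<Longrightarrow> \<bar>s - t\<bar> < d \<Longrightarrow>
      \<exists>w\<in>W. norm (w (x s) - x t - (s - t) *\<^sub>R v t) \<le> e * \<bar>s - t\<bar>"
      using orbit_differentiableE[OF od t(1)] by blast
    show "\<exists>d>0. \<forall>s\<in>J. \<bar>s - t\<bar> < d \<longrightarrow> (\<exists>y\<in>(\<lambda>w. w (v t)) ` W. norm (q s - y) \<le> e)"
    proof (intro exI[of _ d] conjI ballI impI d(1))
      fix s assume s: "s \<in> J" "\<bar>s - t\<bar> < d"
      then obtain u where u: "u \<in> W" "l s = u (x s)" using l unfolding lift_on_def by blast
      have "\<exists>w\<in>W. norm (w (x s) - x t - (s - t) *\<^sub>R v t) \<le> e * \<bar>s - t\<bar>" using d s J by auto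
      from orbit_differentiable_mult(2)[OF W rxv u(1) u(1) this]
      obtain w where "w \<in> W" "norm (u (x s) - w (x t) - (s - t) *\<^sub>R w (v t)) \<le> e * \<bar>s - t\<bar>" by auto
      then show "\<exists>y\<in>(\<lambda>w. w (v t)) ` W. norm (q s - y) \<le> e" using q[OF s(1)] u t by force
    qed
  qed (use J in auto)
  then show ?thesis using q by auto
qed

text \<open>The limits of the difference quotients from the left and from the right,
  \<open>w1 (v t)\<close> and \<open>w2 (v t)\<close>, may differ. Turning the right lift by the
  quotient of \<open>w1\<close> and \<open>w2\<close>, which fixes \<open>x t\<close>, makes them
  equal.\<close>

lemma lift_on_isolated_fixed_point:
  assumes W: "isometry_group_on W a" and rxv: "range x \<subseteq> a" "range v \<subseteq> a"
    and od: "orbit_differentiable W x v I" and t: "t \<in> I" "\<forall>w\<in>W. w (x t) = x t"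
    and "\<delta> > 0" and I: "{t-\<delta><..<t} \<subseteq> I" "{t<..<t+\<delta>} \<subseteq> I"
    and l: "lift_on W x v {t-\<delta><..<t} l1" "lift_on W x v {t<..<t+\<delta>} l2"
  shows "\<exists>l. lift_on W x v {t-\<delta><..<t+\<delta>} l"
proof -
  have "\<exists>s\<in>{t-\<delta><..<t}. \<bar>s - t\<bar> < d" "\<exists>s\<in>{t<..<t+\<delta>}. \<bar>s - t\<bar> < d" if "d > 0" for d
    using that \<open>\<delta> > 0\<close> by (intro bexI[of _ "t - min \<delta> d / 2"] bexI[of _ "t + min \<delta> d / 2"]; auto simp: min_def)+
  then have "\<forall>d>0. \<exists>s\<in>{t-\<delta><..<t}. \<bar>s - t\<bar> < d" "\<forall>d>0. \<exists>s\<in>{t<..<t+\<delta>}. \<bar>s - t\<bar> < d" by blast+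
  from lift_on_one_sided[OF W rxv od t I(1) connected_Ioo _ this(1) l(1)]
    lift_on_one_sided[OF W rxv od t I(2) connected_Ioo _ this(2) l(2)]
  obtain w1 w2 where w: "w1 \<in> W" "w2 \<in> W"
    and w1: "\<And>e. e > 0 \<Longrightarrow> \<exists>d>0. \<forall>s\<in>{t-\<delta><..<t}. \<bar>s - t\<bar> < d \<longrightarrow>
           norm (l1 s - x t - (s - t) *\<^sub>R w1 (v t)) \<le> e * \<bar>s - t\<bar>"
    and w2: "\<And>e. e > 0 \<Longrightarrow> \<exists>d>0. \<forall>s\<in>{t<..<t+\<delta>}. \<bar>s - t\<bar> < d \<longrightarrow>
           norm (l2 s - x t - (s - t) *\<^sub>R w2 (v t)) \<le> e * \<bar>s - t\<bar>"
    by auto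
  obtain w2' where w2': "w2' \<in> W" "\<And>x. x \<in> a \<Longrightarrow> w2' (w2 x) = x"
    using isometry_group_on_inverse[OF W w(2)] by metis
  have xa: "x s \<in> a" "v s \<in> a" for s using rxv by auto
  define u where "u = (\<lambda>x. w1 (w2' x))"
  have u: "u \<in> W" "u (w2 (v t)) = w1 (v t)" "u (x t) = x t"
    using isometry_group_on_mult[OF W w(1) w2'(1)] w2' xa t by (auto simp: u_def)
  define l where "l s = (if s < t then l1 s else if s = t then x t else u (l2 s))" for s
  have "(l has_vector_derivative w1 (v t)) (at t)"
    unfolding has_vector_derivative_at_alt
  proof (intro allI impI)
    fix e :: real assume "e > 0"
    from w1[OF this] w2[OF this] obtain d1 d2 where d: "d1 > 0" "d2 > 0"
      and b1: "\<And>s. s\<in>{t-\<delta><..<t} \<Longrightarrow> \<bar>s - t\<bar> < d1 \<Longrightarrow> norm (l1 s - x t - (s - t) *\<^sub>R w1 (v t)) \<le> e * \<bar>s - t\<bar>"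
      and b2: "\<And>s. s\<in>{t<..<t+\<delta>} \<Longrightarrow> \<bar>s - t\<bar> < d2 \<Longrightarrow> norm (l2 s - x t - (s - t) *\<^sub>R w2 (v t)) \<le> e * \<bar>s - t\<bar>"
      by metis
    show "\<exists>d>0. \<forall>s. \<bar>s - t\<bar> < d \<longrightarrow> norm (l s - l t - (s - t) *\<^sub>R w1 (v t)) \<le> e * \<bar>s - t\<bar>"
    proof (intro exI[of _ "min \<delta> (min d1 d2)"] conjI allI impI)
      fix s assume s: "\<bar>s - t\<bar> < min \<delta> (min d1 d2)"
      consider "s < t" | "s = t" | "s > t" by linarith
      then show "norm (l s - l t - (s - t) *\<^sub>R w1 (v t)) \<le> e * \<bar>s - t\<bar>"
      proof cases
        case 1 then show ?thesis using b1[of s] s by (auto simp: l_def)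
      next
        case 2 then show ?thesis by simp
      next
        case 3
        then have sJ: "s \<in> {t<..<t+\<delta>}" using s by auto
        then obtain w' where w': "w' \<in> W" "l2 s = w' (x s)" using l unfolding lift_on_def by blast
        then have "l2 s \<in> a" using isometry_group_on_closed[OF W _ xa(1)] by auto
        then have "norm (u (l2 s) - u (x t) - (s - t) *\<^sub>R u (w2 (v t))) = norm (l2 s - x t - (s - t) *\<^sub>R w2 (v t))"
          by (rule isometry_group_on_bounds[OF W u(1)]) (use xa isometry_group_on_closed[OF W w(2)] in auto)
        then show ?thesis using b2[OF sJ] s 3 u by (auto simp: l_def)
      qed
    qed (use d \<open>\<delta> > 0\<close> in auto)
  qed
  moreover have "lift_on W x v {t-\<delta><..<t} l"
    by (rule lift_on_cong[OF l(1), of "{..<t}"]) (auto simp: l_def)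
  moreover have "lift_on W x v {t<..<t+\<delta>} l"
    by (rule lift_on_cong[OF lift_on_comp[OF W l(2) u(1)], of "{t<..}"]) (auto simp: l_def)
  moreover have "l t = w1 (x t)" by (simp add: l_def bspec[OF t(2) w(1)])
  ultimately have "lift_on W x v ({t-\<delta><..<t} \<union> {t} \<union> {t<..<t+\<delta>}) l"
    unfolding lift_on_def using w(1) by blast
  moreover have "{t-\<delta><..<t} \<union> {t} \<union> {t<..<t+\<delta>} = {t-\<delta><..<t+\<delta>}" using \<open>\<delta> > 0\<close> by auto
  ultimately show ?thesis by auto
qed

text \<open>Off the fixed points of \<open>W\<close> the problem reduces to a proper stabiliser.\<close>

lemma orbit_differentiable_stabilizer:
  assumes W: "isometry_group_on W a" and rxv: "range x \<subseteq> a" "range v \<subseteq> a"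
    and I: "open I" and od: "orbit_differentiable W x v I" and t: "t \<in> I"
  obtains x' v' \<delta> where "range x' \<subseteq> a" "range v' \<subseteq> a" "\<delta> > 0"
    "isometry_group_on {w\<in>W. w (x t) = x t} a"
    "orbit_differentiable {w\<in>W. w (x t) = x t} x' v' {t-\<delta><..<t+\<delta>}"
    "\<And>l. lift_on {w\<in>W. w (x t) = x t} x' v' {t-\<delta><..<t+\<delta>} l \<Longrightarrow> lift_on W x v {t-\<delta><..<t+\<delta>} l"
proof -
  let ?W0 = "{w\<in>W. w (x t) = x t}"
  have xa: "x s \<in> a" "v s \<in> a" for s using rxv by auto
  note closed = isometry_group_on_closed[OF W]
    and mult = isometry_group_on_mult[OF W]
  have finW: "finite W" using W by (auto simp: isometry_group_on_def)
  have W0: "isometry_group_on ?W0 a"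
    unfolding isometry_group_on_def
  proof (intro conjI ballI)
    obtain e where "e \<in> W" "\<And>x. x \<in> a \<Longrightarrow> e x = x" by (rule isometry_group_on_id[OF W]) blast
    then show "?W0 \<noteq> {}" using xa by auto
    fix w assume w: "w \<in> ?W0"
    then have wW: "w \<in> W" "w (x t) = x t" by auto
    obtain w' where w': "w' \<in> W" "\<And>x. x \<in> a \<Longrightarrow> w' (w x) = x"
      by (rule isometry_group_on_inverse[OF W wW(1)]) blast
    then have "w' (x t) = x t" using w'(2)[OF xa(1)[of t]] wW(2) by simp
    then show "\<exists>w'\<in>?W0. \<forall>x\<in>a. w' (w x) = x" using w' by auto
    fix w' assume "w' \<in> ?W0"
    then show "w \<circ> w' \<in> ?W0" using w mult[of w w'] by (auto simp: comp_def)
  qed (use W in \<open>auto simp: isometry_group_on_def\<close>)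
  define R where "R = insert 1 ((\<lambda>w. norm (w (x t) - x t)) ` {w\<in>W. w (x t) \<noteq> x t})"
  \<comment> \<open>Elements of \<open>W\<close> outside of the stabilizer move \<open>x t\<close>
    by at least \<open>4 * r\<close>; below, three distances smaller than \<open>r\<close> are added
    and stay under this bound.\<close>
  define r where "r = Min R / 4"
  have "finite R" using finW by (simp add: R_def)
  then have "Min R > 0" by (subst Min_gr_iff) (auto simp: R_def)
  then have r: "r > 0" by (simp add: r_def)
  have rw: "w \<in> ?W0" if "w \<in> W" "norm (w (x t) - x t) < 4 * r" for w
  proof (rule ccontr)
    assume "w \<notin> ?W0"
    then have "Min R \<le> norm (w (x t) - x t)"
      using that by (intro Min_le[OF \<open>finite R\<close>]) (auto simp: R_def)
    then show False using that by (simp add: r_def)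
  qed
  obtain \<delta>0 where \<delta>0: "\<delta>0 > 0" "\<And>s. s \<in> I \<Longrightarrow> \<bar>s - t\<bar> < \<delta>0 \<Longrightarrow>
    \<exists>w\<in>W. norm (w (x s) - x t - (s - t) *\<^sub>R v t) \<le> 1 * \<bar>s - t\<bar>"
    using orbit_differentiableE[OF od t zero_less_one] by blast
  obtain \<delta>1 where \<delta>1: "\<delta>1 > 0" "\<And>s. \<bar>s - t\<bar> < \<delta>1 \<Longrightarrow> s \<in> I"
    using I t by (auto simp: open_real)
  \<comment> \<open>By the expansion at \<open>t\<close> with error constant \<open>1\<close>, some
    representative of \<open>x s\<close> is within \<open>1 + norm (v t)\<close> times the time
    difference of \<open>x t\<close>. The \<open>2\<close> makes room for strict
    inequalities.\<close>
  define \<delta> where "\<delta> = min (min \<delta>0 \<delta>1) (r / (2 + norm (v t)))"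
  have pos: "2 + norm (v t) > 0" by (simp add: add_pos_nonneg)
  then have \<delta>: "\<delta> > 0" using \<delta>0 \<delta>1 r by (simp add: \<delta>_def)
  have "\<exists>w\<in>W. norm (w (x s) - x t) < r" if s: "\<bar>s - t\<bar> < \<delta>" for s
  proof -
    obtain w where w: "w \<in> W" "norm (w (x s) - x t - (s - t) *\<^sub>R v t) \<le> 1 * \<bar>s - t\<bar>"
      using \<delta>0(2)[of s] \<delta>1(2)[of s] s by (auto simp: \<delta>_def)
    have "norm (w (x s) - x t) \<le> norm (w (x s) - x t - (s - t) *\<^sub>R v t) + norm ((s - t) *\<^sub>R v t)"
      by (metis diff_add_cancel norm_triangle_ineq)
    also have "\<dots> \<le> \<bar>s - t\<bar> * (1 + norm (v t))" using w(2) by (simp add: distrib_left)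
    also have "\<dots> \<le> \<bar>s - t\<bar> * (2 + norm (v t))" by (intro mult_left_mono) auto
    also have "\<dots> < r" using s pos by (simp add: \<delta>_def pos_less_divide_eq)
    finally show ?thesis using w by auto
  qed
  then obtain u where u: "\<And>s. \<bar>s - t\<bar> < \<delta> \<Longrightarrow> u s \<in> W \<and> norm (u s (x s) - x t) < r" by metis
  \<comment> \<open>All representatives are now within \<open>r\<close> of \<open>x t\<close>, so a
    group element that nearly maps one of them to another nearly fixes \<open>x t\<close>, hence
    fixes it.\<close>
  define x' v' where "x' s = (if \<bar>s - t\<bar> < \<delta> then u s (x s) else x s)"
    and "v' s = (if \<bar>s - t\<bar> < \<delta> then u s (v s) else v s)" for s
  have x'a: "x' s \<in> a" "v' s \<in> a" for s using closed u xa by (auto simp: x'_def v'_def)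
  have "orbit_differentiable ?W0 x' v' {t-\<delta><..<t+\<delta>}"
    unfolding orbit_differentiable_def
  proof (intro ballI allI impI)
    fix p \<epsilon> :: real assume p: "p \<in> {t-\<delta><..<t+\<delta>}" and \<epsilon>: "\<epsilon> > 0"
    then have pt: "\<bar>p - t\<bar> < \<delta>" by auto
    then have "p \<in> I" using \<delta>1 by (auto simp: \<delta>_def)
    then obtain d where d: "d > 0" "\<And>s. s \<in> I \<Longrightarrow> \<bar>s - p\<bar> < d \<Longrightarrow>
      \<exists>w\<in>W. norm (w (x s) - x p - (s - p) *\<^sub>R v p) \<le> \<epsilon> * \<bar>s - p\<bar>"
      using orbit_differentiableE[OF od \<open>p \<in> I\<close> \<epsilon>] by blast
    have pos': "1 + \<epsilon> + norm (v' p) > 0" using \<epsilon> by (simp add: add_pos_nonneg)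
    show "\<exists>d>0. \<forall>s\<in>{t-\<delta><..<t+\<delta>}. \<bar>s - p\<bar> < d \<longrightarrow>
       (\<exists>w\<in>?W0. norm (w (x' s) - x' p - (s - p) *\<^sub>R v' p) \<le> \<epsilon> * \<bar>s - p\<bar>)"
    proof (intro exI[of _ "min d (r / (1 + \<epsilon> + norm (v' p)))"] conjI ballI impI)
      fix s assume s: "s \<in> {t-\<delta><..<t+\<delta>}" "\<bar>s - p\<bar> < min d (r / (1 + \<epsilon> + norm (v' p)))"
      then have st: "\<bar>s - t\<bar> < \<delta>" by auto
      then have "s \<in> I" using \<delta>1 by (auto simp: \<delta>_def)
      then have "\<exists>w\<in>W. norm (w (x s) - x p - (s - p) *\<^sub>R v p) \<le> \<epsilon> * \<bar>s - p\<bar>" using d s by auto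
      from orbit_differentiable_mult(1)[OF W rxv _ _ this, of "u s" "u p"] u[OF st] u[OF pt]
      obtain w where w: "w \<in> W" "norm (w (x' s) - x' p - (s - p) *\<^sub>R v' p) \<le> \<epsilon> * \<bar>s - p\<bar>"
        using st pt by (auto simp: x'_def v'_def)
      have "norm (w (x' s) - x' p) \<le> norm (w (x' s) - x' p - (s - p) *\<^sub>R v' p) + norm ((s - p) *\<^sub>R v' p)"
        by (metis diff_add_cancel norm_triangle_ineq)
      also have "\<dots> \<le> \<bar>s - p\<bar> * (\<epsilon> + norm (v' p))" using w(2) by (simp add: distrib_left mult.commute[of \<epsilon>])
      also have "\<dots> \<le> \<bar>s - p\<bar> * (1 + \<epsilon> + norm (v' p))" by (intro mult_left_mono) auto
      also have "\<dots> < r" using s pos' by (simp add: pos_less_divide_eq)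
      finally have 1: "norm (w (x' s) - x' p) < r" .
      have 2: "norm (x' p - x t) < r" using u[OF pt] pt by (simp add: x'_def)
      have "norm (w (x t) - w (x' s)) = norm (x t - x' s)"
        using isometry_group_on_bounds[OF W w(1) xa(1)[of t] x'a(1)[of s], of "x t" 0] xa by simp
      also have "\<dots> < r" using u[OF st] st by (simp add: x'_def norm_minus_commute)
      finally have 3: "norm (w (x t) - w (x' s)) < r" .
      have "norm (w (x t) - x t) \<le> norm (w (x t) - w (x' s)) + norm (w (x' s) - x' p) + norm (x' p - x t)"
        by (smt (verit) diff_add_cancel add_diff_eq norm_triangle_ineq)
      then have "norm (w (x t) - x t) < 4 * r" using 1 2 3 r by linarith
      then show "\<exists>w\<in>?W0. norm (w (x' s) - x' p - (s - p) *\<^sub>R v' p) \<le> \<epsilon> * \<bar>s - p\<bar>"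
        using rw w by blast
    qed (use d r pos' in auto)
  qed
  moreover have "lift_on W x v {t-\<delta><..<t+\<delta>} l" if l: "lift_on ?W0 x' v' {t-\<delta><..<t+\<delta>} l" for l
    unfolding lift_on_def
  proof
    fix s assume s: "s \<in> {t-\<delta><..<t+\<delta>}"
    then obtain w where w: "w \<in> W" "l s = w (x' s)" "(l has_vector_derivative w (v' s)) (at s)"
      using l unfolding lift_on_def by blast
    have "\<bar>s - t\<bar> < \<delta>" using s by auto
    then show "\<exists>w\<in>W. l s = w (x s) \<and> (l has_vector_derivative w (v s)) (at s)"
      using w u mult[of w "u s"] by (intro bexI[of _ "\<lambda>x. w (u s x)"]) (auto simp: x'_def v'_def)
  qed
  ultimately show thesis using that[OF _ _ \<delta> W0] x'a by blast
qed

text \<open>The times \<open>F\<close> fixed by \<open>W\<close> need not be isolated. At an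
  accumulation point of \<open>F\<close> not only \<open>x t\<close> but also \<open>v t\<close> is
  fixed, being a limit of fixed difference quotients. There every choice of representatives is
  differentiable, so a lift has to be constructed only on the open set \<open>O'\<close> of the
  other times.\<close>

theorem orbit_differentiable_lift:
  assumes "isometry_group_on W a" and "range x \<subseteq> a" "range v \<subseteq> a"
    and "open I" and "orbit_differentiable W x v I"
  shows "\<exists>l. lift_on W x v I l"
  using assms
proof (induction "card W" arbitrary: W x v I rule: less_induct)
  case less
  note W = less.prems(1) and rxv = less.prems(2,3) and I = less.prems(4) and od = less.prems(5)
  have xa: "x s \<in> a" "v s \<in> a" for s using rxv by auto
  have subsp: "subspace a" and finW: "finite W" using W by (auto simp: isometry_group_on_def)
  have lin: "linear w" if "w \<in> W" for w using W that by (auto simp: isometry_group_on_def)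
  define F where "F = {t\<in>I. \<forall>w\<in>W. w (x t) = x t}"
  define F' where "F' = {t\<in>I. t islimpt F}"
  have nearF: "\<exists>s\<in>F. s \<noteq> t \<and> \<bar>s - t\<bar> < d" if "t \<in> F'" "d > 0" for t d
    using that unfolding F'_def islimpt_approachable dist_real_def by auto
  have approx: "\<exists>d>0. \<forall>s\<in>F. \<bar>s - t\<bar> < d \<longrightarrow> norm (x s - x t - (s - t) *\<^sub>R v t) \<le> \<epsilon> * \<bar>s - t\<bar>"
    if tI: "t \<in> I" "\<epsilon> > 0" for t \<epsilon>
  proof -
    obtain d where d: "d > 0" "\<And>s. s \<in> I \<Longrightarrow> \<bar>s - t\<bar> < d \<Longrightarrow>
      \<exists>w\<in>W. norm (w (x s) - x t - (s - t) *\<^sub>R v t) \<le> \<epsilon> * \<bar>s - t\<bar>"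
      using orbit_differentiableE[OF od tI] by blast
    have "norm (x s - x t - (s - t) *\<^sub>R v t) \<le> \<epsilon> * \<bar>s - t\<bar>" if s: "s \<in> F" "\<bar>s - t\<bar> < d" for s
    proof -
      have "s \<in> I" "\<And>w. w \<in> W \<Longrightarrow> w (x s) = x s" using s by (auto simp: F_def)
      then show ?thesis using d(2)[of s] s(2) by force
    qed
    then show ?thesis using d(1) by blast
  qed
  have quot: "\<exists>s\<in>F. s \<noteq> t \<and> norm (x s - x t) < e \<and> norm ((1 / (s - t)) *\<^sub>R (x s - x t) - v t) < e"
    if t: "t \<in> F'" and e: "e > 0" for t e
  proof -
    have tI: "t \<in> I" using t by (simp add: F'_def)
    define e' where "e' = min (e / 2) 1"
    have e': "e' > 0" "e' < e" "e' \<le> 1" using e by (auto simp: e'_def min_def)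
    obtain d where d: "d > 0" "\<And>s. s \<in> F \<Longrightarrow> \<bar>s - t\<bar> < d \<Longrightarrow> norm (x s - x t - (s - t) *\<^sub>R v t) \<le> e' * \<bar>s - t\<bar>"
      using approx[OF tI e'(1)] by auto
    have pos: "1 + norm (v t) > 0" by (simp add: add_pos_nonneg)
    obtain s where s: "s \<in> F" "s \<noteq> t" "\<bar>s - t\<bar> < min d (e / (1 + norm (v t)))"
      using nearF[OF t, of "min d (e / (1 + norm (v t)))"] d e pos by auto
    have b: "norm (x s - x t - (s - t) *\<^sub>R v t) \<le> e' * \<bar>s - t\<bar>" using d s by auto
    have "norm (x s - x t) \<le> norm (x s - x t - (s - t) *\<^sub>R v t) + norm ((s - t) *\<^sub>R v t)"
      by (metis diff_add_cancel norm_triangle_ineq)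
    also have "\<dots> \<le> 1 * \<bar>s - t\<bar> + \<bar>s - t\<bar> * norm (v t)"
      using b e'(3) mult_right_mono[OF e'(3), of "\<bar>s - t\<bar>"] by simp
    also have "\<dots> = \<bar>s - t\<bar> * (1 + norm (v t))" by (simp add: algebra_simps)
    also have "\<dots> < e" using s pos by (simp add: pos_less_divide_eq)
    finally have 1: "norm (x s - x t) < e" .
    have "x s - x t - (s - t) *\<^sub>R v t = (s - t) *\<^sub>R ((1 / (s - t)) *\<^sub>R (x s - x t) - v t)"
      using s by (simp add: scaleR_diff_right)
    then have "\<bar>s - t\<bar> * norm ((1 / (s - t)) *\<^sub>R (x s - x t) - v t) \<le> e' * \<bar>s - t\<bar>" using b by simp
    then have "norm ((1 / (s - t)) *\<^sub>R (x s - x t) - v t) \<le> e'" using s by (simp add: mult.commute)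
    then show ?thesis using 1 e' s by (intro bexI[of _ s]) auto
  qed
  have fixed: "w (x t) = x t" "w (v t) = v t" if t: "t \<in> F'" and w: "w \<in> W" for t w
  proof -
    have *: "w y = y" if y: "y \<in> a" and ap: "\<And>e. e > 0 \<Longrightarrow> \<exists>z\<in>a. w z = z \<and> norm (z - y) < e" for y
    proof (rule ccontr)
      assume "w y \<noteq> y"
      then have "norm (w y - y) / 2 > 0" by simp
      then obtain z where z: "z \<in> a" "w z = z" "norm (z - y) < norm (w y - y) / 2" using ap by blast
      have "norm (w y - z) = norm (y - z)"
        using isometry_group_on_bounds[OF W w y z(1) y, of 0] z(2) by simp
      then have "norm (w y - y) \<le> norm (z - y) + norm (z - y)"
        using norm_triangle_ineq[of "w y - z" "z - y"] by (simp add: norm_minus_commute)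
      then show False using z by simp
    qed
    show "w (x t) = x t"
    proof (rule *[OF xa(1)])
      fix e :: real assume "e > 0"
      from quot[OF t this] show "\<exists>z\<in>a. w z = z \<and> norm (z - x t) < e"
        using w xa by (auto simp: F_def)
    qed
    show "w (v t) = v t"
    proof (rule *[OF xa(2)])
      fix e :: real assume "e > 0"
      from quot[OF t this] obtain s where s: "s \<in> F" "norm ((1 / (s - t)) *\<^sub>R (x s - x t) - v t) < e" by auto
      let ?z = "(1 / (s - t)) *\<^sub>R (x s - x t)"
      have "w ?z = (1 / (s - t)) *\<^sub>R (w (x s) - w (x t))" using lin[OF w] by (simp add: linear_scale linear_diff)
      also have "\<dots> = ?z" using s w \<open>w (x t) = x t\<close> by (simp add: F_def)
      finally show "\<exists>z\<in>a. w z = z \<and> norm (z - v t) < e"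
        using s xa subsp by (intro bexI[of _ ?z]) (auto intro: subspace_scale subspace_diff)
    qed
  qed
  define O' where "O' = I - F'"
  have "O' = I \<inter> - {t. t islimpt F}" by (auto simp: O'_def F'_def)
  then have "open O'" using I by (simp add: open_Int closed_limpts open_Compl)
  have localO: "\<exists>\<delta>>0. \<exists>l. lift_on W x v {t-\<delta><..<t+\<delta>} l" if t: "t \<in> I" "t \<notin> F" for t
  proof -
    obtain x' v' \<delta> where *: "range x' \<subseteq> a" "range v' \<subseteq> a" "\<delta> > 0"
      "isometry_group_on {w\<in>W. w (x t) = x t} a"
      "orbit_differentiable {w\<in>W. w (x t) = x t} x' v' {t-\<delta><..<t+\<delta>}"
      "\<And>l. lift_on {w\<in>W. w (x t) = x t} x' v' {t-\<delta><..<t+\<delta>} l \<Longrightarrow> lift_on W x v {t-\<delta><..<t+\<delta>} l"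
      using orbit_differentiable_stabilizer[OF W rxv I od t(1)] by blast
    have "card {w\<in>W. w (x t) = x t} < card W"
      by (rule psubset_card_mono[OF finW]) (use t in \<open>auto simp: F_def\<close>)
    from less.hyps[OF this *(4,1,2) open_greaterThanLessThan *(5)]
    obtain l where "lift_on {w\<in>W. w (x t) = x t} x' v' {t-\<delta><..<t+\<delta>} l" by (rule exE)
    from *(6)[OF this] *(3) show ?thesis by (rule_tac exI[of _ \<delta>]) (rule conjI, assumption, rule exI)
  qed
  have "\<exists>\<delta>>0. \<exists>l. lift_on W x v {t-\<delta><..<t+\<delta>} l" if t: "t \<in> O'" for t
  proof (cases "t \<in> F")
    case True
    have "\<not> t islimpt F" "t \<in> I" using t True by (auto simp: O'_def F'_def)
    then obtain d1 where d1: "d1 > 0" "\<And>s. s \<in> F \<Longrightarrow> \<bar>s - t\<bar> < d1 \<Longrightarrow> s = t"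
      unfolding islimpt_approachable dist_real_def by (metis (no_types, lifting))
    obtain d2 where d2: "d2 > 0" "\<And>s. \<bar>s - t\<bar> < d2 \<Longrightarrow> s \<in> I"
      using I \<open>t \<in> I\<close> by (auto simp: open_real)
    define d where "d = min d1 d2"
    have d: "d > 0" using d1 d2 by (simp add: d_def)
    have sub: "{t-d<..<t} \<subseteq> I - F" "{t<..<t+d} \<subseteq> I - F"
      using d1 d2 by (force simp: d_def)+
    have "\<exists>l. lift_on W x v {t-d<..<t} l" "\<exists>l. lift_on W x v {t<..<t+d} l"
      using sub localO by (intro lift_on_open_interval[OF W rxv]; auto)+
    then obtain l1 l2 where "lift_on W x v {t-d<..<t} l1" "lift_on W x v {t<..<t+d} l2" by auto
    from lift_on_isolated_fixed_point[OF W rxv od \<open>t \<in> I\<close> _ d _ _ this] sub True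
    show ?thesis using d by (auto simp: F_def)
  qed (use localO t in \<open>auto simp: O'_def\<close>)
  then obtain m where m: "lift_on W x v O' m" using lift_on_open[OF W rxv \<open>open O'\<close>] by blast
  \<comment> \<open>For a time of \<open>I\<close> outside of \<open>O'\<close> there is no choice:
    \<open>x t\<close> is fixed by \<open>W\<close>.\<close>
  define l where "l t = (if t \<in> O' then m t else x t)" for t
  have lO: "lift_on W x v O' l" by (rule lift_on_cong[OF m \<open>open O'\<close>]) (auto simp: l_def)
  obtain e where e: "e \<in> W" "\<And>x. x \<in> a \<Longrightarrow> e x = x" by (rule isometry_group_on_id[OF W]) blast
  have lW: "\<exists>w\<in>W. l s = w (x s)" if "s \<in> I" for s
  proof (cases "s \<in> O'")
    case True then show ?thesis using lO unfolding lift_on_def by blast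
  next
    case False then show ?thesis using e(1) e(2)[OF xa(1)] by (intro bexI[of _ e]) (simp_all add: l_def)
  qed
  have "(l has_vector_derivative v t) (at t)" if t: "t \<in> F'" for t
    unfolding has_vector_derivative_at_alt
  proof (intro allI impI)
    fix \<epsilon> :: real assume "\<epsilon> > 0"
    have tI: "t \<in> I" using t by (simp add: F'_def)
    obtain d1 where d1: "d1 > 0" "\<And>s. s \<in> I \<Longrightarrow> \<bar>s - t\<bar> < d1 \<Longrightarrow>
      \<exists>w\<in>W. norm (w (x s) - x t - (s - t) *\<^sub>R v t) \<le> \<epsilon> * \<bar>s - t\<bar>"
      using orbit_differentiableE[OF od tI \<open>\<epsilon> > 0\<close>] by blast
    obtain d2 where d2: "d2 > 0" "\<And>s. \<bar>s - t\<bar> < d2 \<Longrightarrow> s \<in> I"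
      using I tI by (auto simp: open_real)
    show "\<exists>d>0. \<forall>s. \<bar>s - t\<bar> < d \<longrightarrow> norm (l s - l t - (s - t) *\<^sub>R v t) \<le> \<epsilon> * \<bar>s - t\<bar>"
    proof (intro exI[of _ "min d1 d2"] conjI allI impI)
      fix s assume s: "\<bar>s - t\<bar> < min d1 d2"
      then obtain u where u: "u \<in> W" "l s = u (x s)" using lW d2 by force
      have "\<exists>w\<in>W. norm (w (x s) - x t - (s - t) *\<^sub>R v t) \<le> \<epsilon> * \<bar>s - t\<bar>" using d1 d2 s by auto
      from orbit_differentiable_mult(2)[OF W rxv u(1) u(1) this]
      obtain w where w: "w \<in> W" "norm (u (x s) - w (x t) - (s - t) *\<^sub>R w (v t)) \<le> \<epsilon> * \<bar>s - t\<bar>" by auto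
      have "l t = x t" using t by (auto simp: l_def O'_def)
      then show "norm (l s - l t - (s - t) *\<^sub>R v t) \<le> \<epsilon> * \<bar>s - t\<bar>"
        using w(2) u(2) by (simp add: fixed[OF t w(1)])
    qed (use d1 d2 in auto)
  qed
  moreover have "l t = e (x t)" "e (v t) = v t" if "t \<in> F'" for t
    using that e xa by (auto simp: l_def O'_def)
  ultimately have "lift_on W x v F' l"
    unfolding lift_on_def by (intro ballI bexI[OF _ e(1)]) simp
  then have "lift_on W x v (O' \<union> F') l"
    using lO unfolding lift_on_def by blast
  then have "lift_on W x v I l" by (rule lift_on_subset) (auto simp: O'_def)
  then show ?case by blast
qed

section \<open>Symmetric Lie algebras with a compact group of automorphisms\<close>

definition trace_of :: "('a::euclidean_space \<Rightarrow> 'a) \<Rightarrow> real" where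
  "trace_of f = (\<Sum>b\<in>Basis. f b \<bullet> b)"

lemma trace_of_comp_commute:
  fixes f g :: "'a::euclidean_space \<Rightarrow> 'a"
  assumes "linear f" "linear g" shows "trace_of (\<lambda>x. f (g x)) = trace_of (\<lambda>x. g (f x))"
proof -
  have *: "f y = (\<Sum>c\<in>Basis. (y \<bullet> c) *\<^sub>R f c)" if "linear f" for f :: "'a \<Rightarrow> 'a" and y
    using that by (metis (mono_tags, lifting) euclidean_representation linear_sum linear_scale sum.cong)
  have "trace_of (\<lambda>x. f (g x)) = (\<Sum>b\<in>Basis. \<Sum>c\<in>Basis. (g b \<bullet> c) * (f c \<bullet> b))"
    unfolding trace_of_def by (subst *[OF assms(1)]) (simp add: inner_sum_left)
  also have "\<dots> = (\<Sum>c\<in>Basis. \<Sum>b\<in>Basis. (f c \<bullet> b) * (g b \<bullet> c))"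
    by (subst sum.swap) (simp add: mult.commute)
  also have "\<dots> = trace_of (\<lambda>x. g (f x))"
    unfolding trace_of_def by (subst (2) *[OF assms(2)]) (simp add: inner_sum_left)
  finally show ?thesis .
qed

lemma trace_of_diff: "trace_of (\<lambda>x. f x - g x) = trace_of f - trace_of g"
  by (simp add: trace_of_def inner_diff_left sum_subtractf)

definition symmetric_automorphism ::
  "('a::euclidean_space \<Rightarrow> 'a \<Rightarrow> 'a) \<Rightarrow> ('a \<Rightarrow> 'a) \<Rightarrow> ('a \<Rightarrow> 'a) \<Rightarrow> bool" where
  "symmetric_automorphism br s A \<longleftrightarrow> linear A \<and> (\<forall>x y. A (br x y) = br (A x) (A y)) \<and>
     (\<forall>x. A (s x) = s (A x)) \<and> (\<forall>x y. A x \<bullet> A y = x \<bullet> y)"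

text \<open>What is used of the Lie groups, with the inner product of the type as the invariant one.
  Of the one-parameter group generated by \<open>br x\<close>, the assumption \<open>flow\<close>
  keeps the derivative at \<open>0\<close> and that the kernel of \<open>br x\<close> stays fixed;
  the latter serves for maxima over stabilizers. Semisimplicity appears as the absence of nonzero
  Abelian ideals.\<close>

locale orthogonal_symmetric_algebra =
  fixes br :: "'a::euclidean_space \<Rightarrow> 'a \<Rightarrow> 'a" and s :: "'a \<Rightarrow> 'a" and H :: "('a \<Rightarrow>\<^sub>L 'a) set"
  assumes bil: "bilinear br" and alt: "br x x = 0"
    and jacobi: "br x (br y z) + br y (br z x) + br z (br x y) = 0"
    and s_linear: "linear s" and s_br: "s (br x y) = br (s x) (s y)" and s_s: "s (s x) = x"
    and s_inner: "s x \<bullet> s y = x \<bullet> y"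
    and no_abelian_ideal: "\<And>J. subspace J \<Longrightarrow> (\<And>x y. y \<in> J \<Longrightarrow> br x y \<in> J) \<Longrightarrow>
      (\<And>x y. x \<in> J \<Longrightarrow> y \<in> J \<Longrightarrow> br x y = 0) \<Longrightarrow> J \<subseteq> {0}"
    and H_compact: "compact H" and H_id: "id_blinfun \<in> H"
    and H_comp: "\<And>A C. A \<in> H \<Longrightarrow> C \<in> H \<Longrightarrow> A o\<^sub>L C \<in> H"
    and H_inv: "\<And>A. A \<in> H \<Longrightarrow> \<exists>C\<in>H. \<forall>x. C (A x) = x \<and> A (C x) = x"
    and H_aut: "\<And>A. A \<in> H \<Longrightarrow> symmetric_automorphism br s A"
    and flow: "\<And>x. s x = x \<Longrightarrow> \<exists>e::real \<Rightarrow> 'a \<Rightarrow>\<^sub>L 'a. e 0 = id_blinfun \<and> (\<forall>t. e t \<in> H) \<and>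
      (\<forall>y. ((\<lambda>t. e t y) has_vector_derivative br x y) (at 0)) \<and> (\<forall>y. br x y = 0 \<longrightarrow> (\<forall>t. e t y = y))"
begin

abbreviation kk where "kk \<equiv> k_part s"
abbreviation pp where "pp \<equiv> p_part s"

lemmas br_simps = bilinear_ladd[OF bil] bilinear_radd[OF bil] bilinear_lmul[OF bil] bilinear_rmul[OF bil]
  bilinear_lneg[OF bil] bilinear_rneg[OF bil] bilinear_lzero[OF bil] bilinear_rzero[OF bil]
  bilinear_lsub[OF bil] bilinear_rsub[OF bil]

lemma br_linear: "linear (br x)" "linear (\<lambda>x. br x y)"
  using bil by (auto simp: bilinear_def)

lemma br_anti: "br x y = - br y x"
proof -
  have "br x y + br y x = br (x + y) (x + y)"
    by (simp only: br_simps alt[of x] alt[of y]) simp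
  then have "br x y + br y x = 0" by (simp only: alt)
  then show ?thesis by (simp add: eq_neg_iff_add_eq_0)
qed

lemma br_zero_sym: "br x y = 0 \<longleftrightarrow> br y x = 0"
  using br_anti[of x y] by simp

lemma br_br: "br x (br y z) = br (br x y) z + br y (br x z)"
proof -
  have "br x (br y z) = - br y (br z x) - br z (br x y)"
    using jacobi[of x y z] by (simp add: algebra_simps eq_neg_iff_add_eq_0)
  also have "\<dots> = br y (br x z) + br (br x y) z"
    using br_anti[of z x] br_anti[of z "br x y"] by (simp add: br_simps)
  finally show ?thesis by (simp add: add.commute)
qed

lemma kkD: "x \<in> kk \<Longrightarrow> s x = x"
  and ppI: "s x = - x \<Longrightarrow> x \<in> pp" and ppD: "x \<in> pp \<Longrightarrow> s x = - x"
  by (auto simp: k_part_def p_part_def)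

lemma subspace_kk: "subspace kk" and subspace_pp: "subspace pp"
  using s_linear by (auto simp: subspace_def k_part_def p_part_def linear_0 linear_add linear_scale)

lemma br_kp: "x \<in> kk \<Longrightarrow> y \<in> pp \<Longrightarrow> br x y \<in> pp"
  and br_pk: "x \<in> pp \<Longrightarrow> y \<in> kk \<Longrightarrow> br x y \<in> pp"
  and br_pp: "x \<in> pp \<Longrightarrow> y \<in> pp \<Longrightarrow> br x y \<in> kk"
  by (auto simp: k_part_def p_part_def s_br br_simps)

lemma decomp: obtains u v where "u \<in> kk" "v \<in> pp" "x = u + v"
proof (rule that)
  show "(1/2) *\<^sub>R (x + s x) \<in> kk" "(1/2) *\<^sub>R (x - s x) \<in> pp"
    using s_linear by (auto simp: k_part_def p_part_def linear_add linear_diff linear_scale s_s algebra_simps)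
  show "x = (1/2) *\<^sub>R (x + s x) + (1/2) *\<^sub>R (x - s x)"
    by (simp add: algebra_simps flip: scaleR_add_left)
qed

section \<open>The Killing form and its operator\<close>

definition killing where "killing x y = trace_of (\<lambda>z. br x (br y z))"

lemma killing_sym: "killing x y = killing y x"
  unfolding killing_def by (rule trace_of_comp_commute) (rule br_linear)+

lemma killing_linear: "linear (killing x)" "linear (\<lambda>x. killing x y)"
  by (rule linearI; simp add: killing_def trace_of_def br_simps inner_add_left sum.distrib sum_distrib_left)+

lemma killing_add: "killing (x + x') y = killing x y + killing x' y" "killing y (x + x') = killing y x + killing y x'"
  and killing_minus: "killing (- x) y = - killing x y" "killing y (- x) = - killing y x"
  and killing_diff: "killing (x - x') y = killing x y - killing x' y"
  and killing_zero: "killing 0 y = 0" "killing y 0 = 0"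
  by (simp_all add: linear_add[OF killing_linear(1)] linear_add[OF killing_linear(2)] linear_neg[OF killing_linear(1)]
      linear_neg[OF killing_linear(2)] linear_0[OF killing_linear(1)] linear_0[OF killing_linear(2)]
      linear_diff[OF killing_linear(2)])

text \<open>By the Jacobi identity \<open>br (br x y)\<close> is the commutator of
  \<open>br x\<close> and \<open>br y\<close>; the rest is cyclicity of the trace.\<close>

lemma killing_br: "killing (br x y) z = killing x (br y z)"
proof -
  have "killing (br x y) z = trace_of (\<lambda>w. br x (br y (br z w)) - br y (br x (br z w)))"
    unfolding killing_def using br_br[of x y] by simp
  also have "\<dots> = trace_of (\<lambda>w. br x (br y (br z w))) - trace_of (\<lambda>w. br y (br x (br z w)))"
    by (rule trace_of_diff)
  also have "trace_of (\<lambda>w. br y (br x (br z w))) = trace_of (\<lambda>w. br x (br z (br y w)))"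
    using trace_of_comp_commute[OF br_linear(1)[of y] linear_compose[OF br_linear(1)[of z] br_linear(1)[of x]]]
    by (simp add: o_def)
  also have "trace_of (\<lambda>w. br x (br y (br z w))) - trace_of (\<lambda>w. br x (br z (br y w)))
     = trace_of (\<lambda>w. br x (br y (br z w)) - br x (br z (br y w)))"
    by (rule trace_of_diff[symmetric])
  also have "\<dots> = killing x (br y z)"
  proof -
    have "br x (br y (br z w)) - br x (br z (br y w)) = br x (br (br y z) w)" for w
      using br_br[of y z w] by (simp add: br_simps)
    then show ?thesis unfolding killing_def by simp
  qed
  finally show ?thesis .
qed

lemma killing_s: "killing (s x) (s y) = killing x y"
proof -
  have "killing (s x) (s y) = trace_of (\<lambda>z. s (br x (br y (s z))))"
    unfolding killing_def by (simp add: s_br s_s)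
  also have "\<dots> = trace_of (\<lambda>z. br x (br y (s (s z))))"
    using trace_of_comp_commute[OF s_linear linear_compose[OF s_linear
        linear_compose[OF br_linear(1)[of y] br_linear(1)[of x]]]]
    by (simp add: o_def)
  finally show ?thesis by (simp add: killing_def s_s)
qed

text \<open>The derivative at \<open>0\<close> of the constant inner product of two vectors moved by
  the flow of \<open>x\<close>.\<close>

lemma skew: assumes "x \<in> kk" shows "br x y \<bullet> z = - (y \<bullet> br x z)"
proof -
  obtain e :: "real \<Rightarrow> 'a \<Rightarrow>\<^sub>L 'a" where e: "e 0 = id_blinfun" "\<And>t. e t \<in> H"
    "\<And>y. ((\<lambda>t. e t y) has_vector_derivative br x y) (at 0)"
    using flow[OF kkD[OF assms]] by blast
  have "((\<lambda>t. e t y \<bullet> e t z) has_vector_derivative (e 0 y \<bullet> br x z + br x y \<bullet> e 0 z)) (at 0)"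
    by (rule bounded_bilinear.has_vector_derivative[OF bounded_bilinear_inner e(3) e(3)])
  moreover have "e t y \<bullet> e t z = y \<bullet> z" for t
    using H_aut[OF e(2)] by (simp add: symmetric_automorphism_def)
  ultimately have "((\<lambda>t. y \<bullet> z) has_vector_derivative (y \<bullet> br x z + br x y \<bullet> z)) (at 0)"
    using e(1) by simp
  from vector_derivative_unique_at[OF this has_vector_derivative_const] show ?thesis by simp
qed

lemma center_trivial: assumes "\<And>y. br x y = 0" shows "x = 0"
proof -
  have "{x. \<forall>y. br x y = 0} \<subseteq> {0}"
  proof (rule no_abelian_ideal)
    show "subspace {x. \<forall>y. br x y = 0}" by (auto simp: subspace_def br_simps)
    fix u v assume v: "v \<in> {x. \<forall>y. br x y = 0}"
    then have "br u v = 0" using br_zero_sym[of u v] by auto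
    then show "br u v \<in> {x. \<forall>y. br x y = 0}" by (simp add: br_simps)
  qed auto
  then show ?thesis using assms by auto
qed

text \<open>As \<open>br x\<close> is skew, \<open>killing x x\<close> is minus the sum of the
  squared norms of \<open>br x b\<close> over the basis. If it vanishes, \<open>x\<close> is
  central.\<close>

lemma killing_definite: assumes "x \<in> kk" "killing x x = 0" shows "x = 0"
proof (rule center_trivial)
  have "br x (br x b) \<bullet> b = - (br x b \<bullet> br x b)" for b by (rule skew[OF assms(1)])
  then have "killing x x = - (\<Sum>b\<in>Basis. br x b \<bullet> br x b)"
    unfolding killing_def trace_of_def by (simp add: sum_negf)
  then have "0 = (\<Sum>b\<in>Basis. br x b \<bullet> br x b)" using assms by simp
  then have "\<forall>b\<in>Basis. br x b \<bullet> br x b = 0"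
    by (subst (asm) eq_commute, subst (asm) sum_nonneg_eq_0_iff) auto
  then have "br x b = 0" if "b \<in> Basis" for b using that by simp
  then show "br x y = 0" for y
    by (rule linear_eq_0_on_span[OF br_linear(1), of Basis, rule_format]) (auto simp: span_Basis)
qed

definition killing_operator where "killing_operator x = (\<Sum>b\<in>Basis. killing x b *\<^sub>R b)"

lemma killing_operator_inner: "killing_operator x \<bullet> y = killing x y"
proof -
  have "killing_operator x \<bullet> y = (\<Sum>b\<in>Basis. killing x ((y \<bullet> b) *\<^sub>R b))"
    unfolding killing_operator_def inner_sum_left
    by (rule sum.cong[OF refl]) (simp add: linear_scale[OF killing_linear(1)] inner_commute)
  also have "\<dots> = killing x y"
    by (simp add: euclidean_representation flip: linear_sum[OF killing_linear(1)])
  finally show ?thesis .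
qed

lemma killing_operator_sym: "killing_operator x \<bullet> y = x \<bullet> killing_operator y"
  using killing_operator_inner[of x y] killing_operator_inner[of y x] killing_sym[of x y] by (simp add: inner_commute)

lemma killing_operator_eqI: "(\<And>y. killing_operator x \<bullet> y = z \<bullet> y) \<Longrightarrow> killing_operator x = z"
  by (metis vector_eq_rdot)

lemma killing_operator_linear: "linear killing_operator"
  by (rule linearI; rule killing_operator_eqI)
    (simp_all add: killing_operator_inner inner_add_left killing_add linear_scale[OF killing_linear(2)])

lemma killing_operator_pp: assumes "x \<in> pp" shows "killing_operator x \<in> pp"
proof (rule ppI)
  have "s (killing_operator x) \<bullet> y = (- killing_operator x) \<bullet> y" for y
    using s_inner[of "killing_operator x" "s y"] killing_operator_inner[of x "s y"] killing_s[of x "s y"] killing_operator_inner[of x y] ppD[OF assms]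
    by (simp add: s_s killing_minus)
  then show "s (killing_operator x) = - killing_operator x" by (metis vector_eq_rdot)
qed

lemma killing_operator_br: assumes "z \<in> kk" shows "killing_operator (br z x) = br z (killing_operator x)"
proof (rule killing_operator_eqI)
  fix y
  have "killing_operator (br z x) \<bullet> y = - killing (br x z) y" using br_anti[of z x] by (simp add: killing_operator_inner killing_minus)
  also have "\<dots> = - (killing_operator x \<bullet> br z y)" by (simp add: killing_br killing_operator_inner)
  also have "\<dots> = br z (killing_operator x) \<bullet> y" using skew[OF assms] by simp
  finally show "killing_operator (br z x) \<bullet> y = br z (killing_operator x) \<bullet> y" .
qed

text \<open>Both sides lie in \<open>kk\<close>. Since the Killing form and the inner product are
  invariant under \<open>kk\<close>, they have the same Killing products with all of
  \<open>kk\<close>, and definiteness on \<open>kk\<close> makes them equal.\<close>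

lemma killing_operator_swap: assumes "x \<in> pp" "y \<in> pp" shows "br (killing_operator x) y = br x (killing_operator y)"
proof -
  let ?d = "br (killing_operator x) y - br x (killing_operator y)"
  have k: "br (killing_operator x) y \<in> kk" "br x (killing_operator y) \<in> kk" using assms by (auto intro!: br_pp killing_operator_pp)
  have "killing (br (killing_operator x) y) w = killing (br x (killing_operator y)) w" if w: "w \<in> kk" for w
  proof -
    have "killing (br (killing_operator x) y) w = killing (br y w) (killing_operator x)" by (metis killing_br killing_sym)
    also have "\<dots> = - (killing_operator (br w y) \<bullet> killing_operator x)" using br_anti[of y w] by (simp add: killing_minus killing_operator_inner)
    also have "\<dots> = - (killing_operator x \<bullet> br w (killing_operator y))" by (simp add: killing_operator_br[OF w] inner_commute)
    also have "\<dots> = killing x (br (killing_operator y) w)" using br_anti[of w "killing_operator y"] by (simp add: killing_operator_inner killing_minus)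
    finally show ?thesis by (simp add: killing_br)
  qed
  moreover have "?d \<in> kk" using k subspace_kk by (simp add: subspace_diff)
  ultimately have "?d = 0" by (intro killing_definite) (simp_all add: killing_diff)
  then show ?thesis by simp
qed

lemma killing_br_br:
  "killing (br x y) (br x y) = killing y (br (br x y) x)"
proof -
  have "killing (br x y) (br x y) = - killing (br y x) (br x y)" using br_anti[of x y] by (simp add: killing_minus)
  also have "\<dots> = - killing y (br x (br x y))" by (simp add: killing_br)
  also have "\<dots> = killing y (br (br x y) x)" using br_anti[of x "br x y"] by (simp add: killing_minus)
  finally show ?thesis .
qed

text \<open>The bridge between the two forms. The left side is definite by
  \<open>killing_definite\<close>; on the right \<open>y\<close> is multiplied with a vector
  \<open>br z x\<close>, \<open>z \<in> kk\<close>, tangent to the orbit of \<open>x\<close>. The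
  identity rests on \<open>killing_operator x\<close> commuting with \<open>x\<close>.\<close>

lemma killing_br_operator:
  assumes "x \<in> pp" "y \<in> pp" shows "killing (br x y) (br x y) = - (y \<bullet> br (br y (killing_operator x)) x)"
proof -
  have "br x (killing_operator x) = - br x (killing_operator x)"
    using killing_operator_swap[OF assms(1,1)] br_anti[of "killing_operator x" x] by simp
  then have "2 *\<^sub>R br x (killing_operator x) = 0" by (simp add: scaleR_2 eq_neg_iff_add_eq_0)
  then have "br x (killing_operator x) = 0" by simp
  then have "br (br x y) (killing_operator x) = br x (br y (killing_operator x))"
    using br_br[of x y "killing_operator x"] by (simp add: br_simps)
  moreover have "killing (br x y) (br x y) = y \<bullet> br (br x y) (killing_operator x)"
    using killing_br_br[of x y] killing_operator_inner[of y "br (br x y) x"] killing_operator_sym killing_operator_br[OF br_pp[OF assms]] by simp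
  ultimately show ?thesis using br_anti[of x "br y (killing_operator x)"] by simp
qed

lemma commute_if_orthogonal:
  assumes "x \<in> pp" "y \<in> pp" "\<And>z. z \<in> kk \<Longrightarrow> y \<bullet> br z x = 0" shows "br x y = 0"
  using killing_br_operator[OF assms(1,2)] assms(3)[OF br_pp[OF assms(2) killing_operator_pp[OF assms(1)]]]
  by (intro killing_definite br_pp assms) simp

text \<open>An element of the kernel commutes with all of \<open>pp\<close>, because the Killing
  square of such a bracket vanishes. Hence the kernel in \<open>pp\<close> is an Abelian
  ideal.\<close>

lemma killing_operator_inj: assumes "x \<in> pp" "killing_operator x = 0" shows "x = 0"
proof -
  have "{x \<in> pp. killing_operator x = 0} \<subseteq> {0}"
  proof (rule no_abelian_ideal)
    show "subspace {x \<in> pp. killing_operator x = 0}"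
      using subspace_pp killing_operator_linear by (auto simp: subspace_def linear_0 linear_add linear_scale)
    have comm: "br u v = 0" if "u \<in> pp" "v \<in> {x \<in> pp. killing_operator x = 0}" for u v
      using that killing_br_br[of u v] killing_operator_inner[of v "br (br u v) u"] by (intro killing_definite br_pp) auto
    show "br u v = 0" if "u \<in> {x \<in> pp. killing_operator x = 0}" "v \<in> {x \<in> pp. killing_operator x = 0}" for u v
      using comm that by auto
    fix u v assume v: "v \<in> {x \<in> pp. killing_operator x = 0}"
    obtain u1 u2 where u: "u1 \<in> kk" "u2 \<in> pp" "u = u1 + u2" by (rule decomp)
    have "br u v = br u1 v" using comm[OF u(2) v] by (simp add: u br_simps)
    then show "br u v \<in> {x \<in> pp. killing_operator x = 0}"
      using v killing_operator_br[OF u(1), of v] br_kp[OF u(1)] by (auto simp: br_simps)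
  qed
  then show ?thesis using assms by auto
qed

section \<open>Centralizers in \<open>pp\<close> and tangent spaces of orbits\<close>

lemma subspace_p_centralizer: "subspace (p_centralizer br s x)"
  using subspace_pp by (auto simp: subspace_def p_centralizer_def br_simps)

lemma killing_operator_centralizer:
  assumes "x \<in> pp" "y \<in> pp" "br x y = 0" shows "br x (killing_operator y) = 0"
proof (rule commute_if_orthogonal)
  fix z assume "z \<in> kk"
  have "killing_operator y \<bullet> br z x = - killing (br y x) z"
    using br_anti[of z x] by (simp add: killing_operator_inner killing_minus killing_br)
  also have "br y x = 0" using assms br_zero_sym by blast
  finally show "killing_operator y \<bullet> br z x = 0" by (simp add: killing_zero)
qed (use assms killing_operator_pp in auto)

text \<open>Orthogonality for the Killing form would follow from invariance at once. To have it for
  the inner product, \<open>y\<close> is written as \<open>killing_operator u\<close> with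
  \<open>u\<close> in the centralizer of \<open>x\<close>; this is possible because the operator is
  injective and maps the centralizer into itself, hence onto itself.\<close>

lemma orthogonal_if_commute:
  assumes "x \<in> pp" "y \<in> pp" "br x y = 0" "z \<in> kk" shows "y \<bullet> br z x = 0"
proof -
  let ?V = "p_centralizer br s x"
  have sub: "killing_operator ` ?V \<subseteq> ?V" using killing_operator_pp killing_operator_centralizer assms(1) by (auto simp: p_centralizer_def)
  have "inj_on killing_operator ?V"
  proof (rule inj_onI)
    fix u v assume uv: "u \<in> ?V" "v \<in> ?V" "killing_operator u = killing_operator v"
    then have "u - v \<in> pp" "killing_operator (u - v) = 0"
      using subspace_pp killing_operator_linear by (auto simp: p_centralizer_def subspace_diff linear_diff)
    then show "u = v" using killing_operator_inj[of "u - v"] by simp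
  qed
  moreover have "span ?V = ?V" using subspace_p_centralizer by (simp add: span_eq_iff)
  ultimately have "dim (killing_operator ` ?V) = dim ?V" by (intro dim_image_eq killing_operator_linear) metis
  then have "killing_operator ` ?V = ?V"
    using sub by (intro subspace_dim_equal linear_subspace_image killing_operator_linear subspace_p_centralizer) auto
  then obtain u where u: "y = killing_operator u" "u \<in> pp" "br x u = 0"
    using assms by (auto simp: p_centralizer_def)
  have "y \<bullet> br z x = - killing (br u x) z"
    using br_anti[of z x] u by (simp add: killing_operator_inner killing_minus killing_br)
  also have "br u x = 0" using u br_zero_sym by blast
  finally show ?thesis by (simp add: killing_zero)
qed

text \<open>The vector \<open>br z x\<close> lies in the centralizer of \<open>x\<close> and is
  therefore orthogonal to itself.\<close>

lemma tangent_centralizer_trivial: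
  assumes "x \<in> pp" "z \<in> kk" "br x (br z x) = 0" shows "br z x = 0"
  using orthogonal_if_commute[OF assms(1) br_kp[OF assms(2,1)] assms(3,2)] by simp

lemma tangent_decomp:
  assumes "x \<in> pp" "v \<in> pp"
  obtains y z where "y \<in> pp" "br x y = 0" "z \<in> kk" "v = y + br z x"
proof -
  let ?U = "(\<lambda>z. br z x) ` kk"
  have U: "subspace ?U" by (intro linear_subspace_image br_linear subspace_kk)
  obtain u y where uy: "u \<in> span ?U" "\<And>w. w \<in> span ?U \<Longrightarrow> orthogonal y w" "v = u + y"
    using orthogonal_subspace_decomp_exists[of ?U v] by blast
  have "span ?U = ?U" using U by (simp add: span_eq_iff)
  then have "u \<in> ?U" using uy(1) by metis
  then obtain z where z: "z \<in> kk" "u = br z x" by blast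
  have "y = v - u" using uy by simp
  then have "y \<in> pp" using z assms br_kp subspace_pp by (auto intro: subspace_diff)
  moreover have "y \<bullet> br z x = 0" if "z \<in> kk" for z
    using uy(2)[OF span_base, of "br z x"] that by (auto simp: orthogonal_def)
  ultimately show thesis using that z uy(3) assms commute_if_orthogonal
    by (metis add.commute)
qed

text \<open>For \<open>y = y\<^sub>0 + [z, h]\<close> with \<open>y\<^sub>0\<close> commuting with \<open>h\<close>, the brackets of \<open>h + d\<close> with the two
  parts are orthogonal for the Killing form, so both vanish if the sum does.\<close>

lemma centralizer_upper_semicontinuous:
  assumes h: "h \<in> pp"
  shows "\<exists>\<epsilon>>0. \<forall>d\<in>pp. br h d = 0 \<longrightarrow> norm d < \<epsilon> \<longrightarrow> (\<forall>y\<in>pp. br (h + d) y = 0 \<longrightarrow> br h y = 0)"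
proof -
  let ?V = "(\<lambda>z. br z h) ` kk"
  have V: "subspace ?V" by (intro linear_subspace_image br_linear subspace_kk)
  have inj: "\<forall>y\<in>?V. br h y = 0 \<longrightarrow> y = 0" using tangent_centralizer_trivial[OF h] by auto
  have bl: "bounded_linear (br h)" using br_linear by (simp add: linear_conv_bounded_linear)
  obtain c where c: "c > 0" "\<And>y. y \<in> ?V \<Longrightarrow> c * norm y \<le> norm (br h y)"
    using injective_imp_isometric[OF closed_subspace[OF V] V bl inj] by (auto simp: mult.commute)
  obtain C where C: "C > 0" "\<And>x y. norm (br x y) \<le> C * norm x * norm y"
    using bilinear_bounded_pos[OF bil] by auto
  \<comment> \<open>The map \<open>br h\<close> is bounded below by \<open>c\<close> on the tangent
    space \<open>?V\<close>; for \<open>norm d < c / C\<close> the perturbation \<open>br d\<close>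
    is too small to cancel it there.\<close>
  have "br h y = 0" if d: "d \<in> pp" "br h d = 0" "norm d < c / C" and y: "y \<in> pp" "br (h + d) y = 0" for d y
  proof -
    obtain y0 z where yz: "y0 \<in> pp" "br h y0 = 0" "z \<in> kk" "y = y0 + br z h"
      by (rule tangent_decomp[OF h y(1)])
    define c0 c1 where "c0 = br d y0" and "c1 = br (h + d) (br z h)"
    have hd: "h + d \<in> pp" using h d subspace_pp by (simp add: subspace_add)
    have kk: "c0 \<in> kk" "c1 \<in> kk" unfolding c0_def c1_def
      by (intro br_pp d yz hd br_kp h)+
    have sum: "c0 + c1 = 0" using y yz by (simp add: c0_def c1_def br_simps)
    have hc0: "br h c0 = 0" unfolding c0_def using br_br[of h d y0] d yz by (simp add: br_simps)
    have "killing c1 c0 = - killing (br z h) (br (h + d) c0)"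
      unfolding c1_def using br_anti[of "h + d" "br z h"] by (simp add: killing_minus killing_br)
    also have "br (h + d) c0 = br d c0" using hc0 by (simp add: br_simps)
    also have "killing (br z h) (br d c0) = killing z (br h (br d c0))" by (rule killing_br)
    also have "br h (br d c0) = 0" using br_br[of h d c0] d hc0 by (simp add: br_simps)
    finally have "killing c1 c0 = 0" by (simp add: killing_zero)
    moreover have "c0 = - c1" using sum by (simp add: eq_neg_iff_add_eq_0)
    ultimately have "killing c1 c1 = 0" by (simp add: killing_minus)
    then have "c1 = 0" using killing_definite kk by blast
    then have "br h (br z h) = - br d (br z h)"
      unfolding c1_def by (simp add: br_simps eq_neg_iff_add_eq_0)
    then have "c * norm (br z h) \<le> C * norm d * norm (br z h)"
      using c(2)[of "br z h"] yz(3) C(2)[of d "br z h"] by auto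
    moreover have "C * norm d < c" using d(3) C(1) by (simp add: pos_less_divide_eq mult.commute)
    ultimately have "br z h = 0"
      by (metis mult_le_cancel_right norm_le_zero_iff not_le)
    then show "br h y = 0" using yz by simp
  qed
  then show ?thesis using c C by (intro exI[of _ "c / C"]) auto
qed

text \<open>By the Jacobi identity the elements of \<open>pp\<close> that commute with all of
  \<open>pp\<close> form an ideal, and it is Abelian.\<close>

lemma centralizer_pp_trivial: assumes "d \<in> pp" "\<And>y. y \<in> pp \<Longrightarrow> br d y = 0" shows "d = 0"
proof -
  let ?J = "{d \<in> pp. \<forall>y\<in>pp. br d y = 0}"
  have "?J \<subseteq> {0}"
  proof (rule no_abelian_ideal)
    show "subspace ?J" using subspace_pp by (auto simp: subspace_def br_simps)
    fix u v assume v: "v \<in> ?J"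
    obtain u1 u2 where u: "u1 \<in> kk" "u2 \<in> pp" "u = u1 + u2" by (rule decomp)
    have "br u v = br u1 v" using v u br_zero_sym[of u2 v] by (auto simp: br_simps)
    moreover have "br (br u1 v) y = 0" if "y \<in> pp" for y
      using br_br[of u1 v y] v that br_kp[OF u(1) that] by (simp add: br_simps)
    ultimately show "br u v \<in> ?J" using br_kp[OF u(1)] v by auto
  qed auto
  then show ?thesis using assms by auto
qed

section \<open>Regular elements of a maximal Abelian subspace\<close>

definition regular where "regular a h \<longleftrightarrow> h \<in> a \<and> (\<forall>y\<in>pp. br h y = 0 \<longrightarrow> y \<in> a)"

context
  fixes a assumes maxab: "maximal_abelian br pp a"
begin

lemma subspace_a: "subspace a" and a_pp: "x \<in> a \<Longrightarrow> x \<in> pp"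
  and a_commute: "x \<in> a \<Longrightarrow> y \<in> a \<Longrightarrow> br x y = 0"
  using maxab by (auto simp: maximal_abelian_def)

lemma a_maximal: assumes "y \<in> pp" "\<And>x. x \<in> a \<Longrightarrow> br x y = 0" shows "y \<in> a"
proof -
  let ?b = "{u + r *\<^sub>R y | u r. u \<in> a}"
  have "?b = a"
  proof -
    have "subspace ?b"
    proof (rule subspaceI)
      show "0 \<in> ?b" using subspace_a by (auto intro!: exI[of _ 0] simp: subspace_0)
      fix p q assume "p \<in> ?b" "q \<in> ?b"
      then obtain u r u' r' where "p = u + r *\<^sub>R y" "q = u' + r' *\<^sub>R y" "u \<in> a" "u' \<in> a" by auto
      then show "p + q \<in> ?b" using subspace_a
        by (auto intro!: exI[of _ "u + u'"] exI[of _ "r + r'"] simp: subspace_add algebra_simps)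
    next
      fix c p assume "p \<in> ?b"
      then obtain u r where "p = u + r *\<^sub>R y" "u \<in> a" by auto
      then show "c *\<^sub>R p \<in> ?b" using subspace_a
        by (auto intro!: exI[of _ "c *\<^sub>R u"] exI[of _ "c * r"] simp: subspace_scale algebra_simps)
    qed
    moreover have "?b \<subseteq> pp" using subspace_pp a_pp assms(1)
      by (auto intro: subspace_add subspace_scale)
    moreover have "\<forall>p\<in>?b. \<forall>q\<in>?b. br p q = 0"
      using assms(2) a_commute br_zero_sym alt by (auto simp: br_simps)
    moreover have "a \<subseteq> ?b" by (force intro: exI[of _ 0])
    ultimately show ?thesis using maxab unfolding maximal_abelian_def by blast
  qed
  moreover have "y \<in> ?b" using subspace_a by (auto intro!: exI[of _ 0] exI[of _ 1] simp: subspace_0)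
  ultimately show ?thesis by simp
qed

text \<open>Take \<open>h\<close> in \<open>a\<close> with a centralizer of least dimension. A small
  step from \<open>h\<close> inside \<open>a\<close> can only shrink the centralizer, hence keeps
  it, so whatever commutes with \<open>h\<close> commutes with all of \<open>a\<close> and lies in
  \<open>a\<close> by maximality.\<close>

lemma regular_exists: "\<exists>h. regular a h"
proof -
  let ?d = "\<lambda>h. dim (p_centralizer br s h)"
  obtain h where h: "h \<in> a" "\<And>h'. h' \<in> a \<Longrightarrow> ?d h \<le> ?d h'"
    using ex_has_least_nat[of "\<lambda>h. h \<in> a" 0 ?d] subspace_0[OF subspace_a] by blast
  have "y \<in> a" if y: "y \<in> pp" "br h y = 0" for y
  proof (rule a_maximal[OF y(1)])
    fix x assume x: "x \<in> a"
    obtain \<epsilon> where \<epsilon>: "\<epsilon> > 0" "\<And>d y. d \<in> pp \<Longrightarrow> br h d = 0 \<Longrightarrow> norm d < \<epsilon> \<Longrightarrow> y \<in> pp \<Longrightarrow>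
      br (h + d) y = 0 \<Longrightarrow> br h y = 0"
      using centralizer_upper_semicontinuous[OF a_pp[OF h(1)]] by blast
    define r where "r = \<epsilon> / (2 * (1 + norm x))"
    have pos: "1 + norm x > 0" by (simp add: add_pos_nonneg)
    have r: "r > 0" "norm (r *\<^sub>R x) < \<epsilon>"
    proof -
      show "r > 0" using \<epsilon> pos by (simp add: r_def)
      then have "norm (r *\<^sub>R x) \<le> r * (1 + norm x)" by simp
      also have "\<dots> = \<epsilon> / 2" using pos by (simp add: r_def field_simps)
      finally show "norm (r *\<^sub>R x) < \<epsilon>" using \<epsilon> by simp
    qed
    have rx: "r *\<^sub>R x \<in> a" using x subspace_a by (simp add: subspace_scale)
    have "p_centralizer br s (h + r *\<^sub>R x) \<subseteq> p_centralizer br s h"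
      using \<epsilon>(2)[OF a_pp[OF rx] a_commute[OF h(1) rx] r(2)] by (auto simp: p_centralizer_def)
    moreover have "h + r *\<^sub>R x \<in> a" using rx h subspace_a by (simp add: subspace_add)
    ultimately have "p_centralizer br s (h + r *\<^sub>R x) = p_centralizer br s h"
      using h(2) by (intro subspace_dim_equal subspace_p_centralizer) auto
    then have "br (h + r *\<^sub>R x) y = 0" using y by (auto simp: p_centralizer_def)
    then show "br x y = 0" using y(2) r(1) by (simp add: br_simps)
  qed
  then show ?thesis using h by (auto simp: regular_def)
qed

text \<open>Add to \<open>y\<close> a small multiple of a regular \<open>h\<close>: what commutes
  with the sum commutes with \<open>y\<close>, hence with \<open>h\<close>.\<close>

lemma regular_dense: assumes "y \<in> a" "\<epsilon> > 0" shows "\<exists>h. regular a h \<and> norm (h - y) < \<epsilon>"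
proof -
  obtain h where h: "regular a h" using regular_exists by blast
  then have ha: "h \<in> a" by (simp add: regular_def)
  obtain \<epsilon>' where \<epsilon>': "\<epsilon>' > 0" "\<And>d w. d \<in> pp \<Longrightarrow> br y d = 0 \<Longrightarrow> norm d < \<epsilon>' \<Longrightarrow> w \<in> pp \<Longrightarrow>
    br (y + d) w = 0 \<Longrightarrow> br y w = 0"
    using centralizer_upper_semicontinuous[OF a_pp[OF assms(1)]] by blast
  define r where "r = min \<epsilon> \<epsilon>' / (2 * (1 + norm h))"
  have pos: "1 + norm h > 0" by (simp add: add_pos_nonneg)
  have r: "r > 0" "norm (r *\<^sub>R h) < min \<epsilon> \<epsilon>'"
  proof -
    show "r > 0" using \<epsilon>' assms pos by (simp add: r_def)
    then have "norm (r *\<^sub>R h) \<le> r * (1 + norm h)" by simp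
    also have "\<dots> = min \<epsilon> \<epsilon>' / 2" using pos by (simp add: r_def field_simps)
    finally show "norm (r *\<^sub>R h) < min \<epsilon> \<epsilon>'" using \<epsilon>' assms by simp
  qed
  have rh: "r *\<^sub>R h \<in> a" using ha subspace_a by (simp add: subspace_scale)
  have "regular a (y + r *\<^sub>R h)"
    unfolding regular_def
  proof (intro conjI ballI impI)
    show "y + r *\<^sub>R h \<in> a" using rh assms subspace_a by (simp add: subspace_add)
    fix w assume w: "w \<in> pp" "br (y + r *\<^sub>R h) w = 0"
    then have "br y w = 0" using \<epsilon>'(2)[OF a_pp[OF rh] a_commute[OF assms(1) rh]] r by auto
    then have "br h w = 0" using w r(1) by (simp add: br_simps)
    then show "w \<in> a" using h w by (simp add: regular_def)
  qed
  then show ?thesis using r by (intro exI[of _ "y + r *\<^sub>R h"]) auto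
qed

lemma regular_open: assumes "regular a h"
  shows "\<exists>\<epsilon>>0. \<forall>h'\<in>a. norm (h' - h) < \<epsilon> \<longrightarrow> regular a h'"
proof -
  have h: "h \<in> a" using assms by (simp add: regular_def)
  obtain \<epsilon> where \<epsilon>: "\<epsilon> > 0" "\<And>d w. d \<in> pp \<Longrightarrow> br h d = 0 \<Longrightarrow> norm d < \<epsilon> \<Longrightarrow> w \<in> pp \<Longrightarrow>
    br (h + d) w = 0 \<Longrightarrow> br h w = 0"
    using centralizer_upper_semicontinuous[OF a_pp[OF h]] by blast
  have "regular a h'" if "h' \<in> a" "norm (h' - h) < \<epsilon>" for h'
  proof -
    have "h' - h \<in> a" using that h subspace_a by (simp add: subspace_diff)
    then show ?thesis using \<epsilon>(2)[of "h' - h"] a_pp a_commute[OF h] that assms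
      by (auto simp: regular_def)
  qed
  then show ?thesis using \<epsilon>(1) by blast
qed
end
end

section \<open>Commuting conjugates and the Weyl group\<close>

lemma quadratic_nonpos_linear_coeff:
  fixes a b :: real assumes "\<And>t. t * a + t\<^sup>2 * b \<le> 0" shows "a = 0"
proof -
  have "((\<lambda>t. t * a + t\<^sup>2 * b) has_real_derivative a) (at 0)"
    by (auto intro!: derivative_eq_intros)
  from DERIV_local_max[OF this zero_less_one] show ?thesis using assms by simp
qed

text \<open>The Rayleigh quotient is maximized on the unit sphere of \<open>E\<close>. Varying the
  maximizer in the direction of its defect \<open>w = D z - \<mu> z\<close> gives the linear
  coefficient \<open>2 * (w \<bullet> w)\<close>, which must vanish.\<close>

lemma symmetric_eigenvector:
  fixes D :: "'a::euclidean_space \<Rightarrow> 'a"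
  assumes D: "linear D" and E: "subspace E" "\<And>x. x \<in> E \<Longrightarrow> D x \<in> E" "z0 \<in> E" "z0 \<noteq> 0"
    and sym: "\<And>x y. x \<in> E \<Longrightarrow> y \<in> E \<Longrightarrow> D x \<bullet> y = x \<bullet> D y"
  obtains z \<mu> where "z \<in> E" "z \<noteq> 0" "D z = \<mu> *\<^sub>R z"
proof -
  let ?K = "E \<inter> sphere 0 1"
  have "compact ?K" using closed_subspace[OF E(1)] by (simp add: closed_Int_compact)
  moreover have "(1 / norm z0) *\<^sub>R z0 \<in> ?K" using E by (simp add: subspace_scale)
  then have "?K \<noteq> {}" by blast
  moreover have "continuous_on ?K (\<lambda>x. D x \<bullet> x)"
    using D by (intro continuous_intros linear_continuous_on) (simp add: linear_conv_bounded_linear)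
  ultimately have "\<exists>x\<in>?K. \<forall>y\<in>?K. D y \<bullet> y \<le> D x \<bullet> x" by (rule continuous_attains_sup)
  then obtain z where z: "z \<in> ?K" "\<And>y. y \<in> ?K \<Longrightarrow> D y \<bullet> y \<le> D z \<bullet> z" by blast
  define \<mu> where "\<mu> = D z \<bullet> z"
  have zE: "z \<in> E" and zz: "z \<bullet> z = 1" using z(1) by (auto simp: norm_eq_1)
  have le: "D y \<bullet> y \<le> \<mu> * (y \<bullet> y)" if y: "y \<in> E" for y
  proof (cases "y = 0")
    case False
    let ?u = "(1 / norm y) *\<^sub>R y"
    have "?u \<in> ?K" using False y E(1) by (simp add: subspace_scale)
    then have "D ?u \<bullet> ?u \<le> \<mu>" using z(2) unfolding \<mu>_def by blast
    then have "(D y \<bullet> y) / (norm y * norm y) \<le> \<mu>"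
      using D by (simp add: linear_scale)
    then show ?thesis using False by (simp add: divide_le_eq dot_square_norm power2_eq_square)
  qed (use D in \<open>simp add: linear_0\<close>)
  define w where "w = D z - \<mu> *\<^sub>R z"
  have wE: "w \<in> E" unfolding w_def using zE E by (intro subspace_diff subspace_scale) auto
  have "t * (2 * (w \<bullet> w)) + t\<^sup>2 * (D w \<bullet> w - \<mu> * (w \<bullet> w)) \<le> 0" for t
  proof -
    let ?y = "z + t *\<^sub>R w"
    have "?y \<in> E" using zE wE E(1) by (simp add: subspace_add subspace_scale)
    from le[OF this] have "D z \<bullet> z + t * (D z \<bullet> w) + t * (D w \<bullet> z) + t\<^sup>2 * (D w \<bullet> w)
      \<le> \<mu> * (z \<bullet> z + 2 * t * (z \<bullet> w) + t\<^sup>2 * (w \<bullet> w))"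
      using D by (simp add: linear_add linear_scale inner_simps power2_eq_square algebra_simps inner_commute)
    moreover have "D w \<bullet> z = D z \<bullet> w" using sym[OF wE zE] by (simp add: inner_commute)
    moreover have "D z \<bullet> w = w \<bullet> w + \<mu> * (z \<bullet> w)" by (simp add: w_def inner_simps algebra_simps)
    ultimately show ?thesis by (simp add: zz algebra_simps \<mu>_def[symmetric])
  qed
  from quadratic_nonpos_linear_coeff[OF this] have "w = 0" by simp
  moreover have "z \<noteq> 0" using zz by auto
  ultimately show thesis using that[of z \<mu>] zE by (simp add: w_def)
qed

definition spectrum_on :: "('a::euclidean_space \<Rightarrow> 'a) \<Rightarrow> 'a set \<Rightarrow> real set" where
  "spectrum_on D E = {\<mu>. \<exists>z\<in>E. z \<noteq> 0 \<and> D z = \<mu> *\<^sub>R z}"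

lemma finite_spectrum_on:
  fixes D :: "'a::euclidean_space \<Rightarrow> 'a"
  assumes sym: "\<And>x y. x \<in> E \<Longrightarrow> y \<in> E \<Longrightarrow> D x \<bullet> y = x \<bullet> D y"
  shows "finite (spectrum_on D E)"
proof -
  obtain f where f: "\<And>\<mu>. \<mu> \<in> spectrum_on D E \<Longrightarrow> f \<mu> \<in> E \<and> f \<mu> \<noteq> 0 \<and> D (f \<mu>) = \<mu> *\<^sub>R f \<mu>"
  proof -
    have "\<forall>\<mu>\<in>spectrum_on D E. \<exists>z. z \<in> E \<and> z \<noteq> 0 \<and> D z = \<mu> *\<^sub>R z"
      by (auto simp: spectrum_on_def)
    from bchoice[OF this] show thesis using that by blast
  qed
  have orth: "f \<mu> \<bullet> f \<nu> = 0" if "\<mu> \<in> spectrum_on D E" "\<nu> \<in> spectrum_on D E" "\<mu> \<noteq> \<nu>" for \<mu> \<nu>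
    using sym[of "f \<mu>" "f \<nu>"] f[OF that(1)] f[OF that(2)] that(3) by simp
  have inj: "inj_on f (spectrum_on D E)"
    using orth f by (metis inj_onI inner_eq_zero_iff)
  have "pairwise orthogonal (f ` spectrum_on D E)"
    unfolding pairwise_def orthogonal_def using orth by auto
  then have "independent (f ` spectrum_on D E)"
    by (rule pairwise_orthogonal_independent) (use f in auto)
  then show ?thesis using inj by (metis finite_imageD independent_imp_finite)
qed

text \<open>On an eigenspace of the difference \<open>D' - D\<close> with eigenvalue \<open>\<nu>\<close> an eigenvector of \<open>D\<close> is one
  of \<open>D'\<close>, its eigenvalue being shifted by \<open>\<nu>\<close>; but the spectrum has gaps.\<close>

lemma commuting_isospectral_close_eq:
  fixes D :: "'a::euclidean_space \<Rightarrow> 'a"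
  assumes D: "linear D" and E: "subspace E" "\<And>x. x \<in> E \<Longrightarrow> D x \<in> E"
    and sym: "\<And>x y. x \<in> E \<Longrightarrow> y \<in> E \<Longrightarrow> D x \<bullet> y = x \<bullet> D y"
  shows "\<exists>g>0. \<forall>D'. linear D' \<longrightarrow> (\<forall>x\<in>E. D' x \<in> E) \<longrightarrow> (\<forall>x\<in>E. \<forall>y\<in>E. D' x \<bullet> y = x \<bullet> D' y) \<longrightarrow>
    (\<forall>x\<in>E. D (D' x) = D' (D x)) \<longrightarrow> spectrum_on D' E \<subseteq> spectrum_on D E \<longrightarrow>
    (\<forall>x\<in>E. x \<noteq> 0 \<longrightarrow> norm (D' x - D x) < g * norm x) \<longrightarrow> (\<forall>x\<in>E. D' x = D x)"
proof -
  \<comment> \<open>The least distance between distinct eigenvalues; the \<open>1\<close> keeps the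
    set nonempty if there are fewer than two of them.\<close>
  define R where "R = insert 1 ((\<lambda>(\<mu>, \<nu>). \<bar>\<mu> - \<nu>\<bar>) ` {(\<mu>, \<nu>) \<in> spectrum_on D E \<times> spectrum_on D E. \<mu> \<noteq> \<nu>})"
  have fin: "finite (spectrum_on D E)" using finite_spectrum_on[of E D] sym by blast
  have "finite {(\<mu>, \<nu>) \<in> spectrum_on D E \<times> spectrum_on D E. \<mu> \<noteq> \<nu>}"
    by (rule finite_subset[of _ "spectrum_on D E \<times> spectrum_on D E"]) (use fin in auto)
  then have finR: "finite R" by (simp add: R_def)
  then have pos: "Min R > 0" by (subst Min_gr_iff) (auto simp: R_def)
  have gap: "Min R \<le> \<bar>\<mu> - \<nu>\<bar>" if "\<mu> \<in> spectrum_on D E" "\<nu> \<in> spectrum_on D E" "\<mu> \<noteq> \<nu>" for \<mu> \<nu>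
    by (rule Min_le[OF finR]) (use that in \<open>auto simp: R_def\<close>)
  show ?thesis
  proof (intro exI[of _ "Min R"] conjI pos allI impI ballI, rule ccontr)
    fix D' x0
    assume D': "linear D'" "\<forall>x\<in>E. D' x \<in> E" "\<forall>x\<in>E. \<forall>y\<in>E. D' x \<bullet> y = x \<bullet> D' y"
      "\<forall>x\<in>E. D (D' x) = D' (D x)" "spectrum_on D' E \<subseteq> spectrum_on D E"
      "\<forall>x\<in>E. x \<noteq> 0 \<longrightarrow> norm (D' x - D x) < Min R * norm x" and x0: "x0 \<in> E" "D' x0 \<noteq> D x0"
    define N where "N x = D' x - D x" for x
    have N: "linear N" unfolding N_def using D' D by (simp add: linear_compose_sub)
    have NE: "N x \<in> E" if "x \<in> E" for x using that D' E by (simp add: N_def subspace_diff)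
    have Nsym: "N x \<bullet> y = x \<bullet> N y" if "x \<in> E" "y \<in> E" for x y
      using that D' sym by (simp add: N_def inner_simps)
    have sub: "subspace (N ` E)" by (rule linear_subspace_image[OF N E(1)])
    have Nx0: "N x0 \<in> N ` E" "N x0 \<noteq> 0" using x0 by (auto simp: N_def)
    have inv: "N x \<in> N ` E" if "x \<in> N ` E" for x using that NE by blast
    have sym': "N x \<bullet> y = x \<bullet> N y" if "x \<in> N ` E" "y \<in> N ` E" for x y
      using that NE by (intro Nsym) auto
    obtain w \<nu> where w: "w \<in> N ` E" "w \<noteq> 0" "N w = \<nu> *\<^sub>R w"
      by (rule symmetric_eigenvector[OF N sub inv Nx0 sym'])
    have wE: "w \<in> E" using w NE by auto
    \<comment> \<open>The eigenvector \<open>w\<close> was taken in the image of \<open>N\<close>,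
      which is orthogonal to the kernel of the symmetric operator \<open>N\<close>.\<close>
    have \<nu>: "\<nu> \<noteq> 0"
    proof
      assume "\<nu> = 0"
      obtain u where "u \<in> E" "w = N u" using w by auto
      then have "w \<bullet> w = 0" using Nsym[of u w] wE w \<open>\<nu> = 0\<close> by simp
      then show False using w by simp
    qed
    let ?F = "{x \<in> E. N x = \<nu> *\<^sub>R x}"
    have subF: "subspace ?F" using E(1) N
      by (auto simp: subspace_def linear_0 linear_add linear_scale algebra_simps)
    have invF: "D x \<in> ?F" if "x \<in> ?F" for x
    proof -
      have "D (D' x) = D' (D x)" using that D'(4) by blast
      then have "N (D x) = D (N x)" using D by (simp only: N_def linear_diff)
      then show ?thesis using that E D by (simp add: linear_scale)
    qed
    have wF: "w \<in> ?F" using w wE by simp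
    have symF: "D x \<bullet> y = x \<bullet> D y" if "x \<in> ?F" "y \<in> ?F" for x y using that sym by blast
    obtain z \<mu> where z: "z \<in> ?F" "z \<noteq> 0" "D z = \<mu> *\<^sub>R z"
      by (rule symmetric_eigenvector[OF D subF invF wF w(2) symF])
    have D'z: "D' z = (\<mu> + \<nu>) *\<^sub>R z" using z by (simp add: N_def algebra_simps)
    have "\<mu> \<in> spectrum_on D E" using z by (auto simp: spectrum_on_def)
    moreover have "\<mu> + \<nu> \<in> spectrum_on D' E" using z D'z by (auto simp: spectrum_on_def)
    ultimately have "Min R \<le> \<bar>(\<mu> + \<nu>) - \<mu>\<bar>" using D'(5) \<nu> by (intro gap) auto
    moreover have "norm (D' z - D z) < Min R * norm z" using z(1,2) D'(6) by blast
    then have "\<bar>\<nu>\<bar> < Min R" using z D'z by (simp flip: scaleR_diff_left)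
    ultimately show False by simp
  qed
qed

lemma finite_if_separated_bounded:
  fixes T :: "'a::euclidean_space set"
  assumes "bounded T" "\<epsilon> > 0" "\<And>x y. x \<in> T \<Longrightarrow> y \<in> T \<Longrightarrow> norm (x - y) < \<epsilon> \<Longrightarrow> x = y"
  shows "finite T"
proof (rule ccontr)
  assume "infinite T"
  then obtain l where "l islimpt T" using bounded_infinite_imp_islimpt[OF _ assms(1)] by blast
  then have lim: "\<exists>x\<in>T. x \<noteq> l \<and> dist x l < e" if "e > 0" for e
    using that by (auto simp: islimpt_approachable)
  obtain x where x: "x \<in> T" "x \<noteq> l" "dist x l < \<epsilon> / 2" using lim[of "\<epsilon>/2"] assms(2) by auto
  obtain y where y: "y \<in> T" "y \<noteq> l" "dist y l < min (dist x l) (\<epsilon> / 2)"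
    using lim[of "min (dist x l) (\<epsilon>/2)"] assms(2) x by auto
  have "dist x y < \<epsilon>" using x y dist_triangle_half_l[of x l \<epsilon> y] by simp
  then have "x = y" using assms(3) x y by (simp add: dist_norm)
  then show False using y by simp
qed

text \<open>Extends maps of \<open>a\<close> to the whole space in a way that is determined by their
  values on \<open>a\<close>.\<close>

lemma subspace_retraction:
  fixes a :: "'a::euclidean_space set"
  assumes "subspace a"
  obtains P where "linear P" "\<And>x. P x \<in> a" "\<And>x. x \<in> a \<Longrightarrow> P x = x"
proof -
  obtain B where B: "B \<subseteq> a" "independent B" "a \<subseteq> span B" "card B = dim a"
    by (rule basis_exists)
  from linear_independent_extend_subspace[OF B(2), of "\<lambda>x. x"]
  obtain P where "linear P \<and> (\<forall>x\<in>B. P x = x) \<and> range P = span ((\<lambda>x. x) ` B)" by (rule exE)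
  then have P: "linear P" "\<And>x. x \<in> B \<Longrightarrow> P x = x" "range P \<subseteq> span B" by simp_all
  have sp: "span B = a" using B assms by (simp add: span_minimal subset_antisym)
  have "P x = x" if "x \<in> a" for x
    by (rule linear_eq_on_span[OF P(1) linear_ident, of B]) (use P sp that in auto)
  then show thesis using that P sp by blast
qed

lemma symmetric_automorphism_comp:
  "symmetric_automorphism br s A \<Longrightarrow> symmetric_automorphism br s C \<Longrightarrow>
    symmetric_automorphism br s (\<lambda>x. A (C x))"
  unfolding symmetric_automorphism_def using linear_compose[of C A] by (simp add: o_def)

lemma symmetric_automorphismD:
  assumes "symmetric_automorphism br s A"
  shows "linear A" "A (br x y) = br (A x) (A y)" "A (s x) = s (A x)" "A x \<bullet> A y = x \<bullet> y" "norm (A x) = norm x"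
  using assms by (auto simp: symmetric_automorphism_def norm_eq_sqrt_inner)

lemma symmetric_automorphism_inverse:
  assumes A: "symmetric_automorphism br s A"
  obtains A' where "symmetric_automorphism br s A'" "\<And>x. A' (A x) = x" "\<And>x. A (A' x) = x"
proof -
  note D = symmetric_automorphismD[OF A]
  have "orthogonal_transformation A" using D by (simp add: orthogonal_transformation_def)
  then have b: "bij A" by (rule orthogonal_transformation_bij)
  define A' where "A' = inv_into UNIV A"
  have inv: "A' (A x) = x" "A (A' x) = x" for x
    using b by (simp_all add: A'_def bij_is_inj bij_is_surj surj_f_inv_f)
  have eqI: "x = y" if "A x = A y" for x y using that inv by metis
  have "linear A'"
    by (rule linearI; rule eqI) (simp_all add: linear_add[OF D(1)] linear_scale[OF D(1)] inv)
  moreover have "A' (br x y) = br (A' x) (A' y)" for x y by (rule eqI) (simp add: D inv)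
  moreover have "A' (s x) = s (A' x)" for x by (rule eqI) (simp add: D inv)
  moreover have "A' x \<bullet> A' y = x \<bullet> y" for x y using D(4)[of "A' x" "A' y"] by (simp add: inv)
  ultimately have "symmetric_automorphism br s A'" by (simp add: symmetric_automorphism_def)
  then show thesis using that inv by blast
qed

section \<open>Commuting conjugates under \<open>H\<close>\<close>

context orthogonal_symmetric_algebra begin

lemma aut_pp: "symmetric_automorphism br s A \<Longrightarrow> x \<in> pp \<Longrightarrow> A x \<in> pp"
  by (metis ppI ppD symmetric_automorphismD(3) symmetric_automorphismD(1) linear_neg)

lemma aut_pp_iff: assumes "symmetric_automorphism br s A" shows "A x \<in> pp \<longleftrightarrow> x \<in> pp"
  using symmetric_automorphism_inverse[OF assms] aut_pp assms by metis

lemma aut_zero: assumes "symmetric_automorphism br s A" shows "br (A x) (A y) = 0 \<longleftrightarrow> br x y = 0"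
  by (metis symmetric_automorphismD(1,2,5)[OF assms] norm_eq_zero)

text \<open>The vectors of \<open>X\<close> are to stay fixed, so the maximum is taken over a
  stabilizer only, and the first variation is available only along elements of \<open>kk\<close>
  that annihilate \<open>X\<close>. A single well-chosen one suffices.\<close>

lemma maximizer_commutes:
  assumes X: "\<And>x. x \<in> X \<Longrightarrow> x \<in> pp \<and> br x h1 = 0 \<and> br x h2 = 0" and h: "h1 \<in> pp" "h2 \<in> pp"
    and A: "A \<in> H" "\<And>x. x \<in> X \<Longrightarrow> A x = x"
    and min: "\<And>C. C \<in> H \<Longrightarrow> (\<And>x. x \<in> X \<Longrightarrow> C x = x) \<Longrightarrow> C h1 \<bullet> h2 \<le> A h1 \<bullet> h2"
  shows "br (A h1) h2 = 0"
proof -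
  note AD = symmetric_automorphismD[OF H_aut[OF A(1)]]
  define y where "y = A h1"
  have y: "y \<in> pp" unfolding y_def using aut_pp[OF H_aut[OF A(1)]] h by simp
  have crit: "br z y \<bullet> h2 = 0" if z: "z \<in> kk" "\<And>x. x \<in> X \<Longrightarrow> br z x = 0" for z
  proof -
    obtain e :: "real \<Rightarrow> 'a \<Rightarrow>\<^sub>L 'a" where e: "e 0 = id_blinfun" "\<And>t. e t \<in> H"
      "\<And>y. ((\<lambda>t. e t y) has_vector_derivative br z y) (at 0)" "\<And>y t. br z y = 0 \<Longrightarrow> e t y = y"
      using flow[OF kkD[OF z(1)]] by blast
    have "((\<lambda>t. e t y \<bullet> h2) has_vector_derivative (br z y \<bullet> h2)) (at 0)"
      using bounded_linear.has_vector_derivative[OF bounded_linear_inner_left e(3)] .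
    then have "((\<lambda>t. e t y \<bullet> h2) has_real_derivative (br z y \<bullet> h2)) (at 0)"
      by (simp add: has_real_derivative_iff_has_vector_derivative)
    moreover have "e t y \<bullet> h2 \<le> e 0 y \<bullet> h2" for t
    proof -
      have "(e t o\<^sub>L A) h1 \<bullet> h2 \<le> A h1 \<bullet> h2"
        by (rule min) (use H_comp e A z in auto)
      then show ?thesis by (simp add: y_def e)
    qed
    ultimately show ?thesis using DERIV_local_max[of "\<lambda>t. e t y \<bullet> h2" "br z y \<bullet> h2" 0 1] by simp
  qed
  \<comment> \<open>For this direction \<open>killing_br_operator\<close> turns the first-order
    condition into the vanishing of the Killing square of \<open>br h2 y\<close>. It annihilates
    \<open>X\<close> because \<open>y\<close> and \<open>killing_operator h2\<close> commute with
    \<open>X\<close>.\<close>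
  define z where "z = br y (killing_operator h2)"
  have zk: "z \<in> kk" unfolding z_def by (intro br_pp y killing_operator_pp h)
  have "br z x = 0" if x: "x \<in> X" for x
  proof -
    have "br x y = 0" using AD(2)[of x h1] A(2)[OF x] X[OF x] linear_0[OF AD(1)] by (simp add: y_def)
    moreover have "br x (killing_operator h2) = 0" using X[OF x] h by (intro killing_operator_centralizer) auto
    ultimately have "br x z = 0" unfolding z_def using br_br[of x y "killing_operator h2"] by (simp add: br_simps)
    then show ?thesis using br_zero_sym by blast
  qed
  then have "br z y \<bullet> h2 = 0" by (rule crit[OF zk])
  then have "y \<bullet> br z h2 = 0" using skew[OF zk, of y h2] by simp
  then have "killing (br h2 y) (br h2 y) = 0"
    using killing_br_operator[OF h(2) y] by (simp add: z_def)
  then have "br h2 y = 0" using killing_definite br_pp[OF h(2) y] by blast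
  then show ?thesis using br_zero_sym by (simp add: y_def)
qed

lemma H_norm: "A \<in> H \<Longrightarrow> norm (A x) = norm x"
  using symmetric_automorphismD(5)[OF H_aut] by blast

lemma commuting_conjugate:
  assumes X: "\<And>x. x \<in> X \<Longrightarrow> x \<in> pp \<and> br x h1 = 0 \<and> br x h2 = 0" and h: "h1 \<in> pp" "h2 \<in> pp"
  obtains A where "A \<in> H" "\<And>x. x \<in> X \<Longrightarrow> A x = x" "norm (A h1 - h2) \<le> norm (h1 - h2)" "br (A h1) h2 = 0"
proof -
  define HX where "HX = H \<inter> (\<Inter>x\<in>X. {A. blinfun_apply A x = x})"
  have "closed (\<Inter>x\<in>X. {A. blinfun_apply A x = x})"
    by (intro closed_INT ballI closed_Collect_eq continuous_intros)
  then have "compact HX" unfolding HX_def using H_compact by (rule compact_Int_closed[rotated])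
  moreover have id: "id_blinfun \<in> HX" using H_id by (simp add: HX_def)
  moreover have "continuous_on HX (\<lambda>A. blinfun_apply A h1 \<bullet> h2)" by (intro continuous_intros)
  ultimately obtain A where A: "A \<in> HX" "\<And>C. C \<in> HX \<Longrightarrow> C h1 \<bullet> h2 \<le> A h1 \<bullet> h2"
    using continuous_attains_sup[of HX "\<lambda>A. blinfun_apply A h1 \<bullet> h2"] by blast
  \<comment> \<open>A maximal inner product means a minimal distance, as \<open>A\<close> preserves
    norms; the identity is one of the competitors.\<close>
  have "(norm (A h1 - h2))\<^sup>2 \<le> (norm (h1 - h2))\<^sup>2"
    using A(2)[OF id] H_norm[of A h1] A(1)
    by (simp add: dot_square_norm[symmetric] HX_def inner_simps inner_commute) (simp add: dot_square_norm)
  then have "norm (A h1 - h2) \<le> norm (h1 - h2)" by (simp add: power2_le_iff_abs_le)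
  moreover have "br (A h1) h2 = 0"
    by (rule maximizer_commutes[OF X h]) (use A in \<open>auto simp: HX_def\<close>)
  ultimately show thesis using that[of A] A by (auto simp: HX_def)
qed

definition ad_square where "ad_square x y = br x (br x y)"

lemma ad_square_linear: "linear (ad_square x)"
  unfolding ad_square_def using linear_compose[OF br_linear(1)[of x] br_linear(1)[of x]] by (simp add: o_def)

text \<open>No symmetry of \<open>br x\<close> itself is available for \<open>x\<close> in
  \<open>pp\<close>. But \<open>br x y\<close> is in \<open>kk\<close>, and its skewness rewrites
  the left side as \<open>x \<bullet> br (br x y) z\<close>. By the Jacobi identity exchanging
  \<open>y\<close> and \<open>z\<close> changes this by \<open>x \<bullet> br x (br y z)\<close>,
  which is zero by skewness again.\<close>

lemma ad_square_sym: assumes "x \<in> pp" "y \<in> pp" "z \<in> pp" shows "ad_square x y \<bullet> z = y \<bullet> ad_square x z"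
proof -
  have *: "ad_square x u \<bullet> v = x \<bullet> br (br x u) v" if "u \<in> pp" for u v
    using skew[OF br_pp[OF assms(1) that], of x v] br_anti[of x "br x u"] by (simp add: ad_square_def)
  have "br (br x y) z - br (br x z) y = br x (br y z)"
    using br_br[of x y z] br_anti[of y "br x z"] by simp
  then have "x \<bullet> br (br x y) z - x \<bullet> br (br x z) y = x \<bullet> br x (br y z)"
    by (simp flip: inner_diff_right)
  also have "\<dots> = 0"
    using skew[OF br_pp[OF assms(2,3)], of x x] br_anti[of x "br y z"] by (simp add: inner_commute)
  finally show ?thesis using *[OF assms(2), of z] *[OF assms(3), of y] by (simp add: inner_commute)
qed

lemma ad_square_spectrum: assumes A: "symmetric_automorphism br s A"
  shows "spectrum_on (ad_square (A x)) pp \<subseteq> spectrum_on (ad_square x) pp"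
proof
  fix \<mu> assume "\<mu> \<in> spectrum_on (ad_square (A x)) pp"
  then obtain z where z: "z \<in> pp" "z \<noteq> 0" "ad_square (A x) z = \<mu> *\<^sub>R z" by (auto simp: spectrum_on_def)
  obtain A' where A': "symmetric_automorphism br s A'" "\<And>x. A' (A x) = x"
    by (rule symmetric_automorphism_inverse[OF A]) blast
  have "ad_square x (A' z) = A' (ad_square (A x) z)"
    by (simp add: ad_square_def symmetric_automorphismD(2)[OF A'(1)] A'(2))
  also have "\<dots> = \<mu> *\<^sub>R A' z" using symmetric_automorphismD(1)[OF A'(1)] by (simp add: z linear_scale)
  finally show "\<mu> \<in> spectrum_on (ad_square x) pp"
    using z aut_pp[OF A'(1) z(1)] symmetric_automorphismD(5)[OF A'(1), of z]
    unfolding spectrum_on_def by (intro CollectI bexI[of _ "A' z"]) auto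
qed

text \<open>On \<open>pp\<close> the operators \<open>ad_square x\<close> and
  \<open>ad_square (A x)\<close> commute and the eigenvalues of the second are among those of the
  first, so closeness makes them equal. Equal squares alone would allow \<open>A x = - x\<close>, so
  closeness is used once more, through the centralizer of \<open>2 *\<^sub>R x\<close>.\<close>

lemma close_commuting_conjugate_eq:
  assumes x: "x \<in> pp"
  shows "\<exists>\<epsilon>>0. \<forall>A. symmetric_automorphism br s A \<longrightarrow> br x (A x) = 0 \<longrightarrow> norm (A x - x) < \<epsilon> \<longrightarrow> A x = x"
proof -
  have ad_square_pp: "ad_square x y \<in> pp" if "x \<in> pp" "y \<in> pp" for x y
    using that by (simp add: ad_square_def br_pk br_pp)
  obtain g where g: "g > 0" "\<And>D'. linear D' \<Longrightarrow> (\<forall>y\<in>pp. D' y \<in> pp) \<Longrightarrow>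
    (\<forall>y\<in>pp. \<forall>z\<in>pp. D' y \<bullet> z = y \<bullet> D' z) \<Longrightarrow> (\<forall>y\<in>pp. ad_square x (D' y) = D' (ad_square x y)) \<Longrightarrow>
    spectrum_on D' pp \<subseteq> spectrum_on (ad_square x) pp \<Longrightarrow>
    (\<forall>y\<in>pp. y \<noteq> 0 \<longrightarrow> norm (D' y - ad_square x y) < g * norm y) \<Longrightarrow> (\<forall>y\<in>pp. D' y = ad_square x y)"
    using commuting_isospectral_close_eq[OF ad_square_linear[of x] subspace_pp, OF ad_square_pp[OF x] ad_square_sym[OF x]]
    by blast
  have x2: "2 *\<^sub>R x \<in> pp" using x subspace_pp by (simp add: subspace_scale)
  obtain \<epsilon>1 where \<epsilon>1: "\<epsilon>1 > 0" "\<And>d y. d \<in> pp \<Longrightarrow> br (2 *\<^sub>R x) d = 0 \<Longrightarrow> norm d < \<epsilon>1 \<Longrightarrow> y \<in> pp \<Longrightarrow>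
      br (2 *\<^sub>R x + d) y = 0 \<Longrightarrow> br (2 *\<^sub>R x) y = 0"
    using centralizer_upper_semicontinuous[OF x2] by blast
  obtain C where C: "C > 0" "\<And>x y. norm (br x y) \<le> C * norm x * norm y"
    using bilinear_bounded_pos[OF bil] by auto
  \<comment> \<open>The difference of the two squares at \<open>y\<close> is at most
    \<open>2 * C\<^sup>2 * norm x\<close> times \<open>norm d * norm y\<close>; the \<open>1\<close>
    makes \<open>M\<close> positive.\<close>
  define M where "M = 2 * C\<^sup>2 * norm x + 1"
  have M: "M > 0" unfolding M_def by (simp add: add_nonneg_pos)
  have "A x = x" if A: "symmetric_automorphism br s A" "br x (A x) = 0" "norm (A x - x) < min \<epsilon>1 (g / M)" for A
  proof -
    define x' d where "x' = A x" and "d = x' - x"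
    have x': "x' \<in> pp" using aut_pp[OF A(1) x] by (simp add: x'_def)
    have d: "d \<in> pp" using x x' subspace_pp by (simp add: d_def subspace_diff)
    have xx': "br x x' = 0" "br x' x = 0" using A(2) br_zero_sym by (auto simp: x'_def)
    have comm: "br x (br x' y) = br x' (br x y)" for y using br_br[of x x' y] xx' by (simp add: br_simps)
    have nx': "norm x' = norm x" using symmetric_automorphismD(5)[OF A(1)] by (simp add: x'_def)
    have dM: "norm d * M < g" using A(3) M by (simp add: d_def x'_def pos_less_divide_eq)
    have "\<forall>y\<in>pp. ad_square x' y = ad_square x y"
    proof (rule g(2))
      show "linear (ad_square x')" by (rule ad_square_linear)
      show "\<forall>y\<in>pp. ad_square x' y \<in> pp" using ad_square_pp x' by blast
      show "\<forall>y\<in>pp. \<forall>z\<in>pp. ad_square x' y \<bullet> z = y \<bullet> ad_square x' z" using ad_square_sym x' by blast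
      show "\<forall>y\<in>pp. ad_square x (ad_square x' y) = ad_square x' (ad_square x y)" by (simp add: ad_square_def comm)
      show "spectrum_on (ad_square x') pp \<subseteq> spectrum_on (ad_square x) pp" unfolding x'_def by (rule ad_square_spectrum[OF A(1)])
      show "\<forall>y\<in>pp. y \<noteq> 0 \<longrightarrow> norm (ad_square x' y - ad_square x y) < g * norm y"
      proof (intro ballI impI)
        fix y assume y: "y \<in> pp" "y \<noteq> 0"
        have "ad_square x' y - ad_square x y = br d (br x' y) + br x (br d y)"
          by (simp add: ad_square_def d_def br_simps)
        then have "norm (ad_square x' y - ad_square x y) \<le> norm (br d (br x' y)) + norm (br x (br d y))"
          by (simp add: norm_triangle_ineq)
        also have "\<dots> \<le> C * norm d * (C * norm x' * norm y) + C * norm x * (C * norm d * norm y)"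
          by (intro add_mono order_trans[OF C(2)] mult_left_mono C(2)) (use C(1) in auto)
        also have "\<dots> = norm d * (2 * C\<^sup>2 * norm x) * norm y" by (simp add: nx' power2_eq_square)
        also have "\<dots> \<le> norm d * M * norm y" unfolding M_def
          by (intro mult_right_mono mult_left_mono) auto
        also have "\<dots> < g * norm y" using dM y by simp
        finally show "norm (ad_square x' y - ad_square x y) < g * norm y" .
      qed
    qed
    then have eq: "br x' (br x' y) = br x (br x y)" if "y \<in> pp" for y using that by (simp add: ad_square_def)
    \<comment> \<open>Equality of the squares says that \<open>?u\<close>, the sum of
      \<open>x\<close> and \<open>x'\<close>, commutes with \<open>z\<close>. It commutes with
      \<open>d\<close> too, hence with \<open>w\<close>. As \<open>?u\<close> is a small
      perturbation of \<open>2 *\<^sub>R x\<close>, both \<open>x\<close> and then \<open>d\<close>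
      commute with \<open>w\<close>, which is tangent to the orbit of \<open>d\<close>; so
      \<open>w = 0\<close>, and the Killing square of \<open>z\<close> vanishes.\<close>
    have "br d y = 0" if y: "y \<in> pp" for y
    proof -
      define z where "z = br d y"
      have zk: "z \<in> kk" unfolding z_def by (intro br_pp d y)
      define w where "w = br z d"
      have wp: "w \<in> pp" unfolding w_def by (intro br_kp zk d)
      let ?u = "2 *\<^sub>R x + d"
      have u: "?u = x + x'" by (simp add: d_def scaleR_2)
      have "br (x + x') (br (x' - x) y) = br x (br x' y) - br x (br x y) + (br x' (br x' y) - br x' (br x y))"
        by (simp add: br_simps)
      then have uz: "br ?u z = 0" unfolding u z_def using eq[OF y] comm[of y] by (simp add: d_def)
      have ud: "br ?u d = 0" unfolding u d_def by (simp add: br_simps xx' alt)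
      have uw: "br ?u w = 0" unfolding w_def using br_br[of ?u z d]
        by (simp only: uz ud bilinear_lzero[OF bil] bilinear_rzero[OF bil] add_0_left)
      have xd: "br (2 *\<^sub>R x) d = 0" unfolding d_def by (simp add: br_simps xx' alt)
      have "norm d < \<epsilon>1" using A(3) by (simp add: d_def x'_def)
      from \<epsilon>1(2)[OF d xd this wp uw] have "br (2 *\<^sub>R x) w = 0" .
      then have "br d w = 0" using uw by (simp add: br_simps)
      then have "w = 0" unfolding w_def by (rule tangent_centralizer_trivial[OF d zk])
      then have "killing z z = 0" using killing_br_br[of d y] by (simp add: killing_zero z_def w_def)
      then show ?thesis using killing_definite[OF zk] by (simp add: z_def)
    qed
    then have "d = 0" by (rule centralizer_pp_trivial[OF d])
    then show ?thesis by (simp add: d_def x'_def)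
  qed
  then show ?thesis using \<epsilon>1 g M by (intro exI[of _ "min \<epsilon>1 (g / M)"]) auto
qed

section \<open>Conjugation into \<open>a\<close> and finiteness of the Weyl group\<close>

context
  fixes a assumes maxab: "maximal_abelian br pp a"
begin

lemmas sub_a = subspace_a[OF maxab] and a_in_pp = a_pp[OF maxab] and a_comm = a_commute[OF maxab]
  and a_max = a_maximal[OF maxab]

text \<open>It is enough to move the single vector \<open>x + r *\<^sub>R v\<close> into
  \<open>a\<close>. For small \<open>r\<close> everything that commutes with it commutes with
  \<open>x\<close>; hence all of \<open>a\<close> commutes with the image of \<open>x\<close>, which
  lies in \<open>a\<close> by maximality, and so does the image of \<open>v\<close>.\<close>

lemma commuting_pair_into_a:
  assumes x: "x \<in> pp" and v: "v \<in> pp" "br x v = 0"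
  obtains A where "A \<in> H" "A x \<in> a" "A v \<in> a"
proof -
  obtain \<epsilon> where \<epsilon>: "\<epsilon> > 0" "\<And>d y. d \<in> pp \<Longrightarrow> br x d = 0 \<Longrightarrow> norm d < \<epsilon> \<Longrightarrow> y \<in> pp \<Longrightarrow>
      br (x + d) y = 0 \<Longrightarrow> br x y = 0"
    using centralizer_upper_semicontinuous[OF x] by blast
  define r where "r = \<epsilon> / (2 * (1 + norm v))"
  have pos: "1 + norm v > 0" by (simp add: add_pos_nonneg)
  have r: "r > 0" using \<epsilon> pos by (simp add: r_def)
  then have "norm (r *\<^sub>R v) \<le> r * (1 + norm v)" by simp
  also have "\<dots> = \<epsilon> / 2" using pos by (simp add: r_def field_simps)
  finally have rv: "norm (r *\<^sub>R v) < \<epsilon>" "r *\<^sub>R v \<in> pp" "br x (r *\<^sub>R v) = 0"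
    using \<epsilon> v subspace_pp by (auto simp: subspace_scale br_simps)
  have xp: "x + r *\<^sub>R v \<in> pp" using x rv subspace_pp by (simp add: subspace_add)
  obtain h where h: "regular a h" using regular_exists[OF maxab] by blast
  then have ha: "h \<in> a" by (simp add: regular_def)
  obtain A where A: "A \<in> H" "br (A (x + r *\<^sub>R v)) h = 0"
    by (rule commuting_conjugate[where X = "{}", OF _ xp a_in_pp[OF ha]]) (simp, blast)
  note aut = H_aut[OF A(1)]
  have Aa: "A (x + r *\<^sub>R v) \<in> a"
    using h A(2) aut_pp[OF aut xp] br_zero_sym by (auto simp: regular_def)
  obtain A' where A': "symmetric_automorphism br s A'" "\<And>x. A' (A x) = x" "\<And>x. A (A' x) = x"
    by (rule symmetric_automorphism_inverse[OF aut]) blast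
  have "br y (A x) = 0" if y: "y \<in> a" for y
  proof -
    have "br (A (x + r *\<^sub>R v)) (A (A' y)) = 0" using a_comm[OF Aa y] by (simp add: A')
    then have "br (x + r *\<^sub>R v) (A' y) = 0" using aut_zero[OF aut] by blast
    then have "br x (A' y) = 0" using \<epsilon>(2)[OF rv(2,3,1) aut_pp[OF A'(1) a_in_pp[OF y]]] by blast
    then have "br (A x) y = 0" using aut_zero[OF aut, of x "A' y"] by (simp add: A')
    then show ?thesis using br_zero_sym by blast
  qed
  then have "A x \<in> a" by (rule a_max[OF aut_pp[OF aut x]])
  moreover have "A v = (1 / r) *\<^sub>R (A (x + r *\<^sub>R v) - A x)"
    using r by (simp add: blinfun.bilinear_simps)
  ultimately show thesis using that A Aa sub_a by (metis subspace_scale subspace_diff)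
qed

text \<open>A regular \<open>h\<close> decides. An element of \<open>H\<close> that fixes the image
  of \<open>X\<close> makes \<open>M h\<close> commute with \<open>h\<close>, hence moves it into
  \<open>a\<close>. The inverse of the composite then takes \<open>a\<close> to vectors commuting
  with \<open>h\<close>, that is, into \<open>a\<close>.\<close>

lemma conjugate_into_a_normalizer:
  assumes M: "symmetric_automorphism br s M" and X: "X \<subseteq> a" "M ` X \<subseteq> a"
  obtains C where "C \<in> H" "\<And>x. x \<in> X \<Longrightarrow> C (M x) = M x" "(\<lambda>x. C (M x)) ` a = a"
proof -
  obtain h where h: "regular a h" using regular_exists[OF maxab] by blast
  then have ha: "h \<in> a" by (simp add: regular_def)
  have "x \<in> pp \<and> br x (M h) = 0 \<and> br x h = 0" if "x \<in> M ` X" for x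
    using that X ha aut_zero[OF M] a_comm a_in_pp by blast
  from commuting_conjugate[OF this aut_pp[OF M a_in_pp[OF ha]] a_in_pp[OF ha]]
  obtain C where C: "C \<in> H" "\<And>x. x \<in> M ` X \<Longrightarrow> C x = x" "br (C (M h)) h = 0" by blast
  define N where "N x = C (M x)" for x
  have N: "symmetric_automorphism br s N" unfolding N_def
    by (rule symmetric_automorphism_comp[OF H_aut[OF C(1)] M])
  have Nh: "N h \<in> a" using h C(3) aut_pp[OF N a_in_pp[OF ha]] br_zero_sym
    by (auto simp: regular_def N_def)
  obtain N' where N': "symmetric_automorphism br s N'" "\<And>x. N' (N x) = x" "\<And>x. N (N' x) = x"
    by (rule symmetric_automorphism_inverse[OF N]) blast
  have sub: "a \<subseteq> N ` a"
  proof
    fix y assume y: "y \<in> a"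
    have "br (N h) (N (N' y)) = 0" using a_comm[OF Nh y] by (simp add: N')
    then have "br h (N' y) = 0" using aut_zero[OF N] by blast
    then have "N' y \<in> a" using h aut_pp[OF N'(1) a_in_pp[OF y]] by (simp add: regular_def)
    then show "y \<in> N ` a" using N'(3) by (metis imageI)
  qed
  have "linear N" by (rule symmetric_automorphismD(1)[OF N])
  have "a = N ` a"
    by (rule subspace_dim_equal[OF sub_a linear_subspace_image[OF \<open>linear N\<close> sub_a] sub dim_image_le[OF \<open>linear N\<close>]])
  then show thesis using that[of C] C by (simp add: N_def)
qed

text \<open>For regular \<open>y\<close> this is \<open>commuting_conjugate\<close>, since a vector
  of \<open>pp\<close> commuting with \<open>y\<close> lies in \<open>a\<close>. In general
  \<open>y\<close> is approximated by regular elements at the cost of \<open>\<epsilon>\<close>, and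
  a minimum over a compact part of \<open>H\<close> removes the \<open>\<epsilon>\<close>.\<close>

lemma conjugate_near:
  assumes y: "y \<in> a" and x: "x \<in> pp"
  obtains A where "A \<in> H" "A x \<in> a" "norm (A x - y) \<le> norm (x - y)"
proof -
  let ?HA = "H \<inter> {A. blinfun_apply A x \<in> a}"
  have near: "\<exists>A\<in>?HA. norm (A x - y) \<le> norm (x - y) + \<epsilon>" if \<epsilon>: "\<epsilon> > 0" for \<epsilon>
  proof -
    obtain h where h: "regular a h" "norm (h - y) < \<epsilon> / 2"
      using regular_dense[OF maxab y half_gt_zero[OF \<epsilon>]] by blast
    then have ha: "h \<in> a" by (simp add: regular_def)
    obtain A where A: "A \<in> H" "norm (A x - h) \<le> norm (x - h)" "br (A x) h = 0"
      by (rule commuting_conjugate[where X = "{}", OF _ x a_in_pp[OF ha]]) (simp, blast)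
    have "A x \<in> a" using h(1) A(3) aut_pp[OF H_aut[OF A(1)] x] br_zero_sym by (auto simp: regular_def)
    moreover have "norm (A x - y) \<le> norm (A x - h) + norm (h - y)"
      using norm_triangle_ineq[of "A x - h" "h - y"] by simp
    moreover have "norm (x - h) \<le> norm (x - y) + norm (h - y)"
      using norm_triangle_ineq4[of "x - y" "h - y"] by simp
    ultimately show ?thesis using A h by (intro bexI[of _ A]) auto
  qed
  have "closed {A. blinfun_apply A x \<in> a}"
    using continuous_closed_vimage[OF closed_subspace[OF sub_a], of "\<lambda>A. blinfun_apply A x"]
    by (simp add: vimage_def continuous_intros)
  then have "compact ?HA" using H_compact by (rule compact_Int_closed[rotated])
  moreover have "?HA \<noteq> {}" using near[OF zero_less_one] by blast
  moreover have "continuous_on ?HA (\<lambda>A. norm (blinfun_apply A x - y))" by (intro continuous_intros)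
  ultimately obtain A where A: "A \<in> ?HA" "\<And>C. C \<in> ?HA \<Longrightarrow> norm (A x - y) \<le> norm (C x - y)"
    using continuous_attains_inf[of ?HA "\<lambda>A. norm (blinfun_apply A x - y)"] by blast
  have "norm (A x - y) \<le> norm (x - y) + \<epsilon>" if "\<epsilon> > 0" for \<epsilon>
    using near[OF that] A(2) by (meson order_trans)
  then have "norm (A x - y) \<le> norm (x - y)" by (rule field_le_epsilon)
  then show thesis using that A by blast
qed

text \<open>The action on \<open>a\<close> of its normalizer in \<open>H\<close>. Composing with the
  retraction \<open>P\<close> makes elements of \<open>H\<close> that agree on \<open>a\<close> give
  the same function, so that this set can be finite.\<close>

definition weyl_maps where
  "weyl_maps P = {\<lambda>x. blinfun_apply A (P x) | A. A \<in> H \<and> blinfun_apply A ` a = a}"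

lemma weyl_maps_group:
  assumes P: "linear P" "\<And>x. P x \<in> a" "\<And>x. x \<in> a \<Longrightarrow> P x = x"
  shows "isometry_group_on (weyl_maps P) a"
  unfolding isometry_group_on_def
proof (intro conjI ballI)
  show "subspace a" by (rule sub_a)
  have "(\<lambda>x. id_blinfun (P x)) \<in> weyl_maps P"
    unfolding weyl_maps_def using H_id by (intro CollectI exI[of _ id_blinfun]) simp
  then show "weyl_maps P \<noteq> {}" by blast
  fix w assume w: "w \<in> weyl_maps P"
  then obtain A where A: "A \<in> H" "blinfun_apply A ` a = a" "w = (\<lambda>x. blinfun_apply A (P x))" by (auto simp: weyl_maps_def)
  show "linear w" unfolding A(3)
    using linear_compose[OF P(1) bounded_linear.linear[OF blinfun.bounded_linear_right[of A]]] by (simp add: o_def)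
  show "w x \<in> a" if "x \<in> a" for x using A P by blast
  show "norm (w x) = norm x" if "x \<in> a" for x using A P that H_norm by simp
  obtain C where C: "C \<in> H" "\<And>x. C (A x) = x" "\<And>x. A (C x) = x" using H_inv[OF A(1)] by blast
  have "blinfun_apply C ` a = a"
  proof -
    have "blinfun_apply C ` a = blinfun_apply C ` (blinfun_apply A ` a)" using A by simp
    then show ?thesis by (simp add: image_image C)
  qed
  then have "(\<lambda>x. C (P x)) \<in> weyl_maps P" using C by (auto simp: weyl_maps_def)
  moreover have "\<forall>x\<in>a. C (P (w x)) = x" using A P C by (metis imageI)
  ultimately show "\<exists>w'\<in>weyl_maps P. \<forall>x\<in>a. w' (w x) = x" by auto
  fix w' assume "w' \<in> weyl_maps P"
  then obtain A' where A': "A' \<in> H" "blinfun_apply A' ` a = a" "w' = (\<lambda>x. blinfun_apply A' (P x))" by (auto simp: weyl_maps_def)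
  have "A' (P x) \<in> a" for x using A'(2) P(2) by blast
  then have "w \<circ> w' = (\<lambda>x. (A o\<^sub>L A') (P x))" using A(3) A'(3) P(3) by (simp add: fun_eq_iff)
  moreover have "blinfun_apply (A o\<^sub>L A') ` a = a"
    using A(2) A'(2) image_image[of A A' a] by (simp add: o_def)
  ultimately show "w \<circ> w' \<in> weyl_maps P" using H_comp[OF A(1) A'(1)]
    unfolding weyl_maps_def by (intro CollectI exI[of _ "A o\<^sub>L A'"] conjI)
next
  \<comment> \<open>Finiteness: a map is determined by its values on a basis of \<open>a\<close>,
    and the possible images of a basis vector are separated by
    \<open>close_commuting_conjugate_eq\<close>, since all of them lie in \<open>a\<close> and so
    commute.\<close>
  obtain Bs where Bs: "Bs \<subseteq> a" "independent Bs" "a \<subseteq> span Bs" "card Bs = dim a" by (rule basis_exists)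
  have finB: "finite Bs" using Bs by (simp add: independent_imp_finite)
  have fin: "finite ((\<lambda>w. w b) ` weyl_maps P)" if b: "b \<in> Bs" for b
  proof -
    have ba: "b \<in> a" using b Bs by auto
    obtain \<epsilon> where \<epsilon>: "\<epsilon> > 0" "\<And>A. symmetric_automorphism br s A \<Longrightarrow> br b (A b) = 0 \<Longrightarrow>
        norm (A b - b) < \<epsilon> \<Longrightarrow> A b = b"
      using close_commuting_conjugate_eq[OF a_in_pp[OF ba]] by blast
    show ?thesis
    proof (rule finite_if_separated_bounded[OF _ \<epsilon>(1)])
      show "bounded ((\<lambda>w. w b) ` weyl_maps P)"
        unfolding bounded_iff weyl_maps_def using H_norm P(3)[OF ba] by (intro exI[of _ "norm b"]) auto
      fix u v assume "u \<in> (\<lambda>w. w b) ` weyl_maps P" "v \<in> (\<lambda>w. w b) ` weyl_maps P" and uv: "norm (u - v) < \<epsilon>"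
      then obtain A A' where A: "A \<in> H" "blinfun_apply A ` a = a" "u = A b"
        and A': "A' \<in> H" "blinfun_apply A' ` a = a" "v = A' b"
        using P(3)[OF ba] by (auto simp: weyl_maps_def)
      obtain C where C: "C \<in> H" "\<And>x. C (A x) = x" "\<And>x. A (C x) = x" using H_inv[OF A(1)] by blast
      have "C (A' b) \<in> a" using A(2) A'(2) ba C(2) by (metis imageE imageI)
      moreover have "norm ((C o\<^sub>L A') b - b) < \<epsilon>"
      proof -
        have "(C o\<^sub>L A') b - b = C (v - u)" by (simp add: A A' C blinfun.bilinear_simps)
        then show ?thesis using uv H_norm[OF C(1)] by (simp add: norm_minus_commute)
      qed
      ultimately have "(C o\<^sub>L A') b = b"
        by (intro \<epsilon>(2) H_aut H_comp C A') (auto intro: a_comm ba)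
      then show "u = v" using C(3)[of "A' b"] by (simp add: A A')
    qed
  qed
  let ?r = "\<lambda>w. restrict w Bs"
  have "?r ` weyl_maps P \<subseteq> PiE Bs (\<lambda>b. (\<lambda>w. w b) ` weyl_maps P)" by auto
  then have "finite (?r ` weyl_maps P)" by (rule finite_subset) (intro finite_PiE finB fin)
  moreover have "inj_on ?r (weyl_maps P)"
  proof (rule inj_onI)
    fix w w' assume w: "w \<in> weyl_maps P" "w' \<in> weyl_maps P" and eq: "?r w = ?r w'"
    obtain A A' where A: "w = (\<lambda>x. blinfun_apply A (P x))" "w' = (\<lambda>x. blinfun_apply A' (P x))" "A \<in> H" "A' \<in> H"
      using w by (auto simp: weyl_maps_def)
    have "A y = A' y" if "y \<in> a" for y
    proof (rule linear_eq_on_span[of A A' Bs])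
      show "linear A" "linear A'" using bounded_linear.linear blinfun.bounded_linear_right by blast+
      show "A b = A' b" if b: "b \<in> Bs" for b
      proof -
        have "P b = b" using P(3) b Bs by auto
        then show ?thesis using fun_cong[OF eq, of b] b by (simp add: A)
      qed
    qed (use that Bs in auto)
    then show "w = w'" using P by (auto simp: A)
  qed
  ultimately show "finite (weyl_maps P)" by (rule finite_imageD)
qed
end
end

section \<open>Differentiable lifts to a maximal Abelian subspace\<close>

text \<open>A vector that avoids the hyperplanes of \<open>U\<close> is shifted by
  \<open>\<eta>\<close> along the new normal \<open>u\<close>. If \<open>u \<bullet> v\<close> is
  nonzero, one \<open>\<eta>\<close> is bad for \<open>v\<close>; otherwise the product with
  \<open>v\<close> does not change. So finitely many \<open>\<eta>\<close> are excluded.\<close>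

lemma avoid_hyperplanes:
  fixes a :: "'a::euclidean_space set"
  assumes "finite U" "subspace a" "U \<subseteq> a - {0}" "h0 \<in> a" "\<epsilon> > 0"
  shows "\<exists>h\<in>a. norm (h - h0) < \<epsilon> \<and> (\<forall>u\<in>U. h \<bullet> u \<noteq> 0)"
  using assms
proof (induction U arbitrary: \<epsilon>)
  case empty then show ?case by (intro bexI[of _ h0]) auto
next
  case (insert u U)
  have "U \<subseteq> a - {0}" "\<epsilon> / 2 > 0" using insert.prems by auto
  from insert.IH[OF insert.prems(1) this(1) insert.prems(3) this(2)]
  obtain h where h: "h \<in> a" "norm (h - h0) < \<epsilon> / 2" "\<And>v. v \<in> U \<Longrightarrow> h \<bullet> v \<noteq> 0" by blast
  have u: "u \<in> a" "u \<noteq> 0" using insert.prems by auto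
  define r where "r = \<epsilon> / (2 * norm u)"
  have "r > 0" using u insert.prems by (simp add: r_def)
  then have "infinite {0<..<r}" by (rule infinite_Ioo)
  moreover have "finite ((\<lambda>v. - (h \<bullet> v) / (u \<bullet> v)) ` insert u U)" using insert.hyps by simp
  ultimately have "\<not> {0<..<r} \<subseteq> (\<lambda>v. - (h \<bullet> v) / (u \<bullet> v)) ` insert u U"
    using finite_subset by blast
  then obtain \<eta> where "\<eta> \<in> {0<..<r}" and \<eta>3: "\<eta> \<notin> (\<lambda>v. - (h \<bullet> v) / (u \<bullet> v)) ` insert u U" by blast
  then have \<eta>: "0 < \<eta>" "\<eta> < r" by auto
  let ?h = "h + \<eta> *\<^sub>R u"
  have "?h \<bullet> v \<noteq> 0" if v: "v \<in> insert u U" for v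
  proof (cases "u \<bullet> v = 0")
    case True
    then have "v \<in> U" using v u by auto
    then show ?thesis using h(3) True by (simp add: inner_add_left)
  next
    case False
    have "\<eta> \<noteq> - (h \<bullet> v) / (u \<bullet> v)" using \<eta>3 v by blast
    then show ?thesis using False by (auto simp: inner_add_left field_simps eq_neg_iff_add_eq_0 add.commute)
  qed
  moreover have "norm (?h - h0) \<le> norm (h - h0) + norm (\<eta> *\<^sub>R u)"
    using norm_triangle_ineq[of "h - h0" "\<eta> *\<^sub>R u"] by (simp add: algebra_simps)
  moreover have "norm (\<eta> *\<^sub>R u) < \<epsilon> / 2"
    using \<eta>(1,2) u by (simp add: r_def pos_less_divide_eq mult.commute)
  moreover have "?h \<in> a" using h u insert.prems by (simp add: subspace_add subspace_scale)
  ultimately show ?case using h by (intro bexI[of _ ?h]) auto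
qed

lemma finite_range_constant_subseq:
  fixes f :: "nat \<Rightarrow> 'b" assumes "finite S" "\<And>n. f n \<in> S"
  obtains c and r :: "nat \<Rightarrow> nat" where "strict_mono r" "\<And>n. f (r n) = c" "c \<in> S"
proof -
  have "finite (f ` UNIV)" using assms by (meson finite_subset image_subsetI)
  then obtain n0 where "infinite {n\<in>UNIV. f n = f n0}"
    using pigeonhole_infinite[of UNIV f] by auto
  then obtain r :: "nat \<Rightarrow> nat" where r: "strict_mono r" "\<And>n. r n \<in> {n\<in>UNIV. f n = f n0}"
    using infinite_enumerate by metis
  then show thesis using that[of r "f n0"] assms by simp
qed

lemma has_vector_derivative_quotient_seq:
  assumes f: "(f has_vector_derivative D) (at t0)" and u: "u \<longlonglongrightarrow> t0" "\<And>n. u n \<noteq> t0"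
  shows "(\<lambda>n. (1 / (u n - t0)) *\<^sub>R (f (u n) - f t0)) \<longlonglongrightarrow> D"
proof (rule metric_LIMSEQ_I)
  fix e :: real assume "e > 0"
  then have "e / 2 > 0" by simp
  then obtain d where d: "d > 0" "\<And>s. \<bar>s - t0\<bar> < d \<Longrightarrow> norm (f s - f t0 - (s - t0) *\<^sub>R D) \<le> e / 2 * \<bar>s - t0\<bar>"
    using f unfolding has_vector_derivative_at_alt by blast
  obtain N where N: "\<And>n. n \<ge> N \<Longrightarrow> \<bar>u n - t0\<bar> < d"
    using metric_LIMSEQ_D[OF u(1) d(1)] by (auto simp: dist_real_def)
  have "dist ((1 / (u n - t0)) *\<^sub>R (f (u n) - f t0)) D < e" if "n \<ge> N" for n
  proof -
    let ?\<delta> = "u n - t0"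
    have \<delta>: "?\<delta> \<noteq> 0" using u(2) by simp
    have "f (u n) - f t0 - ?\<delta> *\<^sub>R D = ?\<delta> *\<^sub>R ((1 / ?\<delta>) *\<^sub>R (f (u n) - f t0) - D)"
      using \<delta> by (simp add: scaleR_diff_right)
    then have "\<bar>?\<delta>\<bar> * norm ((1 / ?\<delta>) *\<^sub>R (f (u n) - f t0) - D) \<le> \<bar>?\<delta>\<bar> * (e / 2)"
      using d(2)[OF N[OF that]] by (simp add: mult.commute)
    then have "norm ((1 / ?\<delta>) *\<^sub>R (f (u n) - f t0) - D) \<le> e / 2" using \<delta> by simp
    then show ?thesis using \<open>e > 0\<close> by (simp add: dist_norm)
  qed
  then show "\<exists>N. \<forall>n\<ge>N. dist ((1 / (u n - t0)) *\<^sub>R (f (u n) - f t0)) D < e" by blast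
qed

context orthogonal_symmetric_algebra begin

lemma derivative_in_pp:
  assumes "open I" "\<And>t. t \<in> I \<Longrightarrow> \<rho> t \<in> pp" "t \<in> I" "(\<rho> has_vector_derivative v) (at t)"
  shows "v \<in> pp"
proof -
  have "bounded_linear s" using s_linear by (simp add: linear_conv_bounded_linear)
  then have "((\<lambda>t. s (\<rho> t) + \<rho> t) has_vector_derivative (s v + v)) (at t)"
    by (intro has_vector_derivative_add assms(4)) (rule bounded_linear.has_vector_derivative[OF _ assms(4)])
  then have "((\<lambda>t. 0) has_vector_derivative (s v + v)) (at t)"
    by (rule has_vector_derivative_transform_within_open[OF _ assms(1,3)]) (use assms(2) ppD in auto)
  from vector_derivative_unique_at[OF this has_vector_derivative_const]
  show ?thesis by (intro ppI) (simp add: eq_neg_iff_add_eq_0)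
qed

text \<open>Uniqueness of the orthogonal decomposition identifies \<open>q\<close> with the
  centralizer part of \<open>v\<close>, so that \<open>v - q\<close> is tangent to the orbit of
  \<open>x\<close>.\<close>

lemma projection_tangent:
  assumes x: "x \<in> pp" and v: "v \<in> pp" and q: "q \<in> pp" "br x q = 0"
    and orth: "\<And>z. z \<in> p_centralizer br s x \<Longrightarrow> (v - q) \<bullet> z = 0"
  obtains z where "z \<in> kk" "v = q + br z x"
proof -
  obtain y z where yz: "y \<in> pp" "br x y = 0" "z \<in> kk" "v = y + br z x" by (rule tangent_decomp[OF x v])
  have "y - q \<in> p_centralizer br s x" using yz q subspace_pp
    by (simp add: p_centralizer_def subspace_diff br_simps)
  moreover have "w \<bullet> br z x = 0" if "w \<in> p_centralizer br s x" for w
    using orthogonal_if_commute[OF x _ _ yz(3)] that by (simp add: p_centralizer_def)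
  ultimately have "(v - q) \<bullet> (y - q) = 0" "br z x \<bullet> (y - q) = 0"
    using orth[of "y - q"] by (simp_all only: inner_commute[of "br z x"])
  moreover have "y - q = (v - q) - br z x" by (simp add: yz(4))
  ultimately have "(y - q) \<bullet> (y - q) = 0" by (metis inner_diff_left diff_self)
  then show thesis using that[OF yz(3)] yz(4) by simp
qed

text \<open>To first order the flow of \<open>-z\<close> removes the tangential part \<open>[z, \<rho> t]\<close> of \<open>\<rho>' t\<close>.\<close>

lemma first_order_normal_form:
  assumes x: "\<rho> t \<in> pp" and v: "v \<in> pp" "(\<rho> has_vector_derivative v) (at t)"
    and q: "q \<in> pp" "br (\<rho> t) q = 0" "\<And>z. z \<in> p_centralizer br s (\<rho> t) \<Longrightarrow> (v - q) \<bullet> z = 0"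
    and "\<epsilon> > 0"
  shows "\<exists>\<delta>>0. \<forall>u. \<bar>u - t\<bar> < \<delta> \<longrightarrow> (\<exists>A\<in>H. norm (A (\<rho> u) - \<rho> t - (u - t) *\<^sub>R q) \<le> \<epsilon> * \<bar>u - t\<bar>)"
proof -
  obtain z where z: "z \<in> kk" "v = q + br z (\<rho> t)" by (rule projection_tangent[OF x v(1) q])
  have "- z \<in> kk" using z subspace_kk by (simp add: subspace_neg)
  then obtain e :: "real \<Rightarrow> 'a \<Rightarrow>\<^sub>L 'a" where e: "e 0 = id_blinfun" "\<And>t. e t \<in> H"
    "\<And>y. ((\<lambda>t. e t y) has_vector_derivative br (- z) y) (at 0)"
    using flow[OF kkD] by blast
  define \<eta> where "\<eta> = \<epsilon> / 3"
  have \<eta>: "\<eta> > 0" using \<open>\<epsilon> > 0\<close> by (simp add: \<eta>_def)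
  obtain d1 where d1: "d1 > 0" "\<And>u. \<bar>u - t\<bar> < d1 \<Longrightarrow> norm (\<rho> u - \<rho> t - (u - t) *\<^sub>R v) \<le> \<eta> * \<bar>u - t\<bar>"
    using v(2) \<eta> unfolding has_vector_derivative_at_alt by blast
  have "\<exists>d>0. \<forall>r. \<bar>r - 0\<bar> < d \<longrightarrow> norm (e r (\<rho> t) - e 0 (\<rho> t) - (r - 0) *\<^sub>R br (- z) (\<rho> t)) \<le> \<eta> * \<bar>r - 0\<bar>"
    using e(3)[of "\<rho> t"] \<eta> unfolding has_vector_derivative_at_alt by blast
  then obtain d2 where d2: "d2 > 0" "\<And>r. \<bar>r\<bar> < d2 \<Longrightarrow> norm (e r (\<rho> t) - \<rho> t + r *\<^sub>R br z (\<rho> t)) \<le> \<eta> * \<bar>r\<bar>"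
    by (auto simp: e br_simps)
  have "isCont (\<lambda>r. e r v) 0" by (rule has_vector_derivative_continuous[OF e(3)])
  then obtain d3 where d3: "d3 > 0" "\<And>r. \<bar>r\<bar> < d3 \<Longrightarrow> norm (e r v - v) < \<eta>"
    using \<eta> unfolding continuous_at_eps_delta by (fastforce simp: dist_norm e)
  have "\<exists>A\<in>H. norm (A (\<rho> u) - \<rho> t - (u - t) *\<^sub>R q) \<le> \<epsilon> * \<bar>u - t\<bar>" if u: "\<bar>u - t\<bar> < min d1 (min d2 d3)" for u
  proof (intro bexI[OF _ e(2)[of "u - t"]])
    let ?E = "e (u - t)"
    \<comment> \<open>The three errors come from the derivative of \<open>\<rho>\<close>, from the
      derivative of the flow at the point \<open>\<rho> t\<close>, and from moving the velocity
      \<open>v\<close>; the tangential parts cancel because of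
      \<open>v = q + br z (\<rho> t)\<close>.\<close>
    have "?E (\<rho> u) - \<rho> t - (u - t) *\<^sub>R q = ?E (\<rho> u - \<rho> t - (u - t) *\<^sub>R v) +
       (?E (\<rho> t) - \<rho> t + (u - t) *\<^sub>R br z (\<rho> t)) + (u - t) *\<^sub>R (?E v - v)"
      by (simp add: blinfun.bilinear_simps z(2) algebra_simps)
    also have "norm \<dots> \<le> norm (?E (\<rho> u - \<rho> t - (u - t) *\<^sub>R v)) +
       norm (?E (\<rho> t) - \<rho> t + (u - t) *\<^sub>R br z (\<rho> t)) + norm ((u - t) *\<^sub>R (?E v - v))"
      by (rule norm_triangle_le add_mono norm_triangle_ineq order_refl)+
    also have "\<dots> \<le> \<eta> * \<bar>u - t\<bar> + \<eta> * \<bar>u - t\<bar> + \<bar>u - t\<bar> * \<eta>"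
    proof (intro add_mono)
      show "norm (?E (\<rho> u - \<rho> t - (u - t) *\<^sub>R v)) \<le> \<eta> * \<bar>u - t\<bar>"
        using H_norm[OF e(2)] d1(2)[of u] u by simp
      show "norm (?E (\<rho> t) - \<rho> t + (u - t) *\<^sub>R br z (\<rho> t)) \<le> \<eta> * \<bar>u - t\<bar>"
        using d2(2)[of "u - t"] u by simp
      have "norm (?E v - v) \<le> \<eta>" using d3(2)[of "u - t"] u by simp
      then show "norm ((u - t) *\<^sub>R (?E v - v)) \<le> \<bar>u - t\<bar> * \<eta>" by (simp add: mult_left_mono)
    qed
    also have "\<dots> = \<epsilon> * \<bar>u - t\<bar>" by (simp add: \<eta>_def)
    finally show "norm (?E (\<rho> u) - \<rho> t - (u - t) *\<^sub>R q) \<le> \<epsilon> * \<bar>u - t\<bar>" .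
  qed
  then show ?thesis using d1 d2 d3 by (intro exI[of _ "min d1 (min d2 d3)"]) auto
qed

lemma aut_zero_pp:
  assumes "A \<in> H" shows "blinfun_apply A x \<in> pp \<longleftrightarrow> x \<in> pp"
  using aut_pp_iff[OF H_aut[OF assms]] .

context
  fixes a assumes maxab: "maximal_abelian br pp a"
begin

theorem differentiable_lift:
  assumes I: "open I" and \<rho>: "\<And>t. t \<in> I \<Longrightarrow> \<rho> t \<in> pp"
    "\<And>t. t \<in> I \<Longrightarrow> (\<rho> has_vector_derivative \<rho>' t) (at t)"
    and q: "\<And>t. t \<in> I \<Longrightarrow> q t \<in> p_centralizer br s (\<rho> t)"
      "\<And>t z. t \<in> I \<Longrightarrow> z \<in> p_centralizer br s (\<rho> t) \<Longrightarrow> (\<rho>' t - q t) \<bullet> z = 0"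
  shows "\<exists>lam. \<forall>t\<in>I. \<exists>A\<in>H. lam t = A (\<rho> t) \<and> A (\<rho> t) \<in> a \<and> A (q t) \<in> a \<and>
           (lam has_vector_derivative A (q t)) (at t)"
proof -
  have \<rho>': "\<rho>' t \<in> pp" if "t \<in> I" for t by (rule derivative_in_pp[OF I \<rho>(1) that \<rho>(2)[OF that]])
  have qp: "q t \<in> pp" "br (\<rho> t) (q t) = 0" if "t \<in> I" for t
    using q(1)[OF that] by (auto simp: p_centralizer_def)
  obtain P where P: "linear P" "\<And>x. P x \<in> a" "\<And>x. x \<in> a \<Longrightarrow> P x = x"
    by (rule subspace_retraction[OF sub_a[OF maxab]]) blast
  let ?W = "weyl_maps a P"
  have W: "isometry_group_on ?W a" by (rule weyl_maps_group[OF maxab P])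
  have "\<forall>t\<in>I. \<exists>A. A \<in> H \<and> blinfun_apply A (\<rho> t) \<in> a \<and> blinfun_apply A (q t) \<in> a"
    using commuting_pair_into_a[OF maxab \<rho>(1) qp] by metis
  from bchoice[OF this] obtain A where "\<forall>t\<in>I. A t \<in> H \<and> blinfun_apply (A t) (\<rho> t) \<in> a \<and> blinfun_apply (A t) (q t) \<in> a"
    by (rule exE)
  then have A: "\<And>t. t \<in> I \<Longrightarrow> A t \<in> H" "\<And>t. t \<in> I \<Longrightarrow> A t (\<rho> t) \<in> a" "\<And>t. t \<in> I \<Longrightarrow> A t (q t) \<in> a" by blast+
  have a0: "0 \<in> a" using subspace_0[OF sub_a[OF maxab]] .
  define x v where "x t = (if t \<in> I then A t (\<rho> t) else 0)" and "v t = (if t \<in> I then A t (q t) else 0)" for t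
  have ra: "range x \<subseteq> a" "range v \<subseteq> a" using A a0 by (auto simp: x_def v_def)
  have "orbit_differentiable ?W x v I"
    unfolding orbit_differentiable_def
  proof (intro ballI allI impI)
    fix t \<epsilon> :: real assume t: "t \<in> I" and \<epsilon>: "\<epsilon> > 0"
    obtain \<delta> where \<delta>: "\<delta> > 0" "\<And>u. \<bar>u - t\<bar> < \<delta> \<Longrightarrow> \<exists>E\<in>H. norm (E (\<rho> u) - \<rho> t - (u - t) *\<^sub>R q t) \<le> \<epsilon> * \<bar>u - t\<bar>"
      using first_order_normal_form[OF \<rho>(1)[OF t] \<rho>'[OF t] \<rho>(2)[OF t] qp[OF t] q(2)[OF t] \<epsilon>] by blast
    show "\<exists>\<delta>>0. \<forall>u\<in>I. \<bar>u - t\<bar> < \<delta> \<longrightarrow> (\<exists>w\<in>?W. norm (w (x u) - x t - (u - t) *\<^sub>R v t) \<le> \<epsilon> * \<bar>u - t\<bar>)"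
    proof (intro exI[of _ \<delta>] conjI \<delta>(1) ballI impI)
      fix u assume u: "u \<in> I" "\<bar>u - t\<bar> < \<delta>"
      obtain E where E: "E \<in> H" "norm (E (\<rho> u) - \<rho> t - (u - t) *\<^sub>R q t) \<le> \<epsilon> * \<bar>u - t\<bar>" using \<delta>(2)[OF u(2)] by blast
      \<comment> \<open>The first-order prediction in \<open>a\<close>. The conjugate
        \<open>\<tau>\<close> of \<open>\<rho> u\<close> is close to it but need not lie in
        \<open>a\<close>; \<open>conjugate_near\<close> moves it there without increasing the
        distance, and \<open>conjugate_into_a_normalizer\<close> shows the result to be the image of
        \<open>x u\<close> under a Weyl map.\<close>
      define y where "y = x t + (u - t) *\<^sub>R v t"
      have y: "y \<in> a" unfolding y_def using ra sub_a[OF maxab] by (intro subspace_add subspace_scale) auto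
      define \<tau> where "\<tau> = A t (E (\<rho> u))"
      have \<tau>: "\<tau> \<in> pp" unfolding \<tau>_def using aut_zero_pp[OF A(1)[OF t]] aut_zero_pp[OF E(1)] \<rho>(1)[OF u(1)] by blast
      have "\<tau> - y = A t (E (\<rho> u) - \<rho> t - (u - t) *\<^sub>R q t)"
        using t by (simp add: \<tau>_def y_def x_def v_def blinfun.bilinear_simps algebra_simps)
      then have \<tau>y: "norm (\<tau> - y) \<le> \<epsilon> * \<bar>u - t\<bar>" using E(2) H_norm[OF A(1)[OF t]] by simp
      obtain C where C: "C \<in> H" "C \<tau> \<in> a" "norm (C \<tau> - y) \<le> norm (\<tau> - y)" by (rule conjugate_near[OF maxab y \<tau>])
      obtain D where D: "D \<in> H" "\<And>z. D (A u z) = z" using H_inv[OF A(1)[OF u(1)]] by blast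
      define M where "M = C o\<^sub>L (A t o\<^sub>L (E o\<^sub>L D))"
      have M: "M \<in> H" unfolding M_def by (intro H_comp C A(1) t E D)
      have Mx: "M (x u) = C \<tau>" using u by (simp add: M_def x_def D \<tau>_def)
      obtain N where N: "N \<in> H" "\<And>z. z \<in> {x u} \<Longrightarrow> N (M z) = M z" "(\<lambda>z. N (M z)) ` a = a"
        by (rule conjugate_into_a_normalizer[OF maxab H_aut[OF M], of "{x u}"]) (use ra Mx C in auto)
      have "(\<lambda>z. blinfun_apply (N o\<^sub>L M) (P z)) \<in> ?W"
        unfolding weyl_maps_def[OF maxab] using H_comp[OF N(1) M] N(3)
        by (intro CollectI exI[of _ "N o\<^sub>L M"]) simp
      moreover have "(N o\<^sub>L M) (P (x u)) = C \<tau>"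
      proof -
        have "P (x u) = x u" using P(3) ra by auto
        then show ?thesis using N(2)[of "x u"] Mx by simp
      qed
      moreover have "norm (C \<tau> - x t - (u - t) *\<^sub>R v t) \<le> \<epsilon> * \<bar>u - t\<bar>"
        using C(3) \<tau>y by (simp add: y_def diff_diff_eq)
      ultimately show "\<exists>w\<in>?W. norm (w (x u) - x t - (u - t) *\<^sub>R v t) \<le> \<epsilon> * \<bar>u - t\<bar>"
        by (intro bexI[of _ "\<lambda>z. blinfun_apply (N o\<^sub>L M) (P z)"]) simp_all
    qed
  qed
  from orbit_differentiable_lift[OF W ra I this] obtain lam where lam: "lift_on ?W x v I lam" by (rule exE)
  show ?thesis
  proof (intro exI[of _ lam] ballI)
    fix t assume t: "t \<in> I"
    obtain w where w: "w \<in> ?W" "lam t = w (x t)" "(lam has_vector_derivative w (v t)) (at t)"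
      using lam t unfolding lift_on_def by blast
    obtain N where N: "N \<in> H" "blinfun_apply N ` a = a" "w = (\<lambda>x. blinfun_apply N (P x))"
      using w(1) by (auto simp: weyl_maps_def[OF maxab])
    have "w (x t) = (N o\<^sub>L A t) (\<rho> t)" "w (v t) = (N o\<^sub>L A t) (q t)"
      using t N(3) P(3) A by (simp_all add: x_def v_def)
    moreover have "w (x t) \<in> a" "w (v t) \<in> a"
    proof -
      have "x t \<in> a" "v t \<in> a" using ra by auto
      then show "w (x t) \<in> a" "w (v t) \<in> a" using isometry_group_on_closed[OF W w(1)] by auto
    qed
    ultimately show "\<exists>A\<in>H. lam t = A (\<rho> t) \<and> A (\<rho> t) \<in> a \<and> A (q t) \<in> a \<and> (lam has_vector_derivative A (q t)) (at t)"
      using w H_comp[OF N(1) A(1)[OF t]] by (intro bexI[of _ "N o\<^sub>L A t"]) auto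
  qed
qed

text \<open>For a maximizer \<open>A1\<close> the vector \<open>A1 x\<close> is in \<open>a\<close>,
  but nothing is known of \<open>A1 q\<close>. Correcting \<open>A1\<close> by an element that fixes
  \<open>A1 x\<close> makes it differ from \<open>A0\<close> by an element normalizing
  \<open>a\<close>, so that one Weyl map accounts for both \<open>x\<close> and
  \<open>q\<close>.\<close>

lemma maximizer_in_weyl_orbit:
  assumes h: "regular a h" and x: "x \<in> pp" and P: "linear P" "\<And>x. P x \<in> a" "\<And>x. x \<in> a \<Longrightarrow> P x = x"
    and A0: "A0 \<in> H" "A0 x \<in> a" "A0 q \<in> a"
  shows "\<exists>w\<in>weyl_maps a P. \<exists>A\<in>H. A x = w (A0 x) \<and> A q = w (A0 q) \<and> A x \<in> a \<and> (\<forall>C\<in>H. C x \<bullet> h \<le> A x \<bullet> h)"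
proof -
  have ha: "h \<in> a" using h by (simp add: regular_def)
  have "H \<noteq> {}" using H_id by blast
  moreover have "continuous_on H (\<lambda>A. blinfun_apply A x \<bullet> h)" by (intro continuous_intros)
  ultimately have "\<exists>A\<in>H. \<forall>C\<in>H. blinfun_apply C x \<bullet> h \<le> blinfun_apply A x \<bullet> h"
    by (intro continuous_attains_sup H_compact)
  then obtain A1 where A1: "A1 \<in> H" "\<And>C. C \<in> H \<Longrightarrow> C x \<bullet> h \<le> A1 x \<bullet> h" by blast
  have "br (A1 x) h = 0"
    by (rule maximizer_commutes[where X = "{}", OF _ x a_in_pp[OF maxab ha] A1(1)]) (use A1 in auto)
  then have A1a: "A1 x \<in> a" using h aut_zero_pp[OF A1(1)] x br_zero_sym by (auto simp: regular_def)
  obtain D where D: "D \<in> H" "\<And>z. D (A0 z) = z" using H_inv[OF A0(1)] by blast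
  define M where "M = A1 o\<^sub>L D"
  have M: "M \<in> H" unfolding M_def by (intro H_comp A1 D)
  obtain C where C: "C \<in> H" "\<And>z. z \<in> {A0 x} \<Longrightarrow> C (M z) = M z" "(\<lambda>z. C (M z)) ` a = a"
    by (rule conjugate_into_a_normalizer[OF maxab H_aut[OF M], of "{A0 x}"])
      (use A0 A1a D in \<open>auto simp: M_def\<close>)
  define A where "A = C o\<^sub>L A1"
  have Ax: "A x = A1 x" using C(2)[of "A0 x"] by (simp add: A_def M_def D)
  have AH: "A \<in> H" unfolding A_def by (intro H_comp C A1)
  have "(\<lambda>z. blinfun_apply (C o\<^sub>L M) (P z)) \<in> weyl_maps a P"
    unfolding weyl_maps_def[OF maxab] using H_comp[OF C(1) M] C(3)
    by (intro CollectI exI[of _ "C o\<^sub>L M"]) simp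
  moreover have "A x = (C o\<^sub>L M) (P (A0 x))" "A q = (C o\<^sub>L M) (P (A0 q))"
    using P(3) A0 by (simp_all add: A_def M_def D)
  ultimately show ?thesis using AH A1(2) A1a unfolding Ax by (metis Ax)
qed

text \<open>Along a subsequence the Weyl element is constant, \<open>w0\<close>, and the maximizers
  converge to a maximizer \<open>A'\<close> at \<open>t0\<close>. With \<open>M\<close> the product
  of \<open>A' (\<rho>' t0)\<close> and \<open>h\<close>, an envelope argument gives
  \<open>w0 (lam' t0) \<bullet> h = M\<close>, while the derivatives along the sequence give
  \<open>w0 y \<bullet> h = M\<close>.\<close>

lemma derivative_limit:
  assumes h: "regular a h" and P: "linear P" "\<And>x. P x \<in> a" "\<And>x. x \<in> a \<Longrightarrow> P x = x"
    and \<rho>: "\<And>t. t \<in> I \<Longrightarrow> \<rho> t \<in> pp" "(\<rho> has_vector_derivative \<rho>' t0) (at t0)"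
    and q: "\<And>t z. t \<in> I \<Longrightarrow> z \<in> p_centralizer br s (\<rho> t) \<Longrightarrow> (\<rho>' t - q t) \<bullet> z = 0"
    and lam: "\<And>t. t \<in> I \<Longrightarrow> \<exists>A\<in>H. lam t = A (\<rho> t) \<and> A (\<rho> t) \<in> a \<and> lam' t = A (q t) \<and> A (q t) \<in> a"
      "(lam has_vector_derivative lam' t0) (at t0)"
    and t: "\<And>n. t n \<in> I" "t \<longlonglongrightarrow> t0" "\<And>n. t n \<noteq> t0"
    and lim: "(\<lambda>n. \<rho>' (t n)) \<longlonglongrightarrow> \<rho>' t0" "(\<lambda>n. lam' (t n)) \<longlonglongrightarrow> y"
  shows "\<exists>w\<in>weyl_maps a P. w y \<bullet> h = w (lam' t0) \<bullet> h"
proof -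
  have W: "isometry_group_on (weyl_maps a P) a" by (rule weyl_maps_group[OF maxab P])
  have ha: "h \<in> a" using h by (simp add: regular_def)
  have "\<exists>w A. w \<in> weyl_maps a P \<and> A \<in> H \<and> blinfun_apply A (\<rho> (t n)) = w (lam (t n)) \<and> A (q (t n)) = w (lam' (t n)) \<and>
      A (\<rho> (t n)) \<in> a \<and> (\<forall>C\<in>H. C (\<rho> (t n)) \<bullet> h \<le> A (\<rho> (t n)) \<bullet> h)" for n
  proof -
    obtain A0 where A0: "A0 \<in> H" "lam (t n) = A0 (\<rho> (t n))" "A0 (\<rho> (t n)) \<in> a" "lam' (t n) = A0 (q (t n))" "A0 (q (t n)) \<in> a"
      using lam(1)[OF t(1)[of n]] by blast
    show ?thesis using maximizer_in_weyl_orbit[OF h \<rho>(1)[OF t(1)] P A0(1,3,5)] unfolding A0(2,4) by blast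
  qed
  then obtain w A where wA: "\<And>n. w n \<in> weyl_maps a P" "\<And>n. A n \<in> H"
    "\<And>n. blinfun_apply (A n) (\<rho> (t n)) = w n (lam (t n))" "\<And>n. A n (q (t n)) = w n (lam' (t n))"
    "\<And>n. A n (\<rho> (t n)) \<in> a" "\<And>n C. C \<in> H \<Longrightarrow> C (\<rho> (t n)) \<bullet> h \<le> A n (\<rho> (t n)) \<bullet> h"
    by metis
  have finW: "finite (weyl_maps a P)" using W by (simp add: isometry_group_on_def)
  obtain w0 and r1 :: "nat \<Rightarrow> nat" where r1: "strict_mono r1" "\<And>n. w (r1 n) = w0" "w0 \<in> weyl_maps a P"
    using finite_range_constant_subseq[of "weyl_maps a P" w, OF finW wA(1)] by metis
  have "\<forall>n. (A \<circ> r1) n \<in> H" using wA by simp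
  then obtain A' r2 where r2: "A' \<in> H" "strict_mono (r2 :: nat \<Rightarrow> nat)" "((A \<circ> r1) \<circ> r2) \<longlonglongrightarrow> A'"
    using H_compact unfolding compact_def by meson
  define r where "r n = r1 (r2 n)" for n
  have r: "strict_mono r" unfolding r_def using r1 r2 by (simp add: strict_mono_def)
  have sub: "(\<lambda>n. f (r n)) \<longlonglongrightarrow> l" if "f \<longlonglongrightarrow> l" for f :: "nat \<Rightarrow> 'b::topological_space" and l
    using LIMSEQ_subseq_LIMSEQ[OF that r] by (simp add: o_def)
  define u B where "u n = t (r n)" and "B n = A (r n)" for n
  have u: "u n \<in> I" "u n \<noteq> t0" for n using t by (auto simp: u_def)
  have ulim: "u \<longlonglongrightarrow> t0" unfolding u_def by (rule sub[OF t(2)])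
  have Blim: "B \<longlonglongrightarrow> A'" using r2(3) by (simp add: B_def[abs_def] r_def o_def)
  have B: "B n \<in> H" "B n (\<rho> (u n)) = w0 (lam (u n))" "B n (q (u n)) = w0 (lam' (u n))" "B n (\<rho> (u n)) \<in> a"
    "C \<in> H \<Longrightarrow> C (\<rho> (u n)) \<bullet> h \<le> B n (\<rho> (u n)) \<bullet> h" for n C
    using wA(2-5)[of "r n"] wA(6)[of C "r n"] r1(2)[of "r2 n"] by (auto simp: B_def u_def r_def)
  note app = bounded_bilinear.tendsto[OF bounded_bilinear_blinfun_apply]
  have blw: "bounded_linear w0" using W r1(3) by (auto simp: isometry_group_on_def linear_conv_bounded_linear)
  note wlim = bounded_linear.tendsto[OF blw]
  define x where "x = \<rho> t0"
  have xlim: "(\<lambda>n. \<rho> (u n)) \<longlonglongrightarrow> x" unfolding x_def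
    by (rule isCont_tendsto_compose[OF has_vector_derivative_continuous[OF \<rho>(2)] ulim])
  have llim: "(\<lambda>n. lam (u n)) \<longlonglongrightarrow> lam t0"
    by (rule isCont_tendsto_compose[OF has_vector_derivative_continuous[OF lam(2)] ulim])
  have "(\<lambda>n. B n (\<rho> (u n))) \<longlonglongrightarrow> A' x" by (rule app[OF Blim xlim])
  moreover have "(\<lambda>n. B n (\<rho> (u n))) \<longlonglongrightarrow> w0 (lam t0)" unfolding B(2) by (rule wlim[OF llim])
  ultimately have A'x: "A' x = w0 (lam t0)" by (rule LIMSEQ_unique)
  have max: "C x \<bullet> h \<le> A' x \<bullet> h" if "C \<in> H" for C
  proof (rule LIMSEQ_le)
    show "(\<lambda>n. C (\<rho> (u n)) \<bullet> h) \<longlonglongrightarrow> C x \<bullet> h"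
      by (intro tendsto_inner tendsto_const app xlim)
    show "(\<lambda>n. B n (\<rho> (u n)) \<bullet> h) \<longlonglongrightarrow> A' x \<bullet> h"
      by (intro tendsto_inner tendsto_const app xlim Blim)
  qed (use B(5)[OF that] in auto)
  define Q where "Q n = (1 / (u n - t0)) *\<^sub>R (\<rho> (u n) - x)" for n
  have Qlim: "Q \<longlonglongrightarrow> \<rho>' t0" unfolding Q_def x_def
    by (rule has_vector_derivative_quotient_seq[OF \<rho>(2) ulim u(2)])
  have lq: "(\<lambda>n. (1 / (u n - t0)) *\<^sub>R (lam (u n) - lam t0)) \<longlonglongrightarrow> lam' t0"
    by (rule has_vector_derivative_quotient_seq[OF lam(2) ulim u(2)])
  define c where "c n = w0 ((1 / (u n - t0)) *\<^sub>R (lam (u n) - lam t0)) \<bullet> h" for n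
  have c1: "c \<longlonglongrightarrow> w0 (lam' t0) \<bullet> h" unfolding c_def
    by (intro tendsto_inner tendsto_const wlim lq)
  define M where "M = A' (\<rho>' t0) \<bullet> h"
  have L: "(\<lambda>n. A' (Q n) \<bullet> h) \<longlonglongrightarrow> M" "(\<lambda>n. B n (Q n) \<bullet> h) \<longlonglongrightarrow> M" unfolding M_def
    by (intro tendsto_inner tendsto_const app Qlim Blim)+
  \<comment> \<open>Optimality of \<open>B n\<close> at \<open>u n\<close> and of \<open>A'\<close>
    at \<open>t0\<close> bounds the difference quotient of the maximum on both sides. Which bound is
    the upper one depends on the sign of \<open>u n - t0\<close>.\<close>
  have "min (A' (Q n) \<bullet> h) (B n (Q n) \<bullet> h) \<le> c n \<and> c n \<le> max (A' (Q n) \<bullet> h) (B n (Q n) \<bullet> h)" for n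
  proof -
    define \<delta> where "\<delta> = u n - t0"
    have \<delta>: "\<delta> \<noteq> 0" using u by (simp add: \<delta>_def)
    have cn: "c n = (B n (\<rho> (u n)) \<bullet> h - A' x \<bullet> h) / \<delta>"
      using linear_scale[OF bounded_linear.linear[OF blw]] linear_diff[OF bounded_linear.linear[OF blw]]
      by (simp add: c_def B(2) A'x \<delta>_def inner_diff_left)
    have l: "A' (Q n) \<bullet> h = (A' (\<rho> (u n)) \<bullet> h - A' x \<bullet> h) / \<delta>"
      and ub: "B n (Q n) \<bullet> h = (B n (\<rho> (u n)) \<bullet> h - B n x \<bullet> h) / \<delta>"
      by (simp_all add: Q_def blinfun.bilinear_simps inner_diff_left \<delta>_def)
    have "A' (\<rho> (u n)) \<bullet> h - A' x \<bullet> h \<le> B n (\<rho> (u n)) \<bullet> h - A' x \<bullet> h"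
      "B n (\<rho> (u n)) \<bullet> h - A' x \<bullet> h \<le> B n (\<rho> (u n)) \<bullet> h - B n x \<bullet> h"
      using B(5)[OF r2(1)] max[OF B(1)] by auto
    then show ?thesis unfolding cn l ub using \<delta>
      by (cases "\<delta> > 0") (auto simp: min_le_iff_disj le_max_iff_disj divide_right_mono divide_right_mono_neg)
  qed
  then have "c \<longlonglongrightarrow> M"
    using tendsto_sandwich[OF _ _ tendsto_min[OF L, unfolded min.idem] tendsto_max[OF L, unfolded max.idem]]
    by simp
  then have 1: "w0 (lam' t0) \<bullet> h = M" using c1 LIMSEQ_unique by blast
  have "(\<lambda>n. \<rho>' (u n)) \<longlonglongrightarrow> \<rho>' t0" unfolding u_def by (rule sub[OF lim(1)])
  then have "(\<lambda>n. B n (\<rho>' (u n)) \<bullet> h) \<longlonglongrightarrow> M" unfolding M_def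
    by (intro tendsto_inner tendsto_const app Blim)
  \<comment> \<open>The image of \<open>\<rho> (u n)\<close> and \<open>h\<close> both lie in
    \<open>a\<close>. Hence \<open>h\<close> pulled back by \<open>B n\<close> is in the centralizer
    of \<open>\<rho> (u n)\<close> and does not see the tangential part of the derivative.\<close>
  moreover have "B n (\<rho>' (u n)) \<bullet> h = w0 (lam' (u n)) \<bullet> h" for n
  proof -
    obtain D where D: "D \<in> H" "\<And>z. D (B n z) = z" "\<And>z. B n (D z) = z" using H_inv[OF B(1)] by blast
    note aut = H_aut[OF B(1)[of n]]
    have "br (B n (\<rho> (u n))) (B n (D h)) = 0" using a_comm[OF maxab B(4) ha] by (simp add: D)
    then have "D h \<in> p_centralizer br s (\<rho> (u n))"
      using aut_zero[OF aut] aut_zero_pp[OF D(1)] a_in_pp[OF maxab ha] by (simp add: p_centralizer_def)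
    then have "(\<rho>' (u n) - q (u n)) \<bullet> D h = 0" by (rule q[OF u(1)])
    then have "B n (\<rho>' (u n) - q (u n)) \<bullet> B n (D h) = 0" using symmetric_automorphismD(4)[OF aut] by simp
    then show ?thesis using B(3)[of n] by (simp add: D blinfun.bilinear_simps inner_diff_left)
  qed
  moreover have "(\<lambda>n. w0 (lam' (u n)) \<bullet> h) \<longlonglongrightarrow> w0 y \<bullet> h"
    unfolding u_def by (intro tendsto_inner tendsto_const wlim sub[OF lim(2)])
  ultimately have "w0 y \<bullet> h = M" using LIMSEQ_unique by simp
  then show ?thesis using 1 r1(3) by (intro bexI[of _ w0]) simp_all
qed

theorem lift_derivative_continuous:
  assumes \<rho>: "\<And>t. t \<in> I \<Longrightarrow> \<rho> t \<in> pp" "\<And>t. t \<in> I \<Longrightarrow> (\<rho> has_vector_derivative \<rho>' t) (at t)"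
      "continuous_on I \<rho>'"
    and q: "\<And>t. t \<in> I \<Longrightarrow> q t \<in> p_centralizer br s (\<rho> t)"
      "\<And>t z. t \<in> I \<Longrightarrow> z \<in> p_centralizer br s (\<rho> t) \<Longrightarrow> (\<rho>' t - q t) \<bullet> z = 0"
    and lam: "\<And>t. t \<in> I \<Longrightarrow> \<exists>A\<in>H. lam t = A (\<rho> t) \<and> A (\<rho> t) \<in> a \<and> lam' t = A (q t) \<and> A (q t) \<in> a"
      "\<And>t. t \<in> I \<Longrightarrow> (lam has_vector_derivative lam' t) (at t)"
  shows "continuous_on I lam'"
proof (rule ccontr)
  assume "\<not> continuous_on I lam'"
  then obtain t0 e where t0: "t0 \<in> I" and e: "e > 0"
    and "\<forall>d>0. \<exists>t\<in>I. dist t t0 < d \<and> \<not> dist (lam' t) (lam' t0) < e"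
    unfolding continuous_on_iff by blast
  then have "\<forall>n. \<exists>t. t \<in> I \<and> dist t t0 < inverse (real (Suc n)) \<and> \<not> dist (lam' t) (lam' t0) < e"
    by (metis inverse_positive_iff_positive of_nat_0_less_iff zero_less_Suc)
  from choice[OF this] obtain t where t: "\<And>n. t n \<in> I" "\<And>n. dist (t n) t0 < inverse (real (Suc n))"
    "\<And>n. \<not> dist (lam' (t n)) (lam' t0) < e" by blast
  have tlim: "t \<longlonglongrightarrow> t0"
    by (rule metric_tendsto_imp_tendsto[OF LIMSEQ_inverse_real_of_nat])
      (use t(2) in \<open>auto intro!: always_eventually simp: dist_norm less_imp_le\<close>)
  have tn: "t n \<noteq> t0" for n using t(3)[of n] e by auto
  \<comment> \<open>Neither the projection nor \<open>H\<close> increases norms; so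
    \<open>lam' (t n)\<close> is bounded and has a convergent subsequence.\<close>
  have nrm: "norm (lam' u) \<le> norm (\<rho>' u)" if u: "u \<in> I" for u
  proof -
    obtain A where A: "A \<in> H" "lam' u = A (q u)" using lam(1)[OF u] by blast
    have "(\<rho>' u - q u) \<bullet> q u = 0" by (rule q(2)[OF u q(1)[OF u]])
    then have "norm (q u) * norm (q u) \<le> norm (\<rho>' u) * norm (q u)"
      using norm_cauchy_schwarz[of "\<rho>' u" "q u"] by (simp add: inner_diff_left dot_square_norm power2_eq_square)
    then have "norm (q u) \<le> norm (\<rho>' u)" by (cases "q u = 0") auto
    then show ?thesis using A H_norm by simp
  qed
  have rlim: "(\<lambda>n. \<rho>' (t n)) \<longlonglongrightarrow> \<rho>' t0"
    using continuous_on_tendsto_compose[OF \<rho>(3) tlim t0] t(1) by simp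
  then have "Bseq (\<lambda>n. \<rho>' (t n))" by (rule convergent_imp_Bseq[OF convergentI])
  then obtain K where "\<And>n. norm (\<rho>' (t n)) \<le> K" unfolding Bseq_def by blast
  then have "norm (lam' (t n)) \<le> K" for n using nrm[OF t(1)] order_trans by blast
  then have "bounded (range (\<lambda>n. lam' (t n)))" unfolding bounded_iff by blast
  from bounded_imp_convergent_subsequence[OF this]
  obtain y and r :: "nat \<Rightarrow> nat" where r: "strict_mono r" "(\<lambda>n. lam' (t (r n))) \<longlonglongrightarrow> y"
    by (auto simp: o_def)
  obtain P where P: "linear P" "\<And>x. P x \<in> a" "\<And>x. x \<in> a \<Longrightarrow> P x = x"
    by (rule subspace_retraction[OF sub_a[OF maxab]]) blast
  let ?W = "weyl_maps a P"
  have W: "isometry_group_on ?W a" by (rule weyl_maps_group[OF maxab P])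
  have la: "lam' u \<in> a" if "u \<in> I" for u using lam(1)[OF that] by auto
  have "y \<in> a"
    by (rule closed_sequentially[OF closed_subspace[OF sub_a[OF maxab]] _ r(2)]) (use la t in auto)
  define d where "d = y - lam' t0"
  have da: "d \<in> a" unfolding d_def by (intro subspace_diff sub_a[OF maxab] \<open>y \<in> a\<close> la t0)
  have "d = 0"
  proof (rule ccontr)
    assume d: "d \<noteq> 0"
    let ?U = "(\<lambda>w. w d) ` ?W"
    have "w d \<in> a - {0}" if "w \<in> ?W" for w
      using isometry_group_on_closed[OF W that da] isometry_group_on_norm[OF W that da] d by auto
    then have U: "?U \<subseteq> a - {0}" by auto
    have finU: "finite ?U" using W by (simp add: isometry_group_on_def)
    obtain h0 where h0: "regular a h0" using regular_exists[OF maxab] by blast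
    then have h0a: "h0 \<in> a" by (simp add: regular_def)
    obtain \<epsilon> where \<epsilon>: "\<epsilon> > 0" "\<And>h. h \<in> a \<Longrightarrow> norm (h - h0) < \<epsilon> \<Longrightarrow> regular a h"
      using regular_open[OF maxab h0] by blast
    \<comment> \<open>Regularity is an open condition, so a regular \<open>h0\<close> can be moved
      off the hyperplanes orthogonal to the vectors \<open>w d\<close> and stay regular.\<close>
    obtain h where h: "h \<in> a" "norm (h - h0) < \<epsilon>" "\<And>u. u \<in> ?U \<Longrightarrow> h \<bullet> u \<noteq> 0"
      using avoid_hyperplanes[OF finU sub_a[OF maxab] U h0a \<epsilon>(1)] by blast
    have s1: "(\<lambda>n. t (r n)) \<longlonglongrightarrow> t0" "(\<lambda>n. \<rho>' (t (r n))) \<longlonglongrightarrow> \<rho>' t0"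
      using LIMSEQ_subseq_LIMSEQ[OF tlim r(1)] LIMSEQ_subseq_LIMSEQ[OF rlim r(1)] by (simp_all add: o_def)
    obtain w where w: "w \<in> ?W" "w y \<bullet> h = w (lam' t0) \<bullet> h"
      using derivative_limit[OF \<epsilon>(2)[OF h(1,2)] P \<rho>(1) \<rho>(2)[OF t0] q(2) lam(1) lam(2)[OF t0] t(1) s1(1) tn s1(2) r(2)]
      by blast
    have "linear w" using W w(1) by (simp add: isometry_group_on_def)
    then have "h \<bullet> w d = 0" using w(2) by (simp add: d_def linear_diff inner_diff_right inner_commute)
    then show False using h(3) w(1) by blast
  qed
  then have "(\<lambda>n. lam' (t (r n))) \<longlonglongrightarrow> lam' t0" using r(2) by (simp add: d_def)
  then have "\<forall>\<^sub>F n in sequentially. dist (lam' (t (r n))) (lam' t0) < e" using e by (rule tendstoD)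
  then show False using t(3) by (simp add: eventually_sequentially)
qed
end
end

section \<open>Linear flows as limits of Euler polygons\<close>

lemma funpow_bounded_linear:
  fixes A :: "'a::euclidean_space \<Rightarrow> 'a" assumes "linear A"
  shows "linear (A ^^ n)"
  by (induction n) (simp_all only: funpow.simps linear_id linear_compose[OF _ assms])

definition exp_path :: "('a::euclidean_space \<Rightarrow> 'a) \<Rightarrow> 'a \<Rightarrow> real \<Rightarrow> 'a" where
  "exp_path A y t = (\<Sum>n. (t ^ n / fact n) *\<^sub>R (A ^^ n) y)"

context
  fixes A :: "'a::euclidean_space \<Rightarrow> 'a" assumes A: "linear A"
begin

lemma norm_funpow: obtains K where "K > 0" "\<And>n y. norm ((A ^^ n) y) \<le> K ^ n * norm y"
proof -
  have "bounded_linear A" using A by (simp add: linear_conv_bounded_linear)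
  then obtain K where K: "K > 0" "\<And>y. norm (A y) \<le> norm y * K" using bounded_linear.pos_bounded by blast
  have "norm ((A ^^ n) y) \<le> K ^ n * norm y" for n y
  proof (induction n)
    case (Suc n)
    have "norm ((A ^^ Suc n) y) \<le> norm ((A ^^ n) y) * K" using K(2) by simp
    also have "\<dots> \<le> K ^ n * norm y * K" using Suc K(1) by (simp add: mult_right_mono)
    finally show ?case by (simp add: algebra_simps)
  qed simp
  then show thesis using that K by blast
qed

lemma exp_path_norm_summable: "summable (\<lambda>n. norm ((t ^ n / fact n) *\<^sub>R (A ^^ n) y))"
proof -
  obtain K where K: "K > 0" "\<And>n y. norm ((A ^^ n) y) \<le> K ^ n * norm y" by (rule norm_funpow) blast
  have "summable (\<lambda>n. ((K * \<bar>t\<bar>) ^ n /\<^sub>R fact n) * norm y)"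
    by (intro summable_mult2 summable_exp_generic)
  then show ?thesis
  proof (rule summable_comparison_test'[of _ 0])
    fix n
    have "norm (norm ((t ^ n / fact n) *\<^sub>R (A ^^ n) y)) = (\<bar>t\<bar> ^ n / fact n) * norm ((A ^^ n) y)"
      by (simp add: power_abs)
    also have "\<dots> \<le> (\<bar>t\<bar> ^ n / fact n) * (K ^ n * norm y)" by (intro mult_left_mono K) auto
    also have "\<dots> = ((K * \<bar>t\<bar>) ^ n /\<^sub>R fact n) * norm y"
      by (simp add: power_mult_distrib divide_inverse)
    finally show "norm (norm ((t ^ n / fact n) *\<^sub>R (A ^^ n) y)) \<le> ((K * \<bar>t\<bar>) ^ n /\<^sub>R fact n) * norm y" .
  qed
qed

lemmas exp_path_summable = summable_norm_cancel[OF exp_path_norm_summable]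

lemma exp_path_0: "exp_path A y 0 = y"
proof -
  have "(\<lambda>n. (0 ^ n / fact n) *\<^sub>R (A ^^ n) y) = (\<lambda>n. if n = 0 then y else 0)" by (auto simp: fun_eq_iff)
  then show ?thesis unfolding exp_path_def using suminf_finite[of "{0::nat}" "\<lambda>n. if n = 0 then y else 0"] by simp
qed

lemma exp_path_commute: "A (exp_path A y t) = exp_path A (A y) t"
proof -
  have bl: "bounded_linear A" using A by (simp add: linear_conv_bounded_linear)
  have "A (exp_path A y t) = (\<Sum>n. A ((t ^ n / fact n) *\<^sub>R (A ^^ n) y))"
    unfolding exp_path_def by (rule bounded_linear.suminf[OF bl exp_path_summable])
  also have "\<dots> = exp_path A (A y) t"
    unfolding exp_path_def using A by (simp add: linear_scale funpow_swap1)
  finally show ?thesis .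
qed

lemma exp_path_fixed: assumes "A y = 0" shows "exp_path A y t = y"
proof -
  have "(A ^^ n) y = 0" if "n > 0" for n
    using that assms linear_0[OF funpow_bounded_linear[OF A]]
    by (cases n) (simp_all add: funpow_swap1)
  then have "(\<lambda>n. (t ^ n / fact n) *\<^sub>R (A ^^ n) y) = (\<lambda>n. if n = 0 then y else 0)" by (auto simp: fun_eq_iff)
  then show ?thesis unfolding exp_path_def using suminf_finite[of "{0::nat}" "\<lambda>n. if n = 0 then y else 0"] by simp
qed

text \<open>Each component is a real power series and may be differentiated termwise; the shifted
  coefficients are those of \<open>exp_path A (A y)\<close>.\<close>

lemma exp_path_derivative: "(exp_path A y has_vector_derivative A (exp_path A y t)) (at t)"
proof -
  have comp: "exp_path A y t \<bullet> b = (\<Sum>n. ((A ^^ n) y \<bullet> b / fact n) * t ^ n)"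
    and sm: "summable (\<lambda>n. ((A ^^ n) y \<bullet> b / fact n) * t ^ n)" for y t b
  proof -
    have *: "(\<lambda>n. ((A ^^ n) y \<bullet> b / fact n) * t ^ n) = (\<lambda>n. ((t ^ n / fact n) *\<^sub>R (A ^^ n) y) \<bullet> b)"
      by (simp add: fun_eq_iff)
    show "exp_path A y t \<bullet> b = (\<Sum>n. ((A ^^ n) y \<bullet> b / fact n) * t ^ n)"
      unfolding exp_path_def * by (rule bounded_linear.suminf[OF bounded_linear_inner_left exp_path_summable])
    show "summable (\<lambda>n. ((A ^^ n) y \<bullet> b / fact n) * t ^ n)"
      unfolding * by (rule bounded_linear.summable[OF bounded_linear_inner_left exp_path_summable])
  qed
  have "((\<lambda>t. exp_path A y t \<bullet> b) has_vector_derivative A (exp_path A y t) \<bullet> b) (at t)" for b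
  proof -
    have "((\<lambda>t. \<Sum>n. ((A ^^ n) y \<bullet> b / fact n) * t ^ n) has_field_derivative
      (\<Sum>n. diffs (\<lambda>n. (A ^^ n) y \<bullet> b / fact n) n * t ^ n)) (at t)"
      by (rule termdiffs_strong_converges_everywhere) (rule sm)
    moreover have "diffs (\<lambda>n. (A ^^ n) y \<bullet> b / fact n) = (\<lambda>n. (A ^^ n) (A y) \<bullet> b / fact n)"
      by (simp add: diffs_def fun_eq_iff funpow_swap1 del: of_nat_Suc)
    ultimately show ?thesis
      unfolding exp_path_commute comp by (simp add: has_real_derivative_iff_has_vector_derivative)
  qed
  then show ?thesis
    unfolding has_vector_derivative_def by (subst has_derivative_componentwise_within) (simp add: inner_simps)
qed

lemma exp_end_apply: "blinfun_apply (exp_end (\<lambda>x. t *\<^sub>R A x)) y = exp_path A y t"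
proof -
  let ?A = "\<lambda>x. t *\<^sub>R A x"
  have pow: "(?A ^^ n) x = t ^ n *\<^sub>R (A ^^ n) x" for n x
  proof (induction n)
    case (Suc n) then show ?case using A by (simp add: linear_scale)
  qed simp
  have bl: "bounded_linear (?A ^^ n)" for n
    using linear_compose_scale_right[OF A, of t]
    by (intro linear_conv_bounded_linear[THEN iffD1] funpow_bounded_linear)
  obtain K where K: "K > 0" "\<And>n y. norm ((A ^^ n) y) \<le> K ^ n * norm y" by (rule norm_funpow) blast
  have nb: "norm (Blinfun (?A ^^ n)) \<le> (K * \<bar>t\<bar>) ^ n" for n
  proof (rule norm_blinfun_bound)
    fix x
    show "norm (blinfun_apply (Blinfun (?A ^^ n)) x) \<le> (K * \<bar>t\<bar>) ^ n * norm x"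
      using mult_left_mono[OF K(2)[of n x], of "\<bar>t\<bar> ^ n"]
      by (simp add: bounded_linear_Blinfun_apply[OF bl] pow power_abs power_mult_distrib algebra_simps)
  qed (use K in auto)
  have "summable (\<lambda>n. (K * \<bar>t\<bar>) ^ n /\<^sub>R fact n)" by (rule summable_exp_generic)
  then have sm: "summable (\<lambda>n. (1 / fact n) *\<^sub>R Blinfun (?A ^^ n))"
  proof (rule summable_comparison_test'[of _ 0])
    fix n show "norm ((1 / fact n) *\<^sub>R Blinfun (?A ^^ n)) \<le> (K * \<bar>t\<bar>) ^ n /\<^sub>R fact n"
      using nb[of n] by (simp add: divide_inverse mult_left_mono)
  qed
  have "blinfun_apply (exp_end ?A) y = (\<Sum>n. blinfun_apply ((1 / fact n) *\<^sub>R Blinfun (?A ^^ n)) y)"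
    unfolding exp_end_def by (rule bounded_linear.suminf[OF blinfun.bounded_linear_left sm])
  also have "\<dots> = exp_path A y t"
    unfolding exp_path_def
    by (simp add: blinfun.bilinear_simps bounded_linear_Blinfun_apply[OF bl] pow)
  finally show ?thesis .
qed

text \<open>\<open>E\<close> is one step, of length \<open>h\<close>, of a perturbed Euler method for \<open>e' = A e\<close>.\<close>

lemma euler_error:
  assumes C: "\<And>x. norm (A x) \<le> C * norm x" "C > 0"
    and T: "\<And>t. t \<in> {0..1} \<Longrightarrow> norm (exp_path A y t) \<le> K"
    and E: "linear E" "\<And>x. norm (E x - x - h *\<^sub>R A x) \<le> \<eta> * h * norm x" and h: "h > 0" "\<eta> \<ge> 0"
  shows "real k * h \<le> 1 \<Longrightarrow>
    norm ((E ^^ k) y - exp_path A y (real k * h)) \<le> real k * h * (\<eta> * K + C * C * K * h) * exp ((\<eta> + C) * (real k * h))"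
proof (induction k)
  case 0 then show ?case by (simp add: exp_path_0)
next
  case (Suc k)
  let ?e = "exp_path A y"
  define t where "t = real k * h"
  have t: "0 \<le> t" "t + h \<le> 1" using Suc.prems h by (auto simp: t_def algebra_simps)
  have K: "K \<ge> 0" using order_trans[OF norm_ge_zero T[of 0]] by simp
  \<comment> \<open>Stability: one step enlarges norms at most by this factor.\<close>
  have En: "norm (E x) \<le> exp ((\<eta> + C) * h) * norm x" for x
  proof -
    have "norm (E x) \<le> norm (E x - x - h *\<^sub>R A x) + norm (x + h *\<^sub>R A x)"
      using norm_triangle_ineq[of "E x - x - h *\<^sub>R A x" "x + h *\<^sub>R A x"] by simp
    also have "norm (x + h *\<^sub>R A x) \<le> norm x + h * (C * norm x)"
    proof -
      have "h * norm (A x) \<le> h * (C * norm x)" using C(1)[of x] h by (intro mult_left_mono) auto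
      moreover have "norm (h *\<^sub>R A x) = h * norm (A x)" using h by simp
      ultimately show ?thesis using norm_triangle_ineq[of x "h *\<^sub>R A x"] by linarith
    qed
    also have "norm (E x - x - h *\<^sub>R A x) + (norm x + h * (C * norm x)) \<le> (1 + (\<eta> + C) * h) * norm x"
      using E(2)[of x] by (simp add: algebra_simps)
    also have "\<dots> \<le> exp ((\<eta> + C) * h) * norm x"
      by (intro mult_right_mono exp_ge_add_one_self) auto
    finally show ?thesis by simp
  qed
  \<comment> \<open>Consistency: the curve leaves its tangent only quadratically in
    \<open>h\<close>, because its velocity is Lipschitz.\<close>
  have step: "norm (?e (t + h) - ?e t - h *\<^sub>R A (?e t)) \<le> h * (C * C * K * h)"
  proof -
    have lip: "norm (?e v - ?e t) \<le> C * K * h" if v: "v \<in> {t..t+h}" for v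
    proof -
      have "norm (?e v - ?e t) \<le> (C * K) * norm (v - t)"
      proof (rule differentiable_bound[of "{t..t+h}" ?e "\<lambda>u r. r *\<^sub>R A (?e u)"])
        fix u assume u: "u \<in> {t..t+h}"
        show "(?e has_derivative (\<lambda>r. r *\<^sub>R A (?e u))) (at u within {t..t+h})"
          using exp_path_derivative[of y u] by (simp add: has_vector_derivative_def has_derivative_at_withinI)
        have "norm (A (?e u)) \<le> C * K"
          by (rule order_trans[OF C(1)], rule mult_left_mono[OF T]) (use u t C(2) in auto)
        then show "onorm (\<lambda>r. r *\<^sub>R A (?e u)) \<le> C * K"
          by (intro onorm_le) (simp add: mult.commute mult_left_mono)
      qed (use v t h in auto)
      also have "\<dots> \<le> (C * K) * h" using v C K by (intro mult_left_mono) auto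
      finally show ?thesis .
    qed
    have "norm ((?e (t + h) - (t + h) *\<^sub>R A (?e t)) - (?e t - t *\<^sub>R A (?e t))) \<le> (C * C * K * h) * norm ((t + h) - t)"
    proof (rule differentiable_bound[of "{t..t+h}" "\<lambda>u. ?e u - u *\<^sub>R A (?e t)" "\<lambda>u r. r *\<^sub>R (A (?e u) - A (?e t))"])
      fix u assume u: "u \<in> {t..t+h}"
      have "((\<lambda>u. ?e u - u *\<^sub>R A (?e t)) has_vector_derivative (A (?e u) - A (?e t))) (at u)"
        by (auto intro!: derivative_eq_intros exp_path_derivative simp: has_vector_derivative_def scaleR_diff_right
          exp_path_derivative[unfolded has_vector_derivative_def])
      then show "((\<lambda>u. ?e u - u *\<^sub>R A (?e t)) has_derivative (\<lambda>r. r *\<^sub>R (A (?e u) - A (?e t)))) (at u within {t..t+h})"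
        by (simp add: has_vector_derivative_def has_derivative_at_withinI)
      have "norm (A (?e u) - A (?e t)) \<le> C * norm (?e u - ?e t)"
        using C(1)[of "?e u - ?e t"] A by (simp add: linear_diff)
      also have "\<dots> \<le> C * (C * K * h)" using lip[OF u] C(2) by (intro mult_left_mono) auto
      finally have "norm (A (?e u) - A (?e t)) \<le> C * C * K * h" by (simp add: mult.assoc)
      then show "onorm (\<lambda>r. r *\<^sub>R (A (?e u) - A (?e t))) \<le> C * C * K * h"
        by (intro onorm_le) (metis norm_scaleR real_norm_def mult.commute mult_left_mono norm_ge_zero)
    qed (use h in auto)
    moreover have "(?e (t + h) - (t + h) *\<^sub>R A (?e t)) - (?e t - t *\<^sub>R A (?e t)) = ?e (t + h) - ?e t - h *\<^sub>R A (?e t)"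
      by (simp add: algebra_simps)
    ultimately show ?thesis using h by (simp add: mult.commute)
  qed
  have loc: "norm (E (?e t) - ?e (t + h)) \<le> h * (\<eta> * K + C * C * K * h)"
  proof -
    have "E (?e t) - ?e (t + h) = (E (?e t) - ?e t - h *\<^sub>R A (?e t)) - (?e (t + h) - ?e t - h *\<^sub>R A (?e t))" by simp
    then have "norm (E (?e t) - ?e (t + h)) \<le> norm (E (?e t) - ?e t - h *\<^sub>R A (?e t)) + norm (?e (t + h) - ?e t - h *\<^sub>R A (?e t))"
      by (metis norm_triangle_ineq4)
    also have "\<dots> \<le> \<eta> * h * K + h * (C * C * K * h)"
    proof (rule add_mono[OF _ step])
      have "norm (?e t) \<le> K" using T[of t] t h by auto
      then show "norm (E (?e t) - ?e t - h *\<^sub>R A (?e t)) \<le> \<eta> * h * K"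
        using E(2)[of "?e t"] h mult_left_mono[of "norm (?e t)" K "\<eta> * h"] by auto
    qed
    finally show ?thesis by (simp add: algebra_simps)
  qed
  define q where "q = exp ((\<eta> + C) * h)"
  define R where "R = \<eta> * K + C * C * K * h"
  have q1: "q \<ge> 1" using C h by (simp add: q_def)
  have R0: "R \<ge> 0" using C h K by (simp add: R_def)
  have IH: "norm ((E ^^ k) y - ?e t) \<le> t * R * exp ((\<eta> + C) * t)"
    using Suc.IH t h by (simp add: t_def R_def)
  have tk: "real (Suc k) * h = t + h" by (simp add: t_def algebra_simps)
  have "(E ^^ Suc k) y - ?e (t + h) = E ((E ^^ k) y - ?e t) + (E (?e t) - ?e (t + h))"
    using E(1) by (simp add: linear_diff)
  then have "norm ((E ^^ Suc k) y - ?e (t + h)) \<le> norm (E ((E ^^ k) y - ?e t)) + norm (E (?e t) - ?e (t + h))"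
    by (metis norm_triangle_ineq)
  also have "\<dots> \<le> q * (t * R * exp ((\<eta> + C) * t)) + h * R"
    using En[of "(E ^^ k) y - ?e t"] IH q1 loc mult_left_mono[OF IH, of q]
    unfolding q_def[symmetric] R_def[symmetric] by linarith
  also have "q * (t * R * exp ((\<eta> + C) * t)) = t * R * exp ((\<eta> + C) * (t + h))"
    by (simp add: q_def ring_distribs exp_add)
  also have "h * R \<le> h * R * exp ((\<eta> + C) * (t + h))"
    using h R0 C t mult_left_mono[of 1 "exp ((\<eta> + C) * (t + h))" "h * R"] by simp
  also have "t * R * exp ((\<eta> + C) * (t + h)) + h * R * exp ((\<eta> + C) * (t + h)) = (t + h) * R * exp ((\<eta> + C) * (t + h))"
    by (simp add: algebra_simps)
  finally show ?case unfolding tk R_def by simp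
qed

text \<open>For every \<open>\<eta> < 1\<close> the accumulated error is eventually at most a
  constant times \<open>\<eta> + h n\<close>, so the perturbation of the method must be small
  relative to the step length, but at no particular rate.\<close>

lemma euler_convergence:
  fixes E :: "nat \<Rightarrow> 'a \<Rightarrow> 'a"
  assumes E: "\<And>n. linear (E n)"
    "\<And>\<eta>. \<eta> > 0 \<Longrightarrow> \<forall>\<^sub>F n in sequentially. \<forall>x. norm (E n x - x - h n *\<^sub>R A x) \<le> \<eta> * h n * norm x"
    and h: "\<And>n. h n > 0" "h \<longlonglongrightarrow> 0" "\<And>n. real (k n) * h n = 1"
  shows "(\<lambda>n. (E n ^^ k n) y) \<longlonglongrightarrow> exp_path A y 1"
proof -
  have "bounded_linear A" using A by (simp add: linear_conv_bounded_linear)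
  then obtain C where C: "C > 0" "\<And>x. norm (A x) \<le> C * norm x"
    using bounded_linear.pos_bounded by (metis mult.commute)
  have "continuous_on {0..1} (exp_path A y)"
    by (intro continuous_at_imp_continuous_on ballI has_vector_derivative_continuous[OF exp_path_derivative])
  then have "bounded (exp_path A y ` {0..1})" by (intro compact_imp_bounded compact_continuous_image) auto
  then obtain K where K: "\<And>t. t \<in> {0..1} \<Longrightarrow> norm (exp_path A y t) \<le> K" unfolding bounded_iff by blast
  have K0: "K \<ge> 0" using order_trans[OF norm_ge_zero K[of 0]] by simp
  have bound: "\<forall>\<^sub>F n in sequentially. norm ((E n ^^ k n) y - exp_path A y 1) \<le> (\<eta> * K + C * C * K * h n) * exp (1 + C)"
    if \<eta>: "0 < \<eta>" "\<eta> < 1" for \<eta>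
    using E(2)[OF \<eta>(1)]
  proof eventually_elim
    case (elim n)
    have "norm ((E n ^^ k n) y - exp_path A y (real (k n) * h n))
      \<le> real (k n) * h n * (\<eta> * K + C * C * K * h n) * exp ((\<eta> + C) * (real (k n) * h n))"
      by (rule euler_error[OF C(2,1) K E(1)]) (use elim h \<eta> in auto)
    then have "norm ((E n ^^ k n) y - exp_path A y 1) \<le> (\<eta> * K + C * C * K * h n) * exp (\<eta> + C)"
      by (simp add: h)
    also have "\<dots> \<le> (\<eta> * K + C * C * K * h n) * exp (1 + C)"
      using \<eta> K0 C h(1)[of n] by (intro mult_left_mono) auto
    finally show ?case .
  qed
  show ?thesis
  proof (rule tendstoI)
    fix e :: real assume e: "e > 0"
    define M where "M = exp (1 + C)"
    have M: "M > 0" by (simp add: M_def)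
    define \<eta> where "\<eta> = min (1/2) (e / (2 * M * (K + 1)))"
    have \<eta>: "0 < \<eta>" "\<eta> < 1" using e M K0 by (auto simp: \<eta>_def)
    have pos: "2 * M * (K + 1) > 0" using M K0 by simp
    have "\<eta> \<le> e / (2 * M * (K + 1))" by (simp add: \<eta>_def)
    then have "\<eta> * (2 * M * (K + 1)) \<le> e" using pos by (simp only: pos_le_divide_eq)
    moreover have "\<eta> * (2 * M * (K + 1)) = 2 * (\<eta> * K * M) + 2 * (\<eta> * M)" by (simp add: algebra_simps)
    moreover have "\<eta> * M > 0" using \<eta> M by simp
    ultimately have *: "\<eta> * K * M \<le> e / 2" by linarith
    have "(\<lambda>n. C * C * K * h n * M) \<longlonglongrightarrow> C * C * K * 0 * M" by (intro tendsto_intros h)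
    then have "\<forall>\<^sub>F n in sequentially. C * C * K * h n * M < e / 2"
      using e by (intro order_tendstoD(2)) auto
    then show "\<forall>\<^sub>F n in sequentially. dist ((E n ^^ k n) y) (exp_path A y 1) < e"
      using bound[OF \<eta>]
    proof eventually_elim
      case (elim n)
      then show ?case unfolding dist_norm M_def[symmetric] using * by (simp add: distrib_right) 
    qed
  qed
qed
end

section \<open>Charts and the adjoint representation\<close>

lemma smooth_manifoldD:
  assumes "smooth_manifold X A" "c \<in> A"
  shows "openin X (fst c)" "open (snd c ` fst c)"
    "homeomorphic_map (subtopology X (fst c)) (top_of_set (snd c ` fst c)) (snd c)"
    "d \<in> A \<Longrightarrow> smooth_on (snd c ` (fst c \<inter> fst d)) (snd d \<circ> chart_inv c)"
  using assms by (auto simp: smooth_manifold_def)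

lemma smooth_manifold_chart_exists:
  "smooth_manifold X A \<Longrightarrow> p \<in> topspace X \<Longrightarrow> \<exists>c. c \<in> A \<and> p \<in> fst c"
  unfolding smooth_manifold_def by blast

lemma chart_subset: "smooth_manifold X A \<Longrightarrow> c \<in> A \<Longrightarrow> fst c \<subseteq> topspace X"
  by (meson openin_subset smooth_manifoldD(1))

lemma chart_inj: assumes "smooth_manifold X A" "c \<in> A" shows "inj_on (snd c) (fst c)"
proof -
  have "topspace (subtopology X (fst c)) = fst c" using chart_subset[OF assms] by auto
  then show ?thesis using homeomorphic_imp_injective_map[OF smooth_manifoldD(3)[OF assms]] by simp
qed

lemma chart_inv_chart: "smooth_manifold X A \<Longrightarrow> c \<in> A \<Longrightarrow> p \<in> fst c \<Longrightarrow> chart_inv c (snd c p) = p"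
  unfolding chart_inv_def by (rule inv_into_f_f[OF chart_inj])

lemma chart_chart_inv: "u \<in> snd c ` fst c \<Longrightarrow> snd c (chart_inv c u) = u"
  unfolding chart_inv_def by (rule f_inv_into_f)

lemma chart_inv_in: "u \<in> snd c ` fst c \<Longrightarrow> chart_inv c u \<in> fst c"
  unfolding chart_inv_def by (rule inv_into_into)

lemma chart_open_image:
  assumes "smooth_manifold X A" "c \<in> A" "openin X O'" shows "open (snd c ` (fst c \<inter> O'))"
proof -
  have "openin (subtopology X (fst c)) (fst c \<inter> O')" using assms(3) by (auto simp: openin_subtopology)
  then have "openin (top_of_set (snd c ` fst c)) (snd c ` (fst c \<inter> O'))"
    using homeomorphic_imp_open_map[OF smooth_manifoldD(3)[OF assms(1,2)]] by (simp add: open_map_def)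
  then show ?thesis using smooth_manifoldD(2)[OF assms(1,2)] by (metis openin_open_eq)
qed

lemma chart_nhd:
  assumes "smooth_manifold X A" "c \<in> A" "openin X O'" "p \<in> fst c" "p \<in> O'"
  obtains N where "open N" "snd c p \<in> N"
    "\<And>u. u \<in> N \<Longrightarrow> u \<in> snd c ` fst c" "\<And>u. u \<in> N \<Longrightarrow> chart_inv c u \<in> O'"
proof (rule that[OF chart_open_image[OF assms(1,2,3)]])
  show "snd c p \<in> snd c ` (fst c \<inter> O')" using assms by blast
  fix u assume "u \<in> snd c ` (fst c \<inter> O')"
  then show "u \<in> snd c ` fst c" "chart_inv c u \<in> O'" using chart_inv_chart[OF assms(1,2)] by auto
qed

abbreviation chart_rep ::
    "('p, 'm::euclidean_space) chart \<Rightarrow> ('q, 'n::euclidean_space) chart \<Rightarrow> ('p \<Rightarrow> 'q) \<Rightarrow> 'm \<Rightarrow> 'n" where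
  "chart_rep c d f \<equiv> snd d \<circ> f \<circ> chart_inv c"

lemma chart_rep_cong:
  assumes "smooth_manifold X A" "c \<in> A" "p \<in> fst c" "openin X O'" "p \<in> O'" "\<And>q. q \<in> O' \<Longrightarrow> f q = g q"
    and "(chart_rep c d f has_derivative F) (at (snd c p))"
  shows "(chart_rep c d g has_derivative F) (at (snd c p))"
proof -
  obtain N where "open N" "snd c p \<in> N" "\<And>u. u \<in> N \<Longrightarrow> chart_inv c u \<in> O'"
    by (rule chart_nhd[OF assms(1,2,4,3,5)]) blast
  then show ?thesis using assms(6)
    by (intro has_derivative_transform_within_open[OF assms(7)]) auto
qed

lemma chart_rep_id:
  assumes "smooth_manifold X A" "c \<in> A" "p \<in> fst c"
  shows "(chart_rep c c (\<lambda>x. x) has_derivative (\<lambda>x. x)) (at (snd c p))"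
  by (rule has_derivative_transform_within_open[OF has_derivative_ident smooth_manifoldD(2)[OF assms(1,2)]])
    (use assms chart_inv_chart[OF assms(1,2)] in auto)

lemma chart_rep_chain:
  assumes X: "smooth_manifold X A" and Y: "smooth_manifold Y B" and f: "continuous_map X Y f"
    and c: "c \<in> A" "p \<in> fst c" and d: "d \<in> B" "f p \<in> fst d"
    and F: "(chart_rep c d f has_derivative F) (at (snd c p))"
    and G: "(chart_rep d e g has_derivative G) (at (snd d (f p)))"
  shows "(chart_rep c e (\<lambda>x. g (f x)) has_derivative (\<lambda>v. G (F v))) (at (snd c p))"
proof -
  have op: "openin X {x \<in> topspace X. f x \<in> fst d}"
    using openin_continuous_map_preimage[OF f smooth_manifoldD(1)[OF Y d(1)]] .
  have pin: "p \<in> {x \<in> topspace X. f x \<in> fst d}" using c d chart_subset[OF X c(1)] by auto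
  obtain N where N: "open N" "snd c p \<in> N" "\<And>u. u \<in> N \<Longrightarrow> chart_inv c u \<in> {x \<in> topspace X. f x \<in> fst d}"
    by (rule chart_nhd[OF X c(1) op c(2) pin]) blast
  have "chart_rep c d f (snd c p) = snd d (f p)" using chart_inv_chart[OF X c] by simp
  then have "(chart_rep d e g \<circ> chart_rep c d f has_derivative G \<circ> F) (at (snd c p))"
    using G by (intro diff_chain_at F) simp
  then have "(chart_rep c e (\<lambda>x. g (f x)) has_derivative G \<circ> F) (at (snd c p))"
    by (rule has_derivative_transform_within_open[OF _ N(1,2)])
      (use N(3) chart_inv_chart[OF Y d(1)] in auto)
  then show ?thesis by (simp add: o_def)
qed

lemma smooth_on_differentiable: "smooth_on S f \<Longrightarrow> x \<in> S \<Longrightarrow> f differentiable at x"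
  unfolding smooth_on_def by (metis C_on.simps(2))

lemma smooth_on_differentiable2:
  "smooth_on S f \<Longrightarrow> x \<in> S \<Longrightarrow> (\<lambda>x. frechet_derivative f (at x) v) differentiable at x"
  unfolding smooth_on_def by (metis C_on.simps(2))

lemma transition_has_derivative:
  assumes "smooth_manifold X A" "c \<in> A" "d \<in> A" "p \<in> fst c" "p \<in> fst d"
  shows "(chart_rep c d (\<lambda>x. x) has_derivative frechet_derivative (snd d \<circ> chart_inv c) (at (snd c p))) (at (snd c p))"
proof -
  have "chart_rep c d (\<lambda>x. x) = snd d \<circ> chart_inv c" by auto
  then show ?thesis
    using smooth_on_differentiable[OF smooth_manifoldD(4)[OF assms(1,2,3)], of "snd c p"] assms
    by (simp flip: frechet_derivative_works)
qed

lemma smooth_map_differentiable: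
  assumes "smooth_map X A Y B f" "c \<in> A" "d \<in> B" "p \<in> fst c" "f p \<in> fst d"
  shows "chart_rep c d f differentiable at (snd c p)"
    "(\<lambda>x. frechet_derivative (chart_rep c d f) (at x) v) differentiable at (snd c p)"
proof -
  have "smooth_on (snd c ` {p \<in> fst c. f p \<in> fst d}) (chart_rep c d f)"
    using assms(1-3) unfolding smooth_map_def by blast
  then show "chart_rep c d f differentiable at (snd c p)"
    "(\<lambda>x. frechet_derivative (chart_rep c d f) (at x) v) differentiable at (snd c p)"
    using assms by (auto intro: smooth_on_differentiable smooth_on_differentiable2)
qed

lemma frechet_derivative_eq: "(f has_derivative F) (at x) \<Longrightarrow> frechet_derivative f (at x) = F"
  by (rule frechet_derivative_at[symmetric])

lemma has_frechet_derivative: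
  "f differentiable at x \<Longrightarrow> (f has_derivative frechet_derivative f (at x)) (at x)"
  using frechet_derivative_works by blast

lemma tangent_vector_determined:
  assumes "v \<in> tangent_space A p" "w \<in> tangent_space A p" "c \<in> A" "p \<in> fst c" "v c = w c"
  shows "v = w"
proof
  fix d show "v d = w d"
  proof (cases "d \<in> A \<and> p \<in> fst d")
    case True
    then have "v d = frechet_derivative (snd d \<circ> chart_inv c) (at (snd c p)) (v c)"
      "w d = frechet_derivative (snd d \<circ> chart_inv c) (at (snd c p)) (w c)"
      using assms unfolding tangent_space_def by blast+
    then show ?thesis using assms by simp
  next
    case False
    then have "v d = 0" "w d = 0" using assms(1,2) unfolding tangent_space_def by blast+
    then show ?thesis by simp
  qed
qed

text \<open>The components in the other charts are forced by the coordinate changes; their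
  compatibility is the chain rule.\<close>

lemma tangent_vector_exists:
  assumes X: "smooth_manifold X A" and c: "c \<in> A" "p \<in> fst c"
  obtains v where "v \<in> tangent_space A p" "v c = \<xi>"
proof -
  define v where "v d = (if d \<in> A \<and> p \<in> fst d
    then frechet_derivative (snd d \<circ> chart_inv c) (at (snd c p)) \<xi> else 0)" for d
  have "v c = \<xi>" using c frechet_derivative_eq[OF chart_rep_id[OF X c]] by (simp add: v_def o_def)
  moreover have "v \<in> tangent_space A p"
    unfolding tangent_space_def
  proof (intro CollectI conjI ballI allI impI)
    fix d e assume de: "d \<in> A" "e \<in> A" "p \<in> fst d \<and> p \<in> fst e"
    have "(chart_rep c e (\<lambda>x. x) has_derivative (\<lambda>v. frechet_derivative (snd e \<circ> chart_inv d) (at (snd d p))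
        (frechet_derivative (snd d \<circ> chart_inv c) (at (snd c p)) v))) (at (snd c p))"
      by (rule chart_rep_chain[OF X X _ c de(1) _ transition_has_derivative[OF X c(1) de(1) c(2)]
            transition_has_derivative[OF X de(1,2)]]) (use de in auto)
    from frechet_derivative_eq[OF this]
    have "frechet_derivative (snd e \<circ> chart_inv c) (at (snd c p)) \<xi> = frechet_derivative (snd e \<circ> chart_inv d) (at (snd d p))
        (frechet_derivative (snd d \<circ> chart_inv c) (at (snd c p)) \<xi>)"
      by (simp add: o_def)
    then show "v e = frechet_derivative (snd e \<circ> chart_inv d) (at (snd d p)) (v d)"
      using de by (simp add: v_def)
  qed (auto simp: v_def)
  ultimately show thesis using that by blast
qed

lemma tangent_map_in_tangent_space:
  assumes X: "smooth_manifold X A" and Y: "smooth_manifold Y B" and f: "continuous_map X Y f"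
    and p: "p \<in> topspace X"
    and D: "\<And>c d. c \<in> A \<Longrightarrow> p \<in> fst c \<Longrightarrow> d \<in> B \<Longrightarrow> f p \<in> fst d \<Longrightarrow> chart_rep c d f differentiable at (snd c p)"
  shows "tangent_map A B f p v \<in> tangent_space B (f p)"
proof -
  define c where "c = (SOME c. c \<in> A \<and> p \<in> fst c)"
  have "c \<in> A \<and> p \<in> fst c" unfolding c_def by (rule someI_ex[OF smooth_manifold_chart_exists[OF X p]])
  then have c: "c \<in> A" "p \<in> fst c" by auto
  have ev: "tangent_map A B f p v d = frechet_derivative (chart_rep c d f) (at (snd c p)) (v c)"
    if "d \<in> B" "f p \<in> fst d" for d
    unfolding tangent_map_def c_def Let_def using that by simp
  show ?thesis
    unfolding tangent_space_def
  proof (intro CollectI conjI ballI allI impI)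
    fix d e assume de: "d \<in> B" "e \<in> B" "f p \<in> fst d \<and> f p \<in> fst e"
    have "(chart_rep c e (\<lambda>x. f x) has_derivative (\<lambda>v. frechet_derivative (snd e \<circ> chart_inv d) (at (snd d (f p)))
        (frechet_derivative (chart_rep c d f) (at (snd c p)) v))) (at (snd c p))"
      by (rule chart_rep_chain[OF X Y f c de(1) _ has_frechet_derivative[OF D[OF c de(1)]]
            transition_has_derivative[OF Y de(1,2)]]) (use de in auto)
    from frechet_derivative_eq[OF this]
    show "tangent_map A B f p v e = frechet_derivative (snd e \<circ> chart_inv d) (at (snd d (f p))) (tangent_map A B f p v d)"
      using de by (simp add: ev)
  qed (auto simp: tangent_map_def)
qed

section \<open>Group operations in charts\<close>

locale lie_group_charts =
  fixes G :: "('g, 'm::euclidean_space) smooth_group"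
  assumes lie: "lie_group G"
begin

lemma group_G: "group G" and topspace_G: "topspace (topol G) = carrier G"
  and manifold_G: "smooth_manifold (topol G) (atlas G)"
  and mult_smooth: "smooth_map (prod_topology (topol G) (topol G)) (prod_atlas (atlas G) (atlas G))
       (topol G) (atlas G) (\<lambda>(x, y). x \<otimes>\<^bsub>G\<^esub> y)"
  and inv_smooth: "smooth_map (topol G) (atlas G) (topol G) (atlas G) (\<lambda>x. inv\<^bsub>G\<^esub> x)"
  using lie by (auto simp: lie_group_def)

lemmas chart_inv_chart_G = chart_inv_chart[OF manifold_G]

lemma chart_carrier: "c \<in> atlas G \<Longrightarrow> p \<in> fst c \<Longrightarrow> p \<in> carrier G"
  using chart_subset[OF manifold_G] topspace_G by blast

lemma mult_continuous: "continuous_map (prod_topology (topol G) (topol G)) (topol G) (\<lambda>(x, y). x \<otimes>\<^bsub>G\<^esub> y)"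
  using mult_smooth by (simp add: smooth_map_def)

lemma left_mult_continuous: assumes "g \<in> carrier G" shows "continuous_map (topol G) (topol G) (\<lambda>h. g \<otimes>\<^bsub>G\<^esub> h)"
proof -
  have "continuous_map (topol G) (prod_topology (topol G) (topol G)) (\<lambda>h. (g, h))"
    using assms by (intro continuous_map_pairedI) (auto simp: topspace_G)
  from continuous_map_compose[OF this mult_continuous] show ?thesis by (simp add: o_def)
qed

lemma right_mult_continuous: assumes "g \<in> carrier G" shows "continuous_map (topol G) (topol G) (\<lambda>h. h \<otimes>\<^bsub>G\<^esub> g)"
proof -
  have "continuous_map (topol G) (prod_topology (topol G) (topol G)) (\<lambda>h. (h, g))"
    using assms by (intro continuous_map_pairedI) (auto simp: topspace_G)
  from continuous_map_compose[OF this mult_continuous] show ?thesis by (simp add: o_def)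
qed

abbreviation prod_chart where "prod_chart c d \<equiv> (fst c \<times> fst d, map_prod (snd c) (snd d))"

lemma prod_chart_inv:
  assumes "c \<in> atlas G" "d \<in> atlas G" "u \<in> snd c ` fst c" "v \<in> snd d ` fst d"
  shows "chart_inv (prod_chart c d) (u, v) = (chart_inv c u, chart_inv d v)"
proof -
  have inj: "inj_on (map_prod (snd c) (snd d)) (fst c \<times> fst d)"
    using chart_inj[OF manifold_G] assms by (intro map_prod_inj_on) auto
  have "(u, v) = map_prod (snd c) (snd d) (chart_inv c u, chart_inv d v)"
    using chart_chart_inv[OF assms(3)] chart_chart_inv[OF assms(4)] by simp
  moreover have "(chart_inv c u, chart_inv d v) \<in> fst c \<times> fst d"
    using chart_inv_in[OF assms(3)] chart_inv_in[OF assms(4)] by simp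
  ultimately show ?thesis unfolding chart_inv_def[of "prod_chart c d"]
    using inv_into_f_f[OF inj] by (metis fst_conv snd_conv)
qed

text \<open>It is tied to the representative in the product chart only over the product of the two
  coordinate domains, where the inverse of the product chart splits into the inverses of the
  factors.\<close>

definition mult_rep where "mult_rep c d e = (\<lambda>(u, v). snd e (chart_inv c u \<otimes>\<^bsub>G\<^esub> chart_inv d v))"

lemma mult_rep_eq:
  assumes "c \<in> atlas G" "d \<in> atlas G" "x \<in> (snd c ` fst c) \<times> (snd d ` fst d)"
  shows "chart_rep (prod_chart c d) e (\<lambda>(x, y). x \<otimes>\<^bsub>G\<^esub> y) x = mult_rep c d e x"
  using assms by (auto simp: mult_rep_def prod_chart_inv)

lemma mult_nhd:
  assumes pq: "p \<in> carrier G" "q \<in> carrier G" and e: "e \<in> atlas G" "p \<otimes>\<^bsub>G\<^esub> q \<in> fst e"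
  obtains O1 O2 where "openin (topol G) O1" "openin (topol G) O2" "p \<in> O1" "q \<in> O2"
    "\<And>x y. x \<in> O1 \<Longrightarrow> y \<in> O2 \<Longrightarrow> x \<otimes>\<^bsub>G\<^esub> y \<in> fst e"
proof -
  let ?Q = "{x \<in> topspace (prod_topology (topol G) (topol G)). (\<lambda>(x, y). x \<otimes>\<^bsub>G\<^esub> y) x \<in> fst e}"
  have "openin (prod_topology (topol G) (topol G)) ?Q"
    by (rule openin_continuous_map_preimage[OF mult_continuous smooth_manifoldD(1)[OF manifold_G e(1)]])
  moreover have "(p, q) \<in> ?Q" using pq e by (auto simp: topspace_G)
  ultimately have "\<exists>U V. openin (topol G) U \<and> openin (topol G) V \<and> p \<in> U \<and> q \<in> V \<and> U \<times> V \<subseteq> ?Q"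
    unfolding openin_prod_topology_alt by blast
  then obtain U V where "openin (topol G) U" "openin (topol G) V" "p \<in> U" "q \<in> V" "U \<times> V \<subseteq> ?Q" by blast
  then show thesis by (intro that[of U V]) auto
qed

lemma mult_rep_differentiable:
  assumes c: "c \<in> atlas G" "d \<in> atlas G" "e \<in> atlas G" and p: "p \<in> fst c" "q \<in> fst d" "p \<otimes>\<^bsub>G\<^esub> q \<in> fst e"
  shows "mult_rep c d e differentiable at (snd c p, snd d q)"
    "(\<lambda>x. frechet_derivative (mult_rep c d e) (at x) v) differentiable at (snd c p, snd d q)"
proof -
  let ?F = "chart_rep (prod_chart c d) e (\<lambda>(x, y). x \<otimes>\<^bsub>G\<^esub> y)"
  let ?\<Omega> = "(snd c ` fst c) \<times> (snd d ` fst d)"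
  let ?S = "map_prod (snd c) (snd d) ` {p \<in> fst c \<times> fst d. (\<lambda>(x, y). x \<otimes>\<^bsub>G\<^esub> y) p \<in> fst e}"
  have pc: "prod_chart c d \<in> prod_atlas (atlas G) (atlas G)" unfolding prod_atlas_def
    using c by (intro CollectI exI[of _ c] exI[of _ d] conjI refl)
  have op: "open ?\<Omega>" using smooth_manifoldD(2)[OF manifold_G] c by (simp add: open_Times)
  have pt: "(snd c p, snd d q) \<in> ?\<Omega>" using p by auto
  have "?F differentiable at (snd (prod_chart c d) (p, q))"
    "(\<lambda>x. frechet_derivative ?F (at x) v) differentiable at (snd (prod_chart c d) (p, q))"
    using smooth_map_differentiable[OF mult_smooth pc c(3), of "(p, q)"] p by auto
  then have 1: "?F differentiable at (snd c p, snd d q)"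
    "(\<lambda>x. frechet_derivative ?F (at x) v) differentiable at (snd c p, snd d q)" by auto
  show "mult_rep c d e differentiable at (snd c p, snd d q)"
    using has_derivative_transform_within_open[OF has_frechet_derivative[OF 1(1)] op pt mult_rep_eq[OF c(1,2)]]
    by (auto simp: differentiable_def)
  obtain D where D: "((\<lambda>x. frechet_derivative ?F (at x) v) has_derivative D) (at (snd c p, snd d q))"
    using 1(2) by (auto simp: differentiable_def)
  have smS: "smooth_on ?S ?F" using mult_smooth pc c(3) unfolding smooth_map_def by fastforce
  \<comment> \<open>The first derivatives have to agree on a whole neighbourhood before they can be
    differentiated again; continuity of the multiplication provides one inside
    \<open>?S\<close>.\<close>
  have "\<exists>N. open N \<and> (snd c p, snd d q) \<in> N \<and> N \<subseteq> ?S"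
  proof -
    obtain O1 O2 where O: "openin (topol G) O1" "openin (topol G) O2" "p \<in> O1" "q \<in> O2"
      "\<And>x y. x \<in> O1 \<Longrightarrow> y \<in> O2 \<Longrightarrow> x \<otimes>\<^bsub>G\<^esub> y \<in> fst e"
      by (rule mult_nhd[OF chart_carrier[OF c(1) p(1)] chart_carrier[OF c(2) p(2)] c(3) p(3)]) blast
    show ?thesis
    proof (intro exI[of _ "(snd c ` (fst c \<inter> O1)) \<times> (snd d ` (fst d \<inter> O2))"] conjI)
      show "open ((snd c ` (fst c \<inter> O1)) \<times> (snd d ` (fst d \<inter> O2)))"
        using chart_open_image[OF manifold_G] c O by (simp add: open_Times)
      show "(snd c p, snd d q) \<in> (snd c ` (fst c \<inter> O1)) \<times> (snd d ` (fst d \<inter> O2))" using p O by auto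
      show "(snd c ` (fst c \<inter> O1)) \<times> (snd d ` (fst d \<inter> O2)) \<subseteq> ?S" using O(5) by (force simp: image_iff)
    qed
  qed
  then obtain N where N: "open N" "(snd c p, snd d q) \<in> N" "N \<subseteq> ?S" by blast
  have "?S \<subseteq> ?\<Omega>" by auto
  have eq: "frechet_derivative ?F (at x) v = frechet_derivative (mult_rep c d e) (at x) v" if x: "x \<in> N" for x
  proof -
    have "?F differentiable at x" using smooth_on_differentiable[OF smS] x N(3) by blast
    moreover have "x \<in> ?\<Omega>" using x N(3) \<open>?S \<subseteq> ?\<Omega>\<close> by (rule_tac subsetD) blast+
    ultimately have "(mult_rep c d e has_derivative frechet_derivative ?F (at x)) (at x)"
      by (intro has_derivative_transform_within_open[OF has_frechet_derivative op _ mult_rep_eq[OF c(1,2)]])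
    from frechet_derivative_eq[OF this] show ?thesis by simp
  qed
  show "(\<lambda>x. frechet_derivative (mult_rep c d e) (at x) v) differentiable at (snd c p, snd d q)"
    unfolding differentiable_def
    by (rule exI[of _ D], rule has_derivative_transform_within_open[OF D N(1,2) eq])
qed

text \<open>Multiplication by the identity does not move \<open>u\<close>, and the partial
  derivative in the second variable is bounded on a compact product of balls. The mean value
  inequality then gives a constant that is uniform in \<open>u\<close>.\<close>

lemma mult_rep_lipschitz:
  assumes c: "c \<in> atlas G" and one: "\<one>\<^bsub>G\<^esub> \<in> fst c"
  obtains r C where "r > 0" "C \<ge> 1" "cball (snd c \<one>\<^bsub>G\<^esub>) r \<subseteq> snd c ` fst c"
    "\<And>u v. u \<in> cball (snd c \<one>\<^bsub>G\<^esub>) r \<Longrightarrow> v \<in> cball (snd c \<one>\<^bsub>G\<^esub>) r \<Longrightarrow>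
       chart_inv c u \<otimes>\<^bsub>G\<^esub> chart_inv c v \<in> fst c \<and>
       norm (snd c (chart_inv c u \<otimes>\<^bsub>G\<^esub> chart_inv c v) - u) \<le> C * norm (v - snd c \<one>\<^bsub>G\<^esub>)"
proof -
  let ?u0 = "snd c \<one>\<^bsub>G\<^esub>" and ?m = "mult_rep c c c"
  have oneG: "\<one>\<^bsub>G\<^esub> \<in> carrier G" by (rule chart_carrier[OF c one])
  have r1: "p \<otimes>\<^bsub>G\<^esub> \<one>\<^bsub>G\<^esub> = p" if "p \<in> carrier G" for p
    using that group_G by (simp add: group.is_monoid monoid.r_one)
  then have "\<one>\<^bsub>G\<^esub> \<otimes>\<^bsub>G\<^esub> \<one>\<^bsub>G\<^esub> \<in> fst c" using one oneG by simp
  note mn = mult_nhd[OF oneG oneG c this]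
  obtain O1 O2 where O: "openin (topol G) O1" "openin (topol G) O2" "\<one>\<^bsub>G\<^esub> \<in> O1" "\<one>\<^bsub>G\<^esub> \<in> O2"
    "\<And>x y. x \<in> O1 \<Longrightarrow> y \<in> O2 \<Longrightarrow> x \<otimes>\<^bsub>G\<^esub> y \<in> fst c" by (rule mn) blast
  obtain N where N: "open N" "?u0 \<in> N" "\<And>u. u \<in> N \<Longrightarrow> u \<in> snd c ` fst c" "\<And>u. u \<in> N \<Longrightarrow> chart_inv c u \<in> O1 \<inter> O2"
    by (rule chart_nhd[OF manifold_G c openin_Int[OF O(1,2)] one IntI[OF O(3,4)]]) blast
  obtain r where r: "r > 0" "cball ?u0 r \<subseteq> N" using N(1,2) open_contains_cball by blast
  let ?K = "cball ?u0 r"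
  have inK: "u \<in> snd c ` fst c" "chart_inv c u \<in> O1" "chart_inv c u \<in> O2" if "u \<in> ?K" for u
    using N(3,4)[of u] that r(2) by auto
  have prod: "chart_inv c u \<otimes>\<^bsub>G\<^esub> chart_inv c v \<in> fst c" if "u \<in> ?K" "v \<in> ?K" for u v
    using O(5) inK that by blast
  have diff: "?m differentiable at (u, v)" "(\<lambda>x. frechet_derivative ?m (at x) w) differentiable at (u, v)"
    if "u \<in> ?K" "v \<in> ?K" for u v w
    using mult_rep_differentiable[OF c c c chart_inv_in[OF inK(1)[OF that(1)]] chart_inv_in[OF inK(1)[OF that(2)]] prod[OF that]]
    by (simp_all add: chart_chart_inv[OF inK(1)[OF that(1)]] chart_chart_inv[OF inK(1)[OF that(2)]])
  have "\<exists>M. \<forall>x\<in>?K \<times> ?K. norm (frechet_derivative ?m (at x) (0, b)) \<le> M" for b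
  proof -
    have "continuous_on (?K \<times> ?K) (\<lambda>x. frechet_derivative ?m (at x) (0, b))"
      by (intro continuous_at_imp_continuous_on ballI differentiable_imp_continuous_within) (use diff in auto)
    then have "compact ((\<lambda>x. frechet_derivative ?m (at x) (0, b)) ` (?K \<times> ?K))"
      by (intro compact_continuous_image compact_Times compact_cball)
    from compact_imp_bounded[OF this]
    obtain M0 where M0: "\<forall>y\<in>(\<lambda>x. frechet_derivative ?m (at x) (0, b)) ` (?K \<times> ?K). norm y \<le> M0"
      unfolding bounded_iff by (rule exE)
    show ?thesis by (intro exI[of _ M0] ballI) (rule bspec[OF M0 imageI])
  qed
  then obtain M where M: "\<And>b x. x \<in> ?K \<times> ?K \<Longrightarrow> norm (frechet_derivative ?m (at x) (0, b)) \<le> M b" by metis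
  define C where "C = 1 + (\<Sum>b\<in>Basis. \<bar>M b\<bar>)"
  have C: "C \<ge> 1" by (simp add: C_def sum_nonneg)
  have Dbound: "norm (frechet_derivative ?m (at (u, v)) (0, \<eta>)) \<le> C * norm \<eta>" if uv: "u \<in> ?K" "v \<in> ?K" for u v \<eta>
  proof -
    let ?D = "frechet_derivative ?m (at (u, v))"
    have lin: "linear ?D" by (rule linear_frechet_derivative[OF diff(1)[OF uv]])
    have "linear (\<lambda>\<eta>::'m. (0::'m, \<eta>))" by (rule linearI) auto
    from linear_compose[OF this lin] have linD: "linear (\<lambda>\<eta>. ?D (0, \<eta>))" by (simp add: o_def)
    have "?D (0, \<Sum>b\<in>Basis. (\<eta> \<bullet> b) *\<^sub>R b) = (\<Sum>b\<in>Basis. (\<eta> \<bullet> b) *\<^sub>R ?D (0, b))"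
      by (simp only: linear_sum[OF linD] linear_scale[OF linD])
    then have "?D (0, \<eta>) = (\<Sum>b\<in>Basis. (\<eta> \<bullet> b) *\<^sub>R ?D (0, b))"
      by (simp only: euclidean_representation)
    also have "norm \<dots> \<le> (\<Sum>b\<in>Basis. norm \<eta> * \<bar>M b\<bar>)"
    proof (rule order_trans[OF norm_sum sum_mono])
      fix b :: 'm assume b: "b \<in> Basis"
      have "norm (?D (0, b)) \<le> \<bar>M b\<bar>" using M[of "(u, v)" b] uv by auto
      then show "norm ((\<eta> \<bullet> b) *\<^sub>R ?D (0, b)) \<le> norm \<eta> * \<bar>M b\<bar>"
        using Basis_le_norm[OF b, of \<eta>] by (auto intro!: mult_mono)
    qed
    also have "\<dots> \<le> C * norm \<eta>" by (simp add: C_def sum_distrib_left[symmetric] algebra_simps)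
    finally show ?thesis .
  qed
  have "norm (?m (u, v) - u) \<le> C * norm (v - ?u0)" if uv: "u \<in> ?K" "v \<in> ?K" for u v
  proof -
    have u0K: "?u0 \<in> ?K" using r by simp
    have "norm (?m (u, v) - ?m (u, ?u0)) \<le> C * norm (v - ?u0)"
    proof (rule differentiable_bound[of ?K "\<lambda>v. ?m (u, v)" "\<lambda>v \<eta>. frechet_derivative ?m (at (u, v)) (0, \<eta>)"])
      fix w assume w: "w \<in> ?K"
      have "((\<lambda>v. (u, v)) has_derivative (\<lambda>\<eta>. (0, \<eta>))) (at w)" by (auto intro!: derivative_eq_intros)
      from has_derivative_compose[OF this has_frechet_derivative[OF diff(1)[OF uv(1) w]]]
      show "((\<lambda>v. ?m (u, v)) has_derivative (\<lambda>\<eta>. frechet_derivative ?m (at (u, w)) (0, \<eta>))) (at w within ?K)"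
        by (rule has_derivative_at_withinI)
      show "onorm (\<lambda>\<eta>. frechet_derivative ?m (at (u, w)) (0, \<eta>)) \<le> C"
        by (rule onorm_le) (rule Dbound[OF uv(1) w])
    qed (use uv u0K in auto)
    moreover have "?m (u, ?u0) = u"
      using chart_inv_chart_G[OF c one] r1[OF chart_carrier[OF c chart_inv_in[OF inK(1)[OF uv(1)]]]]
        chart_chart_inv[OF inK(1)[OF uv(1)]] by (simp add: mult_rep_def)
    ultimately show ?thesis by simp
  qed
  then show thesis using prod inK(1) by (intro that[OF r(1) C]) (auto simp: mult_rep_def)
qed

lemma left_mult_differentiable:
  assumes g: "g \<in> carrier G" and c: "c \<in> atlas G" "h \<in> fst c" and e: "e \<in> atlas G" "g \<otimes>\<^bsub>G\<^esub> h \<in> fst e"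
  shows "chart_rep c e (\<lambda>h. g \<otimes>\<^bsub>G\<^esub> h) differentiable at (snd c h)"
proof -
  obtain d where d: "d \<in> atlas G" "g \<in> fst d"
    using smooth_manifold_chart_exists[OF manifold_G] g topspace_G by blast
  have "mult_rep d c e \<circ> (\<lambda>u. (snd d g, u)) differentiable at (snd c h)"
    using mult_rep_differentiable(1)[OF d(1) c(1) e(1) d(2) c(2) e(2)]
    by (intro differentiable_chain_at) (auto intro!: derivative_intros simp: differentiable_def)
  moreover have "mult_rep d c e \<circ> (\<lambda>u. (snd d g, u)) = chart_rep c e (\<lambda>h. g \<otimes>\<^bsub>G\<^esub> h)"
    using chart_inv_chart_G[OF d] by (auto simp: mult_rep_def)
  ultimately show ?thesis by simp
qed

lemma right_mult_differentiable:
  assumes g: "g \<in> carrier G" and c: "c \<in> atlas G" "h \<in> fst c" and e: "e \<in> atlas G" "h \<otimes>\<^bsub>G\<^esub> g \<in> fst e"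
  shows "chart_rep c e (\<lambda>h. h \<otimes>\<^bsub>G\<^esub> g) differentiable at (snd c h)"
proof -
  obtain d where d: "d \<in> atlas G" "g \<in> fst d"
    using smooth_manifold_chart_exists[OF manifold_G] g topspace_G by blast
  have "mult_rep c d e \<circ> (\<lambda>u. (u, snd d g)) differentiable at (snd c h)"
    using mult_rep_differentiable(1)[OF c(1) d(1) e(1) c(2) d(2) e(2)]
    by (intro differentiable_chain_at) (auto intro!: derivative_intros simp: differentiable_def)
  moreover have "mult_rep c d e \<circ> (\<lambda>u. (u, snd d g)) = chart_rep c e (\<lambda>h. h \<otimes>\<^bsub>G\<^esub> g)"
    using chart_inv_chart_G[OF d] by (auto simp: mult_rep_def)
  ultimately show ?thesis by simp
qed

definition conjugation where "conjugation g = (\<lambda>h. g \<otimes>\<^bsub>G\<^esub> h \<otimes>\<^bsub>G\<^esub> inv\<^bsub>G\<^esub> g)"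

lemma conjugation_continuous: assumes "g \<in> carrier G" shows "continuous_map (topol G) (topol G) (conjugation g)"
proof -
  have "inv\<^bsub>G\<^esub> g \<in> carrier G" using assms group_G by (simp add: group.inv_closed)
  from continuous_map_compose[OF left_mult_continuous[OF assms] right_mult_continuous[OF this]]
  show ?thesis by (simp add: o_def conjugation_def)
qed

lemma conjugation_one: "g \<in> carrier G \<Longrightarrow> conjugation g \<one>\<^bsub>G\<^esub> = \<one>\<^bsub>G\<^esub>"
  using group_G by (simp add: conjugation_def group.is_monoid monoid.r_one group.r_inv)

lemma conjugation_differentiable:
  assumes g: "g \<in> carrier G" and c: "c \<in> atlas G" "h \<in> fst c" and e: "e \<in> atlas G" "conjugation g h \<in> fst e"
  shows "chart_rep c e (conjugation g) differentiable at (snd c h)"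
proof -
  have gi: "inv\<^bsub>G\<^esub> g \<in> carrier G" using g group_G by (simp add: group.inv_closed)
  have "g \<otimes>\<^bsub>G\<^esub> h \<in> carrier G" using g chart_carrier[OF c] group_G
    by (simp add: group.is_monoid monoid.m_closed)
  then obtain d where d: "d \<in> atlas G" "g \<otimes>\<^bsub>G\<^esub> h \<in> fst d"
    using smooth_manifold_chart_exists[OF manifold_G] topspace_G by blast
  from chart_rep_chain[OF manifold_G manifold_G left_mult_continuous[OF g] c d
      has_frechet_derivative[OF left_mult_differentiable[OF g c d]]
      has_frechet_derivative[OF right_mult_differentiable[OF gi d e(1)]]] e(2)
  show ?thesis by (auto simp: differentiable_def conjugation_def)
qed
end

section \<open>The adjoint representation\<close>

locale lie_pair =
  fixes br :: "'a::euclidean_space \<Rightarrow> 'a \<Rightarrow> 'a" and s :: "'a \<Rightarrow> 'a"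
    and G :: "('g, 'm::euclidean_space) smooth_group" and \<iota> :: "'a \<Rightarrow> ('g, 'm) chart \<Rightarrow> 'm"
    and K :: "('g, 'k::euclidean_space) smooth_group"
  assumes pair: "associated_pair br s G \<iota> K" and br_bilinear: "bilinear br"
begin

sublocale G: lie_group_charts G
  by unfold_locales (use pair in \<open>simp add: associated_pair_def\<close>)

lemma lie_K: "lie_group K" and subgroup_K: "subgroup (carrier K) G" and one_K: "\<one>\<^bsub>K\<^esub> = \<one>\<^bsub>G\<^esub>"
  and mult_K: "x \<in> carrier K \<Longrightarrow> y \<in> carrier K \<Longrightarrow> x \<otimes>\<^bsub>K\<^esub> y = x \<otimes>\<^bsub>G\<^esub> y"
  and incl_smooth: "smooth_map (topol K) (atlas K) (topol G) (atlas G) (\<lambda>x. x)"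
  using pair by (auto simp: associated_pair_def lie_subgroup_def)

sublocale K: lie_group_charts K
  by unfold_locales (rule lie_K)

lemma K_carrier: "U \<in> carrier K \<Longrightarrow> U \<in> carrier G"
  using subgroup_K by (rule subgroup.mem_carrier)

lemma inv_K: assumes "U \<in> carrier K" shows "inv\<^bsub>K\<^esub> U = inv\<^bsub>G\<^esub> U"
proof -
  have i: "inv\<^bsub>K\<^esub> U \<in> carrier K" using assms K.group_G by (simp add: group.inv_closed)
  have "inv\<^bsub>K\<^esub> U \<otimes>\<^bsub>G\<^esub> U = \<one>\<^bsub>G\<^esub>"
    using mult_K[OF i assms] group.l_inv[OF K.group_G assms] one_K by simp
  then show ?thesis using group.inv_equality[OF G.group_G _ K_carrier[OF assms] K_carrier[OF i]] by simp
qed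

lemma iota_linear: "linear (\<lambda>x. \<iota> x c)"
  and iota_bij: "bij_betw \<iota> UNIV (tangent_space (atlas G) \<one>\<^bsub>G\<^esub>)"
  and iota_br: "c \<in> atlas G \<Longrightarrow> \<one>\<^bsub>G\<^esub> \<in> fst c \<Longrightarrow>
        frechet_derivative (\<lambda>u. Ad G \<iota> (chart_inv c u) y) (at (snd c \<one>\<^bsub>G\<^esub>)) (\<iota> x c) = br x y"
  using pair unfolding associated_pair_def identifies_lie_algebra_def by blast+

lemma oneG: "\<one>\<^bsub>G\<^esub> \<in> carrier G" using G.group_G by (simp add: group.is_monoid monoid.one_closed)
lemma oneK: "\<one>\<^bsub>K\<^esub> \<in> carrier K" using K.group_G by (simp add: group.is_monoid monoid.one_closed)

text \<open>These are the very charts that \<open>tangent_map\<close> picks at the identity, so its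
  values are obtained with no change of chart.\<close>

definition c0 where "c0 = (SOME c. c \<in> atlas G \<and> \<one>\<^bsub>G\<^esub> \<in> fst c)"
definition c1 where "c1 = (SOME c. c \<in> atlas K \<and> \<one>\<^bsub>K\<^esub> \<in> fst c)"

lemma c0: "c0 \<in> atlas G" "\<one>\<^bsub>G\<^esub> \<in> fst c0"
proof -
  have "c0 \<in> atlas G \<and> \<one>\<^bsub>G\<^esub> \<in> fst c0" unfolding c0_def
    by (rule someI_ex[OF smooth_manifold_chart_exists[OF G.manifold_G]]) (simp add: G.topspace_G oneG)
  then show "c0 \<in> atlas G" "\<one>\<^bsub>G\<^esub> \<in> fst c0" by auto
qed

lemma c1: "c1 \<in> atlas K" "\<one>\<^bsub>K\<^esub> \<in> fst c1"
proof -
  have "c1 \<in> atlas K \<and> \<one>\<^bsub>K\<^esub> \<in> fst c1" unfolding c1_def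
    by (rule someI_ex[OF smooth_manifold_chart_exists[OF K.manifold_G]]) (simp add: K.topspace_G oneK)
  then show "c1 \<in> atlas K" "\<one>\<^bsub>K\<^esub> \<in> fst c1" by auto
qed

abbreviation u0 where "u0 \<equiv> snd c0 \<one>\<^bsub>G\<^esub>"
abbreviation k0 where "k0 \<equiv> snd c1 \<one>\<^bsub>K\<^esub>"

definition J where "J x = \<iota> x c0"

lemma J_linear: "linear J" unfolding J_def by (rule iota_linear)

lemma iota_tangent: "\<iota> x \<in> tangent_space (atlas G) \<one>\<^bsub>G\<^esub>"
  using iota_bij by (auto simp: bij_betw_def)

lemma J_inj: "J x = J y \<Longrightarrow> x = y"
  using tangent_vector_determined[OF iota_tangent iota_tangent c0, of x y] iota_bij
  by (auto simp: J_def bij_betw_def inj_on_def)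

text \<open>By \<open>J_Ad\<close> the vectors \<open>dconj g (J x)\<close> are in the range of
  \<open>J\<close>, so a linear left inverse recovers \<open>Ad\<close> from them.\<close>

definition J' where "J' = (SOME f. linear f \<and> (\<forall>x. f (J x) = x))"

lemma J': "linear J'" "J' (J x) = x"
proof -
  have "inj J" using J_inj by (auto simp: inj_on_def)
  then have "\<exists>f. linear f \<and> (\<forall>x. f (J x) = x)"
    using linear_injective_left_inverse[OF J_linear] by (auto simp: fun_eq_iff)
  from someI_ex[OF this] show "linear J'" "J' (J x) = x" by (auto simp: J'_def)
qed

definition dconj where "dconj g = frechet_derivative (chart_rep c0 c0 (G.conjugation g)) (at u0)"

lemma dconj_has_derivative:
  assumes "g \<in> carrier G" shows "(chart_rep c0 c0 (G.conjugation g) has_derivative dconj g) (at u0)"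
  unfolding dconj_def using assms c0
  by (intro has_frechet_derivative G.conjugation_differentiable) (simp_all add: G.conjugation_one)

lemma J_Ad: assumes g: "g \<in> carrier G" shows "J (Ad G \<iota> g x) = dconj g (J x)"
proof -
  let ?C = "G.conjugation g"
  have "tangent_map (atlas G) (atlas G) ?C \<one>\<^bsub>G\<^esub> (\<iota> x) \<in> tangent_space (atlas G) (?C \<one>\<^bsub>G\<^esub>)"
    by (rule tangent_map_in_tangent_space[OF G.manifold_G G.manifold_G G.conjugation_continuous[OF g]])
      (simp_all add: G.topspace_G oneG G.conjugation_differentiable[OF g])
  then have "tangent_map (atlas G) (atlas G) ?C \<one>\<^bsub>G\<^esub> (\<iota> x) \<in> range \<iota>"
    using iota_bij G.conjugation_one[OF g] by (simp add: bij_betw_def)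
  then have "\<iota> (Ad G \<iota> g x) = tangent_map (atlas G) (atlas G) ?C \<one>\<^bsub>G\<^esub> (\<iota> x)"
    unfolding Ad_def G.conjugation_def[symmetric] by (rule f_inv_into_f)
  then have "J (Ad G \<iota> g x) = tangent_map (atlas G) (atlas G) ?C \<one>\<^bsub>G\<^esub> (\<iota> x) c0" by (simp add: J_def)
  also have "\<dots> = dconj g (J x)"
    unfolding tangent_map_def c0_def[symmetric] Let_def dconj_def J_def
    using c0 G.conjugation_one[OF g] by simp
  finally show ?thesis .
qed

lemma Ad_eq: "g \<in> carrier G \<Longrightarrow> Ad G \<iota> g x = J' (dconj g (J x))"
  using J_Ad[of g x] J'(2)[of "Ad G \<iota> g x"] by simp

lemma dconj_linear: "g \<in> carrier G \<Longrightarrow> linear (dconj g)"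
  using dconj_has_derivative has_derivative_linear by blast

lemma Ad_linear: assumes "g \<in> carrier G" shows "linear (Ad G \<iota> g)"
proof -
  have "Ad G \<iota> g = J' \<circ> (dconj g \<circ> J)" using Ad_eq[OF assms] by auto
  then show ?thesis using linear_compose[OF linear_compose[OF J_linear dconj_linear[OF assms]] J'(1)] by simp
qed

lemma conjugation_mult:
  assumes "g \<in> carrier G" "h \<in> carrier G" "x \<in> carrier G"
  shows "G.conjugation (g \<otimes>\<^bsub>G\<^esub> h) x = G.conjugation g (G.conjugation h x)"
proof -
  interpret group G by (rule G.group_G)
  show ?thesis using assms by (simp add: G.conjugation_def inv_mult_group m_assoc)
qed

lemma Ad_mult: assumes g: "g \<in> carrier G" "h \<in> carrier G"
  shows "Ad G \<iota> (g \<otimes>\<^bsub>G\<^esub> h) x = Ad G \<iota> g (Ad G \<iota> h x)"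
proof -
  interpret gr: group G by (rule G.group_G)
  have "(chart_rep c0 c0 (\<lambda>x. G.conjugation g (G.conjugation h x)) has_derivative (\<lambda>v. dconj g (dconj h v))) (at u0)"
    by (rule chart_rep_chain[OF G.manifold_G G.manifold_G G.conjugation_continuous[OF g(2)] c0 c0(1) _
          dconj_has_derivative[OF g(2)]]) (simp_all add: G.conjugation_one[OF g(2)] c0 dconj_has_derivative[OF g(1)])
  moreover have "openin (topol G) (carrier G)" using openin_topspace[of "topol G"] by (simp add: G.topspace_G)
  ultimately have "(chart_rep c0 c0 (G.conjugation (g \<otimes>\<^bsub>G\<^esub> h)) has_derivative (\<lambda>v. dconj g (dconj h v))) (at u0)"
    using chart_rep_cong[OF G.manifold_G c0 _ oneG] conjugation_mult[OF g] by metis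
  then have "dconj (g \<otimes>\<^bsub>G\<^esub> h) = (\<lambda>v. dconj g (dconj h v))" unfolding dconj_def by (rule frechet_derivative_eq)
  then have "J (Ad G \<iota> (g \<otimes>\<^bsub>G\<^esub> h) x) = J (Ad G \<iota> g (Ad G \<iota> h x))" using g by (simp add: J_Ad)
  then show ?thesis by (rule J_inj)
qed

lemma Ad_one: "Ad G \<iota> \<one>\<^bsub>G\<^esub> x = x"
proof -
  interpret gr: group G by (rule G.group_G)
  have "openin (topol G) (carrier G)" using openin_topspace[of "topol G"] by (simp add: G.topspace_G)
  then have "(chart_rep c0 c0 (G.conjugation \<one>\<^bsub>G\<^esub>) has_derivative (\<lambda>x. x)) (at u0)"
    by (rule chart_rep_cong[OF G.manifold_G c0 _ oneG _ chart_rep_id[OF G.manifold_G c0]])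
      (simp add: G.conjugation_def)
  then have "dconj \<one>\<^bsub>G\<^esub> = (\<lambda>x. x)" unfolding dconj_def by (rule frechet_derivative_eq)
  then have "J (Ad G \<iota> \<one>\<^bsub>G\<^esub> x) = J x" using oneG by (simp add: J_Ad)
  then show ?thesis by (rule J_inj)
qed

lemma Ad_inv: assumes "g \<in> carrier G"
  shows "Ad G \<iota> (inv\<^bsub>G\<^esub> g) (Ad G \<iota> g x) = x" "Ad G \<iota> g (Ad G \<iota> (inv\<^bsub>G\<^esub> g) x) = x"
proof -
  interpret gr: group G by (rule G.group_G)
  show "Ad G \<iota> (inv\<^bsub>G\<^esub> g) (Ad G \<iota> g x) = x" "Ad G \<iota> g (Ad G \<iota> (inv\<^bsub>G\<^esub> g) x) = x"
    using assms by (simp_all flip: Ad_mult add: Ad_one)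
qed

text \<open>Near the identity the conjugation by \<open>g\<close> is read off from the multiplication \<open>m\<close> in the chart
  \<open>c0\<close>: if \<open>w\<close> and \<open>i w\<close> are the coordinates of \<open>g\<close> and its inverse, the derivative of
  \<open>h \<mapsto> g h g\<^sup>-\<^sup>1\<close> at the identity is \<open>v \<mapsto> D m(w, i w) (D m(w, u0) (0, v), 0)\<close>.\<close>

lemma dconj_near_one:
  assumes w: "w \<in> snd c0 ` fst c0" and iw: "inv\<^bsub>G\<^esub> (chart_inv c0 w) \<in> fst c0"
  defines "m \<equiv> G.mult_rep c0 c0 c0" and "i \<equiv> snd c0 (inv\<^bsub>G\<^esub> (chart_inv c0 w))"
  shows "dconj (chart_inv c0 w) v =
    frechet_derivative m (at (w, i)) (frechet_derivative m (at (w, u0)) (0, v), 0)"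
    and "linear (frechet_derivative m (at (w, i)))"
proof -
  interpret gr: group G by (rule G.group_G)
  define g where "g = chart_inv c0 w"
  have g: "g \<in> fst c0" "snd c0 g = w" unfolding g_def using chart_inv_in[OF w] chart_chart_inv[OF w] by auto
  have gG: "g \<in> carrier G" by (rule G.chart_carrier[OF c0(1) g(1)])
  have gi: "inv\<^bsub>G\<^esub> g \<in> fst c0" using iw by (simp add: g_def)
  have g1: "g \<otimes>\<^bsub>G\<^esub> \<one>\<^bsub>G\<^esub> = g" using gG by simp
  have ii: "i = snd c0 (inv\<^bsub>G\<^esub> g)" by (simp add: i_def g_def)
  have d1: "m differentiable at (w, u0)"
    using G.mult_rep_differentiable(1)[OF c0(1) c0(1) c0(1) g(1) c0(2)] g g1 by (simp add: m_def)
  have d2: "m differentiable at (w, i)"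
    using G.mult_rep_differentiable(1)[OF c0(1) c0(1) c0(1) g(1) gi] g gG c0 by (simp add: m_def ii)
  show "linear (frechet_derivative m (at (w, i)))" by (rule linear_frechet_derivative[OF d2])
  have "((\<lambda>u. (w, u)) has_derivative (\<lambda>v. (0, v))) (at u0)" by (auto intro!: derivative_eq_intros)
  from has_derivative_compose[OF this has_frechet_derivative[OF d1]]
  have "((\<lambda>u. m (w, u)) has_derivative (\<lambda>v. frechet_derivative m (at (w, u0)) (0, v))) (at u0)" .
  moreover have "(\<lambda>u. m (w, u)) = chart_rep c0 c0 (\<lambda>h. g \<otimes>\<^bsub>G\<^esub> h)" by (auto simp: m_def G.mult_rep_def g_def)
  ultimately have L: "(chart_rep c0 c0 (\<lambda>h. g \<otimes>\<^bsub>G\<^esub> h) has_derivative (\<lambda>v. frechet_derivative m (at (w, u0)) (0, v))) (at u0)"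
    by simp
  have "((\<lambda>u. (u, i)) has_derivative (\<lambda>v. (v, 0))) (at w)" by (auto intro!: derivative_eq_intros)
  from has_derivative_compose[OF this has_frechet_derivative[OF d2]]
  have "((\<lambda>u. m (u, i)) has_derivative (\<lambda>v. frechet_derivative m (at (w, i)) (v, 0))) (at w)" .
  moreover have "(\<lambda>u. m (u, i)) = chart_rep c0 c0 (\<lambda>h. h \<otimes>\<^bsub>G\<^esub> inv\<^bsub>G\<^esub> g)"
    using chart_inv_chart[OF G.manifold_G c0(1) gi] by (auto simp: m_def G.mult_rep_def ii)
  ultimately have R: "(chart_rep c0 c0 (\<lambda>h. h \<otimes>\<^bsub>G\<^esub> inv\<^bsub>G\<^esub> g) has_derivative (\<lambda>v. frechet_derivative m (at (w, i)) (v, 0))) (at (snd c0 (g \<otimes>\<^bsub>G\<^esub> \<one>\<^bsub>G\<^esub>)))"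
    using g g1 by simp
  have "g \<otimes>\<^bsub>G\<^esub> \<one>\<^bsub>G\<^esub> \<in> fst c0" using g g1 by simp
  from chart_rep_chain[OF G.manifold_G G.manifold_G G.left_mult_continuous[OF gG] c0 c0(1) this L R]
  have "dconj g = (\<lambda>v. frechet_derivative m (at (w, i)) (frechet_derivative m (at (w, u0)) (0, v), 0))"
    unfolding dconj_def G.conjugation_def by (rule frechet_derivative_eq)
  then show "dconj (chart_inv c0 w) v =
    frechet_derivative m (at (w, i)) (frechet_derivative m (at (w, u0)) (0, v), 0)"
    by (simp add: g_def)
qed

text \<open>The bracket is given through \<open>frechet_derivative\<close>, which is informative
  only once differentiability is known. Expanding the formula of \<open>dconj_near_one\<close> over
  a basis leaves derivatives of the multiplication in the fixed directions \<open>(0, J y)\<close>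
  and \<open>(e, 0)\<close>, and these are differentiable functions of the base point.\<close>

lemma Ad_differentiable: "(\<lambda>w. Ad G \<iota> (chart_inv c0 w) y) differentiable at u0"
proof -
  interpret gr: group G by (rule G.group_G)
  let ?m = "G.mult_rep c0 c0 c0"
  define i where "i w = snd c0 (inv\<^bsub>G\<^esub> (chart_inv c0 w))" for w
  have ic: "continuous_map (topol G) (topol G) (\<lambda>x. inv\<^bsub>G\<^esub> x)" using G.inv_smooth by (simp add: smooth_map_def)
  have op: "openin (topol G) {x \<in> topspace (topol G). inv\<^bsub>G\<^esub> x \<in> fst c0}"
    by (rule openin_continuous_map_preimage[OF ic smooth_manifoldD(1)[OF G.manifold_G c0(1)]])
  have pin: "\<one>\<^bsub>G\<^esub> \<in> {x \<in> topspace (topol G). inv\<^bsub>G\<^esub> x \<in> fst c0}" using c0 oneG by (simp add: G.topspace_G)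
  obtain N where N: "open N" "u0 \<in> N" "\<And>u. u \<in> N \<Longrightarrow> u \<in> snd c0 ` fst c0"
    "\<And>u. u \<in> N \<Longrightarrow> chart_inv c0 u \<in> {x \<in> topspace (topol G). inv\<^bsub>G\<^esub> x \<in> fst c0}"
    by (rule chart_nhd[OF G.manifold_G c0(1) op c0(2) pin]) blast
  define a where "a w = frechet_derivative ?m (at (w, u0)) (0, J y)" for w
  define b where "b e w = frechet_derivative ?m (at (w, i w)) (e, 0)" for e w
  have eq: "J' (\<Sum>e\<in>Basis. (a w \<bullet> e) *\<^sub>R b e w) = Ad G \<iota> (chart_inv c0 w) y" if w: "w \<in> N" for w
  proof -
    have inv: "inv\<^bsub>G\<^esub> (chart_inv c0 w) \<in> fst c0" using N(4)[OF w] by simp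
    have gG: "chart_inv c0 w \<in> carrier G" using N(4)[OF w] by (simp add: G.topspace_G)
    let ?D = "frechet_derivative ?m (at (w, i w))"
    have lin: "linear ?D" using dconj_near_one(2)[OF N(3)[OF w] inv] by (simp add: i_def)
    have "linear (\<lambda>v::'m. (v, 0::'m))" by (rule linearI) auto
    from linear_compose[OF this lin] have linD: "linear (\<lambda>v. ?D (v, 0))" by (simp add: o_def)
    have "?D (\<Sum>e\<in>Basis. (a w \<bullet> e) *\<^sub>R e, 0) = (\<Sum>e\<in>Basis. (a w \<bullet> e) *\<^sub>R b e w)"
      unfolding b_def by (simp only: linear_sum[OF linD] linear_scale[OF linD])
    then have "?D (a w, 0) = (\<Sum>e\<in>Basis. (a w \<bullet> e) *\<^sub>R b e w)"
      by (simp only: euclidean_representation)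
    then show ?thesis
      using Ad_eq[OF gG, of y] dconj_near_one(1)[OF N(3)[OF w] inv, of "J y"] by (simp add: a_def i_def)
  qed
  have iu0: "i u0 = u0" using chart_inv_chart[OF G.manifold_G c0] by (simp add: i_def)
  have i_diff: "i differentiable at u0"
    using smooth_map_differentiable(1)[OF G.inv_smooth c0(1) c0(1) c0(2)] c0 by (simp add: i_def[abs_def] o_def)
  have m2: "(\<lambda>x. frechet_derivative ?m (at x) v) differentiable at (u0, u0)" for v
    using G.mult_rep_differentiable(2)[OF c0(1) c0(1) c0(1) c0(2) c0(2)] oneG c0 by simp
  have "(\<lambda>x. frechet_derivative ?m (at x) (0, J y)) \<circ> (\<lambda>w. (w, u0)) differentiable at u0"
    by (rule differentiable_chain_at) (use m2 in \<open>auto intro!: derivative_intros simp: differentiable_def\<close>)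
  then have ad: "a differentiable at u0" by (simp add: a_def[abs_def] o_def)
  have bd: "b e differentiable at u0" for e
  proof -
    have "(\<lambda>w. (w, i w)) differentiable at u0"
      using i_diff by (auto simp: differentiable_def intro!: has_derivative_Pair has_derivative_ident)
    then have "(\<lambda>x. frechet_derivative ?m (at x) (e, 0)) \<circ> (\<lambda>w. (w, i w)) differentiable at u0"
      by (rule differentiable_chain_at) (simp add: iu0 m2)
    then show ?thesis by (simp add: b_def[abs_def] o_def)
  qed
  have "(\<lambda>w. \<Sum>e\<in>Basis. (a w \<bullet> e) *\<^sub>R b e w) differentiable at u0"
    by (intro differentiable_sum differentiable_scaleR differentiable_inner differentiable_const ad bd finite_Basis ballI)
  then obtain D where "((\<lambda>w. \<Sum>e\<in>Basis. (a w \<bullet> e) *\<^sub>R b e w) has_derivative D) (at u0)"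
    by (auto simp: differentiable_def)
  from bounded_linear.has_derivative[OF linear_conv_bounded_linear[THEN iffD1, OF J'(1)] this]
  have "((\<lambda>w. J' (\<Sum>e\<in>Basis. (a w \<bullet> e) *\<^sub>R b e w)) has_derivative (\<lambda>v. J' (D v))) (at u0)" .
  from has_derivative_transform_within_open[OF this N(1,2) eq]
  show ?thesis by (auto simp: differentiable_def)
qed

definition dAd where "dAd y = frechet_derivative (\<lambda>w. Ad G \<iota> (chart_inv c0 w) y) (at u0)"

lemma dAd: "((\<lambda>w. Ad G \<iota> (chart_inv c0 w) y) has_derivative dAd y) (at u0)" "dAd y (J x) = br x y"
  unfolding dAd_def J_def using has_frechet_derivative[OF Ad_differentiable] iota_br[OF c0] by auto

text \<open>Differentiate at \<open>h = 1\<close> the identity saying that \<open>Ad\<close> of the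
  conjugate of \<open>h\<close> by \<open>g\<close>, applied to \<open>Ad g y\<close>, is
  \<open>Ad g\<close> of \<open>Ad h y\<close>.\<close>

lemma Ad_br: assumes g: "g \<in> carrier G" shows "Ad G \<iota> g (br x y) = br (Ad G \<iota> g x) (Ad G \<iota> g y)"
proof -
  interpret gr: group G by (rule G.group_G)
  let ?y = "Ad G \<iota> g y"
  have bl: "bounded_linear (Ad G \<iota> g)" using Ad_linear[OF g] by (simp add: linear_conv_bounded_linear)
  have R: "((\<lambda>w. Ad G \<iota> g (Ad G \<iota> (chart_inv c0 w) y)) has_derivative (\<lambda>v. Ad G \<iota> g (dAd y v))) (at u0)"
    by (rule bounded_linear.has_derivative[OF bl dAd(1)])
  have op: "openin (topol G) {x \<in> topspace (topol G). G.conjugation g x \<in> fst c0}"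
    by (rule openin_continuous_map_preimage[OF G.conjugation_continuous[OF g] smooth_manifoldD(1)[OF G.manifold_G c0(1)]])
  have pin: "\<one>\<^bsub>G\<^esub> \<in> {x \<in> topspace (topol G). G.conjugation g x \<in> fst c0}"
    using c0 oneG g by (simp add: G.topspace_G G.conjugation_one)
  obtain N where N: "open N" "u0 \<in> N"
    "\<And>u. u \<in> N \<Longrightarrow> chart_inv c0 u \<in> {x \<in> topspace (topol G). G.conjugation g x \<in> fst c0}"
    by (rule chart_nhd[OF G.manifold_G c0(1) op c0(2) pin]) blast
  let ?C = "chart_rep c0 c0 (G.conjugation g)"
  have "?C u0 = u0" using chart_inv_chart[OF G.manifold_G c0] by (simp add: G.conjugation_one[OF g])
  then have "((\<lambda>w. Ad G \<iota> (chart_inv c0 (?C w)) ?y) has_derivative (\<lambda>v. dAd ?y (dconj g v))) (at u0)"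
    using has_derivative_compose[OF dconj_has_derivative[OF g], of "\<lambda>w. Ad G \<iota> (chart_inv c0 w) ?y"] dAd(1) by simp
  then have "((\<lambda>w. Ad G \<iota> g (Ad G \<iota> (chart_inv c0 w) y)) has_derivative (\<lambda>v. dAd ?y (dconj g v))) (at u0)"
  proof (rule has_derivative_transform_within_open[OF _ N(1,2)])
    fix w assume w: "w \<in> N"
    let ?h = "chart_inv c0 w"
    have h: "?h \<in> carrier G" "G.conjugation g ?h \<in> fst c0" using N(3)[OF w] by (auto simp: G.topspace_G)
    have "chart_inv c0 (?C w) = G.conjugation g ?h" using chart_inv_chart[OF G.manifold_G c0(1) h(2)] by simp
    then show "Ad G \<iota> (chart_inv c0 (?C w)) ?y = Ad G \<iota> g (Ad G \<iota> ?h y)"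
      using g h by (simp add: G.conjugation_def Ad_mult Ad_inv)
  qed
  from has_derivative_unique[OF R this] have "Ad G \<iota> g (dAd y (J x)) = dAd ?y (dconj g (J x))" by metis
  then show ?thesis by (simp add: dAd(2) flip: J_Ad[OF g])
qed

definition T where "T = frechet_derivative (chart_rep c1 c0 (\<lambda>x. x)) (at k0)"

lemma T_has_derivative: "(chart_rep c1 c0 (\<lambda>x. x) has_derivative T) (at k0)"
  unfolding T_def
  by (rule has_frechet_derivative, rule smooth_map_differentiable(1)[OF incl_smooth c1(1) c0(1) c1(2)])
    (simp add: one_K c0)

lemma incl_tangent: "tangent_map (atlas K) (atlas G) (\<lambda>x. x) \<one>\<^bsub>K\<^esub> v c0 = T (v c1)"
  unfolding tangent_map_def c1_def[symmetric] Let_def T_def using c0 by (simp add: one_K)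

lemma incl_tangent_image:
  "tangent_map (atlas K) (atlas G) (\<lambda>x. x) \<one>\<^bsub>K\<^esub> ` tangent_space (atlas K) \<one>\<^bsub>K\<^esub> = \<iota> ` k_part s"
  using pair by (simp add: associated_pair_def)

lemma T_into: obtains x where "x \<in> k_part s" "T \<xi> = J x"
proof -
  obtain v where v: "v \<in> tangent_space (atlas K) \<one>\<^bsub>K\<^esub>" "v c1 = \<xi>"
    by (rule tangent_vector_exists[OF K.manifold_G c1])
  then obtain x where "x \<in> k_part s" "tangent_map (atlas K) (atlas G) (\<lambda>x. x) \<one>\<^bsub>K\<^esub> v = \<iota> x"
    using incl_tangent_image by blast
  then show thesis using that[of x] incl_tangent[of v] v by (simp add: J_def)
qed

lemma T_onto: assumes "x \<in> k_part s" obtains \<xi> where "T \<xi> = J x"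
proof -
  obtain v where "\<iota> x = tangent_map (atlas K) (atlas G) (\<lambda>x. x) \<one>\<^bsub>K\<^esub> v"
    using incl_tangent_image assms by blast
  then show thesis using that[of "v c1"] incl_tangent[of v] by (simp add: J_def)
qed

lemma conjugation_K:
  assumes U: "U \<in> carrier K" and h: "h \<in> carrier K" shows "K.conjugation U h = G.conjugation U h"
proof -
  interpret group K by (rule K.group_G)
  have "U \<otimes>\<^bsub>K\<^esub> h \<otimes>\<^bsub>K\<^esub> inv\<^bsub>K\<^esub> U = U \<otimes>\<^bsub>K\<^esub> h \<otimes>\<^bsub>G\<^esub> inv\<^bsub>K\<^esub> U"
    by (rule mult_K[OF m_closed[OF U h] inv_closed[OF U]])
  then show ?thesis by (simp only: K.conjugation_def G.conjugation_def mult_K[OF U h] inv_K[OF U])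
qed

text \<open>The inclusion intertwines conjugation by \<open>U\<close> in \<open>K\<close> and in
  \<open>G\<close>. So \<open>dconj U\<close> preserves the range of \<open>T\<close>, which is the
  image of \<open>k_part s\<close> under \<open>J\<close>.\<close>

lemma Ad_k_part: assumes U: "U \<in> carrier K" and x: "x \<in> k_part s" shows "Ad G \<iota> U x \<in> k_part s"
proof -
  obtain \<xi> where \<xi>: "T \<xi> = J x" by (rule T_onto[OF x])
  have ic: "continuous_map (topol K) (topol G) (\<lambda>x. x)" using incl_smooth by (simp add: smooth_map_def)
  note UG = K_carrier[OF U]
  have "(chart_rep c0 c0 (G.conjugation U) has_derivative dconj U) (at (snd c0 \<one>\<^bsub>K\<^esub>))"
    using dconj_has_derivative[OF UG] by (simp add: one_K)
  from chart_rep_chain[OF K.manifold_G G.manifold_G ic c1 c0(1) _ T_has_derivative this] c0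
  have 1: "(chart_rep c1 c0 (G.conjugation U) has_derivative (\<lambda>v. dconj U (T v))) (at k0)" by (simp add: one_K)
  let ?DK = "frechet_derivative (chart_rep c1 c1 (K.conjugation U)) (at k0)"
  have one: "K.conjugation U \<one>\<^bsub>K\<^esub> = \<one>\<^bsub>K\<^esub>" by (rule K.conjugation_one[OF U])
  have "(chart_rep c1 c1 (K.conjugation U) has_derivative ?DK) (at k0)"
    by (rule has_frechet_derivative, rule K.conjugation_differentiable[OF U c1 c1(1)]) (simp add: one c1)
  moreover have "(chart_rep c1 c0 (\<lambda>x. x) has_derivative T) (at (snd c1 (K.conjugation U \<one>\<^bsub>K\<^esub>)))"
    using T_has_derivative by (simp add: one)
  ultimately have "(chart_rep c1 c0 (K.conjugation U) has_derivative (\<lambda>v. T (?DK v))) (at k0)"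
    using chart_rep_chain[OF K.manifold_G K.manifold_G K.conjugation_continuous[OF U] c1 c1(1), of ?DK c0 "\<lambda>x. x" T]
    by (simp add: one c1)
  note K1 = this
  have "openin (topol K) (carrier K)" using openin_topspace[of "topol K"] by (simp add: K.topspace_G)
  from chart_rep_cong[OF K.manifold_G c1 this oneK conjugation_K[OF U] K1]
  have "(chart_rep c1 c0 (G.conjugation U) has_derivative (\<lambda>v. T (?DK v))) (at k0)" .
  from has_derivative_unique[OF 1 this] have "dconj U (T \<xi>) = T (?DK \<xi>)" by metis
  moreover obtain x' where "x' \<in> k_part s" "T (?DK \<xi>) = J x'" by (rule T_into)
  ultimately show ?thesis using \<xi> J_Ad[OF UG, of x] J_inj by metis
qed

lemma AdK_has_derivative:
  "((\<lambda>u. Ad G \<iota> (chart_inv c1 u) y) has_derivative (\<lambda>\<xi>. dAd y (T \<xi>))) (at k0)"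
proof -
  have ic: "continuous_map (topol K) (topol G) (\<lambda>x. x)" using incl_smooth by (simp add: smooth_map_def)
  have op: "openin (topol K) {x \<in> topspace (topol K). x \<in> fst c0}"
    by (rule openin_continuous_map_preimage[OF ic smooth_manifoldD(1)[OF G.manifold_G c0(1)]])
  have pin: "\<one>\<^bsub>K\<^esub> \<in> {x \<in> topspace (topol K). x \<in> fst c0}" using c0 oneK by (simp add: K.topspace_G one_K)
  obtain N where N: "open N" "k0 \<in> N" "\<And>u. u \<in> N \<Longrightarrow> chart_inv c1 u \<in> {x \<in> topspace (topol K). x \<in> fst c0}"
    by (rule chart_nhd[OF K.manifold_G c1(1) op c1(2) pin]) blast
  let ?j = "chart_rep c1 c0 (\<lambda>x. x)"
  have "?j k0 = u0" using chart_inv_chart[OF K.manifold_G c1] by (simp add: one_K)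
  then have "((\<lambda>u. Ad G \<iota> (chart_inv c0 (?j u)) y) has_derivative (\<lambda>\<xi>. dAd y (T \<xi>))) (at k0)"
    using has_derivative_compose[OF T_has_derivative, of "\<lambda>w. Ad G \<iota> (chart_inv c0 w) y"] dAd(1) by simp
  then show ?thesis
    by (rule has_derivative_transform_within_open[OF _ N(1,2)])
      (use N(3) chart_inv_chart[OF G.manifold_G c0(1)] in auto)
qed
end

section \<open>One-parameter subgroups in the image of the adjoint representation\<close>

lemma linear_basis_sum:
  fixes f :: "'a::euclidean_space \<Rightarrow> 'b::real_vector"
  assumes "linear f" shows "f z = (\<Sum>b\<in>Basis. (z \<bullet> b) *\<^sub>R f b)"
proof -
  have "f (\<Sum>b\<in>Basis. (z \<bullet> b) *\<^sub>R b) = (\<Sum>b\<in>Basis. (z \<bullet> b) *\<^sub>R f b)"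
    by (simp only: linear_sum[OF assms] linear_scale[OF assms])
  then show ?thesis by (simp only: euclidean_representation)
qed

text \<open>In finite dimensions the values on a basis control a linear map, so pointwise
  convergence is enough for moving arguments.\<close>

lemma tendsto_linear_family:
  fixes L :: "nat \<Rightarrow> 'a::euclidean_space \<Rightarrow> 'b::real_normed_vector"
  assumes L: "\<And>n. linear (L n)" "linear L0" "\<And>z. (\<lambda>n. L n z) \<longlonglongrightarrow> L0 z" and z: "z \<longlonglongrightarrow> z0"
  shows "(\<lambda>n. L n (z n)) \<longlonglongrightarrow> L0 z0"
proof -
  have "(\<lambda>n. \<Sum>b\<in>Basis. (z n \<bullet> b) *\<^sub>R L n b) \<longlonglongrightarrow> (\<Sum>b\<in>Basis. (z0 \<bullet> b) *\<^sub>R L0 b)"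
    by (intro tendsto_intros L z)
  then show ?thesis by (simp only: linear_basis_sum[OF L(1), symmetric] linear_basis_sum[OF L(2), symmetric])
qed

lemma tendsto_funpow_linear:
  fixes L :: "nat \<Rightarrow> 'a::euclidean_space \<Rightarrow> 'a"
  assumes "\<And>n. linear (L n)" "linear L0" "\<And>z. (\<lambda>n. L n z) \<longlonglongrightarrow> L0 z"
  shows "(\<lambda>n. (L n ^^ N) z) \<longlonglongrightarrow> (L0 ^^ N) z"
proof (induction N)
  case (Suc N)
  show ?case using tendsto_linear_family[OF assms Suc] by simp
qed simp

lemma linear_error_bound:
  fixes R :: "'a::euclidean_space \<Rightarrow> 'a"
  assumes "linear R" "\<And>b. b \<in> Basis \<Longrightarrow> norm (R b) \<le> e"
  shows "norm (R z) \<le> real DIM('a) * e * norm z"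
proof -
  have "norm (R z) \<le> (\<Sum>b\<in>(Basis::'a set). norm z * e)"
    unfolding linear_basis_sum[OF assms(1), of z]
  proof (rule order_trans[OF norm_sum sum_mono])
    fix b :: 'a assume b: "b \<in> Basis"
    show "norm ((z \<bullet> b) *\<^sub>R R b) \<le> norm z * e"
      using Basis_le_norm[OF b, of z] assms(2)[OF b] by (auto intro!: mult_mono)
  qed
  then show ?thesis by (simp add: algebra_simps)
qed

context lie_pair begin

lemma Ad_pow:
  assumes "V \<in> carrier K" shows "Ad G \<iota> (V [^]\<^bsub>K\<^esub> (j::nat)) = Ad G \<iota> V ^^ j"
proof (induction j)
  case 0 then show ?case by (auto simp: nat_pow_def one_K Ad_one)
next
  case (Suc j)
  interpret group K by (rule K.group_G)
  have c: "V [^]\<^bsub>K\<^esub> j \<in> carrier K" using assms by simp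
  have "Ad G \<iota> (V [^]\<^bsub>K\<^esub> Suc j) x = Ad G \<iota> (V [^]\<^bsub>K\<^esub> j) (Ad G \<iota> V x)" for x
    by (simp add: mult_K[OF c assms] Ad_mult[OF K_carrier[OF c] K_carrier[OF assms]])
  then show ?case by (simp add: fun_eq_iff Suc funpow_swap1)
qed

text \<open>The one-parameter subgroup is obtained as a limit of powers \<open>V\<^sub>n\<^sup>n\<close>, where \<open>V\<^sub>n\<close> lies at distance
  \<open>O(1/n)\<close> from the identity. The Lipschitz estimate for the multiplication keeps the powers in a compact part
  of one chart, so that a subsequence converges in \<open>K\<close>; on \<open>\<gg>\<close> the powers of \<open>Ad V\<^sub>n\<close>
  are Euler's method for \<open>e' = [x, e]\<close>.\<close>

lemma exp_in_Ad:
  assumes x: "x \<in> k_part s"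
  shows "\<exists>U\<in>carrier K. \<forall>y. Ad G \<iota> U y = exp_path (br x) y 1"
proof -
  interpret gK: group K by (rule K.group_G)
  have lin: "linear (br x)" using br_bilinear by (simp add: bilinear_def)
  obtain \<xi> where \<xi>: "T \<xi> = J x" by (rule T_onto[OF x])
  obtain r C where r: "r > 0" and C: "C \<ge> 1" and sub: "cball k0 r \<subseteq> snd c1 ` fst c1"
    and lip: "\<And>u v. u \<in> cball k0 r \<Longrightarrow> v \<in> cball k0 r \<Longrightarrow>
       chart_inv c1 u \<otimes>\<^bsub>K\<^esub> chart_inv c1 v \<in> fst c1 \<and>
       norm (snd c1 (chart_inv c1 u \<otimes>\<^bsub>K\<^esub> chart_inv c1 v) - u) \<le> C * norm (v - k0)"
    using K.mult_rep_lipschitz[OF c1] by blast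
  \<comment> \<open>The powers are known to stay in the ball of radius \<open>r\<close> only up to
    time \<open>1 / N\<close>. The limit taken there is raised to the power \<open>N\<close> at the
    end.\<close>
  obtain N :: nat where N: "C * norm \<xi> / r < real N" using reals_Archimedean2 by blast
  have N0: "0 < real N" using N C r order_le_less_trans[of 0 "C * norm \<xi> / r" "real N"] by simp
  have NC: "C * norm \<xi> / real N \<le> r" using N N0 r by (simp add: field_simps)
  \<comment> \<open>\<open>Suc n\<close> steps of this length make up the time
    \<open>1 / N\<close>.\<close>
  define h where "h n = 1 / (real N * (real n + 1))" for n :: nat
  have h: "h n > 0" for n using N0 by (simp add: h_def)
  have hN: "(real n + 1) * h n = 1 / real N" for n
  proof -
    have "real n + 1 \<noteq> 0" by linarith
    then show ?thesis unfolding h_def times_divide_eq_right mult_1_right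
      by (rule nonzero_divide_mult_cancel_right)
  qed
  have hlim: "h \<longlonglongrightarrow> 0" 
  proof -
    have "(\<lambda>n. (1 / real N) * inverse (real (Suc n))) \<longlonglongrightarrow> (1 / real N) * 0"
      by (intro tendsto_mult tendsto_const LIMSEQ_inverse_real_of_nat)
    then show ?thesis by (simp add: h_def[abs_def] divide_inverse inverse_mult_distrib add.commute)
  qed
  define v where "v n = k0 + h n *\<^sub>R \<xi>" for n
  define V where "V n = chart_inv c1 (v n)" for n
  have hx: "real j * (C * (h n * norm \<xi>)) \<le> r" if "j \<le> Suc n" for j n
  proof -
    have "real j * (C * (h n * norm \<xi>)) \<le> (real n + 1) * (C * (h n * norm \<xi>))"
      using that C h[of n] by (intro mult_right_mono) auto
    also have "\<dots> = C * norm \<xi> * ((real n + 1) * h n)" by simp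
    also have "\<dots> = C * norm \<xi> / real N" unfolding hN by simp
    finally show ?thesis using NC by simp
  qed
  have vK: "v n \<in> cball k0 r" for n
  proof -
    have "h n * norm \<xi> \<le> C * (h n * norm \<xi>)" using C h[of n] mult_right_mono[of 1 C "h n * norm \<xi>"] by simp
    also have "\<dots> \<le> r" using hx[of 1 n] by simp
    finally show ?thesis using h[of n] by (simp add: v_def dist_norm)
  qed
  have V: "V n \<in> fst c1" "snd c1 (V n) = v n" "V n \<in> carrier K" for n
  proof -
    have "v n \<in> snd c1 ` fst c1" using vK sub by blast
    then show "V n \<in> fst c1" "snd c1 (V n) = v n" unfolding V_def by (rule chart_inv_in, rule chart_chart_inv)
    then show "V n \<in> carrier K" using K.chart_carrier[OF c1(1)] by blast
  qed
  have pw: "V n [^]\<^bsub>K\<^esub> j \<in> fst c1 \<and> norm (snd c1 (V n [^]\<^bsub>K\<^esub> j) - k0) \<le> real j * (C * (h n * norm \<xi>))"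
    if "j \<le> Suc n" for n j
    using that
  proof (induction j)
    case 0 then show ?case using c1 by simp
  next
    case (Suc j)
    let ?u = "snd c1 (V n [^]\<^bsub>K\<^esub> j)"
    have IH: "V n [^]\<^bsub>K\<^esub> j \<in> fst c1" "norm (?u - k0) \<le> real j * (C * (h n * norm \<xi>))" using Suc by auto
    then have "norm (?u - k0) \<le> r" using hx[of j n] Suc.prems by linarith
    then have uK: "?u \<in> cball k0 r" by (simp add: dist_norm norm_minus_commute)
    have ciu: "chart_inv c1 ?u = V n [^]\<^bsub>K\<^esub> j" by (rule chart_inv_chart[OF K.manifold_G c1(1) IH(1)])
    have e: "V n [^]\<^bsub>K\<^esub> Suc j = chart_inv c1 ?u \<otimes>\<^bsub>K\<^esub> chart_inv c1 (v n)"
      unfolding ciu V_def[of n, symmetric] by simp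
    have "norm (snd c1 (V n [^]\<^bsub>K\<^esub> Suc j) - ?u) \<le> C * (h n * norm \<xi>)"
      using lip[OF uK vK[of n]] h[of n] unfolding e by (simp add: v_def)
    then have "norm (snd c1 (V n [^]\<^bsub>K\<^esub> Suc j) - k0) \<le> C * (h n * norm \<xi>) + real j * (C * (h n * norm \<xi>))"
      using IH(2) norm_triangle_ineq[of "snd c1 (V n [^]\<^bsub>K\<^esub> Suc j) - ?u" "?u - k0"] by simp
    then show ?case using lip[OF uK vK[of n]] unfolding e by (simp add: distrib_right)
  qed
  define P where "P n = V n [^]\<^bsub>K\<^esub> Suc n" for n
  have P: "P n \<in> fst c1" "snd c1 (P n) \<in> cball k0 r" "P n \<in> carrier K" for n
  proof -
    show "P n \<in> fst c1" using pw[of "Suc n" n] by (simp add: P_def)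
    then show "P n \<in> carrier K" using K.chart_carrier[OF c1(1)] by blast
    have "norm (snd c1 (P n) - k0) \<le> r" using pw[of "Suc n" n] hx[of "Suc n" n] unfolding P_def by linarith
    then show "snd c1 (P n) \<in> cball k0 r" by (simp add: dist_norm norm_minus_commute)
  qed
  have "compact (cball k0 r)" by simp
  then obtain l \<sigma> where l: "l \<in> cball k0 r" "strict_mono (\<sigma> :: nat \<Rightarrow> nat)" "((\<lambda>n. snd c1 (P n)) \<circ> \<sigma>) \<longlonglongrightarrow> l"
    unfolding compact_def using P(2) by meson
  define U where "U = chart_inv c1 l"
  have lim1: "l \<in> snd c1 ` fst c1" using l(1) sub by blast
  have U: "U \<in> fst c1" "snd c1 U = l" unfolding U_def using chart_inv_in[OF lim1] chart_chart_inv[OF lim1] by auto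
  have UK: "U \<in> carrier K" by (rule K.chart_carrier[OF c1(1) U(1)])
  \<comment> \<open>Continuity of \<open>Ad\<close> in the chart of \<open>K\<close> is known at the
    identity only, so the sequence is translated there by the inverse of its limit
    \<open>U\<close>.\<close>
  define Ui where "Ui = inv\<^bsub>K\<^esub> U"
  have Ui: "Ui \<in> carrier K" "Ui \<otimes>\<^bsub>K\<^esub> U = \<one>\<^bsub>K\<^esub>" unfolding Ui_def using UK by auto
  let ?L = "chart_rep c1 c1 (\<lambda>h. Ui \<otimes>\<^bsub>K\<^esub> h)"
  have "?L differentiable at (snd c1 U)"
    by (rule K.left_mult_differentiable[OF Ui(1) c1(1) U(1) c1(1)]) (simp add: Ui c1)
  then have Lc: "isCont ?L l" using differentiable_imp_continuous_within U by blast
  have Ll: "?L l = k0" using chart_inv_chart[OF K.manifold_G c1(1) U(1)] by (simp add: U Ui)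
  define p where "p n = snd c1 (P (\<sigma> n))" for n
  have plim: "p \<longlonglongrightarrow> l" using l(3) by (simp add: p_def[abs_def] o_def)
  have Lp: "(\<lambda>n. ?L (p n)) \<longlonglongrightarrow> k0" using isCont_tendsto_compose[OF Lc plim] Ll by simp
  have op: "openin (topol K) {q \<in> topspace (topol K). Ui \<otimes>\<^bsub>K\<^esub> q \<in> fst c1}"
    by (rule openin_continuous_map_preimage[OF K.left_mult_continuous[OF Ui(1)] smooth_manifoldD(1)[OF K.manifold_G c1(1)]])
  have pin: "U \<in> {q \<in> topspace (topol K). Ui \<otimes>\<^bsub>K\<^esub> q \<in> fst c1}" using UK Ui c1 by (simp add: K.topspace_G)
  obtain W where W: "open W" "snd c1 U \<in> W" "\<And>u. u \<in> W \<Longrightarrow> chart_inv c1 u \<in> {q \<in> topspace (topol K). Ui \<otimes>\<^bsub>K\<^esub> q \<in> fst c1}"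
    by (rule chart_nhd[OF K.manifold_G c1(1) op U(1) pin]) blast
  have evW: "\<forall>\<^sub>F n in sequentially. p n \<in> W" using topological_tendstoD[OF plim W(1)] W(2) U by simp
  have cp: "chart_inv c1 (p n) = P (\<sigma> n)" for n
    unfolding p_def by (rule chart_inv_chart[OF K.manifold_G c1(1) P(1)])
  have AdP: "(\<lambda>n. Ad G \<iota> (P (\<sigma> n)) z) \<longlonglongrightarrow> Ad G \<iota> U z" for z
  proof -
    have "isCont (\<lambda>u. Ad G \<iota> (chart_inv c1 u) z) k0" by (rule has_derivative_continuous[OF AdK_has_derivative])
    from isCont_tendsto_compose[OF this Lp]
    have "(\<lambda>n. Ad G \<iota> (chart_inv c1 (?L (p n))) z) \<longlonglongrightarrow> z"
      using chart_inv_chart[OF K.manifold_G c1] by (simp add: one_K Ad_one)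
    moreover have "\<forall>\<^sub>F n in sequentially. Ad G \<iota> (chart_inv c1 (?L (p n))) z = Ad G \<iota> (Ui \<otimes>\<^bsub>K\<^esub> P (\<sigma> n)) z"
      using evW
    proof eventually_elim
      case (elim n)
      then have "Ui \<otimes>\<^bsub>K\<^esub> P (\<sigma> n) \<in> fst c1" using W(3)[OF elim] by (simp add: cp)
      then show ?case using chart_inv_chart[OF K.manifold_G c1(1)] by (simp add: cp)
    qed
    ultimately have 1: "(\<lambda>n. Ad G \<iota> (Ui \<otimes>\<^bsub>K\<^esub> P (\<sigma> n)) z) \<longlonglongrightarrow> z" by (rule Lim_transform_eventually)
    have "bounded_linear (Ad G \<iota> U)" using Ad_linear[OF K_carrier[OF UK]] by (simp add: linear_conv_bounded_linear)
    from bounded_linear.tendsto[OF this 1]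
    have "(\<lambda>n. Ad G \<iota> U (Ad G \<iota> (Ui \<otimes>\<^bsub>K\<^esub> P (\<sigma> n)) z)) \<longlonglongrightarrow> Ad G \<iota> U z" .
    moreover have "Ad G \<iota> U (Ad G \<iota> (Ui \<otimes>\<^bsub>K\<^esub> P (\<sigma> n)) z) = Ad G \<iota> (P (\<sigma> n)) z" for n
      using Ui(1) P(3)[of "\<sigma> n"] UK unfolding Ui_def
      by (simp add: mult_K inv_K Ad_mult K_carrier Ad_inv)
    ultimately show ?thesis by simp
  qed
  have lP: "linear (Ad G \<iota> (P n))" for n by (rule Ad_linear[OF K_carrier[OF P(3)]])
  have lU: "linear (Ad G \<iota> U)" by (rule Ad_linear[OF K_carrier[OF UK]])
  have lim: "(\<lambda>n. (Ad G \<iota> (P (\<sigma> n)) ^^ N) y) \<longlonglongrightarrow> (Ad G \<iota> U ^^ N) y" for y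
    by (rule tendsto_funpow_linear[OF lP lU AdP])
  have euler: "(\<lambda>n. (Ad G \<iota> (V n) ^^ (Suc n * N)) y) \<longlonglongrightarrow> exp_path (br x) y 1" for y
  proof (rule euler_convergence[OF lin _ _ h hlim])
    show "linear (Ad G \<iota> (V n))" for n by (rule Ad_linear[OF K_carrier[OF V(3)]])
    show "real (Suc n * N) * h n = 1" for n
    proof -
      have "real (Suc n * N) * h n = real N * ((real n + 1) * h n)" by (simp add: algebra_simps)
      then show ?thesis unfolding hN using N0 by simp
    qed
    fix \<eta> :: real assume \<eta>: "\<eta> > 0"
    \<comment> \<open>The estimate is proved for basis vectors; \<open>linear_error_bound\<close>
      makes it uniform in \<open>z\<close> at the cost of the dimension.\<close>
    define \<eta>' where "\<eta>' = \<eta> / real DIM('a)"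
    have \<eta>': "\<eta>' > 0" using \<eta> by (simp add: \<eta>'_def)
    have "\<forall>\<^sub>F n in sequentially. norm (Ad G \<iota> (V n) b - b - h n *\<^sub>R br x b) \<le> \<eta>' * h n" for b
    proof -
      let ?\<phi> = "\<lambda>u. Ad G \<iota> (chart_inv c1 u) b"
      define e where "e = \<eta>' / (norm \<xi> + 1)"
      have e: "e > 0" using \<eta>' by (simp add: e_def add_nonneg_pos)
      have D: "(?\<phi> has_derivative (\<lambda>\<xi>. dAd b (T \<xi>))) (at k0)" by (rule AdK_has_derivative)
      then obtain d where d: "d > 0" "\<And>u. norm (u - k0) < d \<Longrightarrow>
        norm (?\<phi> u - ?\<phi> k0 - dAd b (T (u - k0))) \<le> e * norm (u - k0)"
        using e unfolding has_derivative_at_alt by blast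
      have "(\<lambda>n. norm (h n *\<^sub>R \<xi>)) \<longlonglongrightarrow> norm (0 *\<^sub>R \<xi>)" by (intro tendsto_intros hlim)
      then have "\<forall>\<^sub>F n in sequentially. norm (h n *\<^sub>R \<xi>) < d" using d(1) by (intro order_tendstoD(2)) auto
      then show ?thesis
      proof eventually_elim
        case (elim n)
        have "norm (v n - k0) < d" using elim by (simp add: v_def)
        from d(2)[OF this] have "norm (Ad G \<iota> (V n) b - ?\<phi> k0 - dAd b (T (h n *\<^sub>R \<xi>))) \<le> e * norm (h n *\<^sub>R \<xi>)"
          by (simp add: V_def v_def)
        moreover have "?\<phi> k0 = b" using chart_inv_chart[OF K.manifold_G c1] by (simp add: one_K Ad_one)
        moreover have "dAd b (T (h n *\<^sub>R \<xi>)) = h n *\<^sub>R br x b"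
          using linear_scale[OF has_derivative_linear[OF D]] \<xi> by (simp add: dAd(2))
        ultimately have "norm (Ad G \<iota> (V n) b - b - h n *\<^sub>R br x b) \<le> h n * (e * norm \<xi>)"
          using h[of n] by (simp add: mult.left_commute)
        also have "e * norm \<xi> \<le> \<eta>'"
        proof -
          have "e * norm \<xi> \<le> e * (norm \<xi> + 1)" using e by simp
          also have "\<dots> = \<eta>'" unfolding e_def by (simp add: add_nonneg_eq_0_iff)
          finally show ?thesis .
        qed
        then have "h n * (e * norm \<xi>) \<le> \<eta>' * h n" using h[of n] by (simp add: mult.commute)
        finally show ?case .
      qed
    qed
    then have "\<forall>\<^sub>F n in sequentially. \<forall>b\<in>Basis. norm (Ad G \<iota> (V n) b - b - h n *\<^sub>R br x b) \<le> \<eta>' * h n"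
      by (intro eventually_ball_finite finite_Basis) auto
    then show "\<forall>\<^sub>F n in sequentially. \<forall>z. norm (Ad G \<iota> (V n) z - z - h n *\<^sub>R br x z) \<le> \<eta> * h n * norm z"
    proof eventually_elim
      case (elim n)
      have "linear (\<lambda>z. Ad G \<iota> (V n) z - z - h n *\<^sub>R br x z)"
        by (intro linear_compose_sub Ad_linear[OF K_carrier[OF V(3)]] linear_ident linear_compose_scale_right lin)
      from linear_error_bound[OF this, of "\<eta>' * h n"] elim show ?case by (simp add: \<eta>'_def)
    qed
  qed
  have "(Ad G \<iota> U ^^ N) y = exp_path (br x) y 1" for y
  proof -
    have "(\<lambda>n. (Ad G \<iota> (V (\<sigma> n)) ^^ (Suc (\<sigma> n) * N)) y) \<longlonglongrightarrow> exp_path (br x) y 1"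
      using LIMSEQ_subseq_LIMSEQ[OF euler l(2)] by (simp add: o_def)
    moreover have "Ad G \<iota> (V n) ^^ (Suc n * N) = Ad G \<iota> (P n) ^^ N" for n
      unfolding P_def Ad_pow[OF V(3)] by (simp only: funpow_mult)
    ultimately show ?thesis using lim LIMSEQ_unique by simp blast
  qed
  then show ?thesis using Ad_pow[OF UK, of N] UK by (intro bexI[of _ "U [^]\<^bsub>K\<^esub> N"]) auto
qed
end

section \<open>Passage to the invariant inner product\<close>

lemma inner_product_orthonormal_set:
  fixes B :: "'a::euclidean_space \<Rightarrow> 'a \<Rightarrow> real"
  assumes B: "inner_product B"
  shows "n \<le> DIM('a) \<Longrightarrow> \<exists>E. finite E \<and> card E = n \<and> (\<forall>u\<in>E. \<forall>v\<in>E. B u v = (if u = v then 1 else 0))"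
proof (induction n)
  case 0 then show ?case by (intro exI[of _ "{}"]) auto
next
  case (Suc n)
  have bil: "bilinear B" and sym: "\<And>x y. B x y = B y x" and pos: "\<And>x. x \<noteq> 0 \<Longrightarrow> B x x > 0"
    using B by (auto simp: inner_product_def)
  have lin: "linear (\<lambda>x. B x y)" for y using bil by (simp add: bilinear_def)
  obtain E where E: "finite E" "card E = n" "\<And>u v. u \<in> E \<Longrightarrow> v \<in> E \<Longrightarrow> B u v = (if u = v then 1 else 0)"
    using Suc by auto
  have dimE: "dim (span E) \<le> n" using E dim_le_card'[OF E(1)] by simp
  have "span E \<noteq> UNIV"
  proof
    assume "span E = UNIV"
    then have "dim (span E) = DIM('a)" by (simp only: dim_UNIV)
    then show False using dimE Suc.prems by linarith
  qed
  then obtain x where x: "x \<notin> span E" by auto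
  define y where "y = x - (\<Sum>u\<in>E. B x u *\<^sub>R u)"
  have "(\<Sum>u\<in>E. B x u *\<^sub>R u) \<in> span E" by (intro span_sum span_scale span_base)
  then have "y \<noteq> 0" using x by (auto simp: y_def)
  then have yy: "B y y > 0" by (rule pos)
  have yv: "B y v = 0" if v: "v \<in> E" for v
  proof -
    have "B y v = B x v - (\<Sum>u\<in>E. B x u * B u v)"
      by (simp add: y_def linear_diff[OF lin] linear_sum[OF lin] linear_scale[OF lin])
    also have "(\<Sum>u\<in>E. B x u * B u v) = (\<Sum>u\<in>E. if u = v then B x u else 0)"
      by (rule sum.cong) (auto simp: E(3) v)
    finally show ?thesis using E(1) v by simp
  qed
  define e where "e = (1 / sqrt (B y y)) *\<^sub>R y"
  have ee: "B e e = 1" using yy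
    by (simp add: e_def bilinear_lmul[OF bil] bilinear_rmul[OF bil])
  have ev: "B e v = 0" "B v e = 0" if "v \<in> E" for v
    using yv[OF that] sym[of v e] by (simp_all add: e_def bilinear_lmul[OF bil])
  have "e \<notin> E" using ev ee by force
  then have "card (insert e E) = Suc n" using E by simp
  moreover have "\<forall>u\<in>insert e E. \<forall>v\<in>insert e E. B u v = (if u = v then 1 else 0)"
    using E(3) ev ee \<open>e \<notin> E\<close> by auto
  ultimately show ?case using E(1) by (intro exI[of _ "insert e E"]) simp
qed

text \<open>A change of coordinates after which the invariant inner product is that of the
  type.\<close>

lemma inner_product_isometry:
  fixes B :: "'a::euclidean_space \<Rightarrow> 'a \<Rightarrow> real"
  assumes B: "inner_product B"
  obtains R R' :: "'a \<Rightarrow> 'a" where "linear R" "linear R'" "\<And>x. R (R' x) = x" "\<And>x. R' (R x) = x" "\<And>x y. B (R x) (R y) = x \<bullet> y"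
proof -
  have bil: "bilinear B" using B by (simp add: inner_product_def)
  obtain E where E: "finite E" "card E = DIM('a)" "\<And>u v. u \<in> E \<Longrightarrow> v \<in> E \<Longrightarrow> B u v = (if u = v then 1 else 0)"
    using inner_product_orthonormal_set[OF B order_refl] by auto
  obtain f where f: "bij_betw f (Basis :: 'a set) E"
    using finite_same_card_bij[OF finite_Basis E(1)] E(2) by metis
  define R where "R x = (\<Sum>b\<in>Basis. (x \<bullet> b) *\<^sub>R f b)" for x :: 'a
  have R: "linear R"
    by (rule linearI) (simp_all add: R_def inner_add_left scaleR_add_left sum.distrib scaleR_sum_right)
  have BR: "B (R x) (R y) = x \<bullet> y" for x y
  proof -
    have fb: "B (f b) (f c) = (if b = c then 1 else 0)" if "b \<in> Basis" "c \<in> Basis" for b c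
      using E(3)[of "f b" "f c"] f that by (auto simp: bij_betw_def inj_on_def)
    have "B (R x) (R y) = (\<Sum>(b, c)\<in>Basis \<times> Basis. B ((x \<bullet> b) *\<^sub>R f b) ((y \<bullet> c) *\<^sub>R f c))"
      unfolding R_def by (rule bilinear_sum[OF bil])
    also have "\<dots> = (\<Sum>b\<in>Basis. \<Sum>c\<in>Basis. if b = c then (x \<bullet> b) * (y \<bullet> c) else 0)"
      unfolding sum.cartesian_product[symmetric]
      by (intro sum.cong refl) (simp add: fb bilinear_lmul[OF bil] bilinear_rmul[OF bil])
    also have "\<dots> = x \<bullet> y" by (simp add: euclidean_inner[of x y])
    finally show ?thesis .
  qed
  have "inj R"
  proof (rule injI)
    fix x y assume "R x = R y"
    then have "R (x - y) = 0" using R by (simp add: linear_diff)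
    then have "(x - y) \<bullet> (x - y) = 0" using BR[of "x - y" "x - y"] bilinear_lzero[OF bil] by simp
    then show "x = y" by simp
  qed
  then have "\<exists>R'. linear R' \<and> (\<forall>x. R' (R x) = x) \<and> (\<forall>x. R (R' x) = x)"
    by (intro linear_injective_isomorphism R) auto
  then obtain R' where R': "linear R' \<and> (\<forall>x. R' (R x) = x) \<and> (\<forall>x. R (R' x) = x)" by (rule exE)
  show thesis by (rule that[OF R]) (use R' BR in auto)
qed

lemma blinfun_compose_assoc: "(A o\<^sub>L C) o\<^sub>L D = A o\<^sub>L (C o\<^sub>L D)"
  by (rule blinfun_eqI) simp

lemma blinfun_compose_id: "A o\<^sub>L id_blinfun = A" "id_blinfun o\<^sub>L A = A"
  by (rule blinfun_eqI, simp)+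

lemma group_GL: "group (GL :: ('a::real_normed_vector \<Rightarrow>\<^sub>L 'a) monoid)"
proof (rule groupI)
  fix A C :: "'a \<Rightarrow>\<^sub>L 'a" assume "A \<in> carrier GL" "C \<in> carrier GL"
  then obtain A' C' where A: "A o\<^sub>L A' = id_blinfun" "A' o\<^sub>L A = id_blinfun" and C: "C o\<^sub>L C' = id_blinfun" "C' o\<^sub>L C = id_blinfun"
    by (auto simp: GL_def)
  have "(A o\<^sub>L C) o\<^sub>L (C' o\<^sub>L A') = A o\<^sub>L (C o\<^sub>L C') o\<^sub>L A'"
    "(C' o\<^sub>L A') o\<^sub>L (A o\<^sub>L C) = C' o\<^sub>L (A' o\<^sub>L A) o\<^sub>L C"
    by (simp_all only: blinfun_compose_assoc)
  then have "(A o\<^sub>L C) o\<^sub>L (C' o\<^sub>L A') = id_blinfun" "(C' o\<^sub>L A') o\<^sub>L (A o\<^sub>L C) = id_blinfun"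
    by (simp_all add: A C blinfun_compose_id)
  then show "A \<otimes>\<^bsub>GL\<^esub> C \<in> carrier GL" by (auto simp: GL_def)
next
  fix A :: "'a \<Rightarrow>\<^sub>L 'a" assume "A \<in> carrier GL"
  then show "\<exists>C\<in>carrier GL. C \<otimes>\<^bsub>GL\<^esub> A = \<one>\<^bsub>GL\<^esub>" by (auto simp: GL_def)
qed (auto simp: GL_def blinfun_compose_assoc blinfun_compose_id)

lemma GL_inv_apply:
  assumes "A \<in> carrier GL" shows "(inv\<^bsub>GL\<^esub> A) (A x) = x" "A ((inv\<^bsub>GL\<^esub> A) x) = x"
proof -
  have "inv\<^bsub>GL\<^esub> A \<otimes>\<^bsub>GL\<^esub> A = \<one>\<^bsub>GL\<^esub>" "A \<otimes>\<^bsub>GL\<^esub> inv\<^bsub>GL\<^esub> A = \<one>\<^bsub>GL\<^esub>"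
    using group.l_inv[OF group_GL assms] group.r_inv[OF group_GL assms] by auto
  then have 1: "inv\<^bsub>GL\<^esub> A o\<^sub>L A = id_blinfun" and 2: "A o\<^sub>L inv\<^bsub>GL\<^esub> A = id_blinfun" by (simp_all add: GL_def)
  show "(inv\<^bsub>GL\<^esub> A) (A x) = x" using arg_cong[OF 1, of "\<lambda>C. blinfun_apply C x"] by simp
  show "A ((inv\<^bsub>GL\<^esub> A) x) = x" using arg_cong[OF 2, of "\<lambda>C. blinfun_apply C x"] by simp
qed

locale orthogonal_lie_pair = lie_pair br s G \<iota> K
  for br :: "'a::euclidean_space \<Rightarrow> 'a \<Rightarrow> 'a" and s :: "'a \<Rightarrow> 'a"
    and G :: "('g, 'm::euclidean_space) smooth_group" and \<iota> :: "'a \<Rightarrow> ('g, 'm) chart \<Rightarrow> 'm"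
    and K :: "('g, 'k::euclidean_space) smooth_group" +
  fixes B :: "'a \<Rightarrow> 'a \<Rightarrow> real" and R R' :: "'a \<Rightarrow> 'a"
  assumes sym: "symmetric_lie_algebra br s" and semi: "semisimple br" and orth: "orthogonal_sla br s"
    and invB: "invariant_inner_product s G \<iota> K B"
    and R: "linear R" "linear R'" "\<And>x. R (R' x) = x" "\<And>x. R' (R x) = x" "\<And>x y. B (R x) (R y) = x \<bullet> y"
begin

lemma B_R': "R' x \<bullet> R' y = B x y"
  using R(5)[of "R' x" "R' y"] by (simp add: R)

lemma B_bil: "bilinear B" and B_pos: "x \<noteq> 0 \<Longrightarrow> B x x > 0"
  and B_s: "B (s x) (s y) = B x y" and B_Ad: "U \<in> carrier K \<Longrightarrow> B (Ad G \<iota> U x) (Ad G \<iota> U y) = B x y"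
  using invB by (auto simp: invariant_inner_product_def inner_product_def)

lemma sym_facts: "br x x = 0" "br x (br y z) + br y (br z x) + br z (br x y) = 0" "linear s"
  "s (br x y) = br (s x) (s y)" "s (s x) = x"
  using sym by (auto simp: symmetric_lie_algebra_def lie_algebra_def)

lemma br_lin: "linear (br x)" "linear (\<lambda>x. br x y)"
  using br_bilinear by (auto simp: bilinear_def)

lemma k_orthogonal_p: "x \<in> k_part s \<Longrightarrow> y \<in> p_part s \<Longrightarrow> B x y = 0"
  using B_s[of x y] by (simp add: k_part_def p_part_def bilinear_rneg[OF B_bil])

lemma k_p_decomp: obtains u v where "u \<in> k_part s" "v \<in> p_part s" "x = u + v"
proof (rule that)
  show "(1/2) *\<^sub>R (x + s x) \<in> k_part s" "(1/2) *\<^sub>R (x - s x) \<in> p_part s"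
    using sym_facts(3) by (auto simp: k_part_def p_part_def linear_add linear_diff linear_scale sym_facts(5) algebra_simps)
  show "x = (1/2) *\<^sub>R (x + s x) + (1/2) *\<^sub>R (x - s x)"
    by (simp add: algebra_simps flip: scaleR_add_left)
qed

lemma inv_carrier_K: "U \<in> carrier K \<Longrightarrow> inv\<^bsub>G\<^esub> U \<in> carrier K"
  using subgroup_K by (simp add: subgroup.m_inv_closed)

lemma mult_carrier_K: "U \<in> carrier K \<Longrightarrow> V \<in> carrier K \<Longrightarrow> U \<otimes>\<^bsub>G\<^esub> V \<in> carrier K"
  using subgroup_K by (simp add: subgroup.m_closed)

text \<open>\<open>p_part s\<close> is the \<open>B\<close>-orthogonal complement of
  \<open>k_part s\<close>, and \<open>Ad\<close> preserves \<open>B\<close> and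
  \<open>k_part s\<close>. Compatibility with \<open>s\<close> has to come from here, as no
  involution of the group is given.\<close>

lemma Ad_p_part: assumes U: "U \<in> carrier K" and y: "y \<in> p_part s" shows "Ad G \<iota> U y \<in> p_part s"
proof -
  obtain u v where uv: "u \<in> k_part s" "v \<in> p_part s" "Ad G \<iota> U y = u + v" by (rule k_p_decomp)
  have "B (Ad G \<iota> (inv\<^bsub>G\<^esub> U) u) y = 0"
    by (rule k_orthogonal_p[OF Ad_k_part[OF inv_carrier_K[OF U] uv(1)] y])
  then have "B u (u + v) = 0"
    using B_Ad[OF U, of "Ad G \<iota> (inv\<^bsub>G\<^esub> U) u" y] uv(3) K_carrier[OF U] by (simp add: Ad_inv)
  then have "B u u = 0" using k_orthogonal_p[OF uv(1,2)] by (simp add: bilinear_radd[OF B_bil])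
  then have "u = 0" using B_pos[of u] by auto
  then show ?thesis using uv by simp
qed

lemma Ad_s: assumes U: "U \<in> carrier K" shows "Ad G \<iota> U (s x) = s (Ad G \<iota> U x)"
proof -
  obtain u v where uv: "u \<in> k_part s" "v \<in> p_part s" "x = u + v" by (rule k_p_decomp)
  note lin = Ad_linear[OF K_carrier[OF U]]
  have "Ad G \<iota> U u \<in> k_part s" "Ad G \<iota> U v \<in> p_part s" using Ad_k_part Ad_p_part U uv by auto
  then show ?thesis using uv sym_facts(3) lin
    by (simp add: k_part_def p_part_def linear_add linear_diff)
qed

lemma exp_end_Ad:
  assumes "x \<in> k_part s" obtains U where "U \<in> carrier K" "\<And>y. blinfun_apply (exp_end (br x)) y = Ad G \<iota> U y"
  using exp_in_Ad[OF assms] exp_end_apply[OF br_lin(1), of 1 x] by auto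

lemma exp_end_carrier: assumes "x \<in> k_part s" shows "exp_end (br x) \<in> carrier GL"
proof -
  obtain U where U: "U \<in> carrier K" "\<And>y. blinfun_apply (exp_end (br x)) y = Ad G \<iota> U y"
    by (rule exp_end_Ad[OF assms]) blast
  have "bounded_linear (Ad G \<iota> (inv\<^bsub>G\<^esub> U))"
    using Ad_linear[OF K_carrier[OF inv_carrier_K[OF U(1)]]] by (simp add: linear_conv_bounded_linear)
  note app = bounded_linear_Blinfun_apply[OF this]
  have "exp_end (br x) o\<^sub>L Blinfun (Ad G \<iota> (inv\<^bsub>G\<^esub> U)) = id_blinfun"
    "Blinfun (Ad G \<iota> (inv\<^bsub>G\<^esub> U)) o\<^sub>L exp_end (br x) = id_blinfun"
    by (rule blinfun_eqI; simp add: app U(2) Ad_inv[OF K_carrier[OF U(1)]])+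
  then show ?thesis by (auto simp: GL_def)
qed

lemma exp_set_carrier: "(\<lambda>x. exp_end (br x)) ` k_part s \<subseteq> carrier GL"
  using exp_end_carrier by auto

lemma Int_k_Ad:
  assumes "A \<in> Int_k br s" shows "\<exists>U\<in>carrier K. \<forall>y. blinfun_apply A y = Ad G \<iota> U y"
  using assms unfolding Int_k_def
proof (induction rule: generate.induct)
  case one
  show ?case using oneK Ad_one by (intro bexI[of _ "\<one>\<^bsub>K\<^esub>"]) (auto simp: GL_def one_K)
next
  case (incl h)
  then show ?case using exp_end_Ad by (metis imageE)
next
  case (inv h)
  then obtain x where x: "x \<in> k_part s" "h = exp_end (br x)" by auto
  obtain U where U: "U \<in> carrier K" "\<And>y. blinfun_apply (exp_end (br x)) y = Ad G \<iota> U y"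
    by (rule exp_end_Ad[OF x(1)]) blast
  have "(inv\<^bsub>GL\<^esub> h) y = Ad G \<iota> (inv\<^bsub>G\<^esub> U) y" for y
    using GL_inv_apply(1)[OF exp_end_carrier[OF x(1)], of "Ad G \<iota> (inv\<^bsub>G\<^esub> U) y"] Ad_inv[OF K_carrier[OF U(1)]]
    by (simp add: x(2) U(2))
  then show ?case using inv_carrier_K[OF U(1)] by blast
next
  case (eng h1 h2)
  then obtain U V where U: "U \<in> carrier K" "\<forall>y. blinfun_apply h1 y = Ad G \<iota> U y"
    and V: "V \<in> carrier K" "\<forall>y. blinfun_apply h2 y = Ad G \<iota> V y" by blast
  have "blinfun_apply (h1 \<otimes>\<^bsub>GL\<^esub> h2) y = Ad G \<iota> (U \<otimes>\<^bsub>G\<^esub> V) y" for y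
    using U V by (simp add: GL_def Ad_mult K_carrier)
  then show ?case using mult_carrier_K[OF U(1) V(1)] by blast
qed

definition RB where "RB = Blinfun R"
definition RB' where "RB' = Blinfun R'"
text \<open>Conjugation by \<open>R\<close>; with it and the structure \<open>br'\<close>,
  \<open>s'\<close> transported in the same way, the maps induced by \<open>K\<close> become
  isometries for the inner product of the type.\<close>

definition conj where "conj A = RB' o\<^sub>L (A o\<^sub>L RB)"
definition br' where "br' x y = R' (br (R x) (R y))"
definition s' where "s' x = R' (s (R x))"

lemma RB_apply: "blinfun_apply RB x = R x" "blinfun_apply RB' x = R' x"
  unfolding RB_def RB'_def
  by (rule bounded_linear_Blinfun_apply[THEN fun_cong], use R in \<open>simp add: linear_conv_bounded_linear\<close>)+

lemma conj_apply: "blinfun_apply (conj A) x = R' (A (R x))"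
  by (simp add: conj_def RB_apply)

lemma R_zero: "R x = 0 \<longleftrightarrow> x = 0" "R' x = 0 \<longleftrightarrow> x = 0"
  using R linear_0 by metis+

lemma aut_conj: assumes U: "U \<in> carrier K" shows "symmetric_automorphism br' s' (\<lambda>x. R' (Ad G \<iota> U (R x)))"
  unfolding symmetric_automorphism_def
proof (intro conjI allI)
  show "linear (\<lambda>x. R' (Ad G \<iota> U (R x)))"
    using linear_compose[OF R(1) linear_compose[OF Ad_linear[OF K_carrier[OF U]] R(2)]] by (simp add: o_def)
qed (simp_all add: br'_def s'_def R(3) Ad_br[OF K_carrier[OF U]] Ad_s[OF U] B_R' B_Ad[OF U] R(5))

lemma k_part': "x \<in> k_part s' \<longleftrightarrow> R x \<in> k_part s" and p_part': "x \<in> p_part s' \<longleftrightarrow> R x \<in> p_part s"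
proof -
  have *: "R' u = y \<longleftrightarrow> u = R y" for u y using R(3)[of u] R(4)[of y] by auto
  show "x \<in> k_part s' \<longleftrightarrow> R x \<in> k_part s" by (simp add: k_part_def s'_def *)
  show "x \<in> p_part s' \<longleftrightarrow> R x \<in> p_part s"
    by (simp add: p_part_def s'_def * linear_neg[OF R(1)])
qed

lemma p_centralizer': "x \<in> p_centralizer br' s' y \<longleftrightarrow> R x \<in> p_centralizer br s (R y)"
  by (simp add: p_centralizer_def p_part' br'_def R_zero)

lemma no_abelian_ideal:
  assumes I0: "subspace I0" "\<And>x y. y \<in> I0 \<Longrightarrow> br' x y \<in> I0" "\<And>x y. x \<in> I0 \<Longrightarrow> y \<in> I0 \<Longrightarrow> br' x y = 0"
  shows "I0 \<subseteq> {0}"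
proof -
  have "br x y \<in> R ` I0" if y: "y \<in> R ` I0" for x y
  proof -
    obtain z where z: "z \<in> I0" "y = R z" using y by auto
    have "br' (R' x) z \<in> I0" by (rule I0(2)[OF z(1)])
    then have "R (br' (R' x) z) \<in> R ` I0" by (rule imageI)
    then show ?thesis by (simp add: br'_def R z)
  qed
  then have "lie_ideal br (R ` I0)" unfolding lie_ideal_def using linear_subspace_image[OF R(1) I0(1)] by blast
  moreover have "{br x y |x y. x \<in> R ` I0 \<and> y \<in> R ` I0} \<subseteq> {0}"
    using I0(3) by (auto simp: br'_def R_zero)
  then have "derived_algebra br (R ` I0) \<subseteq> span {0}" unfolding derived_algebra_def by (rule span_mono)
  then have "(derived_algebra br ^^ 1) (R ` I0) = {0}" using span_0 by (auto simp: derived_algebra_def)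
  then have "lie_solvable br (R ` I0)" unfolding lie_solvable_def by blast
  ultimately have "R ` I0 = {0}" using semi unfolding semisimple_def by blast
  then show ?thesis using R_zero by auto
qed

lemma Int_k_closed: "id_blinfun \<in> Int_k br s"
  "A \<in> Int_k br s \<Longrightarrow> C \<in> Int_k br s \<Longrightarrow> A o\<^sub>L C \<in> Int_k br s"
  "A \<in> Int_k br s \<Longrightarrow> \<exists>C\<in>Int_k br s. \<forall>x. C (A x) = x \<and> A (C x) = x"
proof -
  show "id_blinfun \<in> Int_k br s"
    using generate.one[of GL "(\<lambda>x. exp_end (br x)) ` k_part s"] by (simp add: Int_k_def GL_def)
  show "A o\<^sub>L C \<in> Int_k br s" if "A \<in> Int_k br s" "C \<in> Int_k br s"
    using generate.eng[of A GL "(\<lambda>x. exp_end (br x)) ` k_part s" C] that by (simp add: Int_k_def GL_def)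
  assume A: "A \<in> Int_k br s"
  have "A \<in> carrier GL" using A group.generate_in_carrier[OF group_GL exp_set_carrier] by (simp add: Int_k_def)
  moreover have "inv\<^bsub>GL\<^esub> A \<in> Int_k br s"
    using A group.generate_m_inv_closed[OF group_GL exp_set_carrier] by (simp add: Int_k_def)
  ultimately show "\<exists>C\<in>Int_k br s. \<forall>x. C (A x) = x \<and> A (C x) = x" using GL_inv_apply by blast
qed

sublocale P: orthogonal_symmetric_algebra br' s' "conj ` Int_k br s"
proof (rule orthogonal_symmetric_algebra.intro)
  show "bilinear br'"
    unfolding bilinear_def br'_def
    using linear_compose[OF linear_compose[OF R(1) br_lin(1)] R(2)] linear_compose[OF linear_compose[OF R(1) br_lin(2)] R(2)]
    by (simp add: o_def)
  show "br' x x = 0" for x by (simp add: br'_def sym_facts R_zero)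
  show "br' x (br' y z) + br' y (br' z x) + br' z (br' x y) = 0" for x y z
    by (simp add: br'_def R sym_facts(2) R_zero flip: linear_add[OF R(2)])
  show "linear s'" unfolding s'_def[abs_def] using linear_compose[OF linear_compose[OF R(1) sym_facts(3)] R(2)] by (simp add: o_def)
  show "s' (br' x y) = br' (s' x) (s' y)" for x y by (simp add: s'_def br'_def R sym_facts)
  show "s' (s' x) = x" for x by (simp add: s'_def R sym_facts)
  show "s' x \<bullet> s' y = x \<bullet> y" for x y by (simp add: s'_def B_R' B_s R(5))
  show "I0 \<subseteq> {0}" if "subspace I0" "\<And>x y. y \<in> I0 \<Longrightarrow> br' x y \<in> I0" "\<And>x y. x \<in> I0 \<Longrightarrow> y \<in> I0 \<Longrightarrow> br' x y = 0" for I0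
    by (rule no_abelian_ideal[OF that])
  have "continuous_on (Int_k br s) conj"
    unfolding conj_def[abs_def]
    by (intro bounded_bilinear.continuous_on[OF bounded_bilinear_blinfun_compose] continuous_on_const continuous_on_id)
  then show "compact (conj ` Int_k br s)"
    using orth by (intro compact_continuous_image) (simp_all add: orthogonal_sla_def)
  have "conj id_blinfun = id_blinfun" by (rule blinfun_eqI) (simp add: conj_apply R)
  then show "id_blinfun \<in> conj ` Int_k br s" using Int_k_closed(1) by (metis imageI)
  show "A o\<^sub>L C \<in> conj ` Int_k br s" if AC: "A \<in> conj ` Int_k br s" "C \<in> conj ` Int_k br s" for A C
  proof -
    obtain A0 C0 where AC0: "A = conj A0" "C = conj C0" "A0 \<in> Int_k br s" "C0 \<in> Int_k br s" using AC by auto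
    then have "A o\<^sub>L C = conj (A0 o\<^sub>L C0)" by (intro blinfun_eqI) (simp add: conj_apply R)
    then show ?thesis using Int_k_closed(2)[OF AC0(3,4)] by simp
  qed
  show "\<exists>C\<in>conj ` Int_k br s. \<forall>x. C (A x) = x \<and> A (C x) = x" if A: "A \<in> conj ` Int_k br s" for A
  proof -
    obtain A0 where A0: "A = conj A0" "A0 \<in> Int_k br s" using A by auto
    obtain C0 where "C0 \<in> Int_k br s" "\<forall>x. C0 (A0 x) = x \<and> A0 (C0 x) = x" using Int_k_closed(3)[OF A0(2)] by blast
    then show ?thesis by (intro bexI[of _ "conj C0"]) (simp_all add: A0 conj_apply R)
  qed
  show "symmetric_automorphism br' s' (blinfun_apply A)" if A: "A \<in> conj ` Int_k br s" for A
  proof -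
    obtain A0 where A0: "A = conj A0" "A0 \<in> Int_k br s" using A by auto
    obtain U where U: "U \<in> carrier K" "\<forall>y. blinfun_apply A0 y = Ad G \<iota> U y" using Int_k_Ad[OF A0(2)] by blast
    have "blinfun_apply A = (\<lambda>x. R' (Ad G \<iota> U (R x)))" using U by (simp add: fun_eq_iff A0 conj_apply)
    then show ?thesis using aut_conj[OF U(1)] by simp
  qed
  show "\<exists>e::real \<Rightarrow> 'a \<Rightarrow>\<^sub>L 'a. e 0 = id_blinfun \<and> (\<forall>t. e t \<in> conj ` Int_k br s) \<and>
      (\<forall>y. ((\<lambda>t. e t y) has_vector_derivative br' x y) (at 0)) \<and> (\<forall>y. br' x y = 0 \<longrightarrow> (\<forall>t. e t y = y))"
    if x: "s' x = x" for x
  proof -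
    have xk: "R x \<in> k_part s" using x k_part' by (simp add: k_part_def)
    define e where "e t = conj (exp_end (br (t *\<^sub>R R x)))" for t
    have ea: "blinfun_apply (e t) y = R' (exp_path (br (R x)) (R y) t)" for t y
    proof -
      have "br (t *\<^sub>R R x) = (\<lambda>y. t *\<^sub>R br (R x) y)" using bilinear_lmul[OF br_bilinear] by auto
      then show ?thesis by (simp add: e_def conj_apply exp_end_apply[OF br_lin(1)])
    qed
    have "e 0 = id_blinfun" by (rule blinfun_eqI) (simp add: ea exp_path_0[OF br_lin(1)] R)
    moreover have "e t \<in> conj ` Int_k br s" for t
    proof -
      have "t *\<^sub>R R x \<in> k_part s" using xk sym_facts(3) by (simp add: k_part_def linear_scale)
      then have "exp_end (br (t *\<^sub>R R x)) \<in> Int_k br s" unfolding Int_k_def by (intro generate.incl imageI)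
      then show ?thesis by (simp add: e_def)
    qed
    moreover have "((\<lambda>t. e t y) has_vector_derivative br' x y) (at 0)" for y
    proof -
      have "bounded_linear R'" using R by (simp add: linear_conv_bounded_linear)
      from bounded_linear.has_vector_derivative[OF this exp_path_derivative[OF br_lin(1), of "R x" "R y" 0]]
      show ?thesis by (simp add: ea exp_path_0[OF br_lin(1)] br'_def)
    qed
    moreover have "e t y = y" if "br' x y = 0" for t y
      using that exp_path_fixed[OF br_lin(1), of "R x" "R y" t] by (simp add: ea br'_def R_zero R)
    ultimately show ?thesis by blast
  qed
qed

text \<open>The definite description needs existence, taken from the Euclidean decomposition after
  transport by \<open>R'\<close>, and uniqueness, which is positivity of \<open>B\<close>.\<close>

lemma proj_p:
  assumes x: "x \<in> p_part s"
  shows "R' (proj_p br s B x v) \<in> p_centralizer br' s' (R' x)"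
    "z \<in> p_centralizer br' s' (R' x) \<Longrightarrow> (R' v - R' (proj_p br s B x v)) \<bullet> z = 0"
proof -
  let ?V = "p_centralizer br' s' (R' x)"
  have V: "subspace ?V" by (rule P.subspace_p_centralizer)
  obtain y u where yz: "y \<in> span ?V" "\<And>w. w \<in> span ?V \<Longrightarrow> orthogonal u w" "R' v = y + u"
    using orthogonal_subspace_decomp_exists[of ?V "R' v"] by blast
  have y: "y \<in> ?V" using yz(1) V by (metis span_eq_iff)
  let ?Q = "\<lambda>y. y \<in> p_centralizer br s x \<and> (\<forall>z\<in>p_centralizer br s x. B (v - y) z = 0)"
  have "?Q (R y)"
  proof (intro conjI ballI)
    show "R y \<in> p_centralizer br s x" using y p_centralizer' by (simp add: R)
    fix w assume "w \<in> p_centralizer br s x"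
    then have "R' w \<in> ?V" using p_centralizer'[of "R' w" "R' x"] by (simp add: R)
    then have "u \<bullet> R' w = 0" using yz(2)[OF span_base] by (simp add: orthogonal_def)
    moreover have "v - R y = R u" using arg_cong[OF yz(3), of R] by (simp add: R linear_add[OF R(1)])
    ultimately show "B (v - R y) w = 0" using R(5)[of u "R' w"] by (simp add: R)
  qed
  moreover have "y1 = y2" if Q: "?Q y1" "?Q y2" for y1 y2
  proof (rule ccontr)
    assume ne: "y1 \<noteq> y2"
    have lin: "linear (\<lambda>z. B z w)" for w using B_bil by (simp add: bilinear_def)
    have "R' y1 \<in> ?V" "R' y2 \<in> ?V" using Q p_centralizer'[of _ "R' x"] by (simp_all add: R)
    then have "R' (y1 - y2) \<in> ?V" using V by (simp add: subspace_diff linear_diff[OF R(2)])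
    then have "y1 - y2 \<in> p_centralizer br s x" using p_centralizer'[of _ "R' x"] by (simp add: R)
    then have "B (v - y2) (y1 - y2) - B (v - y1) (y1 - y2) = 0" using Q by simp
    then have "B (y1 - y2) (y1 - y2) = 0" by (simp flip: linear_diff[OF lin])
    then show False using B_pos[of "y1 - y2"] ne by simp
  qed
  ultimately have "\<exists>!y. ?Q y" by blast
  then have Q: "?Q (proj_p br s B x v)" unfolding proj_p_def by (rule theI')
  then show "R' (proj_p br s B x v) \<in> ?V" using p_centralizer'[of _ "R' x"] by (simp add: R)
  assume "z \<in> ?V"
  then have "R z \<in> p_centralizer br s x" using p_centralizer'[of z "R' x"] by (simp add: R)
  then have "B (v - proj_p br s B x v) (R z) = 0" using Q by blast
  then show "(R' v - R' (proj_p br s B x v)) \<bullet> z = 0"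
    using B_R'[of "v - proj_p br s B x v" "R z"] by (simp add: R linear_diff[OF R(2)])
qed

section \<open>Return to the adjoint action of \<open>K\<close> and its Weyl group\<close>

context
  fixes a assumes maxab: "maximal_abelian br (p_part s) a"
begin

lemma maxab': "maximal_abelian br' (p_part s') (R' ` a)"
  unfolding maximal_abelian_def
proof (intro conjI allI impI ballI)
  show "subspace (R' ` a)" using maxab by (intro linear_subspace_image R) (simp add: maximal_abelian_def)
  show "R' ` a \<subseteq> p_part s'" using maxab p_part' by (auto simp: maximal_abelian_def R)
  show "br' x y = 0" if "x \<in> R' ` a" "y \<in> R' ` a" for x y
    using that maxab by (auto simp: maximal_abelian_def br'_def R R_zero)
  fix b assume b: "subspace b \<and> b \<subseteq> p_part s' \<and> (\<forall>x\<in>b. \<forall>y\<in>b. br' x y = 0) \<and> R' ` a \<subseteq> b"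
  have "subspace (R ` b)" using b by (intro linear_subspace_image R) simp
  moreover have "R ` b \<subseteq> p_part s" using b p_part' by auto
  moreover have "\<forall>x\<in>R ` b. \<forall>y\<in>R ` b. br x y = 0" using b by (auto simp: br'_def R_zero)
  moreover have "a \<subseteq> R ` b"
  proof
    fix x assume "x \<in> a"
    then have "R' x \<in> b" using b by auto
    then show "x \<in> R ` b" using R(3)[of x] by (metis imageI)
  qed
  ultimately have "R ` b = a" using maxab unfolding maximal_abelian_def by blast
  then show "b = R' ` a" by (auto simp: image_image R)
qed

lemma in_a': "x \<in> R' ` a \<longleftrightarrow> R x \<in> a"
  using R(3,4) by (metis imageE imageI)

lemma lift_exists:
  assumes I: "open I" and \<rho>: "\<And>t. t \<in> I \<Longrightarrow> \<rho> t \<in> p_part s"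
    "\<And>t. t \<in> I \<Longrightarrow> (\<rho> has_vector_derivative \<rho>' t) (at t)"
  shows "\<exists>lam D. (\<forall>t\<in>I. (lam has_vector_derivative D t) (at t)) \<and>
    (\<forall>t\<in>I. \<exists>V\<in>carrier K. lam t = Ad G \<iota> V (\<rho> t) \<and> lam t \<in> a \<and>
       D t = Ad G \<iota> V (proj_p br s B (\<rho> t) (\<rho>' t)) \<and> D t \<in> a) \<and>
    (continuous_on I \<rho>' \<longrightarrow> continuous_on I D)"
proof -
  have blR: "bounded_linear R" "bounded_linear R'" using R by (simp_all add: linear_conv_bounded_linear)
  let ?r = "\<lambda>t. R' (\<rho> t)" and ?r' = "\<lambda>t. R' (\<rho>' t)" and ?q = "\<lambda>t. R' (proj_p br s B (\<rho> t) (\<rho>' t))"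
  have r: "?r t \<in> p_part s'" if "t \<in> I" for t using \<rho>(1)[OF that] p_part' by (simp add: R)
  have r': "(?r has_vector_derivative ?r' t) (at t)" if "t \<in> I" for t
    by (rule bounded_linear.has_vector_derivative[OF blR(2) \<rho>(2)[OF that]])
  have q1: "?q t \<in> p_centralizer br' s' (?r t)" if "t \<in> I" for t by (rule proj_p(1)[OF \<rho>(1)[OF that]])
  have q2: "(?r' t - ?q t) \<bullet> z = 0" if "t \<in> I" "z \<in> p_centralizer br' s' (?r t)" for t z
    by (rule proj_p(2)[OF \<rho>(1)[OF that(1)] that(2)])
  from P.differentiable_lift[OF maxab' I r r' q1 q2]
  obtain l where l: "\<forall>t\<in>I. \<exists>A\<in>conj ` Int_k br s. l t = A (?r t) \<and> A (?r t) \<in> R' ` a \<and> A (?q t) \<in> R' ` a \<and>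
      (l has_vector_derivative A (?q t)) (at t)" by (rule exE)
  define l' where "l' t = vector_derivative l (at t)" for t
  have l': "\<exists>A\<in>conj ` Int_k br s. l t = A (?r t) \<and> A (?r t) \<in> R' ` a \<and> l' t = A (?q t) \<and> A (?q t) \<in> R' ` a"
    and ld: "(l has_vector_derivative l' t) (at t)" if t: "t \<in> I" for t
  proof -
    obtain A where A: "A \<in> conj ` Int_k br s" "l t = A (?r t)" "A (?r t) \<in> R' ` a" "A (?q t) \<in> R' ` a"
      "(l has_vector_derivative A (?q t)) (at t)" using l t by blast
    have "l' t = A (?q t)" unfolding l'_def by (rule vector_derivative_at[OF A(5)])
    then show "\<exists>A\<in>conj ` Int_k br s. l t = A (?r t) \<and> A (?r t) \<in> R' ` a \<and> l' t = A (?q t) \<and> A (?q t) \<in> R' ` a"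
      "(l has_vector_derivative l' t) (at t)" using A by auto
  qed
  show ?thesis
  proof (rule exI[of _ "\<lambda>t. R (l t)"], rule exI[of _ "\<lambda>t. R (l' t)"], intro conjI ballI impI)
    fix t assume t: "t \<in> I"
    show "((\<lambda>t. R (l t)) has_vector_derivative R (l' t)) (at t)"
      by (rule bounded_linear.has_vector_derivative[OF blR(1) ld[OF t]])
  next
    fix t assume t: "t \<in> I"
    obtain A where A: "A \<in> conj ` Int_k br s" "l t = A (?r t)" "A (?r t) \<in> R' ` a" "l' t = A (?q t)" "A (?q t) \<in> R' ` a"
      using l'[OF t] by blast
    obtain A0 where A0: "A = conj A0" "A0 \<in> Int_k br s" using A(1) by auto
    obtain V where V: "V \<in> carrier K" "\<forall>y. blinfun_apply A0 y = Ad G \<iota> V y" using Int_k_Ad[OF A0(2)] by blast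
    show "\<exists>V\<in>carrier K. R (l t) = Ad G \<iota> V (\<rho> t) \<and> R (l t) \<in> a \<and>
       R (l' t) = Ad G \<iota> V (proj_p br s B (\<rho> t) (\<rho>' t)) \<and> R (l' t) \<in> a"
    proof (intro bexI[OF _ V(1)] conjI)
      show "R (l t) = Ad G \<iota> V (\<rho> t)" "R (l' t) = Ad G \<iota> V (proj_p br s B (\<rho> t) (\<rho>' t))"
        using V(2) by (simp_all add: A(2,4) A0(1) conj_apply R)
      show "R (l t) \<in> a" "R (l' t) \<in> a" using A(3,5) unfolding A(2,4) in_a' by auto
    qed
  next
    assume c: "continuous_on I \<rho>'"
    have "continuous_on I ?r'" by (rule bounded_linear.continuous_on[OF blR(2) c])
    from P.lift_derivative_continuous[OF maxab' r r' this q1 q2 l' ld]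
    have "continuous_on I l'" by blast
    then show "continuous_on I (\<lambda>t. R (l' t))" by (rule bounded_linear.continuous_on[OF blR(1)])
  qed
qed

text \<open>An element of \<open>K\<close> that keeps \<open>x\<close> and \<open>v\<close> in
  \<open>a\<close> need not normalize \<open>a\<close>, but its product with a suitable element
  fixing their images does; the coset of the product is \<open>w\<close>.\<close>

lemma weyl_group_conjugate:
  assumes U: "U \<in> carrier K" and x: "x \<in> a" "v \<in> a" "Ad G \<iota> U x \<in> a" "Ad G \<iota> U v \<in> a"
  shows "\<exists>w\<in>carrier (weyl_group G \<iota> K a). Ad G \<iota> U x = weyl_act G \<iota> w x \<and> Ad G \<iota> U v = weyl_act G \<iota> w v"
proof -
  let ?M = "\<lambda>x. R' (Ad G \<iota> U (R x))"
  have "R' ` {x, v} \<subseteq> R' ` a" using x by auto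
  moreover have "?M ` (R' ` {x, v}) \<subseteq> R' ` a" using x by (auto simp: R)
  ultimately obtain C where C: "C \<in> conj ` Int_k br s" "\<And>y. y \<in> R' ` {x, v} \<Longrightarrow> C (?M y) = ?M y"
    "(\<lambda>y. C (?M y)) ` (R' ` a) = R' ` a"
    by (rule P.conjugate_into_a_normalizer[OF maxab' aut_conj[OF U]]) blast
  obtain A0 where A0: "C = conj A0" "A0 \<in> Int_k br s" using C(1) by auto
  obtain V where V: "V \<in> carrier K" "\<forall>y. blinfun_apply A0 y = Ad G \<iota> V y" using Int_k_Ad[OF A0(2)] by blast
  define N where "N = V \<otimes>\<^bsub>G\<^esub> U"
  have NK: "N \<in> carrier K" unfolding N_def by (rule mult_carrier_K[OF V(1) U])
  have CM: "C (?M y) = R' (Ad G \<iota> N (R y))" for y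
    using V by (simp add: A0 conj_apply R N_def Ad_mult K_carrier U)
  have Nx: "Ad G \<iota> N y = Ad G \<iota> U y" if "y \<in> {x, v}" for y
  proof -
    have "R' (Ad G \<iota> N y) = R' (Ad G \<iota> U y)" using C(2)[of "R' y"] CM[of "R' y"] that by (auto simp: R)
    then show ?thesis using R(3) by metis
  qed
  have "R' ` (Ad G \<iota> N ` a) = R' ` a" using C(3) by (simp add: CM image_image R)
  then have "R ` R' ` (Ad G \<iota> N ` a) = R ` R' ` a" by simp
  then have Na: "Ad G \<iota> N ` a = a" by (simp add: image_image R)
  let ?Z = "centralizer_K G \<iota> K a"
  define w where "w = ?Z #>\<^bsub>K\<lparr>carrier := normalizer_K G \<iota> K a\<rparr>\<^esub> N"
  have w: "w \<in> carrier (weyl_group G \<iota> K a)"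
    unfolding weyl_group_def FactGroup_def w_def using NK Na by (auto simp: RCOSETS_def normalizer_K_def)
  have w_elems: "w = (\<lambda>z. z \<otimes>\<^bsub>K\<^esub> N) ` ?Z" unfolding w_def r_coset_def by auto
  have "\<one>\<^bsub>K\<^esub> \<in> ?Z" using oneK by (simp add: centralizer_K_def one_K Ad_one)
  then have "w \<noteq> {}" using w_elems by blast
  \<comment> \<open>The representative used by \<open>weyl_act\<close> is some \<open>z\<close>
    times \<open>N\<close> with \<open>z\<close> in the centralizer, which does not move vectors of
    \<open>a\<close>.\<close>
  then have "(SOME U. U \<in> w) \<in> w" by (metis ex_in_conv someI_ex)
  then obtain z where z: "z \<in> ?Z" "(SOME U. U \<in> w) = z \<otimes>\<^bsub>K\<^esub> N" unfolding w_elems by blast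
  have zK: "z \<in> carrier K" using z by (simp add: centralizer_K_def)
  have "weyl_act G \<iota> w y = Ad G \<iota> N y" if "y \<in> a" for y
  proof -
    have "Ad G \<iota> N y \<in> a" using Na that by blast
    then show ?thesis using z(1) unfolding weyl_act_def z(2)
      by (simp add: mult_K[OF zK NK] Ad_mult K_carrier zK NK centralizer_K_def)
  qed
  then show ?thesis using w Nx x by (intro bexI[OF _ w]) auto
qed

lemma orbit_map_Ad: assumes V: "V \<in> carrier K" shows "orbit_map G \<iota> K y = orbit_map G \<iota> K (Ad G \<iota> V y)"
proof -
  note VG = K_carrier[OF V]
  have 1: "Ad G \<iota> U y = Ad G \<iota> (U \<otimes>\<^bsub>G\<^esub> inv\<^bsub>G\<^esub> V) (Ad G \<iota> V y)" if "U \<in> carrier K" for U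
    using that VG K_carrier[OF inv_carrier_K[OF V]] by (simp add: Ad_mult K_carrier Ad_inv)
  have 2: "Ad G \<iota> U (Ad G \<iota> V y) = Ad G \<iota> (U \<otimes>\<^bsub>G\<^esub> V) y" if "U \<in> carrier K" for U
    using that VG by (simp add: Ad_mult K_carrier)
  show ?thesis
  proof (rule subset_antisym)
    show "orbit_map G \<iota> K y \<subseteq> orbit_map G \<iota> K (Ad G \<iota> V y)"
      unfolding orbit_map_def using 1 mult_carrier_K[OF _ inv_carrier_K[OF V]] by blast
    show "orbit_map G \<iota> K (Ad G \<iota> V y) \<subseteq> orbit_map G \<iota> K y"
      unfolding orbit_map_def using 2 mult_carrier_K[OF _ V] by blast
  qed
qed

text \<open>The lift comes from one \<open>V\<close>. For any admissible \<open>U\<close> the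
  product of \<open>V\<close> and \<open>U\<close> maps the pair obtained from \<open>U\<close> to
  the pair \<open>l\<close>, \<open>d\<close>; both pairs lie in \<open>a\<close>, so
  \<open>weyl_group_conjugate\<close> applies.\<close>

lemma lift_conclusion:
  assumes V: "V \<in> carrier K" "l = Ad G \<iota> V r" "l \<in> a" "d = Ad G \<iota> V q" "d \<in> a"
  shows "orbit_map G \<iota> K r = orbit_map G \<iota> K l"
    "\<exists>U\<in>carrier K. Ad G \<iota> (inv\<^bsub>G\<^esub> U) r \<in> a \<and> Ad G \<iota> (inv\<^bsub>G\<^esub> U) q \<in> a"
    "\<And>U. U \<in> carrier K \<Longrightarrow> Ad G \<iota> (inv\<^bsub>G\<^esub> U) r \<in> a \<and> Ad G \<iota> (inv\<^bsub>G\<^esub> U) q \<in> a \<Longrightarrow>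
      \<exists>w\<in>carrier (weyl_group G \<iota> K a).
        (l, d) = (weyl_act G \<iota> w (Ad G \<iota> (inv\<^bsub>G\<^esub> U) r), weyl_act G \<iota> w (Ad G \<iota> (inv\<^bsub>G\<^esub> U) q))"
proof -
  interpret gr: group G by (rule G.group_G)
  note VG = K_carrier[OF V(1)]
  show "orbit_map G \<iota> K r = orbit_map G \<iota> K l" unfolding V(2) by (rule orbit_map_Ad[OF V(1)])
  show "\<exists>U\<in>carrier K. Ad G \<iota> (inv\<^bsub>G\<^esub> U) r \<in> a \<and> Ad G \<iota> (inv\<^bsub>G\<^esub> U) q \<in> a"
    using V VG by (intro bexI[OF _ inv_carrier_K[OF V(1)]]) simp
  fix U assume U: "U \<in> carrier K" and ua: "Ad G \<iota> (inv\<^bsub>G\<^esub> U) r \<in> a \<and> Ad G \<iota> (inv\<^bsub>G\<^esub> U) q \<in> a"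
  have *: "Ad G \<iota> (V \<otimes>\<^bsub>G\<^esub> U) (Ad G \<iota> (inv\<^bsub>G\<^esub> U) y) = Ad G \<iota> V y" for y
    using K_carrier[OF U] VG by (simp add: Ad_mult Ad_inv)
  from weyl_group_conjugate[OF mult_carrier_K[OF V(1) U], of "Ad G \<iota> (inv\<^bsub>G\<^esub> U) r" "Ad G \<iota> (inv\<^bsub>G\<^esub> U) q"]
  show "\<exists>w\<in>carrier (weyl_group G \<iota> K a).
        (l, d) = (weyl_act G \<iota> w (Ad G \<iota> (inv\<^bsub>G\<^esub> U) r), weyl_act G \<iota> w (Ad G \<iota> (inv\<^bsub>G\<^esub> U) q))"
    unfolding * using ua V by auto
qed
end
end

theorem theorem2p11:
  fixes br :: "'a::euclidean_space \<Rightarrow> 'a \<Rightarrow> 'a"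
    and s :: "'a \<Rightarrow> 'a"
    and G :: "('g, 'm::euclidean_space) smooth_group"
    and K :: "('g, 'k::euclidean_space) smooth_group"
    and \<iota> :: "'a \<Rightarrow> ('g, 'm) chart \<Rightarrow> 'm"
    and B :: "'a \<Rightarrow> 'a \<Rightarrow> real"
    and a :: "'a set" and I :: "real set" and \<rho> :: "real \<Rightarrow> 'a"
  assumes "symmetric_lie_algebra br s" and "semisimple br" and "orthogonal_sla br s"
    and "associated_pair br s G \<iota> K" and "connected_space (topol K)"
    and "maximal_abelian br (p_part s) a"
    and "invariant_inner_product s G \<iota> K B"
    and "open I" and "is_interval I" and "\<rho> ` I \<subseteq> p_part s"
  shows "(\<rho> differentiable_on I \<longrightarrow>
      (\<exists>lam. lam differentiable_on I \<and> lam ` I \<subseteq> a \<and>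
         (\<forall>t\<in>I. orbit_map G \<iota> K (\<rho> t) = orbit_map G \<iota> K (lam t)) \<and>
         (\<forall>t\<in>I.
            (\<exists>U\<in>carrier K.
               Ad G \<iota> (inv\<^bsub>G\<^esub> U) (\<rho> t) \<in> a \<and>
               Ad G \<iota> (inv\<^bsub>G\<^esub> U) (proj_p br s B (\<rho> t) (vector_derivative \<rho> (at t))) \<in> a) \<and>
            (\<forall>U\<in>carrier K.
               Ad G \<iota> (inv\<^bsub>G\<^esub> U) (\<rho> t) \<in> a \<and>
               Ad G \<iota> (inv\<^bsub>G\<^esub> U) (proj_p br s B (\<rho> t) (vector_derivative \<rho> (at t))) \<in> a \<longrightarrow>
               (\<exists>w\<in>carrier (weyl_group G \<iota> K a).
                  (lam t, vector_derivative lam (at t)) =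
                  (weyl_act G \<iota> w (Ad G \<iota> (inv\<^bsub>G\<^esub> U) (\<rho> t)),
                   weyl_act G \<iota> w (Ad G \<iota> (inv\<^bsub>G\<^esub> U)
                     (proj_p br s B (\<rho> t) (vector_derivative \<rho> (at t)))))))))) \<and>
    (\<rho> C1_differentiable_on I \<longrightarrow>
      (\<exists>lam. lam C1_differentiable_on I \<and> lam ` I \<subseteq> a \<and>
         (\<forall>t\<in>I. orbit_map G \<iota> K (\<rho> t) = orbit_map G \<iota> K (lam t)) \<and>
         (\<forall>t\<in>I.
            (\<exists>U\<in>carrier K.
               Ad G \<iota> (inv\<^bsub>G\<^esub> U) (\<rho> t) \<in> a \<and>
               Ad G \<iota> (inv\<^bsub>G\<^esub> U) (proj_p br s B (\<rho> t) (vector_derivative \<rho> (at t))) \<in> a) \<and>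
            (\<forall>U\<in>carrier K.
               Ad G \<iota> (inv\<^bsub>G\<^esub> U) (\<rho> t) \<in> a \<and>
               Ad G \<iota> (inv\<^bsub>G\<^esub> U) (proj_p br s B (\<rho> t) (vector_derivative \<rho> (at t))) \<in> a \<longrightarrow>
               (\<exists>w\<in>carrier (weyl_group G \<iota> K a).
                  (lam t, vector_derivative lam (at t)) =
                  (weyl_act G \<iota> w (Ad G \<iota> (inv\<^bsub>G\<^esub> U) (\<rho> t)),
                   weyl_act G \<iota> w (Ad G \<iota> (inv\<^bsub>G\<^esub> U)
                     (proj_p br s B (\<rho> t) (vector_derivative \<rho> (at t))))))))))"
proof -
  have "inner_product B" using assms(7) by (simp add: invariant_inner_product_def)
  then obtain R R' :: "'a \<Rightarrow> 'a" where R: "linear R" "linear R'" "\<And>x. R (R' x) = x"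
    "\<And>x. R' (R x) = x" "\<And>x y. B (R x) (R y) = x \<bullet> y"
    by (rule inner_product_isometry) blast
  have "bilinear br" using assms(1) by (simp add: symmetric_lie_algebra_def lie_algebra_def)
  then interpret orthogonal_lie_pair br s G \<iota> K B R R'
    using assms R
    by (intro orthogonal_lie_pair.intro lie_pair.intro orthogonal_lie_pair_axioms.intro)
  let ?\<rho>' = "\<lambda>t. vector_derivative \<rho> (at t)"
  let ?q = "\<lambda>t. proj_p br s B (\<rho> t) (?\<rho>' t)"
  have \<rho>: "\<rho> t \<in> p_part s" if "t \<in> I" for t using assms(10) that by auto
  \<comment> \<open>One statement serves for both claims of the theorem: continuity of the
    derivative is kept as an implication.\<close>
  have lift: "\<exists>lam. (\<forall>t\<in>I. lam differentiable at t) \<and>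
      (continuous_on I ?\<rho>' \<longrightarrow> continuous_on I (\<lambda>t. vector_derivative lam (at t))) \<and> lam ` I \<subseteq> a \<and>
      (\<forall>t\<in>I. orbit_map G \<iota> K (\<rho> t) = orbit_map G \<iota> K (lam t)) \<and>
      (\<forall>t\<in>I. (\<exists>U\<in>carrier K. Ad G \<iota> (inv\<^bsub>G\<^esub> U) (\<rho> t) \<in> a \<and> Ad G \<iota> (inv\<^bsub>G\<^esub> U) (?q t) \<in> a) \<and>
        (\<forall>U\<in>carrier K. Ad G \<iota> (inv\<^bsub>G\<^esub> U) (\<rho> t) \<in> a \<and> Ad G \<iota> (inv\<^bsub>G\<^esub> U) (?q t) \<in> a \<longrightarrow>
          (\<exists>w\<in>carrier (weyl_group G \<iota> K a). (lam t, vector_derivative lam (at t)) =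
            (weyl_act G \<iota> w (Ad G \<iota> (inv\<^bsub>G\<^esub> U) (\<rho> t)), weyl_act G \<iota> w (Ad G \<iota> (inv\<^bsub>G\<^esub> U) (?q t))))))"
    if \<rho>': "\<forall>t\<in>I. \<rho> differentiable at t"
  proof -
    have der: "(\<rho> has_vector_derivative ?\<rho>' t) (at t)" if "t \<in> I" for t
      using \<rho>' that by (simp flip: vector_derivative_works)
    have "\<exists>lam D. (\<forall>t\<in>I. (lam has_vector_derivative D t) (at t)) \<and>
      (\<forall>t\<in>I. \<exists>V\<in>carrier K. lam t = Ad G \<iota> V (\<rho> t) \<and> lam t \<in> a \<and> D t = Ad G \<iota> V (?q t) \<and> D t \<in> a) \<and>
      (continuous_on I ?\<rho>' \<longrightarrow> continuous_on I D)"
      by (rule lift_exists[OF assms(6,8)]) (rule \<rho> der; assumption)+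
    then obtain lam D where L: "(\<forall>t\<in>I. (lam has_vector_derivative D t) (at t)) \<and>
      (\<forall>t\<in>I. \<exists>V\<in>carrier K. lam t = Ad G \<iota> V (\<rho> t) \<and> lam t \<in> a \<and> D t = Ad G \<iota> V (?q t) \<and> D t \<in> a) \<and>
      (continuous_on I ?\<rho>' \<longrightarrow> continuous_on I D)" by (elim exE)
    have d: "(lam has_vector_derivative D t) (at t)" if "t \<in> I" for t
      by (rule bspec[OF conjunct1[OF L] that])
    have V: "\<exists>V\<in>carrier K. lam t = Ad G \<iota> V (\<rho> t) \<and> lam t \<in> a \<and> D t = Ad G \<iota> V (?q t) \<and> D t \<in> a" if "t \<in> I" for t
      by (rule bspec[OF conjunct1[OF conjunct2[OF L]] that])
    have cont: "continuous_on I ?\<rho>' \<Longrightarrow> continuous_on I D"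
      using conjunct2[OF conjunct2[OF L]] by (rule mp)
    have D: "vector_derivative lam (at t) = D t" if "t \<in> I" for t
      by (rule vector_derivative_at[OF d[OF that]])
    show ?thesis
    proof (intro exI[of _ lam] conjI ballI impI)
      show "lam differentiable at t" if "t \<in> I" for t using d[OF that] by (rule differentiableI_vector)
      show "continuous_on I (\<lambda>t. vector_derivative lam (at t))" if "continuous_on I ?\<rho>'"
        using cont[OF that] D by (simp cong: continuous_on_cong)
      show "lam ` I \<subseteq> a" using V by auto
      fix t assume t: "t \<in> I"
      from V[OF t] obtain V where "V \<in> carrier K" "lam t = Ad G \<iota> V (\<rho> t)" "lam t \<in> a"
        "D t = Ad G \<iota> V (?q t)" "D t \<in> a" by blast
      note c = lift_conclusion[OF assms(6) this, folded D[OF t]]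
      show "orbit_map G \<iota> K (\<rho> t) = orbit_map G \<iota> K (lam t)" by (rule c(1))
      show "\<exists>U\<in>carrier K. Ad G \<iota> (inv\<^bsub>G\<^esub> U) (\<rho> t) \<in> a \<and> Ad G \<iota> (inv\<^bsub>G\<^esub> U) (?q t) \<in> a" by (rule c(2))
      fix U assume "U \<in> carrier K" "Ad G \<iota> (inv\<^bsub>G\<^esub> U) (\<rho> t) \<in> a \<and> Ad G \<iota> (inv\<^bsub>G\<^esub> U) (?q t) \<in> a"
      then show "\<exists>w\<in>carrier (weyl_group G \<iota> K a). (lam t, vector_derivative lam (at t)) =
            (weyl_act G \<iota> w (Ad G \<iota> (inv\<^bsub>G\<^esub> U) (\<rho> t)), weyl_act G \<iota> w (Ad G \<iota> (inv\<^bsub>G\<^esub> U) (?q t)))"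
        by (rule c(3))
    qed
  qed
  show ?thesis
    unfolding C1_differentiable_on_eq differentiable_on_eq_differentiable_at[OF assms(8)]
  proof (intro conjI impI, goal_cases)
    case 1
    from lift[OF this] show ?case by (elim exE conjE, intro exI conjI)
  next
    case 2
    have "\<exists>l. (P l \<and> Q l) \<and> R l" if "\<exists>l. P l \<and> (c \<longrightarrow> Q l) \<and> R l" c
      for P Q R :: "(real \<Rightarrow> 'a) \<Rightarrow> bool" and c using that by blast
    from this[OF lift[OF conjunct1[OF 2]] conjunct2[OF 2]] show ?case .
  qed
qed

end
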